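(* Let $N\in\mathbb{N}^*$, $A=\{a_j\}_{j\le N}\subset\mathbb{R}$ and $T>0$. Let $\mu\in\widetilde H^1(A)$, $\psi_0\in H^1_h$ and $f\in L^2((0,T),\widetilde H^1(A))$. For any $u\in L^2((0,T),\mathbb{R})$, there exists a unique mild solution $\psi\in C([0,T],H^1_h)$ of the problem $$i\partial_t\psi=[-\Delta+x^2]\psi+u(t)\mu(x)\psi+f(t,x)\ \ (x\in\mathbb{R},\ t>0),\qquad\psi(0,\cdot)=\psi_0,$$ that is, a solution of $$\psi(t)=e^{-iHt}\psi_0-i\int_0^te^{-iH(t-s)}\big(u(s)\mu\psi(s)+f(s)\big)\,ds,\qquad t\in[0,T].$$ Moreover, there is a constant $C_T>0$ such that $$\|\psi\|_{C([0,T],H^1_h)}\le C_T\big(\|\psi_0\|_{H^1_h}+\|f\|_{L^2((0,T),\widetilde H^1(A))}\big).$$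
   Context: $\mathbb{N}=\{0,1,2,\dots\}$, $\mathbb{N}^*=\mathbb{N}\setminus\{0\}$. $L^2=L^2(\mathbb{R},\mathbb{C})$ with $\langle f,g\rangle_{L^2}=\int_{\mathbb{R}}f\overline{g}\,dx$. $H=-\Delta+x^2$ is the harmonic oscillator on $L^2(\mathbb{R},\mathbb{C})$ with domain $\{\psi\in L^2:(-\Delta+x^2)\psi\in L^2\}$. Its eigenvalues are $\lambda_k=2k+1$, $k\in\mathbb{N}$, with Hilbert basis of eigenfunctions the Hermite functions $\phi_k(x)=(-1)^k(\sqrt\pi\,2^kk!)^{-1/2}e^{x^2/2}\frac{d^k}{dx^k}(e^{-x^2})$. $H^1_h=\{\psi\in L^2(\mathbb{R},\mathbb{C}):(-\partial_x+x)\psi\in L^2(\mathbb{R},\mathbb{C})\}$ with norm $\|\psi\|_{H^1_h}=\big(\sum_{k\in\mathbb{N}}(2k+1)|\langle\psi,\phi_k\rangle_{L^2}|^2\big)^{1/2}$. For $A=\{a_1<\dots<a_N\}\subset\mathbb{R}$, $\widetilde H^1(A)$ is the space of $\psi\in L^2(\mathbb{R},\mathbb{C})$ such that $x\psi\in L^2$ and $\psi$ is $H^1$ on each of $(-\infty,a_1),(a_1,a_2),\dots,(a_N,+\infty)$, with norm $$\|\psi\|_{\widetilde H^1(A)}=\Big(\|\psi\|^2_{H^1(-\infty,a_1)}+\dots+\|\psi\|^2_{H^1(a_N,+\infty)}+\|(1+|x|)\psi\|^2_{L^2(\mathbb{R})}\Big)^{1/2}.$$ *)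

theory Defs
  imports "HOL-Analysis.Analysis"
begin

section \<open>The Hilbert space of square integrable complex functions on the real line\<close>

text \<open>
  Elements of \<open>L2\<close> are classes of Borel functions modulo equality almost everywhere; since every
  Lebesgue measurable function has a Borel representative, this is the usual space.
\<close>

definition square_integrable :: "(real \<Rightarrow> complex) \<Rightarrow> bool" where
  "square_integrable f \<longleftrightarrow>
     f \<in> borel_measurable lborel \<and> integrable lborel (\<lambda>x. (cmod (f x))\<^sup>2)"

lemma square_integrableD:
  assumes "square_integrable f"
  shows "f \<in> borel_measurable lborel" "integrable lborel (\<lambda>x. (cmod (f x))\<^sup>2)"
  using assms by (auto simp: square_integrable_def)

lemma square_integrable_zero: "square_integrable (\<lambda>x. 0)"
  by (simp add: square_integrable_def)

lemma square_integrable_add: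
  assumes f: "square_integrable f" and g: "square_integrable g"
  shows "square_integrable (\<lambda>x. f x + g x)"
  unfolding square_integrable_def
proof
  have [measurable]: "f \<in> borel_measurable lborel" "g \<in> borel_measurable lborel"
    using f g by (auto simp: square_integrable_def)
  show "(\<lambda>x. f x + g x) \<in> borel_measurable lborel" by measurable
  have "integrable lborel (\<lambda>x. 2 * (cmod (f x))\<^sup>2 + 2 * (cmod (g x))\<^sup>2)"
    using f g by (auto simp: square_integrable_def)
  then show "integrable lborel (\<lambda>x. (cmod (f x + g x))\<^sup>2)"
  proof (rule Bochner_Integration.integrable_bound)
    show "(\<lambda>x. (cmod (f x + g x))\<^sup>2) \<in> borel_measurable lborel" by measurable
    have "(cmod (f x + g x))\<^sup>2 \<le> 2 * (cmod (f x))\<^sup>2 + 2 * (cmod (g x))\<^sup>2" for x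
    proof -
      have "(cmod (f x + g x))\<^sup>2 \<le> (cmod (f x) + cmod (g x))\<^sup>2"
        by (intro power_mono norm_triangle_ineq) auto
      also have "\<dots> \<le> 2 * (cmod (f x))\<^sup>2 + 2 * (cmod (g x))\<^sup>2"
        using sum_squares_bound[of "cmod (f x)" "cmod (g x)"] by (simp add: power2_sum)
      finally show ?thesis .
    qed
    then show "AE x in lborel. norm ((cmod (f x + g x))\<^sup>2) \<le>
        norm (2 * (cmod (f x))\<^sup>2 + 2 * (cmod (g x))\<^sup>2)" by simp
  qed
qed

lemma square_integrable_mult_left:
  assumes f: "square_integrable f"
  shows "square_integrable (\<lambda>x. c * f x)"
  using f by (auto simp: square_integrable_def norm_mult power_mult_distrib)

lemma borel_measurable_cnj [measurable (raw)]:
  "f \<in> borel_measurable M \<Longrightarrow> (\<lambda>x. cnj (f x)) \<in> borel_measurable M"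
  by (rule borel_measurable_continuous_on[where f = cnj]) (auto intro!: continuous_intros)

lemma integrable_mult_cnj:
  assumes f: "square_integrable f" and g: "square_integrable g"
  shows "integrable lborel (\<lambda>x. f x * cnj (g x))"
proof (rule Bochner_Integration.integrable_bound)
  have [measurable]: "f \<in> borel_measurable lborel" "g \<in> borel_measurable lborel"
    using f g by (auto simp: square_integrable_def)
  show "integrable lborel (\<lambda>x. (cmod (f x))\<^sup>2 + (cmod (g x))\<^sup>2)"
    using f g by (auto simp: square_integrable_def)
  show "(\<lambda>x. f x * cnj (g x)) \<in> borel_measurable lborel" by measurable
  have "cmod (f x) * cmod (g x) \<le> (cmod (f x))\<^sup>2 + (cmod (g x))\<^sup>2" for x
    using sum_squares_bound[of "cmod (f x)" "cmod (g x)"]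
      zero_le_power2[of "cmod (f x)"] zero_le_power2[of "cmod (g x)"] 
      mult_nonneg_nonneg[OF norm_ge_zero[of "f x"] norm_ge_zero[of "g x"]]
    by linarith
  then show "AE x in lborel. norm (f x * cnj (g x)) \<le> norm ((cmod (f x))\<^sup>2 + (cmod (g x))\<^sup>2)"
    by (simp add: norm_mult)
qed

definition L2_rel :: "(real \<Rightarrow> complex) \<Rightarrow> (real \<Rightarrow> complex) \<Rightarrow> bool" where
  "L2_rel f g \<longleftrightarrow> square_integrable f \<and> square_integrable g \<and> (AE x in lborel. f x = g x)"

quotient_type L2 = "real \<Rightarrow> complex" / partial: L2_rel
proof (rule part_equivpI)
  show "\<exists>f. L2_rel f f"
    by (rule exI[of _ "\<lambda>x. 0"]) (simp add: L2_rel_def square_integrable_zero)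
  show "symp L2_rel"
    by (auto simp: symp_def L2_rel_def elim: eventually_mono)
  show "transp L2_rel"
    by (auto simp: transp_def L2_rel_def elim: eventually_elim2)
qed

lift_definition cinner_L2 :: "L2 \<Rightarrow> L2 \<Rightarrow> complex" is
  "\<lambda>f g. \<integral>x. f x * cnj (g x) \<partial>lborel"
  by (auto simp: L2_rel_def square_integrable_def 
      intro!: integral_cong_AE borel_measurable_times borel_measurable_cnj elim: eventually_elim2)

lift_definition scaleC_L2 :: "complex \<Rightarrow> L2 \<Rightarrow> L2"  (infixr \<open>*\<^sub>c\<close> 75) is
  "\<lambda>c f x. c * f x"
  by (auto simp: L2_rel_def square_integrable_mult_left elim: eventually_mono)

instantiation L2 :: real_inner
begin

lift_definition zero_L2 :: L2 is "\<lambda>x. 0"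
  by (simp add: L2_rel_def square_integrable_zero)

lift_definition plus_L2 :: "L2 \<Rightarrow> L2 \<Rightarrow> L2" is "\<lambda>f g x. f x + g x"
  by (auto simp: L2_rel_def square_integrable_add elim: eventually_elim2)

definition scaleR_L2 :: "real \<Rightarrow> L2 \<Rightarrow> L2" where
  "scaleR_L2 r f = complex_of_real r *\<^sub>c f"

definition uminus_L2 :: "L2 \<Rightarrow> L2" where
  "uminus_L2 f = (-1) *\<^sub>c f"

definition minus_L2 :: "L2 \<Rightarrow> L2 \<Rightarrow> L2" where
  "minus_L2 f g = f + (-1) *\<^sub>c g"

definition inner_L2 :: "L2 \<Rightarrow> L2 \<Rightarrow> real" where
  "inner_L2 f g = Re (cinner_L2 f g)"

definition norm_L2 :: "L2 \<Rightarrow> real" where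
  "norm_L2 f = sqrt (inner f f)"

definition sgn_L2 :: "L2 \<Rightarrow> L2" where
  "sgn_L2 f = inverse (norm f) *\<^sub>R f"

definition dist_L2 :: "L2 \<Rightarrow> L2 \<Rightarrow> real" where
  "dist_L2 f g = norm (f - g)"

definition uniformity_L2 :: "(L2 \<times> L2) filter" where
  "uniformity_L2 = (INF e\<in>{0<..}. principal {(x, y). dist x y < e})"

definition open_L2 :: "L2 set \<Rightarrow> bool" where
  "open_L2 U \<longleftrightarrow> (\<forall>x\<in>U. eventually (\<lambda>(x', y). x' = x \<longrightarrow> y \<in> U) uniformity)"

instance
proof
  fix f g h :: L2 and r s :: real
  show "f + g + h = f + (g + h)"
    by transfer (simp add: L2_rel_def square_integrable_add add.assoc)
  show "f + g = g + f"
    by transfer (simp add: L2_rel_def square_integrable_add add.commute)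
  show "0 + f = f"
    by transfer (simp add: L2_rel_def)
  show "- f + f = 0"
    unfolding uminus_L2_def
    by transfer (simp add: L2_rel_def square_integrable_zero)
  show "f - g = f + - g"
    by (simp add: minus_L2_def uminus_L2_def)
  show "r *\<^sub>R (f + g) = r *\<^sub>R f + r *\<^sub>R g"
    unfolding scaleR_L2_def
    by transfer (auto simp: L2_rel_def distrib_left
        intro!: square_integrable_add square_integrable_mult_left)
  show "(r + s) *\<^sub>R f = r *\<^sub>R f + s *\<^sub>R f"
    unfolding scaleR_L2_def
    by transfer (auto simp: L2_rel_def distrib_right
        intro!: square_integrable_add square_integrable_mult_left)
  show "r *\<^sub>R s *\<^sub>R f = (r * s) *\<^sub>R f"
    unfolding scaleR_L2_def
    by transfer (auto simp: L2_rel_def mult.assoc intro!: square_integrable_mult_left)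
  show "1 *\<^sub>R f = f"
    unfolding scaleR_L2_def by transfer (auto simp: L2_rel_def)
  show "sgn f = inverse (norm f) *\<^sub>R f"
    by (simp add: sgn_L2_def)
  show "dist f g = norm (f - g)"
    by (simp add: dist_L2_def)
  show "(uniformity :: (L2 \<times> L2) filter) = (INF e\<in>{0<..}. principal {(x, y). dist x y < e})"
    by (simp add: uniformity_L2_def)
  show "open U = (\<forall>x\<in>U. eventually (\<lambda>(x', y). x' = x \<longrightarrow> y \<in> U) uniformity)" for U :: "L2 set"
    by (simp add: open_L2_def)
  show "norm f = sqrt (inner f f)"
    by (simp add: norm_L2_def)
  show "inner f g = inner g f"
    unfolding inner_L2_def
  proof transfer
    fix f g assume "L2_rel f f" "L2_rel g g"
    have "(\<integral>x. f x * cnj (g x) \<partial>lborel) = (\<integral>x. cnj (g x * cnj (f x)) \<partial>lborel)"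
      by (simp add: mult.commute)
    also have "\<dots> = cnj (\<integral>x. g x * cnj (f x) \<partial>lborel)"
      by (rule Bochner_Integration.integral_cnj)
    finally show "Re (\<integral>x. f x * cnj (g x) \<partial>lborel) = Re (\<integral>x. g x * cnj (f x) \<partial>lborel)"
      by simp
  qed
  show "inner (f + g) h = inner f h + inner g h"
    unfolding inner_L2_def
    by transfer (simp add: L2_rel_def integrable_mult_cnj distrib_right)
  show "inner (r *\<^sub>R f) g = r * inner f g"
    unfolding inner_L2_def scaleR_L2_def
    by transfer (simp add: L2_rel_def mult.assoc)
  have sq: "Re (\<integral>x. f x * cnj (f x) \<partial>lborel) = (\<integral>x. (cmod (f x))\<^sup>2 \<partial>lborel)" for f
    by (simp add: complex_norm_square[symmetric] flip: of_real_power)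
  show "0 \<le> inner f f"
    unfolding inner_L2_def by transfer (simp only: sq, simp)
  show "inner f f = 0 \<longleftrightarrow> f = 0"
    unfolding inner_L2_def
  proof transfer
    fix f assume f: "L2_rel f f"
    then have "integrable lborel (\<lambda>x. (cmod (f x))\<^sup>2)"
      by (simp add: L2_rel_def square_integrable_def)
    then have "(\<integral>x. (cmod (f x))\<^sup>2 \<partial>lborel) = 0 \<longleftrightarrow> (AE x in lborel. (cmod (f x))\<^sup>2 = 0)"
      by (intro integral_nonneg_eq_0_iff_AE) auto
    then show "Re (\<integral>x. f x * cnj (f x) \<partial>lborel) = 0 \<longleftrightarrow> L2_rel f (\<lambda>x. 0)"
      using f by (simp only: sq) (simp add: L2_rel_def square_integrable_zero)
  qed
qed

end

definition L2_of :: "(real \<Rightarrow> complex) \<Rightarrow> L2" where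
  "L2_of f = (if square_integrable f then abs_L2 f else 0)"

definition fun_L2 :: "L2 \<Rightarrow> real \<Rightarrow> complex" where
  "fun_L2 = rep_L2"

lemma square_integrable_fun_L2 [simp]: "square_integrable (fun_L2 f)"
  unfolding fun_L2_def by (metis Quotient_L2 Quotient_rep_reflp L2_rel_def)

lemma L2_of_fun_L2 [simp]: "L2_of (fun_L2 f) = f"
  using square_integrable_fun_L2[of f]
  by (simp add: L2_of_def fun_L2_def Quotient_abs_rep[OF Quotient_L2])

lemma fun_L2_L2_of:
  assumes "square_integrable f"
  shows "AE x in lborel. fun_L2 (L2_of f) x = f x"
  using assms Quotient_rep_abs[OF Quotient_L2, of f]
  by (auto simp: L2_of_def fun_L2_def L2_rel_def)

lemma L2_of_eq_iff:
  assumes "square_integrable f" "square_integrable g"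
  shows "L2_of f = L2_of g \<longleftrightarrow> (AE x in lborel. f x = g x)"
  using assms Quotient_rel[OF Quotient_L2, of f g] by (simp add: L2_of_def L2_rel_def)

lemma L2_of_add:
  assumes "square_integrable f" "square_integrable g"
  shows "L2_of (\<lambda>x. f x + g x) = L2_of f + L2_of g"
  using assms by (simp add: L2_of_def square_integrable_add plus_L2.abs_eq L2_rel_def)

lemma L2_of_scaleC:
  assumes "square_integrable f"
  shows "L2_of (\<lambda>x. c * f x) = c *\<^sub>c L2_of f"
  using assms by (simp add: L2_of_def square_integrable_mult_left scaleC_L2.abs_eq L2_rel_def)

lemma L2_of_scaleR:
  assumes "square_integrable f"
  shows "L2_of (\<lambda>x. of_real r * f x) = r *\<^sub>R L2_of f"
  using assms by (simp add: L2_of_scaleC scaleR_L2_def)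

lemma L2_of_diff:
  assumes "square_integrable f" "square_integrable g"
  shows "L2_of (\<lambda>x. f x - g x) = L2_of f - L2_of g"
  using L2_of_add[OF assms(1) square_integrable_mult_left[OF assms(2), of "-1"]]
    L2_of_scaleC[OF assms(2), of "-1"]
  by (simp add: minus_L2_def)

lemma square_integrable_diff:
  assumes "square_integrable f" "square_integrable g"
  shows "square_integrable (\<lambda>x. f x - g x)"
  using square_integrable_add[OF assms(1) square_integrable_mult_left[OF assms(2), of "-1"]]
  by simp

lemma norm_L2_of:
  assumes "square_integrable f"
  shows "norm (L2_of f) = sqrt (\<integral>x. (cmod (f x))\<^sup>2 \<partial>lborel)"
  using assms
  by (simp add: L2_of_def norm_L2_def inner_L2_def cinner_L2.abs_eq L2_rel_def
      complex_norm_square[symmetric] flip: of_real_power)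


lemma second_countable_of_countable_dense:
  fixes D :: "'a::metric_space set"
  assumes "countable D" "closure D = UNIV"
  shows "\<exists>B::'a set set. countable B \<and> open = generate_topology B"
proof -
  define B where "B = (\<lambda>(x, n). ball x (1 / real (Suc n))) ` (D \<times> (UNIV :: nat set))"
  have "countable B"
    unfolding B_def using assms(1) by (intro countable_image countable_SIGMA) auto
  moreover have "topological_basis B"
  proof (rule topological_basisI)
    show "open U" if "U \<in> B" for U using that by (auto simp: B_def)
    fix U :: "'a set" and x assume "open U" "x \<in> U"
    then obtain e where e: "e > 0" "ball x e \<subseteq> U" by (auto simp: open_contains_ball)
    obtain n where n: "1 / real (Suc n) < e / 2"
      using nat_approx_posE[of "e/2"] e(1) by auto
    have "x \<in> closure D" using assms(2) by simp
    moreover have "0 < 1 / real (Suc n)" by simp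
    ultimately obtain d where d: "d \<in> D" "dist d x < 1 / real (Suc n)"
      unfolding closure_approachable by meson
    have "x \<in> ball d (1 / real (Suc n))" using d by simp
    moreover have "ball d (1 / real (Suc n)) \<subseteq> ball x e"
    proof
      fix y assume "y \<in> ball d (1 / real (Suc n))"
      then have "dist d y < e/2" "dist d x < e/2" using d n by auto
      then show "y \<in> ball x e" using dist_triangle_half_r by (auto simp: dist_commute)
    qed
    ultimately show "\<exists>B'\<in>B. x \<in> B' \<and> B' \<subseteq> U"
      using d e(2) unfolding B_def by (intro bexI[of _ "ball d (1 / real (Suc n))"]) auto
  qed
  ultimately show ?thesis by (auto intro: topological_basis_imp_subbasis)
qed

lemma separable_closed_span:
  fixes B :: "'a::real_normed_vector set"
  assumes "countable B"
  obtains Q where "countable Q" "subspace (closure Q)" "B \<subseteq> closure Q"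
proof -
  define c where "c l = (\<Sum>(q, n)\<leftarrow>l. real_of_rat q *\<^sub>R from_nat_into (insert 0 B) n)" for l :: "(rat \<times> nat) list"
  define Q where "Q = range c"
  have cnt: "countable Q" by (simp add: Q_def)
  have capp: "c (l @ l') = c l + c l'" for l l' by (simp add: c_def)
  have cscale: "c (map (\<lambda>(p, n). (q * p, n)) l) = real_of_rat q *\<^sub>R c l" for q l
    by (induction l) (auto simp: c_def of_rat_mult scaleR_add_right)
  have rat: "\<exists>q. \<bar>real_of_rat q - r\<bar> < e" if "e > 0" for r e :: real
  proof -
    obtain q where "r < real_of_rat q" "real_of_rat q < r + e"
      using of_rat_dense[of r "r + e"] \<open>e > 0\<close> by auto
    then show ?thesis by (intro exI[of _ q]) auto
  qed
  have "subspace (closure Q)"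
  proof (rule subspaceI)
    have "c [] = 0" by (simp add: c_def)
    then have "0 \<in> Q" unfolding Q_def by (metis rangeI)
    then show "0 \<in> closure Q" using closure_subset by blast
    show "x + y \<in> closure Q" if xy: "x \<in> closure Q" "y \<in> closure Q" for x y
    proof -
      obtain a b where "\<And>n. a n \<in> Q" "a \<longlonglongrightarrow> x" "\<And>n. b n \<in> Q" "b \<longlonglongrightarrow> y"
        using xy unfolding closure_sequential by blast
      moreover from this have "a n + b n \<in> Q" for n
        unfolding Q_def by (metis capp rangeE rangeI)
      ultimately show ?thesis unfolding closure_sequential
        by (intro exI[of _ "\<lambda>n. a n + b n"]) (auto intro: tendsto_add)
    qed
    show "r *\<^sub>R x \<in> closure Q" if x: "x \<in> closure Q" for r x
    proof -
      obtain a where a: "\<And>n. a n \<in> Q" "a \<longlonglongrightarrow> x"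
        using x unfolding closure_sequential by blast
      obtain q where q: "\<bar>real_of_rat (q n) - r\<bar> < 1 / real (Suc n)" for n
        using rat[of "1 / real (Suc n)" r for n] by (metis of_nat_0_less_iff zero_less_Suc zero_less_divide_1_iff)
      have "(\<lambda>n. real_of_rat (q n) - r) \<longlonglongrightarrow> 0"
        by (rule Lim_null_comparison[OF _ LIMSEQ_Suc[OF lim_1_over_n]])
          (auto intro!: always_eventually less_imp_le q simp del: of_nat_Suc)
      then have "(\<lambda>n. real_of_rat (q n)) \<longlonglongrightarrow> r" by (simp add: LIM_zero_iff)
      then have "(\<lambda>n. real_of_rat (q n) *\<^sub>R a n) \<longlonglongrightarrow> r *\<^sub>R x" using a(2) by (rule tendsto_scaleR)
      moreover have "real_of_rat (q n) *\<^sub>R a n \<in> Q" for n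
        using a(1)[of n] unfolding Q_def by (metis cscale rangeE rangeI)
      ultimately show ?thesis unfolding closure_sequential
        by (intro exI[of _ "\<lambda>n. real_of_rat (q n) *\<^sub>R a n"]) auto
    qed
  qed
  moreover have "B \<subseteq> Q"
  proof
    fix b assume "b \<in> B"
    then obtain n where "from_nat_into (insert 0 B) n = b"
      using from_nat_into_surj[of "insert 0 B" b] assms by auto
    then have "c [(1, n)] = b" by (simp add: c_def)
    then show "b \<in> Q" unfolding Q_def by (metis rangeI)
  qed
  ultimately show ?thesis using cnt closure_subset that by blast
qed

lemma square_integrable_indicator:
  assumes "S \<in> sets lborel" "emeasure lborel S < \<infinity>"
  shows "square_integrable (\<lambda>x. c * indicator S x)"
proof (rule square_integrable_mult_left)
  have "(\<lambda>x. (cmod (indicator S x))\<^sup>2) = (indicator S :: real \<Rightarrow> real)"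
    by (auto simp: indicator_def fun_eq_iff)
  moreover have "integrable lborel (indicator S :: real \<Rightarrow> real)"
    using assms by (simp add: integrable_indicator_iff)
  ultimately show "square_integrable (indicator S)"
    using assms by (simp add: square_integrable_def)
qed

lemma tendsto_L2_of_dominated:
  assumes f: "square_integrable f" and w: "integrable lborel w"
    and s: "\<And>i. square_integrable (s i)"
    and lim: "AE x in lborel. (\<lambda>i. s i x) \<longlonglongrightarrow> f x"
    and bound: "\<And>i. AE x in lborel. (cmod (s i x - f x))\<^sup>2 \<le> w x"
  shows "(\<lambda>i. L2_of (s i)) \<longlonglongrightarrow> L2_of f"
proof -
  have "(\<lambda>i. \<integral>x. (cmod (s i x - f x))\<^sup>2 \<partial>lborel) \<longlonglongrightarrow> (\<integral>x. 0 \<partial>(lborel::real measure))"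
  proof (rule integral_dominated_convergence[where w = w])
    show "(\<lambda>x. (cmod (s i x - f x))\<^sup>2) \<in> borel_measurable lborel" for i
      using square_integrableD(2)[OF square_integrable_diff[OF s f]] by blast
    show "AE x in lborel. (\<lambda>i. (cmod (s i x - f x))\<^sup>2) \<longlonglongrightarrow> 0"
      using lim
    proof eventually_elim
      case (elim x)
      then have "(\<lambda>i. (cmod (s i x - f x))\<^sup>2) \<longlonglongrightarrow> (cmod (f x - f x))\<^sup>2"
        by (intro tendsto_intros)
      then show ?case by simp
    qed
  qed (use w bound in auto)
  then have "(\<lambda>i. sqrt (\<integral>x. (cmod (s i x - f x))\<^sup>2 \<partial>lborel)) \<longlonglongrightarrow> sqrt 0"
    by (intro tendsto_real_sqrt) simp
  then have "(\<lambda>i. norm (L2_of (s i) - L2_of f)) \<longlonglongrightarrow> 0"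
    by (simp add: norm_L2_of square_integrable_diff s f flip: L2_of_diff)
  then show ?thesis by (simp add: tendsto_norm_zero_iff LIM_zero_iff)
qed

instance L2 :: second_countable_topology
proof
  define ind where "ind c S = L2_of (\<lambda>x. c * indicator S x)" for c and S :: "real set"
  define B where "B = (\<lambda>(c, p, q). ind c {p..<q}) ` ({1, \<i>} \<times> \<rat> \<times> \<rat>)"
  have "countable B"
    unfolding B_def by (intro countable_image countable_SIGMA) (auto simp: countable_rat)
  then obtain Q where Q: "countable Q" "subspace (closure Q)" "B \<subseteq> closure Q"
    by (rule separable_closed_span)
  have sq: "square_integrable (\<lambda>x. c * indicator (E \<inter> {p..<q}) x)" if "E \<in> sets borel" for c E and p q :: real
  proof (rule square_integrable_indicator)
    have "emeasure lborel (E \<inter> {p..<q}) \<le> emeasure lborel {p..<q}"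
      using that by (intro emeasure_mono) auto
    also have "\<dots> < \<infinity>" by (cases "p \<le> q") auto
    finally show "emeasure lborel (E \<inter> {p..<q}) < \<infinity>" .
  qed (use that in auto)
  have dom: "ind c (E \<inter> {p..<q}) \<in> closure Q"
    if E: "\<And>i. E' i \<in> sets borel" "E \<in> sets borel"
      and lim: "\<And>x. (\<lambda>i. indicator (E' i \<inter> {p..<q}) x :: complex) \<longlonglongrightarrow> indicator (E \<inter> {p..<q}) x"
      and Q: "\<And>i. ind c (E' i \<inter> {p..<q}) \<in> closure Q" 
    for c E' E and p q :: real
  proof -
    have "(\<lambda>i. L2_of (\<lambda>x. c * indicator (E' i \<inter> {p..<q}) x)) \<longlonglongrightarrow> L2_of (\<lambda>x. c * indicator (E \<inter> {p..<q}) x)"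
    proof (rule tendsto_L2_of_dominated)
      show "integrable lborel (\<lambda>x. (cmod (c * indicator (UNIV \<inter> {p..<q}) x))\<^sup>2)"
        using sq[of UNIV] by (auto dest: square_integrableD)
      show "AE x in lborel. (\<lambda>i. c * indicator (E' i \<inter> {p..<q}) x) \<longlonglongrightarrow> c * indicator (E \<inter> {p..<q}) x"
        using lim by (intro AE_I2 tendsto_intros)
      show "AE x in lborel. (cmod (c * indicator (E' i \<inter> {p..<q}) x - c * indicator (E \<inter> {p..<q}) x))\<^sup>2
          \<le> (cmod (c * indicator (UNIV \<inter> {p..<q}) x))\<^sup>2" for i
        by (auto simp: indicator_def intro!: AE_I2)
    qed (use sq E in auto)
    then show ?thesis
      using Q unfolding ind_def by (meson closed_closure closed_sequentially)
  qed
  have step1: "ind c (E \<inter> {p..<q}) \<in> closure Q"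
    if E: "E \<in> sets borel" and c: "c \<in> {1, \<i>}" and p: "p \<in> \<rat>" and q: "q \<in> \<rat>" for c E p q
  proof -
    have basic': "ind c ({..<a} \<inter> {p..<q}) \<in> closure Q" if a: "a \<in> \<rat>" for a
    proof -
      have "{..<a} \<inter> {p..<q} = {p..<min a q}" by auto
      moreover have "min a q \<in> \<rat>" using a q by (simp add: min_def)
      ultimately show ?thesis using c p Q(3) unfolding B_def by force
    qed
    have "Int_stable (range (lessThan :: real \<Rightarrow> _))"
    proof (rule Int_stableI_image)
      show "\<exists>r\<in>UNIV. {..<a} \<inter> {..<b} = {..<r}" for a b :: real
        by (intro bexI[of _ "min a b"]) auto
    qed
    moreover have "range (lessThan :: real \<Rightarrow> _) \<subseteq> Pow UNIV" by simp
    moreover have "sets borel = sigma_sets UNIV (range (lessThan :: real \<Rightarrow> _))"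
    proof -
      have "(borel :: real measure) = sigma UNIV (range lessThan)"
        using borel_eq_lessThan[where 'a = real] by (simp add: eucl_less_def lessThan_def)
      then show ?thesis by (metis sets_measure_of subset_Pow_Union Pow_UNIV top_greatest)
    qed
    with E have "E \<in> sigma_sets UNIV (range (lessThan :: real \<Rightarrow> _))" by simp
    ultimately show ?thesis
    proof (induction rule: sigma_sets_induct_disjoint)
      case (basic A)
      then obtain a where A: "A = {..<a}" by auto
      have "\<exists>r. r \<in> \<rat> \<and> a - 1 / real (Suc i) < r \<and> r < a" for i
        using Rats_dense_in_real[of "a - 1 / real (Suc i)" a] by auto
      then obtain r where r: "r i \<in> \<rat>" "a - 1 / real (Suc i) < r i" "r i < a" for i by metis
      have ra: "r \<longlonglongrightarrow> a"
      proof (rule tendsto_sandwich)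
        show "(\<lambda>i. a - 1 / real (Suc i)) \<longlonglongrightarrow> a"
          using tendsto_diff[OF tendsto_const[of a] LIMSEQ_Suc[OF lim_1_over_n[where 'a = real]]] by simp
      qed (use r in \<open>auto intro!: always_eventually less_imp_le\<close>)
      show ?case unfolding A
      proof (rule dom[where E' = "\<lambda>i. {..<r i}"])
        fix x
        show "(\<lambda>i. indicator ({..<r i} \<inter> {p..<q}) x :: complex) \<longlonglongrightarrow> indicator ({..<a} \<inter> {p..<q}) x"
        proof (cases "x < a")
          case True
          have "\<forall>\<^sub>F i in sequentially. x < r i" using order_tendstoD(1)[OF ra True] .
          then have "\<forall>\<^sub>F i in sequentially. indicator ({..<a} \<inter> {p..<q}) x = (indicator ({..<r i} \<inter> {p..<q}) x :: complex)"
            by eventually_elim (use True in \<open>auto simp: indicator_def\<close>)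
          then show ?thesis by (rule tendsto_cong[THEN iffD1]) simp
        next
          case False
          then have "indicator ({..<r i} \<inter> {p..<q}) x = (0::complex)" for i
            using r(3)[of i] by (auto simp: indicator_def)
          moreover have "indicator ({..<a} \<inter> {p..<q}) x = (0::complex)"
            using False by (auto simp: indicator_def)
          ultimately show ?thesis by (simp only: tendsto_const)
        qed
      qed (use basic' r in auto)
    next
      case empty
      have "L2_of (\<lambda>x. 0) = 0" by (simp add: L2_of_def square_integrable_zero zero_L2.abs_eq)
      then show ?case using subspace_0[OF Q(2)] by (simp add: ind_def)
    next
      case (compl A)
      have UNIVm: "UNIV \<in> sets (borel :: real measure)" by simp
      have Am: "A \<in> sets borel" using compl(1) \<open>sets borel = _\<close> by simp
      have "ind c ((UNIV - A) \<inter> {p..<q}) = ind c (UNIV \<inter> {p..<q}) - ind c (A \<inter> {p..<q})"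
        unfolding ind_def
        unfolding L2_of_diff[OF sq sq, OF UNIVm Am, symmetric]
        by (rule arg_cong[where f = L2_of]) (auto simp: fun_eq_iff indicator_def)
      moreover have "ind c (UNIV \<inter> {p..<q}) \<in> closure Q"
        using basic'[OF q] by (simp add: Int_absorb1 subset_eq)
      ultimately show ?case using compl subspace_diff[OF Q(2)] by simp
    next
      case (union A)
      have A [simp]: "A i \<in> sets borel" for i using union(2) \<open>sets borel = _\<close> by auto
      show ?case
      proof (rule dom[where E' = "\<lambda>n. \<Union>i<n. A i"])
        fix n
        show "ind c ((\<Union>i<n. A i) \<inter> {p..<q}) \<in> closure Q"
        proof (induction n)
          case 0
          have "L2_of (\<lambda>x. 0) = 0" by (simp add: L2_of_def square_integrable_zero zero_L2.abs_eq)
          then show ?case using subspace_0[OF Q(2)] by (simp add: ind_def)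
        next
          case (Suc n)
          have disj: "x \<notin> A i" if "x \<in> A n" "i < n" for x i
            using disjoint_family_onD[OF union(1), of i n] that by auto
          have "ind c ((\<Union>i<Suc n. A i) \<inter> {p..<q}) = ind c ((\<Union>i<n. A i) \<inter> {p..<q}) + ind c (A n \<inter> {p..<q})"
            unfolding ind_def
            unfolding L2_of_add[OF sq sq, OF sets.finite_UN A, OF finite_lessThan A, symmetric]
            by (rule arg_cong[where f = L2_of])
              (auto simp: fun_eq_iff indicator_def less_Suc_eq dest: disj)
          then show ?case using Suc union(3) subspace_add[OF Q(2)] by simp
        qed
      next
        fix x
        have "(\<lambda>n. indicator (\<Union>i<n. A i) x :: complex) \<longlonglongrightarrow> indicator (\<Union>i. A i) x"
          by (rule LIMSEQ_indicator_UN)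
        then show "(\<lambda>n. indicator ((\<Union>i<n. A i) \<inter> {p..<q}) x :: complex) \<longlonglongrightarrow> indicator ((\<Union>i. A i) \<inter> {p..<q}) x"
          unfolding indicator_inter_arith by (intro tendsto_intros)
      qed auto
    qed
  qed
  have step2: "ind c (E \<inter> {p..<q}) \<in> closure Q"
    if E: "E \<in> sets borel" and p: "p \<in> \<rat>" and q: "q \<in> \<rat>" for c E p q
  proof -
    have "c * indicator S x = of_real (Re c) * (1 * indicator S x) + of_real (Im c) * (\<i> * indicator S x)"
      for S and x :: real
      by (auto simp: indicator_def complex_eq_iff)
    then have "ind c (E \<inter> {p..<q}) = Re c *\<^sub>R ind 1 (E \<inter> {p..<q}) + Im c *\<^sub>R ind \<i> (E \<inter> {p..<q})"
      unfolding ind_def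
      by (simp only: L2_of_add L2_of_scaleR square_integrable_mult_left sq[OF E])
    then show ?thesis
      using step1[OF E _ p q, of 1] step1[OF E _ p q, of \<i>] subspace_add[OF Q(2)] subspace_scale[OF Q(2)]
      by simp
  qed
  have "L2_of f \<in> closure Q" if f: "square_integrable f" for f
  proof -
    have fm [measurable]: "f \<in> borel_measurable lborel" using f by (simp add: square_integrable_def)
    obtain s where s: "\<And>i. simple_function lborel (s i)" "\<And>x. (\<lambda>i. s i x) \<longlonglongrightarrow> f x"
      "\<And>i x. cmod (s i x) \<le> 2 * cmod (f x)"
      using borel_measurable_implies_sequence_metric[OF fm, of 0]
      by (simp add: norm_conv_dist[symmetric]) metis
    have sm [measurable]: "s i \<in> borel_measurable lborel" for i
      by (rule borel_measurable_simple_function[OF s(1)])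
    define g where "g i x = indicator {- real i ..< real i} x * s i x" for i x
    have gsum: "g i x = (\<Sum>c\<in>range (s i). c * indicator ((s i -` {c}) \<inter> {- real i ..< real i}) x)" for i x
    proof -
      have "finite (range (s i))" using s(1) by (auto simp: simple_function_def)
      then have "(\<Sum>c\<in>range (s i). c * indicator ((s i -` {c}) \<inter> {- real i ..< real i}) x)
          = (\<Sum>c\<in>{s i x}. c * indicator ((s i -` {c}) \<inter> {- real i ..< real i}) x)"
        by (intro sum.mono_neutral_right) (auto simp: indicator_def)
      then show ?thesis by (simp add: g_def indicator_def)
    qed
    have pre: "s i -` {c} \<in> sets borel" for i c
      using simple_functionD(2)[OF s(1), of i "{c}"] by simp
    define h where "h i c x = c * indicator ((s i -` {c}) \<inter> {- real i ..< real i}) x" for i c x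
    have hsq: "square_integrable (h i c)" for i c
      unfolding h_def by (rule sq[OF pre])
    have hQ: "L2_of (h i c) \<in> closure Q" for i c
      using step2[OF pre, of "- real i" "real i" c i c] by (simp add: ind_def h_def[abs_def])
    have L2sum: "square_integrable (\<lambda>x. \<Sum>c\<in>C. h i c x) \<and> L2_of (\<lambda>x. \<Sum>c\<in>C. h i c x) \<in> closure Q"
      if "finite C" for i C using that
    proof (induction C)
      case empty
      have "L2_of (\<lambda>x. 0) = 0" by (simp add: L2_of_def square_integrable_zero zero_L2.abs_eq)
      then show ?case using subspace_0[OF Q(2)] by (simp add: square_integrable_zero)
    next
      case (insert c C)
      then show ?case
        using hsq[of i c] hQ[of i c] subspace_add[OF Q(2)]
        by (simp add: square_integrable_add L2_of_add)
    qed
    have fin: "finite (range (s i))" for i using s(1) by (auto simp: simple_function_def)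
    have g: "square_integrable (g i)" "L2_of (g i) \<in> closure Q" for i
      using L2sum[OF fin, of i i] by (simp_all add: gsum[abs_def] h_def del: sum_mult_indicator)
    have "(\<lambda>i. L2_of (g i)) \<longlonglongrightarrow> L2_of f"
    proof (rule tendsto_L2_of_dominated[OF f])
      show "integrable lborel (\<lambda>x. 9 * (cmod (f x))\<^sup>2)" using f by (simp add: square_integrable_def)
      have "(\<lambda>i. g i x) \<longlonglongrightarrow> f x" for x
      proof -
        obtain k :: nat where "\<bar>x\<bar> < real k" using reals_Archimedean2 by blast
        then have "s i x = g i x" if "i \<ge> k" for i
          using that of_nat_mono[OF that, where 'a = real] by (auto simp: g_def indicator_def)
        then have "\<forall>\<^sub>F i in sequentially. s i x = g i x"
          unfolding eventually_sequentially by blast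
        then show ?thesis using s(2) by (metis tendsto_cong)
      qed
      then show "AE x in lborel. (\<lambda>i. g i x) \<longlonglongrightarrow> f x" by simp
      have "(cmod (g i x - f x))\<^sup>2 \<le> 9 * (cmod (f x))\<^sup>2" for i x
      proof -
        have "cmod (g i x - f x) \<le> cmod (g i x) + cmod (f x)" by (rule norm_triangle_ineq4)
        also have "cmod (g i x) \<le> cmod (s i x)" by (auto simp: g_def indicator_def)
        finally have "cmod (g i x - f x) \<le> 3 * cmod (f x)" using s(3)[of i x] by simp
        then have "(cmod (g i x - f x))\<^sup>2 \<le> (3 * cmod (f x))\<^sup>2" by (intro power_mono) auto
        then show ?thesis by (simp add: power_mult_distrib)
      qed
      then show "AE x in lborel. (cmod (g i x - f x))\<^sup>2 \<le> 9 * (cmod (f x))\<^sup>2" for i by simp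
    qed (use g in auto)
    then show ?thesis using g(2) by (meson closed_closure closed_sequentially)
  qed
  then have "closure Q = UNIV"
    by (metis L2_of_fun_L2 UNIV_eq_I square_integrable_fun_L2)
  then show "\<exists>B::L2 set set. countable B \<and> open = generate_topology B"
    by (rule second_countable_of_countable_dense[OF Q(1)])
qed


section \<open>The harmonic oscillator\<close>

definition hermite_fun :: "nat \<Rightarrow> real \<Rightarrow> real" where
  "hermite_fun k x =
     (-1) ^ k / sqrt (sqrt pi * 2 ^ k * fact k) * exp (x\<^sup>2 / 2)
       * (deriv ^^ k) (\<lambda>y. exp (- y\<^sup>2)) x"

definition hermite_L2 :: "nat \<Rightarrow> L2" where
  "hermite_L2 k = L2_of (\<lambda>x. of_real (hermite_fun k x))"

text \<open>
  The unitary group generated by \<open>-i H\<close>, given by the spectral decomposition of \<open>H\<close>: the Hermite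
  functions form a Hilbert basis of eigenfunctions for the eigenvalues \<open>2 k + 1\<close>.
  The series converges in the norm of \<open>L2\<close>.
\<close>

definition exp_iH :: "real \<Rightarrow> L2 \<Rightarrow> L2" where
  "exp_iH t \<psi> =
     (\<Sum>k. (exp (- \<i> * of_real ((2 * real k + 1) * t)) * cinner_L2 \<psi> (hermite_L2 k)) *\<^sub>c hermite_L2 k)"

section \<open>Weak derivatives and function spaces\<close>

definition test_function :: "real set \<Rightarrow> (real \<Rightarrow> real) \<Rightarrow> bool" where
  "test_function I \<theta> \<longleftrightarrow>
     (\<forall>n x. (deriv ^^ n) \<theta> field_differentiable (at x)) \<and>
     compact (closure {x. \<theta> x \<noteq> 0}) \<and> closure {x. \<theta> x \<noteq> 0} \<subseteq> I"

text \<open>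
  Only the restrictions of \<open>\<psi>\<close> and \<open>g\<close> to \<open>I\<close> matter here. As every function in \<open>L\<^sup>2(I)\<close> extends by
  zero, requiring a weak derivative \<open>g :: L2\<close> on \<open>I\<close> amounts to requiring one in \<open>L\<^sup>2(I)\<close>.
\<close>

definition has_weak_deriv :: "real set \<Rightarrow> L2 \<Rightarrow> L2 \<Rightarrow> bool" where
  "has_weak_deriv I \<psi> g \<longleftrightarrow>
     (\<forall>\<theta>. test_function I \<theta> \<longrightarrow>
        (LINT x:I|lborel. fun_L2 \<psi> x * of_real (deriv \<theta> x))
          = - (LINT x:I|lborel. fun_L2 g x * of_real (\<theta> x)))"

definition H1_on :: "real set \<Rightarrow> L2 set" where
  "H1_on I = {\<psi>. \<exists>g. has_weak_deriv I \<psi> g}"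

text \<open>On \<open>I\<close> the weak derivative is unique almost everywhere, so the choice is immaterial.\<close>

definition H1_norm_on :: "real set \<Rightarrow> L2 \<Rightarrow> real" where
  "H1_norm_on I \<psi> =
     (let g = (SOME g. has_weak_deriv I \<psi> g) in
      sqrt ((LINT x:I|lborel. (cmod (fun_L2 \<psi> x))\<^sup>2) + (LINT x:I|lborel. (cmod (fun_L2 g x))\<^sup>2)))"

text \<open>
  The distribution \<open>(- d/dx + x) \<psi>\<close> pairs with \<open>\<theta>\<close> as the integral of \<open>\<psi> (\<theta>' + x \<theta>)\<close>.
\<close>

definition H1h :: "L2 set" where
  "H1h = {\<psi>. \<exists>g. \<forall>\<theta>. test_function UNIV \<theta> \<longrightarrow>
     (\<integral>x. fun_L2 \<psi> x * of_real (deriv \<theta> x + x * \<theta> x) \<partial>lborel)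
       = (\<integral>x. fun_L2 g x * of_real (\<theta> x) \<partial>lborel)}"

definition H1h_norm :: "L2 \<Rightarrow> real" where
  "H1h_norm \<psi> = sqrt (\<Sum>k. (2 * real k + 1) * (cmod (cinner_L2 \<psi> (hermite_L2 k)))\<^sup>2)"

text \<open>
  For \<open>A = {a 1 < \<dots> < a N}\<close> the components of the complement are \<open>piece N a j\<close> with \<open>j \<le> N\<close>:
  \<open>(-\<infinity>, a 1)\<close> for \<open>j = 0\<close>, \<open>(a j, a (j + 1))\<close> for \<open>0 < j < N\<close>, and \<open>(a N, \<infinity>)\<close> for \<open>j = N\<close>.
\<close>

definition piece :: "nat \<Rightarrow> (nat \<Rightarrow> real) \<Rightarrow> nat \<Rightarrow> real set" where
  "piece N a j = {x. (0 < j \<longrightarrow> a j < x) \<and> (j < N \<longrightarrow> x < a (Suc j))}"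

definition H1_tilde :: "nat \<Rightarrow> (nat \<Rightarrow> real) \<Rightarrow> L2 set" where
  "H1_tilde N a =
     {\<psi>. square_integrable (\<lambda>x. of_real x * fun_L2 \<psi> x) \<and> (\<forall>j\<le>N. \<psi> \<in> H1_on (piece N a j))}"

definition H1_tilde_norm :: "nat \<Rightarrow> (nat \<Rightarrow> real) \<Rightarrow> L2 \<Rightarrow> real" where
  "H1_tilde_norm N a \<psi> =
     sqrt ((\<Sum>j\<le>N. (H1_norm_on (piece N a j) \<psi>)\<^sup>2)
           + (\<integral>x. (cmod (of_real (1 + \<bar>x\<bar>) * fun_L2 \<psi> x))\<^sup>2 \<partial>lborel))"

section \<open>Time dependent functions\<close>

definition L2_time_real :: "real \<Rightarrow> (real \<Rightarrow> real) set" where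
  "L2_time_real T =
     {u. u \<in> borel_measurable (lebesgue_on {0<..<T}) \<and>
         integrable (lebesgue_on {0<..<T}) (\<lambda>t. (u t)\<^sup>2)}"

text \<open>
  The Bochner space \<open>L\<^sup>2((0,T), X)\<close> for a subspace \<open>X\<close> of \<open>L2\<close> with its own norm \<open>nX\<close>. Strong
  measurability, that is approximation by simple functions, is meant with respect to \<open>nX\<close>.
\<close>

definition strongly_measurable_time :: "real \<Rightarrow> L2 set \<Rightarrow> (L2 \<Rightarrow> real) \<Rightarrow> (real \<Rightarrow> L2) \<Rightarrow> bool" where
  "strongly_measurable_time T X nX f \<longleftrightarrow>
     (\<exists>s. (\<forall>n. simple_function (lebesgue_on {0<..<T}) (s n) \<and> s n ` {0<..<T} \<subseteq> X) \<and>
          (AE t in lebesgue_on {0<..<T}. (\<lambda>n. nX (f t - s n t)) \<longlonglongrightarrow> 0))"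

definition L2_time :: "real \<Rightarrow> L2 set \<Rightarrow> (L2 \<Rightarrow> real) \<Rightarrow> (real \<Rightarrow> L2) set" where
  "L2_time T X nX =
     {f. (AE t in lebesgue_on {0<..<T}. f t \<in> X) \<and> strongly_measurable_time T X nX f \<and>
         integrable (lebesgue_on {0<..<T}) (\<lambda>t. (nX (f t))\<^sup>2)}"

definition L2_time_norm :: "real \<Rightarrow> (L2 \<Rightarrow> real) \<Rightarrow> (real \<Rightarrow> L2) \<Rightarrow> real" where
  "L2_time_norm T nX f = sqrt (\<integral>t. (nX (f t))\<^sup>2 \<partial>lebesgue_on {0<..<T})"

text \<open>Only the values on \<open>[0,T]\<close> of an element of \<open>C([0,T], X)\<close> are meaningful.\<close>

definition C_time :: "real \<Rightarrow> L2 set \<Rightarrow> (L2 \<Rightarrow> real) \<Rightarrow> (real \<Rightarrow> L2) set" where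
  "C_time T X nX =
     {\<psi>. \<forall>t\<in>{0..T}. \<psi> t \<in> X \<and> ((\<lambda>s. nX (\<psi> s - \<psi> t)) \<longlongrightarrow> 0) (at t within {0..T})}"

definition C_time_norm :: "real \<Rightarrow> (L2 \<Rightarrow> real) \<Rightarrow> (real \<Rightarrow> L2) \<Rightarrow> real" where
  "C_time_norm T nX \<psi> = (SUP t\<in>{0..T}. nX (\<psi> t))"

section \<open>Mild solutions\<close>

text \<open>
  The pointwise product, if it is square integrable. This is always so for \<open>\<mu>\<close> in \<open>H1_tilde\<close>,
  whose elements are essentially bounded.
\<close>

definition mult_L2 :: "L2 \<Rightarrow> L2 \<Rightarrow> L2" where
  "mult_L2 \<mu> \<psi> = L2_of (\<lambda>x. fun_L2 \<mu> x * fun_L2 \<psi> x)"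

text \<open>The integral is a Bochner integral with values in \<open>L2\<close>; its existence is required.\<close>

definition mild_solution ::
    "real \<Rightarrow> L2 \<Rightarrow> (real \<Rightarrow> real) \<Rightarrow> (real \<Rightarrow> L2) \<Rightarrow> L2 \<Rightarrow> (real \<Rightarrow> L2) \<Rightarrow> bool" where
  "mild_solution T \<mu> u f \<psi>0 \<psi> \<longleftrightarrow>
     (\<forall>t\<in>{0..T}. \<exists>J.
        has_bochner_integral (lebesgue_on {0..t})
          (\<lambda>s. exp_iH (t - s) (u s *\<^sub>R mult_L2 \<mu> (\<psi> s) + f s)) J \<and>
        \<psi> t = exp_iH t \<psi>0 - \<i> *\<^sub>c J)"

end

(*
  A function with jumps is not in H1h, but the Duhamel integral gains the missing half power of H.
  Since phi_k is a multiple of (-d/dx + x) phi_(k-1), integrating the pairing of g in H1_tilde with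
  phi_k by parts on each piece gives (2 k)^(-1/2) times the sum of a square summable sequence and of
  the finitely many terms jump_j(g) phi_(k-1)(a_j). The latter are only bounded in k. In the Duhamel
  integral, however, jump_j(g(s)) is integrated against exp(i (2 k + 1) s), which yields Fourier
  coefficients of a square integrable function, and Bessel's inequality makes them square summable.
  Hence s |-> exp(- i H (t - s)) g(s) has an integral in H1h controlled by the L2 norm of g in time.
  As multiplication by mu maps H1h boundedly into H1_tilde, H^(1/2) psi satisfies a Volterra
  equation with the kernel |u|^2, solved by iteration and estimated by a Gronwall argument.
*)
theory Submission
  imports Defs "HOL-Probability.Distributions" "HOL-Real_Asymp.Real_Asymp"
begin

section \<open>The inner product\<close>

text \<open>All curves in time stay in \<open>hermite_span\<close>, the functions that equal their
  own Hermite series: \<open>exp_iH\<close> takes its values there, hence so does every mild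
  solution, and there \<psi> may be traded for H^(1/2) \<psi>, with the L2 norm in place of the norm
  of \<open>H1h\<close>. Two obstacles shape the estimates. The jumps of a source must depend
  measurably on time; \<open>jump\<close> therefore reads them off as limits of continuous linear
  functionals of the function itself. For the control term the product rule is worked out on finite
  Hermite sums, with constants independent of their length, and truncation gives the rest. The
  estimates in time are stated for every measurable subset of [0,T], so that one bound controls both
  size and increments. The frequencies 2 k + 1 differ by even numbers, so \<pi> is a period for the
  orthogonality, and finitely many periods cover [0,T]. The Volterra equation is solved on all of
  [0,T] at once, by a weight adapted to |u|^2.\<close>

lemma cinner_L2_of:
  assumes "square_integrable f" "square_integrable g"
  shows "cinner_L2 (L2_of f) (L2_of g) = (\<integral>x. f x * cnj (g x) \<partial>lborel)"
  using assms by (simp add: L2_of_def cinner_L2.abs_eq L2_rel_def)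

lemma cinner_L2_of_right:
  assumes "square_integrable g"
  shows "cinner_L2 f (L2_of g) = (\<integral>x. fun_L2 f x * cnj (g x) \<partial>lborel)"
  using cinner_L2_of[of "fun_L2 f" g] assms by simp

lemma cinner_add_left: "cinner_L2 (f + g) h = cinner_L2 f h + cinner_L2 g h"
  by transfer (simp add: L2_rel_def integrable_mult_cnj distrib_right)

lemma cinner_scaleC_left: "cinner_L2 (c *\<^sub>c f) h = c * cinner_L2 f h"
  by transfer (simp add: L2_rel_def mult.assoc)

lemma cinner_commute: "cinner_L2 g f = cnj (cinner_L2 f g)"
proof transfer
  fix f g :: "real \<Rightarrow> complex"
  show "(\<integral>x. g x * cnj (f x) \<partial>lborel) = cnj (\<integral>x. f x * cnj (g x) \<partial>lborel)"
    by (simp add: mult.commute flip: Bochner_Integration.integral_cnj)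
qed

lemma scaleR_L2_eq: "r *\<^sub>R f = complex_of_real r *\<^sub>c f" for f :: L2
  by (simp add: scaleR_L2_def)

lemma cinner_scaleR_left: "cinner_L2 (r *\<^sub>R f) h = r *\<^sub>R cinner_L2 f h"
  by (simp add: scaleR_L2_eq cinner_scaleC_left scaleR_conv_of_real)

lemma cinner_zero_left [simp]: "cinner_L2 0 h = 0"
  using cinner_scaleR_left[of 0 0 h] by simp

lemma cinner_minus_left: "cinner_L2 (- f) h = - cinner_L2 f h"
  using cinner_scaleR_left[of "-1" f h] by simp

lemma cinner_diff_left: "cinner_L2 (f - g) h = cinner_L2 f h - cinner_L2 g h"
  using cinner_add_left[of f "-g" h] by (simp add: cinner_minus_left)

lemma cinner_sum_left: "cinner_L2 (sum f A) h = (\<Sum>i\<in>A. cinner_L2 (f i) h)"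
  by (induction A rule: infinite_finite_induct) (auto simp: cinner_add_left)

lemma scaleC_add_right: "c *\<^sub>c (f + g) = c *\<^sub>c f + c *\<^sub>c g"
  by transfer (auto simp: L2_rel_def distrib_left
        intro!: square_integrable_add square_integrable_mult_left)

lemma scaleC_add_left: "(c + d) *\<^sub>c f = c *\<^sub>c f + d *\<^sub>c f"
  by transfer (auto simp: L2_rel_def distrib_right
        intro!: square_integrable_add square_integrable_mult_left)

lemma scaleC_scaleC: "c *\<^sub>c d *\<^sub>c f = (c * d) *\<^sub>c f"
  by transfer (auto simp: L2_rel_def mult.assoc intro!: square_integrable_mult_left)

lemma scaleC_zero_left [simp]: "0 *\<^sub>c f = 0"
  using scaleR_L2_eq[of 0 f] by simp

lemma cinner_self: "cinner_L2 f f = complex_of_real ((norm f)\<^sup>2)"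
proof -
  have "Im (cinner_L2 f f) = 0"
    using arg_cong[OF cinner_commute[of f f], of Im] by simp
  moreover have "Re (cinner_L2 f f) = (norm f)\<^sup>2"
    unfolding inner_L2_def[symmetric] by (simp add: power2_norm_eq_inner)
  ultimately show ?thesis by (simp add: complex_eq_iff)
qed

lemma power2_norm_L2: "(norm f)\<^sup>2 = (\<integral>x. (cmod (fun_L2 f x))\<^sup>2 \<partial>lborel)"
  using norm_L2_of[of "fun_L2 f"] by simp

lemma norm_L2_of_power2:
  assumes "square_integrable f"
  shows "(norm (L2_of f))\<^sup>2 = (\<integral>x. (cmod (f x))\<^sup>2 \<partial>lborel)"
  using norm_L2_of[OF assms] by simp

lemma norm_scaleC: "norm (c *\<^sub>c f) = cmod c * norm f"
proof -
  have "complex_of_real ((norm (c *\<^sub>c f))\<^sup>2) = c * cnj (c * cinner_L2 f f)"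
    using cinner_scaleC_left[of c f "c *\<^sub>c f"] cinner_commute[of f "c *\<^sub>c f"]
    by (simp only: cinner_self cinner_scaleC_left)
  also have "\<dots> = complex_of_real ((cmod c * norm f)\<^sup>2)"
    by (simp add: cinner_self power_mult_distrib mult.assoc[symmetric] flip: complex_norm_square)
  finally have "(norm (c *\<^sub>c f))\<^sup>2 = (cmod c * norm f)\<^sup>2"
    by (simp only: of_real_eq_iff)
  then show ?thesis by simp
qed

text \<open>This is the real Cauchy-Schwarz inequality after rotating \<open>f\<close> by the phase
  that makes the pairing a nonnegative real number.\<close>

lemma norm_cinner_le: "cmod (cinner_L2 f g) \<le> norm f * norm g"
proof (cases "cinner_L2 f g = 0")
  case False
  define z where "z = cinner_L2 f g"
  have z: "z \<noteq> 0" using False by (simp add: z_def)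
  have "complex_of_real (cmod z) = cnj (sgn z) * z"
    using z by (simp add: sgn_eq complex_norm_square[symmetric] mult.commute[of _ z] power2_eq_square)
  also have "\<dots> = cinner_L2 (cnj (sgn z) *\<^sub>c f) g" by (simp add: cinner_scaleC_left z_def)
  finally have "cmod z = inner (cnj (sgn z) *\<^sub>c f) g" 
    unfolding inner_L2_def by (metis Re_complex_of_real)
  also have "\<dots> \<le> norm (cnj (sgn z) *\<^sub>c f) * norm g" by (rule norm_cauchy_schwarz)
  finally show ?thesis using z by (simp add: norm_scaleC z_def norm_sgn)
qed simp

lemma bounded_linear_cinner_left: "bounded_linear (\<lambda>f. cinner_L2 f g)"
  by (rule bounded_linear_intro[where K = "norm g"])
    (auto simp: cinner_add_left cinner_scaleR_left norm_cinner_le)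

lemma bounded_linear_scaleC: "bounded_linear (\<lambda>f. c *\<^sub>c f)"
  by (rule bounded_linear_intro[where K = "cmod c"])
    (auto simp: scaleC_add_right norm_scaleC scaleR_L2_eq scaleC_scaleC mult_ac)

lemma fun_L2_borel [measurable]: "fun_L2 f \<in> borel_measurable borel"
  using square_integrable_fun_L2[of f] by (simp add: square_integrable_def)

lemma fun_L2_add: "AE x in lborel. fun_L2 (f + g) x = fun_L2 f x + fun_L2 g x"
  using fun_L2_L2_of[OF square_integrable_add[of "fun_L2 f" "fun_L2 g"]]
  by (simp add: L2_of_add)

lemma fun_L2_diff: "AE x in lborel. fun_L2 (f - g) x = fun_L2 f x - fun_L2 g x"
  using fun_L2_L2_of[OF square_integrable_diff[of "fun_L2 f" "fun_L2 g"]]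
  by (simp add: L2_of_diff)

lemma fun_L2_scaleC: "AE x in lborel. fun_L2 (c *\<^sub>c f) x = c * fun_L2 f x"
  using fun_L2_L2_of[OF square_integrable_mult_left[of "fun_L2 f" c]]
  by (simp add: L2_of_scaleC)

text \<open>Riesz-Fischer. The geometric rate keeps the increments square summable even against the
  weight 2^n, so the representatives converge almost everywhere; Fatou's lemma then shows that the
  pointwise limit is the limit in norm, with the same rate.\<close>

lemma L2_fast_Cauchy_limit:
  fixes X :: "nat \<Rightarrow> L2"
  assumes X: "\<And>m n. n \<le> m \<Longrightarrow> norm (X m - X n) \<le> (1/2) ^ n"
  shows "convergent X"
proof -
  define f where "f n = fun_L2 (X n)" for n
  have fm [measurable]: "f n \<in> borel_measurable borel" for n by (simp add: f_def)
  have int: "integrable lborel (\<lambda>x. (cmod (f m x - f n x))\<^sup>2)" for m n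
    unfolding f_def by (rule square_integrableD(2)[OF square_integrable_diff]) simp_all
  have nn: "(\<integral>\<^sup>+x. ennreal ((cmod (f m x - f n x))\<^sup>2) \<partial>lborel) = ennreal ((norm (X m - X n))\<^sup>2)" for m n
  proof -
    have "(norm (X m - X n))\<^sup>2 = (\<integral>x. (cmod (f m x - f n x))\<^sup>2 \<partial>lborel)"
      using norm_L2_of_power2[OF square_integrable_diff[of "fun_L2 (X m)" "fun_L2 (X n)"]]
      by (simp add: L2_of_diff f_def)
    then show ?thesis using int by (subst nn_integral_eq_integral) auto
  qed
  have "(\<integral>\<^sup>+x. (\<Sum>n. ennreal (2^n * (cmod (f (Suc n) x - f n x))\<^sup>2)) \<partial>lborel)
      = (\<Sum>n. \<integral>\<^sup>+x. ennreal (2^n * (cmod (f (Suc n) x - f n x))\<^sup>2) \<partial>lborel)"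
    by (rule nn_integral_suminf) measurable
  also have "\<dots> = (\<Sum>n. ennreal (2^n * (norm (X (Suc n) - X n))\<^sup>2))"
    by (simp add: ennreal_mult nn_integral_cmult nn)
  also have "\<dots> \<le> (\<Sum>n. ennreal ((1/2)^n))"
  proof (intro suminf_le ennreal_leI)
    fix n
    have "(norm (X (Suc n) - X n))\<^sup>2 \<le> ((1/2)^n)\<^sup>2"
      using X[of n "Suc n"] by (intro power_mono) auto
    then have "2^n * (norm (X (Suc n) - X n))\<^sup>2 \<le> 2^n * ((1/2)^n)\<^sup>2" by simp
    also have "\<dots> = (1/2 :: real)^n" by (simp add: power2_eq_square flip: power_mult_distrib)
    finally show "2^n * (norm (X (Suc n) - X n))\<^sup>2 \<le> (1/2)^n" .
  qed auto
  also have "\<dots> < \<infinity>"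
    by (subst suminf_ennreal2) (auto intro!: summable_geometric)
  finally have "AE x in lborel. (\<Sum>n. ennreal (2^n * (cmod (f (Suc n) x - f n x))\<^sup>2)) \<noteq> \<infinity>"
    by (intro nn_integral_noteq_infinite) auto
  then have lim: "AE x in lborel. convergent (\<lambda>n. f n x)"
  proof eventually_elim
    case (elim x)
    then have "summable (\<lambda>n. 2^n * (cmod (f (Suc n) x - f n x))\<^sup>2)"
      by (intro summable_suminf_not_top) auto
    then have "summable (\<lambda>n. (1/2)^n + 2^n * (cmod (f (Suc n) x - f n x))\<^sup>2)"
      by (intro summable_add summable_geometric) auto
    then have "summable (\<lambda>n. f (Suc n) x - f n x)"
    proof (rule summable_comparison_test'[where N = 0])
      fix n
      define d where "d = cmod (f (Suc n) x - f n x)"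
      \<comment> \<open>The inequality 2 d <= 2^(-n) + 2^n d^2 turns the weighted square summability
        into absolute summability of the increments.\<close>
      have "0 \<le> (1 - 2^n * d)\<^sup>2 / 2^n" by simp
      also have "\<dots> = (1/2)^n + 2^n * d\<^sup>2 - 2 * d"
        by (simp add: field_simps power2_eq_square)
      finally have "2 * d \<le> (1/2)^n + 2^n * d\<^sup>2" by simp
      moreover have "d \<ge> 0" by (simp add: d_def)
      ultimately show "norm (f (Suc n) x - f n x) \<le> (1/2)^n + 2^n * (cmod (f (Suc n) x - f n x))\<^sup>2"
        unfolding d_def by linarith
    qed
    then obtain s where "(\<lambda>n. \<Sum>i<n. f (Suc i) x - f i x) \<longlonglongrightarrow> s" 
      using summable_LIMSEQ by blast
    then have "(\<lambda>n. f n x - f 0 x) \<longlonglongrightarrow> s" by (simp only: sum_lessThan_telescope[of "\<lambda>i. f i x"])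
    then have "(\<lambda>n. f n x - f 0 x + f 0 x) \<longlonglongrightarrow> s + f 0 x" by (intro tendsto_intros)
    then show ?case by (simp add: convergentI)
  qed
  define g where "g x = lim (\<lambda>n. f n x)" for x
  have gm [measurable]: "g \<in> borel_measurable borel" unfolding g_def by (rule borel_measurable_lim_metric) simp
  \<comment> \<open>Fatou's lemma for \<open>m\<close> tending to infinity, with \<open>n\<close>
    fixed.\<close>
  have bound: "(\<integral>\<^sup>+x. ennreal ((cmod (g x - f n x))\<^sup>2) \<partial>lborel) \<le> ennreal (((1/2)^n)\<^sup>2)" for n
  proof -
    have "(\<integral>\<^sup>+x. ennreal ((cmod (g x - f n x))\<^sup>2) \<partial>lborel)
        = (\<integral>\<^sup>+x. liminf (\<lambda>m. ennreal ((cmod (f m x - f n x))\<^sup>2)) \<partial>lborel)"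
    proof (rule nn_integral_cong_AE)
      show "AE x in lborel. ennreal ((cmod (g x - f n x))\<^sup>2) = liminf (\<lambda>m. ennreal ((cmod (f m x - f n x))\<^sup>2))"
        using lim
      proof eventually_elim
        case (elim x)
        then have "(\<lambda>m. f m x) \<longlonglongrightarrow> g x" by (simp add: g_def convergent_LIMSEQ_iff)
        then have "(\<lambda>m. ennreal ((cmod (f m x - f n x))\<^sup>2)) \<longlonglongrightarrow> ennreal ((cmod (g x - f n x))\<^sup>2)"
          by (intro tendsto_intros)
        then show ?case by (rule lim_imp_Liminf[OF sequentially_bot, symmetric])
      qed
    qed
    also have "\<dots> \<le> liminf (\<lambda>m. \<integral>\<^sup>+x. ennreal ((cmod (f m x - f n x))\<^sup>2) \<partial>lborel)"
      by (rule nn_integral_liminf) measurable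
    also have "\<dots> = liminf (\<lambda>m. ennreal ((norm (X m - X n))\<^sup>2))" by (simp add: nn)
    also have "\<dots> \<le> limsup (\<lambda>m. ennreal ((norm (X m - X n))\<^sup>2))"
      by (rule Liminf_le_Limsup) simp
    also have "\<dots> \<le> ennreal (((1/2)^n)\<^sup>2)"
    proof (rule Limsup_bounded)
      show "\<forall>\<^sub>F m in sequentially. ennreal ((norm (X m - X n))\<^sup>2) \<le> ennreal (((1/2)^n)\<^sup>2)"
        unfolding eventually_sequentially
        by (intro exI[of _ n] allI impI ennreal_leI power_mono X) auto
    qed
    finally show ?thesis .
  qed
  have sq: "square_integrable (\<lambda>x. g x - f n x)" for n
    unfolding square_integrable_def
  proof
    show "integrable lborel (\<lambda>x. (cmod (g x - f n x))\<^sup>2)"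
      using le_less_trans[OF bound[of n] ennreal_less_top] by (intro integrableI_bounded) simp_all
  qed simp
  have sqg: "square_integrable g"
    using square_integrable_add[OF sq[of 0], of "f 0"] by (simp add: f_def)
  have "norm (L2_of g - X n) \<le> (1/2)^n" for n
  proof -
    have "L2_of g - X n = L2_of (\<lambda>x. g x - f n x)"
      using sqg by (simp add: L2_of_diff f_def)
    then have "(norm (L2_of g - X n))\<^sup>2 = (\<integral>x. (cmod (g x - f n x))\<^sup>2 \<partial>lborel)"
      using sq by (simp add: norm_L2_of_power2)
    also have "ennreal \<dots> = (\<integral>\<^sup>+x. ennreal ((cmod (g x - f n x))\<^sup>2) \<partial>lborel)"
      using square_integrableD(2)[OF sq, of n] by (subst nn_integral_eq_integral) auto
    finally have "ennreal ((norm (L2_of g - X n))\<^sup>2) \<le> ennreal (((1/2)^n)\<^sup>2)"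
      using bound[of n] by simp
    then have "(norm (L2_of g - X n))\<^sup>2 \<le> ((1/2)^n)\<^sup>2" by (subst (asm) ennreal_le_iff) auto
    then show ?thesis by (rule power2_le_imp_le) simp
  qed
  then have "(\<lambda>n. L2_of g - X n) \<longlonglongrightarrow> 0"
    by (rule Lim_null_comparison[OF always_eventually[OF allI] LIMSEQ_realpow_zero]) auto
  then have "(\<lambda>n. L2_of g - (L2_of g - X n)) \<longlonglongrightarrow> L2_of g - 0" by (intro tendsto_intros)
  then show ?thesis by (auto simp: convergent_def)
qed

instance L2 :: banach
proof
  fix X :: "nat \<Rightarrow> L2" assume X: "Cauchy X"
  have "\<exists>M. \<forall>m\<ge>M. \<forall>n\<ge>M. norm (X m - X n) < (1/2)^k" for k
    using X by (intro CauchyD) auto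
  then obtain M where M: "\<And>k m n. m \<ge> M k \<Longrightarrow> n \<ge> M k \<Longrightarrow> norm (X m - X n) < (1/2)^k" by metis
  \<comment> \<open>The partial sums dominate \<open>M k\<close>, and the added \<open>k\<close>
    makes the selection strictly increasing.\<close>
  define r where "r k = (\<Sum>i\<le>k. M i) + k" for k
  have r: "strict_mono r" by (auto simp: strict_mono_Suc_iff r_def)
  have rM: "M k \<le> r k" for k by (auto simp: r_def intro: trans_le_add1 member_le_sum)
  have "convergent (X \<circ> r)"
  proof (rule L2_fast_Cauchy_limit)
    show "norm ((X \<circ> r) m - (X \<circ> r) n) \<le> (1/2)^n" if "n \<le> m" for m n
      using M[of n "r m" "r n"] rM[of n] strict_mono_less_eq[OF r, of n m] that by auto
  qed
  then obtain l where "(X \<circ> r) \<longlonglongrightarrow> l" by (auto simp: convergent_def)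
  then show "convergent X"
    using Cauchy_converges_subseq[OF X r] by (auto simp: convergent_def)
qed

section \<open>Primitives of locally integrable functions\<close>

text \<open>Local absolute continuity of \<open>F\<close> with density \<open>f\<close>, encoded by
  the integral identity on compact intervals; pointwise derivatives of \<open>F\<close> do not
  enter.\<close>

definition primitive :: "(real \<Rightarrow> 'a::euclidean_space) \<Rightarrow> (real \<Rightarrow> 'a) \<Rightarrow> bool" where
  "primitive F f \<longleftrightarrow> (\<forall>p q. p \<le> q \<longrightarrow>
     set_integrable lborel {p..q} f \<and> F q - F p = (LINT x:{p..q}|lborel. f x))"

lemma primitive_set_integrable: "primitive F f \<Longrightarrow> set_integrable lborel {p..q} f"
  by (cases "p \<le> q") (auto simp: primitive_def set_integrable_def)

lemma primitive_diff_eq: "primitive F f \<Longrightarrow> p \<le> q \<Longrightarrow> F q - F p = (LINT x:{p..q}|lborel. f x)"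
  by (auto simp: primitive_def)

lemma primitive_exists:
  fixes f :: "real \<Rightarrow> 'a::euclidean_space"
  assumes f: "\<And>p q. set_integrable lborel {p..q} f"
  obtains F where "primitive F f" "F x0 = c"
proof -
  define F where "F x = c + (if x0 \<le> x then integral {x0..x} f else - integral {x..x0} f)" for x
  have io: "f integrable_on {p..q}" for p q
    using set_borel_integral_eq_integral(1)[OF f] .
  have "F q - F p = integral {p..q} f" if "p \<le> q" for p q
  proof -
    consider "x0 \<le> p" | "p \<le> x0" "x0 \<le> q" | "q \<le> x0" using that by linarith
    then show ?thesis
    proof cases
      case 1
      then show ?thesis using that Henstock_Kurzweil_Integration.integral_combine[OF _ _ io, of x0 p q] by (auto simp: F_def algebra_simps)
    next
      case 2
      then show ?thesis using that Henstock_Kurzweil_Integration.integral_combine[OF _ _ io, of p x0 q] by (auto simp: F_def algebra_simps)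
    next
      case 3
      then show ?thesis using that Henstock_Kurzweil_Integration.integral_combine[OF _ _ io, of p q x0] by (auto simp: F_def algebra_simps)
    qed
  qed
  then have "primitive F f"
    using f set_borel_integral_eq_integral(2)[OF f] by (simp add: primitive_def)
  moreover have "F x0 = c" by (simp add: F_def)
  ultimately show ?thesis using that by blast
qed

lemma primitive_continuous:
  assumes "primitive F f"
  shows "continuous_on UNIV F"
proof -
  have "isCont F x" for x
  proof -
    have io: "f integrable_on {x-1..x+1}"
      using set_borel_integral_eq_integral(1)[OF primitive_set_integrable[OF assms]] .
    have "continuous_on {x-1..x+1} (\<lambda>y. F (x-1) + integral {x-1..y} f)"
      by (intro continuous_intros indefinite_integral_continuous_1 io)
    then have "continuous_on {x-1..x+1} F"
    proof (rule continuous_on_eq)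
      show "F (x-1) + integral {x-1..y} f = F y" if "y \<in> {x-1..x+1}" for y
        using that primitive_diff_eq[OF assms, of "x-1" y]
          set_borel_integral_eq_integral(2)[OF primitive_set_integrable[OF assms], of "x-1" y]
        by (simp add: algebra_simps)
    qed
    then have "continuous_on {x-1<..<x+1} F" by (rule continuous_on_subset) auto
    then show ?thesis by (simp add: continuous_on_eq_continuous_at)
  qed
  then show ?thesis by (simp add: continuous_on_eq_continuous_at)
qed

lemma primitive_measurable [measurable_dest]:
  assumes "primitive F f"
  shows "F \<in> borel_measurable borel"
  by (rule borel_measurable_continuous_onI[OF primitive_continuous[OF assms]])

lemma locally_integrable_measurable:
  fixes f :: "real \<Rightarrow> 'a::euclidean_space"
  assumes "\<And>p q. set_integrable lborel {p..q} f"
  shows "f \<in> borel_measurable borel"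
proof (rule borel_measurable_LIMSEQ_metric)
  show "(\<lambda>x. indicator {- real n..real n} x *\<^sub>R f x) \<in> borel_measurable borel" for n
    using borel_measurable_integrable[OF assms[unfolded set_integrable_def, of "- real n" "real n"]] by simp
  fix x
  obtain k :: nat where "\<bar>x\<bar> < real k" using reals_Archimedean2 by blast
  then have "\<forall>\<^sub>F n in sequentially. indicator {- real n..real n} x *\<^sub>R f x = f x"
    unfolding eventually_sequentially
    by (intro exI[of _ k] allI impI) (auto simp: indicator_def)
  then show "(\<lambda>n. indicator {- real n..real n} x *\<^sub>R f x) \<longlonglongrightarrow> f x"
    by (rule tendsto_eventually)
qed

lemma primitive_density_measurable [measurable_dest]:
  assumes "primitive F f"
  shows "f \<in> borel_measurable borel"
  by (rule locally_integrable_measurable[OF primitive_set_integrable[OF assms]])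

lemma primitive_FTC:
  assumes F: "\<And>x. (F has_vector_derivative f x) (at x)" and f: "continuous_on UNIV f"
  shows "primitive F f"
  unfolding primitive_def
proof (intro allI impI conjI)
  fix p q :: real assume "p \<le> q"
  show "set_integrable lborel {p..q} f"
    by (intro borel_integrable_atLeastAtMost' continuous_on_subset[OF f]) auto
  show "F q - F p = (LINT x:{p..q}|lborel. f x)"
    unfolding set_lebesgue_integral_def
    by (rule integral_FTC_atLeastAtMost[symmetric, OF \<open>p \<le> q\<close>])
      (auto intro: has_vector_derivative_at_within F continuous_on_subset[OF f])
qed

lemma primitive_add:
  "primitive F f \<Longrightarrow> primitive G g \<Longrightarrow> primitive (\<lambda>x. F x + G x) (\<lambda>x. f x + g x)"
  by (auto simp: primitive_def set_integral_add algebra_simps)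

lemma primitive_const: "primitive (\<lambda>x. c) (\<lambda>x. 0)"
  by (auto simp: primitive_def set_integrable_def set_lebesgue_integral_def)

lemma primitive_bounded_linear:
  assumes "bounded_linear T" "primitive F f"
  shows "primitive (\<lambda>x. T (F x)) (\<lambda>x. T (f x))"
  unfolding primitive_def
proof (intro allI impI conjI)
  interpret T: bounded_linear T by fact
  fix p q :: real assume "p \<le> q"
  have i: "set_integrable lborel {p..q} f" by (rule primitive_set_integrable[OF assms(2)])
  show "set_integrable lborel {p..q} (\<lambda>x. T (f x))"
    using integrable_bounded_linear[OF assms(1) i[unfolded set_integrable_def]]
    by (simp add: set_integrable_def T.scaleR)
  show "T (F q) - T (F p) = (LINT x:{p..q}|lborel. T (f x))"
    using integral_bounded_linear[OF assms(1) i[unfolded set_integrable_def]]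
      primitive_diff_eq[OF assms(2) \<open>p \<le> q\<close>]
    by (simp add: set_lebesgue_integral_def T.scaleR flip: T.diff)
qed

lemma primitive_of_real:
  "primitive F f \<Longrightarrow> primitive (\<lambda>x. complex_of_real (F x)) (\<lambda>x. complex_of_real (f x))"
  by (rule primitive_bounded_linear[OF bounded_linear_of_real])

text \<open>Fubini on the triangle \<open>x \<le> y\<close>.\<close>

lemma primitive_mult:
  fixes F G :: "real \<Rightarrow> 'a::{real_normed_field, euclidean_space}"
  assumes F: "primitive F f" and G: "primitive G g"
  shows "primitive (\<lambda>x. F x * G x) (\<lambda>x. f x * G x + F x * g x)"
  unfolding primitive_def
proof (intro allI impI conjI)
  fix p q :: real assume pq: "p \<le> q"
  note [measurable] = primitive_measurable[OF F] primitive_measurable[OF G]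
    primitive_density_measurable[OF F] primitive_density_measurable[OF G]
  define f1 where "f1 x = indicator {p..q} x *\<^sub>R f x" for x
  define g1 where "g1 x = indicator {p..q} x *\<^sub>R g x" for x
  have f1: "integrable lborel f1" and g1: "integrable lborel g1"
    using primitive_set_integrable[OF F, of p q] primitive_set_integrable[OF G, of p q]
    unfolding set_integrable_def f1_def g1_def by auto
  have bdd: "\<exists>K. \<forall>x\<in>{p..q}. norm (H x) \<le> K" if "primitive H h" for H h :: "real \<Rightarrow> 'a"
    using compact_imp_bounded[OF compact_continuous_image[OF continuous_on_subset[OF primitive_continuous[OF that]] compact_Icc], of p q]
    by (auto simp: bounded_iff)
  obtain KF KG where K: "\<And>x. x \<in> {p..q} \<Longrightarrow> norm (F x) \<le> KF" "\<And>x. x \<in> {p..q} \<Longrightarrow> norm (G x) \<le> KG"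
    using bdd[OF F] bdd[OF G] by blast
  have i1: "integrable lborel (\<lambda>x. f1 x * G x)"
  proof (rule Bochner_Integration.integrable_bound)
    show "integrable lborel (\<lambda>x. KG * norm (f1 x))" using f1 by simp
    show "AE x in lborel. norm (f1 x * G x) \<le> norm (KG * norm (f1 x))"
      using K(2) by (intro AE_I2) (auto simp: f1_def indicator_def norm_mult abs_mult mult.commute intro!: mult_right_mono order_trans[OF K(2) abs_ge_self])
  qed (simp add: f1_def)
  have i2: "integrable lborel (\<lambda>x. F x * g1 x)"
  proof (rule Bochner_Integration.integrable_bound)
    show "integrable lborel (\<lambda>x. KF * norm (g1 x))" using g1 by simp
    show "AE x in lborel. norm (F x * g1 x) \<le> norm (KF * norm (g1 x))"
      using K(1) by (intro AE_I2) (auto simp: g1_def indicator_def norm_mult abs_mult mult.commute intro!: mult_right_mono order_trans[OF K(1) abs_ge_self])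
  qed (simp add: g1_def)
  have s1: "set_integrable lborel {p..q} (\<lambda>x. f x * G x)" "set_integrable lborel {p..q} (\<lambda>x. F x * g x)"
    using i1 i2 by (simp_all add: set_integrable_def f1_def g1_def)
  then show "set_integrable lborel {p..q} (\<lambda>x. f x * G x + F x * g x)" by (rule set_integral_add)
  define h where "h = (\<lambda>(x, y). if x \<le> y then f1 x * g1 y else 0)"
  have [measurable]: "f1 \<in> borel_measurable borel" "g1 \<in> borel_measurable borel"
    unfolding f1_def g1_def by measurable
  have hint: "integrable (lborel \<Otimes>\<^sub>M lborel) h"
  proof (rule Bochner_Integration.integrable_bound)
    show "integrable (lborel \<Otimes>\<^sub>M lborel) (\<lambda>(x, y). f1 x * g1 y)"
    proof (rule lborel_pair.Fubini_integrable)
      show "integrable lborel (\<lambda>x. \<integral>y. norm (case (x, y) of (x, y) \<Rightarrow> f1 x * g1 y) \<partial>lborel)"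
        using f1 g1 by (simp add: norm_mult)
    qed (use g1 in \<open>auto simp: split_beta'\<close>)
  qed (auto simp: h_def split_beta')
  have inner1: "(\<integral>y. h (x, y) \<partial>lborel) = f1 x * (G q - G x)" for x
  proof (cases "x \<in> {p..q}")
    case True
    have "(\<integral>y. h (x, y) \<partial>lborel) = (\<integral>y. f1 x * (indicator {x..q} y *\<^sub>R g y) \<partial>lborel)"
      using True by (intro Bochner_Integration.integral_cong) (auto simp: h_def g1_def indicator_def)
    also have "\<dots> = f1 x * (LINT y:{x..q}|lborel. g y)"
      unfolding set_lebesgue_integral_def
      using primitive_set_integrable[OF G, of x q] by (intro Bochner_Integration.integral_mult_right) (simp add: set_integrable_def)
    finally show ?thesis using primitive_diff_eq[OF G, of x q] True by simp
  qed (simp add: h_def f1_def cong: if_cong)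
  have inner2: "(\<integral>x. h (x, y) \<partial>lborel) = (F y - F p) * g1 y" for y
  proof (cases "y \<in> {p..q}")
    case True
    have "(\<integral>x. h (x, y) \<partial>lborel) = (\<integral>x. (indicator {p..y} x *\<^sub>R f x) * g1 y \<partial>lborel)"
      using True by (intro Bochner_Integration.integral_cong) (auto simp: h_def f1_def indicator_def)
    also have "\<dots> = (LINT x:{p..y}|lborel. f x) * g1 y"
      unfolding set_lebesgue_integral_def
      using primitive_set_integrable[OF F, of p y] by (intro Bochner_Integration.integral_mult_left) (simp add: set_integrable_def)
    finally show ?thesis using primitive_diff_eq[OF F, of p y] True by simp
  qed (simp add: h_def g1_def cong: if_cong)
  have "(\<integral>y. (\<integral>x. h (x, y) \<partial>lborel) \<partial>lborel) = (\<integral>x. (\<integral>y. h (x, y) \<partial>lborel) \<partial>lborel)"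
    using lborel_pair.Fubini_integral[of "\<lambda>x y. h (x, y)"] hint by simp
  then have *: "(\<integral>y. (F y - F p) * g1 y \<partial>lborel) = (\<integral>x. f1 x * (G q - G x) \<partial>lborel)"
    by (simp add: inner1 inner2)
  have f1I: "(\<integral>x. f1 x \<partial>lborel) = F q - F p" "(\<integral>x. g1 x \<partial>lborel) = G q - G p"
    using primitive_diff_eq[OF F pq] primitive_diff_eq[OF G pq]
    by (simp_all add: f1_def g1_def set_lebesgue_integral_def)
  have "(\<integral>y. F y * g1 y \<partial>lborel) - F p * (G q - G p) = (F q - F p) * G q - (\<integral>x. f1 x * G x \<partial>lborel)"
    using * f1 g1 i1 i2 by (simp add: left_diff_distrib right_diff_distrib f1I)
  then have "(\<integral>x. f1 x * G x \<partial>lborel) + (\<integral>y. F y * g1 y \<partial>lborel) = F q * G q - F p * G p"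
    by (simp add: algebra_simps)
  then show "F q * G q - F p * G p = (LINT x:{p..q}|lborel. f x * G x + F x * g x)"
    using s1 by (simp add: set_integral_add) (simp add: set_lebesgue_integral_def f1_def g1_def)
qed

text \<open>Applied to products, this is integration by parts on the whole line: the integral over
  [-n,n] telescopes to the boundary values, and these vanish in the limit.\<close>

lemma primitive_integral_zero:
  assumes F: "primitive F f" and f: "integrable lborel f"
    and lim: "(F \<longlongrightarrow> 0) at_top" "(F \<longlongrightarrow> 0) at_bot"
  shows "(\<integral>x. f x \<partial>lborel) = 0"
proof -
  have [measurable]: "f \<in> borel_measurable borel" using f by auto
  have "(\<lambda>n. \<integral>x. indicator {- real n..real n} x *\<^sub>R f x \<partial>lborel) \<longlonglongrightarrow> (\<integral>x. f x \<partial>lborel)"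
  proof (rule integral_dominated_convergence[where w = "\<lambda>x. norm (f x)"])
    show "AE x in lborel. (\<lambda>n. indicator {- real n..real n} x *\<^sub>R f x) \<longlonglongrightarrow> f x"
    proof (rule AE_I2, rule tendsto_eventually)
      fix x
      obtain k :: nat where "\<bar>x\<bar> < real k" using reals_Archimedean2 by blast
      then show "\<forall>\<^sub>F n in sequentially. indicator {- real n..real n} x *\<^sub>R f x = f x"
        unfolding eventually_sequentially
        by (intro exI[of _ k] allI impI) (auto simp: indicator_def)
    qed
  qed (use f in \<open>auto simp: indicator_def intro!: AE_I2\<close>)
  moreover have "(\<integral>x. indicator {- real n..real n} x *\<^sub>R f x \<partial>lborel) = F (real n) - F (- real n)" for n
    using primitive_diff_eq[OF F, of "- real n" "real n"] by (simp add: set_lebesgue_integral_def)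
  moreover have "(\<lambda>n. F (real n) - F (- real n)) \<longlonglongrightarrow> 0 - 0"
  proof (intro tendsto_diff)
    show "(\<lambda>n. F (real n)) \<longlonglongrightarrow> 0"
      by (rule filterlim_compose[OF lim(1) filterlim_real_sequentially])
    show "(\<lambda>n. F (- real n)) \<longlonglongrightarrow> 0"
      by (rule filterlim_compose[OF lim(2)]) 
       (intro filterlim_compose[OF filterlim_uminus_at_bot_at_top] filterlim_real_sequentially)
  qed
  ultimately show ?thesis using LIMSEQ_unique by fastforce
qed

section \<open>Gaussian decay\<close>

lemma poly_le_exp_abs:
  fixes p :: "real poly"
  assumes "\<epsilon> > 0"
  shows "\<exists>C>0. \<forall>x. \<bar>poly p x\<bar> \<le> C * exp (\<epsilon> * \<bar>x\<bar>)"
  using assms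
proof (induction p arbitrary: \<epsilon>)
  case (pCons a p)
  \<comment> \<open>Half of the exponent serves the remaining polynomial, the other half absorbs the
    extra factor \<open>x\<close>.\<close>
  obtain C where C: "C > 0" "\<And>x. \<bar>poly p x\<bar> \<le> C * exp (\<epsilon>/2 * \<bar>x\<bar>)"
    using pCons(2)[of "\<epsilon>/2"] pCons(3) by auto
  have "\<bar>poly (pCons a p) x\<bar> \<le> (\<bar>a\<bar> + 2 / \<epsilon> * C) * exp (\<epsilon> * \<bar>x\<bar>)" for x
  proof -
    have "\<epsilon>/2 * \<bar>x\<bar> \<le> exp (\<epsilon>/2 * \<bar>x\<bar>)" using exp_ge_add_one_self[of "\<epsilon>/2 * \<bar>x\<bar>"] by linarith
    then have 1: "\<bar>x\<bar> \<le> 2 / \<epsilon> * exp (\<epsilon>/2 * \<bar>x\<bar>)" using \<open>\<epsilon> > 0\<close> by (simp add: field_simps)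
    have "\<bar>poly (pCons a p) x\<bar> \<le> \<bar>a\<bar> + \<bar>x\<bar> * \<bar>poly p x\<bar>"
      using abs_triangle_ineq[of a "x * poly p x"] by (simp add: abs_mult)
    also have "\<dots> \<le> \<bar>a\<bar> * exp (\<epsilon> * \<bar>x\<bar>) + (2 / \<epsilon> * exp (\<epsilon>/2 * \<bar>x\<bar>)) * (C * exp (\<epsilon>/2 * \<bar>x\<bar>))"
      using \<open>\<epsilon> > 0\<close> by (intro add_mono mult_mono 1 C) (auto simp: mult_le_cancel_left1)
    also have "\<dots> = (\<bar>a\<bar> + 2 / \<epsilon> * C) * exp (\<epsilon> * \<bar>x\<bar>)"
      by (simp add: algebra_simps flip: exp_add)
    finally show ?thesis .
  qed
  then show ?case using C(1) \<open>\<epsilon> > 0\<close> by (intro exI[of _ "\<bar>a\<bar> + 2 / \<epsilon> * C"]) (auto intro: add_nonneg_pos)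
qed (auto intro!: exI[of _ 1])

lemma poly_le_gauss:
  fixes p :: "real poly"
  assumes "\<epsilon> > 0"
  shows "\<exists>C>0. \<forall>x. \<bar>poly p x\<bar> \<le> C * exp (\<epsilon> * x\<^sup>2)"
proof -
  obtain C where C: "C > 0" "\<And>x. \<bar>poly p x\<bar> \<le> C * exp (1 * \<bar>x\<bar>)"
    using poly_le_exp_abs[of 1 p] by auto
  have "\<bar>poly p x\<bar> \<le> (C * exp (1 / (4 * \<epsilon>))) * exp (\<epsilon> * x\<^sup>2)" for x
  proof -
    have "0 \<le> (2 * \<epsilon> * \<bar>x\<bar> - 1)\<^sup>2" by simp
    also have "\<dots> = 4 * \<epsilon> * (\<epsilon> * x\<^sup>2 + 1 / (4 * \<epsilon>) - \<bar>x\<bar>)"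
      using assms by (simp add: power2_eq_square field_simps)
    finally have "\<bar>x\<bar> \<le> 1 / (4 * \<epsilon>) + \<epsilon> * x\<^sup>2" using assms by (simp add: zero_le_mult_iff)
    then have "C * exp (1 * \<bar>x\<bar>) \<le> C * exp (1 / (4 * \<epsilon>) + \<epsilon> * x\<^sup>2)" using C(1) by simp
    then show ?thesis using C(2)[of x] by (simp add: exp_add mult.assoc)
  qed
  then show ?thesis using C(1) by (intro exI[of _ "C * exp (1 / (4 * \<epsilon>))"]) auto
qed

lemma gauss_integrable:
  assumes "c > 0"
  shows "integrable lborel (\<lambda>x::real. exp (- c * x\<^sup>2))"
proof -
  define \<sigma> where "\<sigma> = sqrt (1 / (2 * c))"
  have s: "\<sigma>\<^sup>2 = 1 / (2 * c)" "\<sigma> > 0" using assms by (simp_all add: \<sigma>_def)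
  have "integrable lborel (\<lambda>x. sqrt (2 * pi * \<sigma>\<^sup>2) * normal_density 0 \<sigma> x)"
    by (intro integrable_mult_right integrable_normal_density s)
  moreover have "sqrt (2 * pi * \<sigma>\<^sup>2) * normal_density 0 \<sigma> x = exp (- c * x\<^sup>2)" for x
    using assms by (simp add: normal_density_def s)
  ultimately show ?thesis by simp
qed

lemma gauss_tendsto_zero:
  fixes F :: "real \<Rightarrow> 'a::real_normed_vector"
  assumes "\<And>x. norm (F x) \<le> K * exp (- c * x\<^sup>2)" "c > 0"
  shows "(F \<longlongrightarrow> 0) at_top" "(F \<longlongrightarrow> 0) at_bot"
proof -
  have e: "((\<lambda>x. K * exp (- c * x\<^sup>2)) \<longlongrightarrow> 0) at_top" "((\<lambda>x. K * exp (- c * x\<^sup>2)) \<longlongrightarrow> 0) at_bot"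
    using assms(2) by (real_asymp, real_asymp)
  show "(F \<longlongrightarrow> 0) at_top" "(F \<longlongrightarrow> 0) at_bot"
    by (rule Lim_null_comparison[OF always_eventually[OF allI, OF assms(1)]], rule e)+
qed

text \<open>The class of functions against which distributional derivatives are tested. The rate 1/4
  is half of that of the Hermite functions, which leaves room for their polynomial factors. The
  class contains the Hermite functions, their pairwise products and all test functions.\<close>

definition gauss_C1 :: "(real \<Rightarrow> real) \<Rightarrow> (real \<Rightarrow> real) \<Rightarrow> bool" where
  "gauss_C1 \<Theta> \<Theta>' \<longleftrightarrow> (\<forall>x. (\<Theta> has_real_derivative \<Theta>' x) (at x)) \<and> continuous_on UNIV \<Theta>' \<and>
     (\<exists>C. \<forall>x. \<bar>\<Theta> x\<bar> \<le> C * exp (- (1/4) * x\<^sup>2) \<and> \<bar>\<Theta>' x\<bar> \<le> C * exp (- (1/4) * x\<^sup>2))"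

lemma gauss_C1_primitive: "gauss_C1 \<Theta> \<Theta>' \<Longrightarrow> primitive \<Theta> \<Theta>'"
  by (rule primitive_FTC) (auto simp: gauss_C1_def has_real_derivative_iff_has_vector_derivative)

lemma gauss_C1_measurable [measurable_dest]:
  assumes "gauss_C1 \<Theta> \<Theta>'"
  shows "\<Theta> \<in> borel_measurable borel" "\<Theta>' \<in> borel_measurable borel"
  using gauss_C1_primitive[OF assms] primitive_measurable primitive_density_measurable by blast+

lemma square_integrable_gauss_bound:
  assumes [measurable]: "h \<in> borel_measurable borel" and "\<And>x. \<bar>h x\<bar> \<le> C * exp (- (1/4) * x\<^sup>2)"
  shows "square_integrable (\<lambda>x. complex_of_real (h x))"
  unfolding square_integrable_def
proof
  show "integrable lborel (\<lambda>x. (cmod (complex_of_real (h x)))\<^sup>2)"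
  proof (rule Bochner_Integration.integrable_bound)
    show "integrable lborel (\<lambda>x::real. C\<^sup>2 * exp (- (1/2) * x\<^sup>2))"
      by (intro integrable_mult_right gauss_integrable) simp
    have "(h x)\<^sup>2 \<le> C\<^sup>2 * exp (- (1/2) * x\<^sup>2)" for x
    proof -
      have "\<bar>h x\<bar>\<^sup>2 \<le> (C * exp (- (1/4) * x\<^sup>2))\<^sup>2" by (rule power_mono[OF assms(2)]) simp
      also have "\<dots> = C\<^sup>2 * exp (- (1/2) * x\<^sup>2)"
        by (simp add: power_mult_distrib flip: exp_double)
      finally show ?thesis by simp
    qed
    then show "AE x in lborel. norm ((cmod (complex_of_real (h x)))\<^sup>2) \<le> norm (C\<^sup>2 * exp (- (1/2) * x\<^sup>2))"
      by (simp add: abs_mult)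
  qed simp
qed simp

lemma gauss_C1_square_integrable:
  assumes "gauss_C1 \<Theta> \<Theta>'"
  shows "square_integrable (\<lambda>x. complex_of_real (\<Theta> x))" "square_integrable (\<lambda>x. complex_of_real (\<Theta>' x))"
proof -
  obtain C where C: "\<And>x. \<bar>\<Theta> x\<bar> \<le> C * exp (- (1/4) * x\<^sup>2)" "\<And>x. \<bar>\<Theta>' x\<bar> \<le> C * exp (- (1/4) * x\<^sup>2)"
    using assms by (auto simp: gauss_C1_def)
  show "square_integrable (\<lambda>x. complex_of_real (\<Theta> x))" "square_integrable (\<lambda>x. complex_of_real (\<Theta>' x))"
    by (rule square_integrable_gauss_bound[OF gauss_C1_measurable(1)[OF assms] C(1)],
        rule square_integrable_gauss_bound[OF gauss_C1_measurable(2)[OF assms] C(2)])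
qed

text \<open>A growth rate of 1/8 is half of the decay rate 1/4 in \<open>gauss_C1\<close>; a
  Gaussian with rate 1/8 remains as majorant both for the integrand and for the boundary
  terms.\<close>

lemma integral_by_parts_gauss:
  fixes W :: "real \<Rightarrow> complex"
  assumes W: "primitive W w" and T: "gauss_C1 \<Theta> \<Theta>'"
    and growth: "\<And>x. cmod (W x) \<le> K * exp (x\<^sup>2 / 8)"
    and int: "integrable lborel (\<lambda>x. w x * of_real (\<Theta> x))"
  shows "integrable lborel (\<lambda>x. W x * of_real (\<Theta>' x))"
    "(\<integral>x. W x * of_real (\<Theta>' x) \<partial>lborel) = - (\<integral>x. w x * of_real (\<Theta> x) \<partial>lborel)"
proof -
  note [measurable] = primitive_measurable[OF W] primitive_density_measurable[OF W] gauss_C1_measurable[OF T]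
  obtain C where C: "\<And>x. \<bar>\<Theta> x\<bar> \<le> C * exp (- (1/4) * x\<^sup>2)" "\<And>x. \<bar>\<Theta>' x\<bar> \<le> C * exp (- (1/4) * x\<^sup>2)"
    using T by (auto simp: gauss_C1_def)
  have K: "0 \<le> K" using order_trans[OF norm_ge_zero growth[of 0]] by simp
  have b: "cmod (W x * of_real (\<Theta> x)) \<le> (K * C) * exp (- (1/8) * x\<^sup>2)"
    "cmod (W x * of_real (\<Theta>' x)) \<le> (K * C) * exp (- (1/8) * x\<^sup>2)" for x
  proof -
    have e: "(K * exp (x\<^sup>2 / 8)) * (C * exp (- (1/4) * x\<^sup>2)) = (K * C) * exp (- (1/8) * x\<^sup>2)"
      by (simp add: exp_add[symmetric] mult_ac)
    show "cmod (W x * of_real (\<Theta> x)) \<le> (K * C) * exp (- (1/8) * x\<^sup>2)"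
      "cmod (W x * of_real (\<Theta>' x)) \<le> (K * C) * exp (- (1/8) * x\<^sup>2)"
      unfolding e[symmetric] norm_mult norm_of_real using K C growth
      by (auto intro!: mult_mono)
  qed
  show i: "integrable lborel (\<lambda>x. W x * of_real (\<Theta>' x))"
  proof (rule Bochner_Integration.integrable_bound)
    show "integrable lborel (\<lambda>x::real. (K * C) * exp (- (1/8) * x\<^sup>2))"
      by (intro integrable_mult_right gauss_integrable) simp
    show "AE x in lborel. norm (W x * of_real (\<Theta>' x)) \<le> norm ((K * C) * exp (- (1/8) * x\<^sup>2))"
      by (rule AE_I2, rule order_trans[OF b(2)]) (simp only: real_norm_def abs_ge_self)
  qed measurable
  have "(\<integral>x. w x * of_real (\<Theta> x) + W x * of_real (\<Theta>' x) \<partial>lborel) = 0"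
  proof (rule primitive_integral_zero)
    show "primitive (\<lambda>x. W x * of_real (\<Theta> x)) (\<lambda>x. w x * of_real (\<Theta> x) + W x * of_real (\<Theta>' x))"
      by (intro primitive_mult W primitive_of_real gauss_C1_primitive T)
    show "integrable lborel (\<lambda>x. w x * of_real (\<Theta> x) + W x * of_real (\<Theta>' x))"
      using int i by simp
  qed (rule gauss_tendsto_zero[OF b(1)], simp)+
  then show "(\<integral>x. W x * of_real (\<Theta>' x) \<partial>lborel) = - (\<integral>x. w x * of_real (\<Theta> x) \<partial>lborel)"
    using int i by (simp add: add_eq_0_iff)
qed

section \<open>Test functions and weak derivatives\<close>

text \<open>The positive and the negative part are densities of measures that are finite and equal
  on all half-lines, so the measures coincide and the densities agree almost everywhere.\<close>

lemma AE_zero_real: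
  fixes f :: "real \<Rightarrow> real"
  assumes f: "integrable lborel f" and z: "\<And>x. (\<integral>y. f y * indicator {x<..} y \<partial>lborel) = 0"
  shows "AE x in lborel. f x = 0"
proof -
  have [measurable]: "f \<in> borel_measurable borel" using f by auto
  define M where "M = density lborel (\<lambda>x. ennreal (f x))"
  define N where "N = density lborel (\<lambda>x. ennreal (- f x))"
  have e: "emeasure (density lborel (\<lambda>x. ennreal (g x))) {x<..}
      = ennreal (\<integral>y. max 0 (g y) * indicator {x<..} y \<partial>lborel)" if g: "integrable lborel g" for g :: "real \<Rightarrow> real" and x
  proof -
    have [measurable]: "g \<in> borel_measurable borel" using g by auto
    have "emeasure (density lborel (\<lambda>x. ennreal (g x))) {x<..} = (\<integral>\<^sup>+y. ennreal (max 0 (g y) * indicator {x<..} y) \<partial>lborel)"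
      by (subst emeasure_density) (auto intro!: nn_integral_cong simp: indicator_def ennreal_neg split: split_max)
    also have "\<dots> = ennreal (\<integral>y. max 0 (g y) * indicator {x<..} y \<partial>lborel)"
    proof (rule nn_integral_eq_integral)
      show "integrable lborel (\<lambda>y. max 0 (g y) * indicator {x<..} y)"
        by (rule Bochner_Integration.integrable_bound[OF g]) (auto simp: indicator_def)
    qed auto
    finally show ?thesis .
  qed
  have "M = N"
  proof (rule measure_eqI_lessThan)
    show "emeasure M {x<..} < \<infinity>" for x unfolding M_def e[OF f] by simp
    have mi: "integrable lborel (\<lambda>y. max 0 (f y) * indicator {x<..} y)"
      "integrable lborel (\<lambda>y. max 0 (- f y) * indicator {x<..} y)" for x
      by (auto simp: indicator_def intro!: Bochner_Integration.integrable_bound[OF f] AE_I2)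
    have "(\<integral>y. max 0 (f y) * indicator {x<..} y \<partial>lborel) - (\<integral>y. max 0 (- f y) * indicator {x<..} y \<partial>lborel)
        = (\<integral>y. f y * indicator {x<..} y \<partial>lborel)" for x
      by (subst Bochner_Integration.integral_diff[OF mi, symmetric], rule Bochner_Integration.integral_cong)
       (auto simp: indicator_def)
    then show "emeasure M {x<..} = emeasure N {x<..}" for x
      unfolding M_def N_def e[OF f] e[OF integrable_minus[OF f]] by (simp add: z)
  qed (auto simp: M_def N_def)
  then have "AE x in lborel. ennreal (f x) = ennreal (- f x)"
    unfolding M_def N_def by (subst (asm) sigma_finite_measure.density_unique_iff[OF lborel.sigma_finite_measure_axioms]) auto
  then show ?thesis
  proof eventually_elim
    case (elim x)
    then show ?case by (cases "f x \<ge> 0") (auto simp: ennreal_neg)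
  qed
qed

text \<open>Each interval with rational endpoints in \<open>I\<close> gives one null set for the
  real and one for the imaginary part. There are countably many of them, and since \<open>I\<close>
  is open every point of it lies in such an interval.\<close>

lemma AE_zero_of_interval_integrals:
  fixes z :: "real \<Rightarrow> complex"
  assumes I: "open I" "is_interval I"
    and z: "\<And>p q. set_integrable lborel {p..q} z"
    and zero: "\<And>p q. p \<in> I \<Longrightarrow> q \<in> I \<Longrightarrow> p < q \<Longrightarrow> (LINT x:{p..q}|lborel. z x) = 0"
  shows "AE x in lborel. x \<in> I \<longrightarrow> z x = 0"
proof -
  have part: "AE x in lborel. p \<in> I \<and> q \<in> I \<and> p < q \<longrightarrow> x \<in> {p..q} \<longrightarrow> T (z x) = 0"
    if T: "bounded_linear T" for T :: "complex \<Rightarrow> real" and p q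
  proof (cases "p \<in> I \<and> q \<in> I \<and> p < q")
    case True
    interpret T: bounded_linear T by fact
    define f where "f x = T (indicator {p..q} x *\<^sub>R z x)" for x
    have "AE x in lborel. f x = 0"
    proof (rule AE_zero_real)
      show "integrable lborel f"
        unfolding f_def using z[of p q] by (intro integrable_bounded_linear[OF T]) (simp add: set_integrable_def)
      show "(\<integral>y. f y * indicator {x<..} y \<partial>lborel) = 0" for x
      proof (cases "x < q")
        case xq: True
        \<comment> \<open>Since \<open>f\<close> vanishes outside {p..q}, its integral over the
          half-line from \<open>x\<close> is the one over the interval from \<open>max x p\<close>
          to \<open>q\<close>, up to the single point \<open>x\<close>.\<close>
        have mI: "max x p \<in> I" using True xq I(2) by (auto simp: is_interval_1 max_def)
        have "(\<integral>y. f y * indicator {x<..} y \<partial>lborel) = (\<integral>y. T (indicator {max x p..q} y *\<^sub>R z y) \<partial>lborel)"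
        proof (rule Bochner_Integration.integral_cong_AE)
          have [measurable]: "z \<in> borel_measurable borel" by (rule locally_integrable_measurable[OF z])
          show "(\<lambda>y. f y * indicator {x<..} y) \<in> borel_measurable lborel"
            "(\<lambda>y. T (indicator {max x p..q} y *\<^sub>R z y)) \<in> borel_measurable lborel"
            unfolding f_def using borel_measurable_continuous_onI[OF linear_continuous_on[OF T]] by measurable
          have "AE y in lborel. y \<noteq> x" by (rule AE_lborel_singleton)
          then show "AE y in lborel. f y * indicator {x<..} y = T (indicator {max x p..q} y *\<^sub>R z y)"
            by eventually_elim (auto simp: f_def indicator_def T.zero)
        qed
        also have "\<dots> = T (\<integral>y. indicator {max x p..q} y *\<^sub>R z y \<partial>lborel)"
          using z[of "max x p" q] by (intro integral_bounded_linear[OF T]) (simp add: set_integrable_def)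
        also have "\<dots> = 0"
          using zero[OF mI, of q] True xq by (simp add: set_lebesgue_integral_def T.zero)
        finally show ?thesis .
      next
        case False
        then have *: "f y * indicator {x<..} y = 0" for y by (auto simp: f_def indicator_def T.zero)
        show ?thesis unfolding * by simp
      qed
    qed
    then show ?thesis by eventually_elim (auto simp: f_def)
  qed auto
  have "AE x in lborel. \<forall>p\<in>\<rat>. \<forall>q\<in>\<rat>. p \<in> I \<and> q \<in> I \<and> p < q \<longrightarrow> x \<in> {p..q} \<longrightarrow> Re (z x) = 0"
    "AE x in lborel. \<forall>p\<in>\<rat>. \<forall>q\<in>\<rat>. p \<in> I \<and> q \<in> I \<and> p < q \<longrightarrow> x \<in> {p..q} \<longrightarrow> Im (z x) = 0"
    using part[OF bounded_linear_Re] part[OF bounded_linear_Im] by (simp_all add: AE_ball_countable countable_rat)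
  then show ?thesis
  proof eventually_elim
    case (elim x)
    show ?case
    proof
      assume "x \<in> I"
      then obtain e where e: "e > 0" "ball x e \<subseteq> I" using I(1) by (auto simp: open_contains_ball)
      obtain p where p: "p \<in> \<rat>" "x - e < p" "p < x" using Rats_dense_in_real[of "x - e" x] e(1) by auto
      obtain q where q: "q \<in> \<rat>" "x < q" "q < x + e" using Rats_dense_in_real[of x "x + e"] e(1) by auto
      have "p \<in> I" "q \<in> I" using e(2) p q by (auto simp: subset_eq dist_real_def)
      then show "z x = 0" using elim p q by (force simp: complex_eq_iff)
    qed
  qed
qed

text \<open>The smooth function e^(-1/x), flat at 0, with a polynomial in 1/x carried along so that
  the family is closed under differentiation.\<close>

definition exp_recip :: "real poly \<Rightarrow> real \<Rightarrow> real" where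
  "exp_recip p x = (if x > 0 then poly p (1 / x) * exp (- (1 / x)) else 0)"

lemma exp_recip_deriv: "(exp_recip p has_real_derivative exp_recip (monom 1 2 * (p - pderiv p)) x) (at x)"
proof -
  consider "x > 0" | "x < 0" | "x = 0" by linarith
  then show ?thesis
  proof cases
    case 1
    have "((\<lambda>x. poly p (1 / x) * exp (- (1 / x))) has_real_derivative exp_recip (monom 1 2 * (p - pderiv p)) x) (at x)"
      using 1 by (auto intro!: derivative_eq_intros DERIV_chain'[OF _ poly_DERIV]
          simp: exp_recip_def poly_monom power2_eq_square field_simps)
    then show ?thesis
      by (rule has_field_derivative_transform_within_open[where S = "{0<..}"]) (use 1 in \<open>auto simp: exp_recip_def\<close>)
  next
    case 2
    have "((\<lambda>x. 0) has_real_derivative exp_recip (monom 1 2 * (p - pderiv p)) x) (at x)"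
      using 2 by (simp add: exp_recip_def)
    then show ?thesis
      by (rule has_field_derivative_transform_within_open[where S = "{..<0}"]) (use 2 in \<open>auto simp: exp_recip_def\<close>)
  next
    case 3
    obtain C where C: "C > 0" "\<And>y. \<bar>poly (monom 1 2 * p) y\<bar> \<le> C * exp (1 * \<bar>y\<bar>)"
      using poly_le_exp_abs[of 1 "monom 1 2 * p"] by auto
    \<comment> \<open>With y = 1/h, the bound y^2 |p(y)| <= C e^y makes the function at most C h^2,
      hence the difference quotient at most C |h|.\<close>
    have b: "\<bar>exp_recip p h / h\<bar> \<le> C * \<bar>h\<bar>" for h
    proof (cases "h > 0")
      case True
      have "\<bar>poly p (1/h)\<bar> / h\<^sup>2 \<le> C * exp (1/h)"
        using C(2)[of "1/h"] True by (simp add: poly_monom abs_mult power_divide)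
      then have "\<bar>poly p (1/h)\<bar> * exp (- (1/h)) \<le> C * h\<^sup>2"
        using True by (simp add: exp_minus field_simps)
      then show ?thesis using True by (simp add: exp_recip_def abs_mult power2_eq_square field_simps)
    qed (use C(1) in \<open>auto simp: exp_recip_def mult_le_0_iff\<close>)
    have "(\<lambda>h. exp_recip p h / h) \<midarrow>0\<rightarrow> 0"
    proof (rule Lim_null_comparison)
      show "\<forall>\<^sub>F h in at 0. norm (exp_recip p h / h) \<le> C * \<bar>h\<bar>" using b by simp
      show "(\<lambda>h. C * \<bar>h\<bar>) \<midarrow>0\<rightarrow> 0" by (rule tendsto_eq_intros | simp)+
    qed
    then show ?thesis using 3 by (simp add: DERIV_def exp_recip_def)
  qed
qed

text \<open>\<open>test_function\<close> asks for differentiability of all iterated derivatives. A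
  class closed under \<open>deriv\<close> answers this for all orders at once, and these five rules
  are enough to contain the bumps and be closed.\<close>

inductive bump_fun :: "(real \<Rightarrow> real) \<Rightarrow> bool" where
  bump_fun_exp_recip: "bump_fun (exp_recip p)"
| bump_fun_const: "bump_fun (\<lambda>x. c)"
| bump_fun_add: "bump_fun f \<Longrightarrow> bump_fun g \<Longrightarrow> bump_fun (\<lambda>x. f x + g x)"
| bump_fun_mult: "bump_fun f \<Longrightarrow> bump_fun g \<Longrightarrow> bump_fun (\<lambda>x. f x * g x)"
| bump_fun_affine: "bump_fun f \<Longrightarrow> bump_fun (\<lambda>x. f (c * x + d))"

lemma bump_fun_deriv_ex: "bump_fun f \<Longrightarrow> \<exists>f'. bump_fun f' \<and> (\<forall>x. (f has_real_derivative f' x) (at x))"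
proof (induction rule: bump_fun.induct)
  case (bump_fun_exp_recip p)
  then show ?case using exp_recip_deriv bump_fun.intros(1) by blast
next
  case (bump_fun_const c)
  then show ?case using bump_fun.intros(2)[of 0] by (intro exI[of _ "\<lambda>x. 0"]) auto
next
  case (bump_fun_add f g)
  then obtain f' g' where "bump_fun f'" "bump_fun g'" "\<And>x. (f has_real_derivative f' x) (at x)"
    "\<And>x. (g has_real_derivative g' x) (at x)" by blast
  then show ?case by (intro exI[of _ "\<lambda>x. f' x + g' x"]) (auto intro!: bump_fun.intros derivative_intros)
next
  case (bump_fun_mult f g)
  then obtain f' g' where *: "bump_fun f'" "bump_fun g'" "\<And>x. (f has_real_derivative f' x) (at x)"
    "\<And>x. (g has_real_derivative g' x) (at x)" by blast
  then show ?case using bump_fun_mult(1,2)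
    by (intro exI[of _ "\<lambda>x. f x * g' x + f' x * g x"])
      (auto intro!: bump_fun.intros derivative_eq_intros DERIV_mult' simp: mult.commute)
next
  case (bump_fun_affine f c d)
  then obtain f' where *: "bump_fun f'" "\<And>x. (f has_real_derivative f' x) (at x)" by blast
  have "((\<lambda>x. f (c * x + d)) has_real_derivative f' (c * x + d) * c) (at x)" for x
    by (rule DERIV_chain2[OF *(2)]) (auto intro!: derivative_eq_intros)
  then show ?case
    using bump_fun.intros(2)[of c] bump_fun.intros(5)[OF *(1), of c d] bump_fun.intros(4) by blast
qed

lemma bump_fun_deriv:
  assumes "bump_fun f"
  shows "bump_fun (deriv f)" "(f has_real_derivative deriv f x) (at x)"
proof -
  obtain f' where f': "bump_fun f'" "\<And>x. (f has_real_derivative f' x) (at x)"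
    using bump_fun_deriv_ex[OF assms] by blast
  then have "deriv f = f'" by (auto intro: DERIV_imp_deriv)
  with f' show "bump_fun (deriv f)" "(f has_real_derivative deriv f x) (at x)" by auto
qed

lemma bump_fun_higher_deriv: "bump_fun f \<Longrightarrow> bump_fun ((deriv ^^ n) f)"
  by (induction n) (auto intro: bump_fun_deriv)

lemma bump_fun_smooth: "bump_fun f \<Longrightarrow> (deriv ^^ n) f field_differentiable at x"
  using bump_fun_deriv(2)[OF bump_fun_higher_deriv] field_differentiable_def by blast

lemma bump_fun_continuous: "bump_fun f \<Longrightarrow> continuous_on UNIV f"
  using bump_fun_deriv(2) by (meson DERIV_isCont continuous_at_imp_continuous_on)

text \<open>The parameter \<open>n\<close> steepens both flanks and leaves the support in {p..q}: as
  \<open>n\<close> grows each factor tends to 1 inside the interval, so the bumps converge to the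
  indicator of the open interval. The arguments are written as affine maps to fit the last rule of
  \<open>bump_fun\<close>.\<close>

definition bump :: "real \<Rightarrow> real \<Rightarrow> real \<Rightarrow> real \<Rightarrow> real" where
  "bump n p q x = exp_recip 1 (n * x + - n * p) * exp_recip 1 (- n * x + n * q)"

lemma bump_fun_bump: "bump_fun (bump n p q)"
  unfolding bump_def[abs_def] by (intro bump_fun.intros)

lemma exp_recip_1: "0 \<le> exp_recip 1 x" "exp_recip 1 x \<le> 1" "x > 0 \<Longrightarrow> exp_recip 1 x > 0" "x \<le> 0 \<Longrightarrow> exp_recip 1 x = 0"
  by (auto simp: exp_recip_def)

lemma bump_bounds: "0 \<le> bump n p q x" "bump n p q x \<le> 1"
  using exp_recip_1 by (auto simp: bump_def intro: mult_le_one)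

lemma bump_eq_0:
  assumes "n > 0" "x \<le> p \<or> q \<le> x"
  shows "bump n p q x = 0"
proof -
  have "n * x + - n * p \<le> 0 \<or> - n * x + n * q \<le> 0"
    using assms by (auto simp: mult_le_cancel_left)
  then show ?thesis by (auto simp: bump_def exp_recip_1)
qed

lemma bump_pos:
  assumes "n > 0" "p < x" "x < q"
  shows "bump n p q x > 0"
  using assms by (auto simp: bump_def intro!: mult_pos_pos exp_recip_1(3))

lemma bump_tendsto_indicator: "(\<lambda>n. bump (real (Suc n)) p q x) \<longlonglongrightarrow> indicator {p<..<q} x"
proof (cases "p < x \<and> x < q")
  case True
  have e: "(\<lambda>n. exp_recip 1 (real (Suc n) * c)) \<longlonglongrightarrow> 1" if "c > 0" for c
  proof -
    have "(\<lambda>n. exp (- (1/c * (1 / real (Suc n))))) \<longlonglongrightarrow> exp (- (1/c * 0))"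
      by (intro tendsto_intros LIMSEQ_Suc lim_1_over_n)
    moreover have "exp (- (1/c * (1 / real (Suc n)))) = exp_recip 1 (real (Suc n) * c)" for n
      using that by (simp add: exp_recip_def field_simps add_pos_nonneg)
    ultimately show ?thesis by simp
  qed
  have "bump (real (Suc n)) p q x = exp_recip 1 (real (Suc n) * (x - p)) * exp_recip 1 (real (Suc n) * (q - x))" for n
    by (simp add: bump_def algebra_simps)
  then show ?thesis using tendsto_mult[OF e[of "x - p"] e[of "q - x"]] True by simp
next
  case False
  then have "bump (real (Suc n)) p q x = 0" for n by (intro bump_eq_0) auto
  then show ?thesis using False by (auto simp: indicator_def)
qed

lemma bump_integrable: 
  assumes "n > 0" "\<And>p q. set_integrable lborel {p..q} z"
  shows "integrable lborel (\<lambda>x. z x * of_real (bump n p q x) :: complex)"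
proof (rule Bochner_Integration.integrable_bound)
  have [measurable]: "z \<in> borel_measurable borel" by (rule locally_integrable_measurable[OF assms(2)])
  have [measurable]: "bump n p q \<in> borel_measurable borel"
    by (rule borel_measurable_continuous_onI[OF bump_fun_continuous[OF bump_fun_bump]])
  show "integrable lborel (\<lambda>x. indicator {p..q} x *\<^sub>R z x)"
    using assms(2)[of p q] by (simp add: set_integrable_def)
  show "AE x in lborel. norm (z x * of_real (bump n p q x)) \<le> norm (indicator {p..q} x *\<^sub>R z x)"
    using bump_bounds[of n p q] bump_eq_0[OF assms(1), of _ p q]
    by (intro AE_I2) (auto simp: indicator_def norm_mult mult_left_le)
  show "(\<lambda>x. z x * of_real (bump n p q x)) \<in> borel_measurable lborel" by measurable
qed

lemma set_integrable_const: "set_integrable lborel {p..q::real} (\<lambda>x. c::'a::euclidean_space)"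
  by (intro borel_integrable_atLeastAtMost' continuous_intros)

lemma integral_bump_pos:
  assumes "p < q"
  shows "(\<integral>x. bump 1 p q x \<partial>lborel) > 0"
proof -
  have i: "integrable lborel (bump 1 p q)"
    using integrable_Re[OF bump_integrable[of 1 "\<lambda>x. 1" p q, OF _ set_integrable_const]] by simp
  have "(\<integral>x. bump 1 p q x \<partial>lborel) \<noteq> 0"
  proof
    assume "(\<integral>x. bump 1 p q x \<partial>lborel) = 0"
    then have "AE x in lborel. bump 1 p q x = 0"
      using i by (subst (asm) integral_nonneg_eq_0_iff_AE) (auto simp: bump_bounds)
    then have "AE x in lborel. x \<notin> {p<..<q}"
      by eventually_elim (use bump_pos[of 1 p _ q] in force)
    then have "emeasure lborel {p<..<q} = 0" by (subst (asm) AE_iff_measurable[of "{p<..<q}"]) auto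
    then show False using assms by simp
  qed
  moreover have "(\<integral>x. bump 1 p q x \<partial>lborel) \<ge> 0" by (intro Bochner_Integration.integral_nonneg bump_bounds)
  ultimately show ?thesis by simp
qed

lemma primitive_has_real_derivative:
  fixes F :: "real \<Rightarrow> real"
  assumes F: "primitive F f" and f: "continuous_on UNIV f"
  shows "(F has_real_derivative f x) (at x)"
proof -
  have "((\<lambda>y. integral {x-1..y} f) has_real_derivative f x) (at x within {x-1..x+1})"
    by (rule integral_has_real_derivative) (auto intro: continuous_on_subset[OF f])
  then have "((\<lambda>y. F (x-1) + integral {x-1..y} f) has_real_derivative f x) (at x within {x-1..x+1})"
    by (auto intro!: derivative_eq_intros)
  moreover have "at x within {x-1..x+1} = at x" by (rule at_within_interior) (simp add: interior_atLeastAtMost_real)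
  ultimately have "((\<lambda>y. F (x-1) + integral {x-1..y} f) has_real_derivative f x) (at x)" by simp
  then show ?thesis
  proof (rule has_field_derivative_transform_within_open[where S = "{x-1<..<x+1}"])
    show "F (x-1) + integral {x-1..y} f = F y" if "y \<in> {x-1<..<x+1}" for y
      using that primitive_diff_eq[OF F, of "x-1" y]
        set_borel_integral_eq_integral(2)[OF primitive_set_integrable[OF F], of "x-1" y]
      by (simp add: algebra_simps)
  qed auto
qed

lemma compact_closure_of_support:
  assumes "\<And>x. x \<notin> {l..r::real} \<Longrightarrow> \<theta> x = (0::real)"
  shows "compact (closure {x. \<theta> x \<noteq> 0})" "closure {x. \<theta> x \<noteq> 0} \<subseteq> {l..r}"
proof -
  have s: "{x. \<theta> x \<noteq> 0} \<subseteq> {l..r}" using assms by blast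
  then show "closure {x. \<theta> x \<noteq> 0} \<subseteq> {l..r}" by (rule closure_minimal) simp
  show "compact (closure {x. \<theta> x \<noteq> 0})"
    using bounded_subset[OF bounded_closed_interval s] by (simp add: compact_closure)
qed

section \<open>Functions with vanishing weak derivative on an interval\<close>

text \<open>Any test function is, up to a multiple of a fixed bump, the derivative of a test function.\<close>

lemma du_Bois_Reymond:
  fixes z :: "real \<Rightarrow> complex"
  assumes I: "open I" "is_interval I"
    and z: "\<And>p q. set_integrable lborel {p..q} z"
    and zero: "\<And>\<theta>. test_function I \<theta> \<Longrightarrow> (LINT x:I|lborel. z x * of_real (deriv \<theta> x)) = 0"
  shows "\<exists>c. AE x in lborel. x \<in> I \<longrightarrow> z x = c"
proof (cases "I = {}")
  case False
  then obtain x0 where "x0 \<in> I" by blast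
  then obtain e where e: "e > 0" "ball x0 e \<subseteq> I" using I(1) by (auto simp: open_contains_ball)
  define p0 q0 where "p0 = x0 - e/2" and "q0 = x0 + e/2"
  have pq0: "p0 < q0" "p0 \<in> I" "q0 \<in> I" using e by (auto simp: p0_def q0_def dist_real_def subset_eq)
  define \<eta> where "\<eta> = bump 1 p0 q0"
  define E where "E = (\<integral>x. \<eta> x \<partial>lborel)"
  have E: "E > 0" unfolding E_def \<eta>_def by (rule integral_bump_pos[OF pq0(1)])
  \<comment> \<open>If \<open>z\<close> is to be a constant, testing with the fixed bump \<eta>
    forces this value.\<close>
  define c where "c = (\<integral>x. z x * of_real (\<eta> x) \<partial>lborel) / of_real E"
  have bi: "integrable lborel (bump n p q)" if "n > 0" for n p q
    using integrable_Re[OF bump_integrable[of n "\<lambda>x. 1" p q, OF that set_integrable_const]] by simp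
  have key: "(\<integral>x. z x * of_real (bump n p q x) \<partial>lborel) = c * of_real (\<integral>x. bump n p q x \<partial>lborel)"
    if n: "n > 0" and pq: "p < q" "p \<in> I" "q \<in> I" for n p q
  proof -
    define \<theta> where "\<theta> = bump n p q"
    \<comment> \<open>The multiple of \<eta> that gives \<zeta> integral zero, so that the primitive
      of \<zeta> vanishes to the right of the support as well as to the left and is a test
      function.\<close>
    define k where "k = (\<integral>x. \<theta> x \<partial>lborel) / E"
    define \<zeta> where "\<zeta> x = \<theta> x + (- k) * \<eta> x" for x
    define l r where "l = min p p0" and "r = max q q0"
    have lr: "l \<in> I" "r \<in> I" "l < r" using pq pq0 by (auto simp: l_def r_def min_def max_def)
    have bz: "bump_fun \<zeta>" unfolding \<zeta>_def[abs_def] \<theta>_def \<eta>_def by (intro bump_fun.intros bump_fun_bump)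
    have supp: "\<zeta> x = 0" if "x \<le> l \<or> r \<le> x" for x
      using that n by (auto simp: \<zeta>_def \<theta>_def \<eta>_def l_def r_def bump_eq_0)
    have supp': "l < x \<and> x < r" if "\<zeta> x \<noteq> 0" for x using supp[of x] that by force
    have int0: "(\<integral>x. \<zeta> x \<partial>lborel) = 0"
      unfolding \<zeta>_def using bi[OF n, of p q] bi[of 1 p0 q0] E
      by (simp add: \<theta>_def[symmetric] \<eta>_def[symmetric] k_def E_def[symmetric])
    have zl: "set_integrable lborel {s..t} \<zeta>" for s t
      by (intro borel_integrable_atLeastAtMost' continuous_on_subset[OF bump_fun_continuous[OF bz]]) auto
    obtain Z where Z: "primitive Z \<zeta>" "Z l = 0" using primitive_exists[of \<zeta> l 0] zl by blast
    have dZ: "(Z has_real_derivative \<zeta> x) (at x)" for x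
      by (rule primitive_has_real_derivative[OF Z(1) bump_fun_continuous[OF bz]])
    then have derZ: "deriv Z = \<zeta>" by (auto intro: DERIV_imp_deriv)
    have Z0: "Z x = 0" if "x \<notin> {l..r}" for x
    proof (cases "x < l")
      case True
      have "Z l - Z x = (LINT y:{x..l}|lborel. \<zeta> y)" using True by (intro primitive_diff_eq[OF Z(1)]) simp
      also have "\<dots> = (LINT y:{x..l}|lborel. 0)" by (intro set_lebesgue_integral_cong) (auto simp: supp)
      finally show ?thesis using Z(2) by (simp add: set_lebesgue_integral_def)
    next
      case False
      then have x: "r \<le> x" using that by auto
      have "Z x - Z l = (LINT y:{l..x}|lborel. \<zeta> y)" using x lr by (intro primitive_diff_eq[OF Z(1)]) simp
      also have "\<dots> = (\<integral>y. \<zeta> y \<partial>lborel)"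
        unfolding set_lebesgue_integral_def
        by (intro Bochner_Integration.integral_cong) (use x lr in \<open>auto simp: indicator_def dest: supp'\<close>)
      finally show ?thesis using Z(2) int0 by simp
    qed
    have "test_function I Z"
      unfolding test_function_def
    proof (intro conjI allI)
      show "(deriv ^^ m) Z field_differentiable at x" for m x
      proof (cases m)
        case 0
        then show ?thesis using dZ field_differentiable_def by auto
      next
        case (Suc m')
        then show ?thesis using bump_fun_smooth[OF bz, of m' x] by (simp add: funpow_Suc_right derZ del: funpow.simps)
      qed
      show "compact (closure {x. Z x \<noteq> 0})" using Z0 by (rule compact_closure_of_support)
      have "{l..r} \<subseteq> I" using lr I(2) unfolding is_interval_1 by (meson atLeastAtMost_iff subsetI)
      then show "closure {x. Z x \<noteq> 0} \<subseteq> I" using compact_closure_of_support(2)[of l r Z] Z0 by blast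
    qed
    then have "0 = (LINT x:I|lborel. z x * of_real (\<zeta> x))" using zero derZ by metis
    also have "\<dots> = (\<integral>x. z x * of_real (\<zeta> x) \<partial>lborel)"
      unfolding set_lebesgue_integral_def
    proof (intro Bochner_Integration.integral_cong refl)
      fix x
      have "x \<in> I" if "l < x" "x < r" using that lr I(2) unfolding is_interval_1 by (meson less_imp_le)
      then show "indicator I x *\<^sub>R (z x * of_real (\<zeta> x)) = z x * of_real (\<zeta> x)"
        using supp[of x] by (cases "l < x \<and> x < r") (auto simp: indicator_def)
    qed
    also have "\<dots> = (\<integral>x. z x * of_real (\<theta> x) \<partial>lborel) - of_real k * (\<integral>x. z x * of_real (\<eta> x) \<partial>lborel)"
    proof -
      have "z x * of_real (\<zeta> x) = z x * of_real (\<theta> x) - of_real k * (z x * of_real (\<eta> x))" for x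
        by (simp add: \<zeta>_def algebra_simps)
      then show ?thesis
        using bump_integrable[OF n z, of p q] bump_integrable[of 1 z p0 q0, OF _ z]
        by (simp add: \<theta>_def \<eta>_def)
    qed
    finally show ?thesis using E by (simp add: c_def k_def \<theta>_def[symmetric])
  qed
  define y where "y x = z x - c" for x
  have y: "set_integrable lborel {p..q} y" for p q
    unfolding y_def by (intro set_integral_diff z set_integrable_const)
  have ym [measurable]: "y \<in> borel_measurable borel" by (rule locally_integrable_measurable[OF y])
  have bm [measurable]: "bump n p q \<in> borel_measurable borel" for n p q
    by (rule borel_measurable_continuous_onI[OF bump_fun_continuous[OF bump_fun_bump]])
  have "AE x in lborel. x \<in> I \<longrightarrow> y x = 0"
  proof (rule AE_zero_of_interval_integrals[OF I y])
    fix p q assume pq: "p \<in> I" "q \<in> I" "p < q"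
    \<comment> \<open>The bumps converge to the indicator of the interval, so the identity
      \<open>key\<close>, known for bumps, passes to interval integrals of z - c.\<close>
    have "(\<lambda>n. \<integral>x. y x * of_real (bump (real (Suc n)) p q x) \<partial>lborel) \<longlonglongrightarrow> (\<integral>x. y x * of_real (indicator {p<..<q} x) \<partial>lborel)"
    proof (rule integral_dominated_convergence[where w = "\<lambda>x. norm (indicator {p..q} x *\<^sub>R y x)"])
      show "integrable lborel (\<lambda>x. norm (indicator {p..q} x *\<^sub>R y x))"
        using y[of p q] unfolding set_integrable_def by (rule integrable_norm)
      show "AE x in lborel. (\<lambda>n. y x * of_real (bump (real (Suc n)) p q x)) \<longlonglongrightarrow> y x * of_real (indicator {p<..<q} x)"
        by (intro AE_I2 tendsto_intros bump_tendsto_indicator)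
      show "AE x in lborel. norm (y x * of_real (bump (real (Suc n)) p q x)) \<le> norm (indicator {p..q} x *\<^sub>R y x)" for n
        using bump_bounds[of "real (Suc n)" p q] bump_eq_0[of "real (Suc n)" _ p q]
        by (intro AE_I2) (auto simp: indicator_def norm_mult mult_left_le simp del: of_nat_Suc)
    qed measurable
    moreover have "(\<integral>x. y x * of_real (bump (real (Suc n)) p q x) \<partial>lborel) = 0" for n
      using key[of "real (Suc n)" p q] pq bump_integrable[of "real (Suc n)" z p q, OF _ z] bi[of "real (Suc n)" p q]
      by (simp add: y_def left_diff_distrib del: of_nat_Suc)
    ultimately have "(\<integral>x. y x * of_real (indicator {p<..<q} x) \<partial>lborel) = 0"
      by (simp add: LIMSEQ_const_iff)
    moreover have "(LINT x:{p..q}|lborel. y x) = (\<integral>x. y x * of_real (indicator {p<..<q} x) \<partial>lborel)"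
      unfolding set_lebesgue_integral_def
    proof (rule Bochner_Integration.integral_cong_AE)
      have "AE x in lborel. x \<noteq> p" "AE x in lborel. x \<noteq> q" by (rule AE_lborel_singleton)+
      then show "AE x in lborel. indicator {p..q} x *\<^sub>R y x = y x * of_real (indicator {p<..<q} x)"
        by eventually_elim (auto simp: indicator_def)
    qed measurable
    ultimately show "(LINT x:{p..q}|lborel. y x) = 0" by simp
  qed
  then show ?thesis by (intro exI[of _ c]) (simp add: y_def)
qed simp

text \<open>The support of \<theta> is a compact subset of \<open>I\<close>, so integrals over
  \<open>I\<close> are integrals over the line, and the product of \<open>W\<close> and \<theta>
  vanishes near both infinities.\<close>

lemma test_function_primitive_zero:
  fixes W :: "real \<Rightarrow> complex"
  assumes W: "primitive W w" and \<theta>: "test_function I \<theta>" and I: "I \<in> sets borel"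
  shows "set_integrable lborel I (\<lambda>x. W x * of_real (deriv \<theta> x))"
    "set_integrable lborel I (\<lambda>x. w x * of_real (\<theta> x))"
    "(LINT x:I|lborel. W x * of_real (deriv \<theta> x)) = - (LINT x:I|lborel. w x * of_real (\<theta> x))"
proof -
  have d: "(\<theta> has_real_derivative deriv \<theta> x) (at x)" "(deriv \<theta> has_real_derivative deriv (deriv \<theta>) x) (at x)" for x
  proof -
    have "(deriv ^^ 0) \<theta> field_differentiable at x" "(deriv ^^ 1) \<theta> field_differentiable at x"
      using \<theta> unfolding test_function_def by blast+
    then show "(\<theta> has_real_derivative deriv \<theta> x) (at x)" "(deriv \<theta> has_real_derivative deriv (deriv \<theta>) x) (at x)"
      by (simp_all add: DERIV_deriv_iff_field_differentiable)
  qed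
  have cont: "continuous_on UNIV \<theta>" "continuous_on UNIV (deriv \<theta>)"
    using d by (meson DERIV_isCont continuous_at_imp_continuous_on)+
  have p\<theta>: "primitive \<theta> (deriv \<theta>)"
    by (rule primitive_FTC[OF _ cont(2)]) (use d in \<open>auto simp: has_real_derivative_iff_has_vector_derivative\<close>)
  define S where "S = closure {x. \<theta> x \<noteq> 0}"
  have "bounded S"
    using \<theta> by (intro compact_imp_bounded) (simp add: test_function_def S_def)
  have "open (- S)" by (simp add: S_def open_Compl)
  obtain B where B: "\<And>x. x \<in> S \<Longrightarrow> \<bar>x\<bar> \<le> B"
    using \<open>bounded S\<close> by (auto simp: bounded_iff)
  have z: "\<theta> x = 0" if "x \<notin> S" for x
    using that closure_subset[of "{x. \<theta> x \<noteq> 0}"] unfolding S_def by auto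
  have dz: "deriv \<theta> x = 0" if "x \<notin> S" for x
  proof -
    have "(\<theta> has_real_derivative 0) (at x)"
      by (rule has_field_derivative_transform_within_open[of "\<lambda>x. 0" 0 x "- S"])
        (use that z \<open>open (- S)\<close> in auto)
    then show ?thesis by (rule DERIV_imp_deriv)
  qed
  have sub: "S \<subseteq> I" using \<theta> by (simp add: test_function_def S_def)
  note [measurable] = primitive_measurable[OF W] primitive_density_measurable[OF W]
    primitive_measurable[OF p\<theta>] primitive_density_measurable[OF p\<theta>]
  have s: "set_integrable lborel {- B..B} (\<lambda>x. h x * of_real (g x))"
    if "set_integrable lborel {- B..B} h" "continuous_on UNIV g" for h :: "real \<Rightarrow> complex" and g :: "real \<Rightarrow> real"
  proof -
    have [measurable]: "g \<in> borel_measurable borel" by (rule borel_measurable_continuous_onI[OF that(2)])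
    have "bounded (g ` {-B..B})"
      by (intro compact_imp_bounded compact_continuous_image continuous_on_subset[OF that(2)]) auto
    then obtain K where K: "\<And>x. x \<in> {-B..B} \<Longrightarrow> \<bar>g x\<bar> \<le> K"
      unfolding bounded_iff real_norm_def by blast
    have hm: "(\<lambda>x. indicator {-B..B} x *\<^sub>R h x) \<in> borel_measurable lborel"
      using that(1) unfolding set_integrable_def by (rule borel_measurable_integrable)
    show ?thesis
      unfolding set_integrable_def
    proof (rule Bochner_Integration.integrable_bound)
      show "integrable lborel (\<lambda>x. K * norm (indicator {-B..B} x *\<^sub>R h x))"
        using that(1) unfolding set_integrable_def by (intro integrable_mult_right integrable_norm)
      have "(\<lambda>x. (indicator {-B..B} x *\<^sub>R h x) * of_real (g x)) \<in> borel_measurable lborel"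
        using hm by measurable
      then show "(\<lambda>x. indicator {-B..B} x *\<^sub>R (h x * of_real (g x))) \<in> borel_measurable lborel" by simp
      show "AE x in lborel. norm (indicator {-B..B} x *\<^sub>R (h x * of_real (g x))) \<le> norm (K * norm (indicator {-B..B} x *\<^sub>R h x))"
        by (intro AE_I2) (auto simp: indicator_def norm_mult abs_mult mult.commute[of _ "cmod _"]
            intro!: mult_left_mono order_trans[OF K abs_ge_self])
    qed
  qed
  have ext: "indicator I x *\<^sub>R (h x * of_real (g x)) = h x * of_real (g x)" 
    "indicator {-B..B} x *\<^sub>R (h x * of_real (g x)) = h x * of_real (g x)"
    if "\<And>x. x \<notin> S \<Longrightarrow> g x = 0" for h :: "real \<Rightarrow> complex" and g x
    using that[of x] B[of x] sub by (cases "x \<in> S"; auto simp: indicator_def)+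
  have edz: "indicator I x *\<^sub>R (h x * of_real (deriv \<theta> x)) = h x * of_real (deriv \<theta> x)" 
    "indicator {-B..B} x *\<^sub>R (h x * of_real (deriv \<theta> x)) = h x * of_real (deriv \<theta> x)" 
    and ez: "indicator I x *\<^sub>R (h x * of_real (\<theta> x)) = h x * of_real (\<theta> x)" 
    "indicator {-B..B} x *\<^sub>R (h x * of_real (\<theta> x)) = h x * of_real (\<theta> x)"
    for h :: "real \<Rightarrow> complex" and x
    by (rule ext, erule dz, rule ext, erule dz, rule ext, erule z, rule ext, erule z)
  have i1: "integrable lborel (\<lambda>x. W x * of_real (deriv \<theta> x))"
  proof -
    have "set_integrable lborel {- B..B} W"
      by (intro borel_integrable_atLeastAtMost' continuous_on_subset[OF primitive_continuous[OF W]]) auto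
    from s[OF this cont(2)] show ?thesis unfolding set_integrable_def edz(2) .
  qed
  have i2: "integrable lborel (\<lambda>x. w x * of_real (\<theta> x))"
    using s[of w \<theta>] cont(1) primitive_set_integrable[OF W] unfolding set_integrable_def ez(2) by auto
  show "set_integrable lborel I (\<lambda>x. W x * of_real (deriv \<theta> x))"
    "set_integrable lborel I (\<lambda>x. w x * of_real (\<theta> x))"
    unfolding set_integrable_def edz(1) ez(1) using i1 i2 by auto
  have "(\<integral>x. w x * of_real (\<theta> x) + W x * of_real (deriv \<theta> x) \<partial>lborel) = 0"
  proof (rule primitive_integral_zero[OF primitive_mult[OF W primitive_of_real[OF p\<theta>]]])
    show "integrable lborel (\<lambda>x. w x * of_real (\<theta> x) + W x * of_real (deriv \<theta> x))" using i1 i2 by simp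
    have *: "W x * of_real (\<theta> x) = 0" if "B < \<bar>x\<bar>" for x
      using z[of x] B[of x] that by force
    have "\<forall>\<^sub>F x in at_top. W x * of_real (\<theta> x) = 0"
      using eventually_gt_at_top[of B] by eventually_elim (rule *, auto)
    then show "((\<lambda>x. W x * of_real (\<theta> x)) \<longlongrightarrow> 0) at_top" by (rule tendsto_eventually)
    have "\<forall>\<^sub>F x in at_bot. W x * of_real (\<theta> x) = 0"
      using eventually_gt_at_bot[of "-B"] by eventually_elim (rule *, auto)
    then show "((\<lambda>x. W x * of_real (\<theta> x)) \<longlongrightarrow> 0) at_bot" by (rule tendsto_eventually)
  qed
  then show "(LINT x:I|lborel. W x * of_real (deriv \<theta> x)) = - (LINT x:I|lborel. w x * of_real (\<theta> x))"
    unfolding set_lebesgue_integral_def edz(1) ez(1) using i1 i2 by (simp add: add_eq_0_iff)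
qed

text \<open>The difference of \<open>v\<close> and \<open>W\<close> has weak derivative zero on
  \<open>I\<close>, so it is constant there. The density \<open>w\<close> and its primitive live on
  the whole line, which allows the same \<open>W\<close> for several intervals.\<close>

lemma weak_derivative_primitive:
  fixes W v :: "real \<Rightarrow> complex"
  assumes I: "open I" "is_interval I" and W: "primitive W w"
    and v: "\<And>p q. set_integrable lborel {p..q} v"
    and weak: "\<And>\<theta>. test_function I \<theta> \<Longrightarrow>
      set_integrable lborel I (\<lambda>x. v x * of_real (deriv \<theta> x)) \<and>
      (LINT x:I|lborel. v x * of_real (deriv \<theta> x)) = - (LINT x:I|lborel. w x * of_real (\<theta> x))"
  shows "\<exists>c. AE x in lborel. x \<in> I \<longrightarrow> v x = W x + c"
proof -
  have "\<exists>c. AE x in lborel. x \<in> I \<longrightarrow> v x - W x = c"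
  proof (rule du_Bois_Reymond[OF I])
    show "set_integrable lborel {p..q} (\<lambda>x. v x - W x)" for p q
      by (intro set_integral_diff v borel_integrable_atLeastAtMost' continuous_on_subset[OF primitive_continuous[OF W]]) auto
    fix \<theta> assume \<theta>: "test_function I \<theta>"
    have "I \<in> sets borel" using I(1) by auto
    note t = test_function_primitive_zero[OF W \<theta> this]
    show "(LINT x:I|lborel. (v x - W x) * of_real (deriv \<theta> x)) = 0"
      using weak[OF \<theta>] t by (simp add: left_diff_distrib set_integral_diff)
  qed
  then obtain c where "AE x in lborel. x \<in> I \<longrightarrow> v x - W x = c" by blast
  then have "AE x in lborel. x \<in> I \<longrightarrow> v x = W x + c" by eventually_elim (auto simp: algebra_simps)
  then show ?thesis by blast
qed

section \<open>Hermite functions\<close>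

text \<open>These are the physicists' Hermite polynomials times (-1)^k, since (p e^(-x^2))' = (p' -
  2 x p) e^(-x^2). The sign is compensated in \<open>hermite_const\<close>.\<close>

primrec hermite_poly :: "nat \<Rightarrow> real poly" where
  "hermite_poly 0 = 1"
| "hermite_poly (Suc k) = pderiv (hermite_poly k) - [:0, 2:] * hermite_poly k"

lemma gaussian_higher_deriv:
  "(deriv ^^ k) (\<lambda>y::real. exp (- y\<^sup>2)) = (\<lambda>x. poly (hermite_poly k) x * exp (- x\<^sup>2))"
proof (induction k)
  case (Suc k)
  have "((\<lambda>x. poly (hermite_poly k) x * exp (- x\<^sup>2)) has_real_derivative
      poly (hermite_poly (Suc k)) x * exp (- x\<^sup>2)) (at x)" for x
    by (auto intro!: derivative_eq_intros simp: algebra_simps)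
  then have "deriv (\<lambda>x. poly (hermite_poly k) x * exp (- x\<^sup>2)) = (\<lambda>x. poly (hermite_poly (Suc k)) x * exp (- x\<^sup>2))"
    by (auto intro: DERIV_imp_deriv)
  then show ?case using Suc by simp
qed simp

lemma pderiv_hermite_poly: "pderiv (hermite_poly (Suc k)) = smult (- 2 * (real k + 1)) (hermite_poly k)"
proof (induction k)
  case 0
  then show ?case by (simp add: pderiv_pCons)
next
  case (Suc k)
  have "pderiv (hermite_poly (Suc (Suc k)))
      = smult (- 2 * (real k + 1)) (pderiv (hermite_poly k)) - (smult 2 (hermite_poly (Suc k)) + [:0, 2:] * smult (- 2 * (real k + 1)) (hermite_poly k))"
    by (simp only: hermite_poly.simps(2)[of "Suc k"] pderiv_diff pderiv_mult Suc pderiv_smult)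
      (simp add: pderiv_pCons)
  also have "\<dots> = smult (- 2 * (real (Suc k) + 1)) (hermite_poly (Suc k))"
    by (simp add: poly_eq_poly_eq_iff[symmetric] fun_eq_iff algebra_simps)
  finally show ?case .
qed

definition hermite_const :: "nat \<Rightarrow> real" where
  "hermite_const k = (-1) ^ k / sqrt (sqrt pi * 2 ^ k * fact k)"

lemma hermite_fun_eq: "hermite_fun k x = hermite_const k * poly (hermite_poly k) x * exp (- x\<^sup>2 / 2)"
proof -
  have "exp (x\<^sup>2 / 2) * exp (- x\<^sup>2) = exp (- x\<^sup>2 / 2)" by (simp flip: exp_add)
  then have "hermite_const k * poly (hermite_poly k) x * (exp (x\<^sup>2 / 2) * exp (- x\<^sup>2))
      = hermite_const k * poly (hermite_poly k) x * exp (- x\<^sup>2 / 2)" by (simp only:)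
  then show ?thesis
    by (simp add: hermite_fun_def gaussian_higher_deriv hermite_const_def mult_ac)
qed

lemma hermite_const_Suc: "hermite_const k = - sqrt (2 * real k + 2) * hermite_const (Suc k)"
proof -
  have "sqrt (sqrt pi * 2 ^ Suc k * fact (Suc k)) = sqrt (2 * real k + 2) * sqrt (sqrt pi * 2 ^ k * fact k)"
    by (simp add: real_sqrt_mult[symmetric] algebra_simps)
  then show ?thesis by (simp add: hermite_const_def)
qed

lemma hermite_const_0: "(hermite_const 0)\<^sup>2 = 1 / sqrt pi"
  by (simp add: hermite_const_def power_divide)

text \<open>The derivative in raising form, that is (-d/dx + x) \<phi>_k = sqrt (2 k + 2)
  \<phi>_(k+1). The lowering form is \<open>hermite_deriv_eq\<close>; most computations below use
  one form for one factor and the other form for another.\<close>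

definition hermite_deriv :: "nat \<Rightarrow> real \<Rightarrow> real" where
  "hermite_deriv k x = x * hermite_fun k x - sqrt (2 * real k + 2) * hermite_fun (Suc k) x"

lemma hermite_fun_deriv: "(hermite_fun k has_real_derivative hermite_deriv k x) (at x)"
proof -
  have "((\<lambda>x. hermite_const k * poly (hermite_poly k) x * exp (- x\<^sup>2 / 2)) has_real_derivative
      hermite_const k * (poly (pderiv (hermite_poly k)) x * exp (- x\<^sup>2 / 2) - poly (hermite_poly k) x * (x * exp (- x\<^sup>2 / 2)))) (at x)"
    by (auto intro!: derivative_eq_intros simp: algebra_simps)
  also have "hermite_const k * (poly (pderiv (hermite_poly k)) x * exp (- x\<^sup>2 / 2) - poly (hermite_poly k) x * (x * exp (- x\<^sup>2 / 2)))
      = x * (hermite_const k * poly (hermite_poly k) x * exp (- x\<^sup>2 / 2))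
        + hermite_const k * poly (hermite_poly (Suc k)) x * exp (- x\<^sup>2 / 2)"
    by (simp add: algebra_simps)
  also have "\<dots> = hermite_deriv k x"
    unfolding hermite_deriv_def hermite_fun_eq
    by (subst (2) hermite_const_Suc) (simp add: algebra_simps)
  finally show ?thesis
    by (simp add: hermite_fun_eq[abs_def])
qed

text \<open>For \<open>k = 0\<close> the index \<open>k - 1\<close> is junk, but it comes with the factor \<open>0\<close>.\<close>

lemma hermite_deriv_eq: "hermite_deriv k x = sqrt (2 * real k) * hermite_fun (k - 1) x - x * hermite_fun k x"
proof (cases k)
  case 0
  have "hermite_fun (Suc 0) x = hermite_const (Suc 0) * (- 2 * x) * exp (- x\<^sup>2 / 2)"
    by (simp add: hermite_fun_eq)
  moreover have "hermite_fun 0 x = - sqrt 2 * hermite_const (Suc 0) * exp (- x\<^sup>2 / 2)"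
    using hermite_const_Suc[of 0] by (simp add: hermite_fun_eq)
  ultimately show ?thesis using 0 by (simp add: hermite_deriv_def algebra_simps)
next
  case (Suc m)
  have p: "poly (hermite_poly (Suc (Suc m))) x = - 2 * (real m + 1) * poly (hermite_poly m) x - 2 * x * poly (hermite_poly (Suc m)) x"
    using arg_cong[OF pderiv_hermite_poly[of m], of "\<lambda>p. poly p x"] by (subst hermite_poly.simps(2)) (simp add: algebra_simps)
  define s where "s = sqrt (2 * real m + 2)"
  define t where "t = sqrt (2 * real (Suc m) + 2)"
  define c where "c = hermite_const (Suc (Suc m))"
  have s2: "s * s = 2 * real m + 2" by (simp add: s_def)
  have c1: "hermite_const (Suc m) = - t * c" "hermite_const m = s * (t * c)"
    using hermite_const_Suc[of "Suc m"] hermite_const_Suc[of m] by (simp_all add: s_def t_def c_def)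
  have "hermite_deriv (Suc m) x - (s * hermite_fun m x - x * hermite_fun (Suc m) x)
      = exp (- x\<^sup>2 / 2) * (2 * x * (- t * c) * poly (hermite_poly (Suc m)) x - t * c * poly (hermite_poly (Suc (Suc m))) x
          - (s * s) * t * c * poly (hermite_poly m) x)"
    unfolding hermite_deriv_def hermite_fun_eq c1 c_def[symmetric] t_def[symmetric]
    by (simp add: algebra_simps del: hermite_poly.simps)
  also have "\<dots> = 0" unfolding s2 p by (simp add: algebra_simps del: hermite_poly.simps)
  finally show ?thesis using Suc by (simp add: s_def algebra_simps)
qed

text \<open>Comparing the raising with the lowering form of the derivative eliminates it and leaves
  the three-term recurrence.\<close>

lemma x_hermite_fun: "2 * (x * hermite_fun k x) = sqrt (2 * real k + 2) * hermite_fun (Suc k) x + sqrt (2 * real k) * hermite_fun (k - 1) x"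
  using hermite_deriv_eq[of k x] unfolding hermite_deriv_def by linarith

text \<open>The eigenvalue equation of the oscillator: the raising form is differentiated, and the
  lowering form at index \<open>Suc k\<close> brings the result back to index
  \<open>k\<close>.\<close>

lemma hermite_deriv_deriv: "(hermite_deriv k has_real_derivative (x\<^sup>2 - (2 * real k + 1)) * hermite_fun k x) (at x)"
proof -
  have "(hermite_deriv k has_real_derivative
      hermite_fun k x + x * hermite_deriv k x - sqrt (2 * real k + 2) * hermite_deriv (Suc k) x) (at x)"
    unfolding hermite_deriv_def[of k, abs_def]
    by (auto intro!: derivative_eq_intros hermite_fun_deriv simp: hermite_deriv_def)
  moreover have "hermite_fun k x + x * hermite_deriv k x - sqrt (2 * real k + 2) * hermite_deriv (Suc k) x
     = (x\<^sup>2 - (2 * real k + 1)) * hermite_fun k x"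
  proof -
    define s where "s = sqrt (2 * real k + 2)"
    have s2: "s * s = 2 * real k + 2" by (simp add: s_def)
    have s1: "sqrt (2 * real (Suc k)) = s" by (simp add: s_def)
    have "hermite_fun k x + x * hermite_deriv k x - s * hermite_deriv (Suc k) x
      = hermite_fun k x + x * (x * hermite_fun k x) - (s * s) * hermite_fun k x"
      unfolding hermite_deriv_eq[of "Suc k"] hermite_deriv_def[of k] s1 s_def[symmetric]
      by (simp add: algebra_simps)
    then show ?thesis unfolding s2 by (simp add: s_def power2_eq_square algebra_simps)
  qed
  ultimately show ?thesis by simp
qed

lemma hermite_fun_decay: "\<exists>C. \<forall>x. \<bar>hermite_fun k x\<bar> \<le> C * exp (- (1/4) * x\<^sup>2)"
proof -
  obtain C where C: "C > 0" "\<And>x. \<bar>poly (hermite_poly k) x\<bar> \<le> C * exp (1/4 * x\<^sup>2)"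
    using poly_le_gauss[of "1/4" "hermite_poly k"] by auto
  have "\<bar>hermite_fun k x\<bar> \<le> (\<bar>hermite_const k\<bar> * C) * exp (- (1/4) * x\<^sup>2)" for x
  proof -
    have "\<bar>hermite_fun k x\<bar> \<le> \<bar>hermite_const k\<bar> * (C * exp (1/4 * x\<^sup>2)) * exp (- x\<^sup>2 / 2)"
      unfolding hermite_fun_eq abs_mult abs_exp_cancel by (intro mult_right_mono mult_left_mono C) auto
    also have "\<dots> = (\<bar>hermite_const k\<bar> * C) * exp (- (1/4) * x\<^sup>2)"
      by (simp add: mult.assoc flip: exp_add)
    finally show ?thesis .
  qed
  then show ?thesis by blast
qed

lemma gauss_C1_hermite: "gauss_C1 (hermite_fun k) (hermite_deriv k)"
  unfolding gauss_C1_def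
proof (intro conjI allI hermite_fun_deriv)
  show "continuous_on UNIV (hermite_deriv k)"
    using hermite_deriv_deriv by (meson DERIV_isCont continuous_at_imp_continuous_on)
  obtain C0 where C0: "\<And>x. \<bar>hermite_fun k x\<bar> \<le> C0 * exp (- (1/4) * x\<^sup>2)" using hermite_fun_decay by blast
  obtain C1 where C1: "\<And>x. \<bar>hermite_fun (Suc k) x\<bar> \<le> C1 * exp (- (1/4) * x\<^sup>2)" using hermite_fun_decay by blast
  obtain C2 where C2: "\<And>x. \<bar>hermite_fun (k - 1) x\<bar> \<le> C2 * exp (- (1/4) * x\<^sup>2)" using hermite_fun_decay by blast
  define s t where "s = sqrt (2 * real k + 2)" and "t = sqrt (2 * real k)"
  have st: "s \<ge> 0" "t \<ge> 0" by (auto simp: s_def t_def)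
  have d: "\<bar>hermite_deriv k x\<bar> \<le> (s * C1 + t * C2) * exp (- (1/4) * x\<^sup>2)" for x
  proof -
    \<comment> \<open>Averaging the two forms of the derivative removes the factor \<open>x\<close>,
      so the decay of the two neighbouring Hermite functions suffices.\<close>
    have "2 * hermite_deriv k x = t * hermite_fun (k - 1) x - s * hermite_fun (Suc k) x"
      using hermite_deriv_eq[of k x] hermite_deriv_def[of k x] unfolding s_def t_def by linarith
    then have "\<bar>2 * hermite_deriv k x\<bar> \<le> \<bar>t * hermite_fun (k - 1) x\<bar> + \<bar>s * hermite_fun (Suc k) x\<bar>"
      by (simp only: abs_triangle_ineq4)
    also have "\<dots> \<le> t * (C2 * exp (- (1/4) * x\<^sup>2)) + s * (C1 * exp (- (1/4) * x\<^sup>2))"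
      unfolding abs_mult using st by (intro add_mono mult_mono C1 C2) auto
    finally show ?thesis by (simp add: algebra_simps)
  qed
  have "\<bar>hermite_fun k x\<bar> \<le> max C0 (s * C1 + t * C2) * exp (- (1/4) * x\<^sup>2)" for x
    by (rule order_trans[OF C0]) (simp add: mult_right_mono)
  moreover have "\<bar>hermite_deriv k x\<bar> \<le> max C0 (s * C1 + t * C2) * exp (- (1/4) * x\<^sup>2)" for x
    by (rule order_trans[OF d]) (simp add: mult_right_mono)
  ultimately show "\<exists>C. \<forall>x. \<bar>hermite_fun k x\<bar> \<le> C * exp (- (1/4) * x\<^sup>2) \<and> \<bar>hermite_deriv k x\<bar> \<le> C * exp (- (1/4) * x\<^sup>2)"
    by blast
qed

lemma hermite_fun_measurable [measurable]:
  "hermite_fun k \<in> borel_measurable borel" "hermite_deriv k \<in> borel_measurable borel"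
  using gauss_C1_measurable[OF gauss_C1_hermite] by blast+

lemma square_integrable_hermite: "square_integrable (\<lambda>x. complex_of_real (hermite_fun k x))"
  by (rule gauss_C1_square_integrable[OF gauss_C1_hermite])

text \<open>Needed for products of two Hermite functions, which become the test functions when the
  derivative of \<mu> times a Hermite sum is computed.\<close>

lemma gauss_C1_mult:
  assumes f: "gauss_C1 f f'" and g: "gauss_C1 g g'"
  shows "gauss_C1 (\<lambda>x. f x * g x) (\<lambda>x. f' x * g x + f x * g' x)"
  unfolding gauss_C1_def
proof (intro conjI allI)
  have cont: "continuous_on UNIV f" "continuous_on UNIV g" "continuous_on UNIV f'" "continuous_on UNIV g'"
    using f g by (auto simp: gauss_C1_def intro!: DERIV_continuous_on intro: has_field_derivative_at_within)
  show "((\<lambda>x. f x * g x) has_real_derivative f' x * g x + f x * g' x) (at x)" for x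
    using f g DERIV_mult'[of f "f' x" x UNIV g "g' x"] by (simp add: gauss_C1_def add.commute mult.commute)
  show "continuous_on UNIV (\<lambda>x. f' x * g x + f x * g' x)" by (intro continuous_intros cont)
  obtain C where C: "\<And>x. \<bar>f x\<bar> \<le> C * exp (- (1/4) * x\<^sup>2)" "\<And>x. \<bar>f' x\<bar> \<le> C * exp (- (1/4) * x\<^sup>2)"
    using f by (auto simp: gauss_C1_def)
  obtain D where D: "\<And>x. \<bar>g x\<bar> \<le> D * exp (- (1/4) * x\<^sup>2)" "\<And>x. \<bar>g' x\<bar> \<le> D * exp (- (1/4) * x\<^sup>2)"
    using g by (auto simp: gauss_C1_def)
  have C0: "C \<ge> 0" and D0: "D \<ge> 0" using order_trans[OF abs_ge_zero C(1)[of 0]] order_trans[OF abs_ge_zero D(1)[of 0]] by auto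
  define E where "E x = exp (- (1/4) * x\<^sup>2)" for x :: real
  have E: "0 \<le> E x" "E x \<le> 1" for x by (auto simp: E_def)
  have m: "\<bar>u\<bar> \<le> C * E x \<Longrightarrow> \<bar>v\<bar> \<le> D * E x \<Longrightarrow> \<bar>u * v\<bar> \<le> C * D * E x" for u v x
  proof -
    assume u: "\<bar>u\<bar> \<le> C * E x" and v: "\<bar>v\<bar> \<le> D * E x"
    have "\<bar>u * v\<bar> \<le> (C * E x) * (D * E x)" unfolding abs_mult using u v C0 E by (intro mult_mono) auto
    also have "\<dots> = (C * D * E x) * E x" by simp
    also have "\<dots> \<le> C * D * E x" using C0 D0 E by (intro mult_left_le) auto
    finally show ?thesis .
  qed
  have "\<bar>f x * g x\<bar> \<le> (2 * (C * D)) * E x" for x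
    using m[of "f x" x "g x"] C(1) D(1) C0 D0 E(1)[of x] by (simp add: E_def)
  moreover have "\<bar>f' x * g x + f x * g' x\<bar> \<le> (2 * (C * D)) * E x" for x
    using m[of "f' x" x "g x"] m[of "f x" x "g' x"] C D abs_triangle_ineq[of "f' x * g x" "f x * g' x"]
    by (simp add: E_def)
  ultimately show "\<exists>C. \<forall>x. \<bar>f x * g x\<bar> \<le> C * exp (- (1/4) * x\<^sup>2) \<and> \<bar>f' x * g x + f x * g' x\<bar> \<le> C * exp (- (1/4) * x\<^sup>2)"
    unfolding E_def by blast
qed

lemma hermite_prod_integrable: "integrable lborel (\<lambda>x. hermite_fun m x * hermite_fun n x)"
proof -
  have "integrable lborel (\<lambda>x. Re (complex_of_real (hermite_fun m x) * cnj (complex_of_real (hermite_fun n x))))"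
    by (intro integrable_Re integrable_mult_cnj square_integrable_hermite)
  then show ?thesis by simp
qed

text \<open>The integral of the derivative of the product is zero. With the lowering form for index
  \<open>m\<close> and the raising form for index \<open>n\<close> the terms containing
  \<open>x\<close> cancel.\<close>

lemma hermite_ladder:
  "sqrt (2 * real m) * (\<integral>x. hermite_fun (m - 1) x * hermite_fun n x \<partial>lborel)
    = sqrt (2 * real n + 2) * (\<integral>x. hermite_fun m x * hermite_fun (Suc n) x \<partial>lborel)"
proof -
  define f where "f x = sqrt (2 * real m) * (hermite_fun (m - 1) x * hermite_fun n x)
    - sqrt (2 * real n + 2) * (hermite_fun m x * hermite_fun (Suc n) x)" for x
  have fe: "hermite_deriv m x * hermite_fun n x + hermite_fun m x * hermite_deriv n x = f x" for x
    unfolding f_def hermite_deriv_eq[of m] hermite_deriv_def[of n] by (simp add: algebra_simps)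
  obtain C where C: "\<And>x. norm (hermite_fun m x * hermite_fun n x) \<le> C * exp (- (1/4) * x\<^sup>2)"
    using gauss_C1_mult[OF gauss_C1_hermite gauss_C1_hermite, of m n] by (auto simp: gauss_C1_def)
  have "(\<integral>x. f x \<partial>lborel) = 0"
  proof (rule primitive_integral_zero)
    show "primitive (\<lambda>x. hermite_fun m x * hermite_fun n x) f"
      using gauss_C1_primitive[OF gauss_C1_mult[OF gauss_C1_hermite[of m] gauss_C1_hermite[of n]]] by (simp add: fe)
    show "integrable lborel f" unfolding f_def by (intro Bochner_Integration.integrable_diff integrable_mult_right hermite_prod_integrable)
  qed (rule gauss_tendsto_zero[OF C], simp)+
  then show ?thesis unfolding f_def by (simp add: hermite_prod_integrable)
qed

text \<open>The ladder identity moves the pair (m, n + 1) to (m - 1, n), and for m = 0 the factor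
  sqrt 0 makes the pairing vanish.\<close>

lemma hermite_orthonormal: "(\<integral>x. hermite_fun m x * hermite_fun n x \<partial>lborel) = of_bool (m = n)"
proof (induction n arbitrary: m)
  case 0
  show ?case
  proof (cases m)
    case 0
    \<comment> \<open>The square of the ground state is the centred normal density with variance
      1/2.\<close>
    define \<sigma> where "\<sigma> = sqrt (1/2)"
    have "hermite_fun 0 x * hermite_fun 0 x = (hermite_const 0)\<^sup>2 * (exp (- x\<^sup>2 / 2) * exp (- x\<^sup>2 / 2))" for x
      by (simp add: hermite_fun_eq power2_eq_square)
    then have "hermite_fun 0 x * hermite_fun 0 x = normal_density 0 \<sigma> x" for x
      by (simp add: hermite_const_0 normal_density_def \<sigma>_def flip: exp_add)
    moreover have "\<sigma> > 0" by (simp add: \<sigma>_def)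
    ultimately show ?thesis using 0 by simp
  next
    case (Suc k)
    then show ?thesis using hermite_ladder[of 0 k] by (simp add: mult.commute)
  qed
next
  case (Suc n)
  show ?case
  proof (cases m)
    case 0
    then show ?thesis using hermite_ladder[of 0 n] by simp
  next
    case (Suc k)
    have e: "sqrt (2 * real (Suc k)) = sqrt (2 * real k + 2)" by (simp add: algebra_simps)
    have "sqrt (2 * real k + 2) * of_bool (k = n) = sqrt (2 * real n + 2) * (\<integral>x. hermite_fun m x * hermite_fun (Suc n) x \<partial>lborel)"
      using hermite_ladder[of m n] unfolding Suc e diff_Suc_1 Suc.IH .
    then show ?thesis using Suc by (auto simp: of_bool_def split: if_splits)
  qed
qed

lemma cinner_hermite: "cinner_L2 (hermite_L2 m) (hermite_L2 n) = of_bool (m = n)"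
proof -
  have "cinner_L2 (hermite_L2 m) (hermite_L2 n) = (\<integral>x. complex_of_real (hermite_fun m x * hermite_fun n x) \<partial>lborel)"
    unfolding hermite_L2_def by (simp add: cinner_L2_of square_integrable_hermite)
  also have "\<dots> = complex_of_real (of_bool (m = n))"
    by (subst integral_complex_of_real) (simp only: hermite_orthonormal)
  finally show ?thesis by simp
qed

section \<open>Bounds for the Hermite functions at a fixed point\<close>

text \<open>Sonin's function \<open>\<phi>'\<^sup>2 + (\<lambda> - x\<^sup>2) \<phi>\<^sup>2\<close> has the derivative \<open>- 2 x \<phi>\<^sup>2\<close>, hence its maximum at \<open>0\<close>.\<close>

lemma hermite_fun_Sonin:
  "(hermite_deriv k a)\<^sup>2 + (2 * real k + 1 - a\<^sup>2) * (hermite_fun k a)\<^sup>2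
    \<le> (hermite_deriv k 0)\<^sup>2 + (2 * real k + 1) * (hermite_fun k 0)\<^sup>2"
proof -
  define w where "w x = (hermite_deriv k x)\<^sup>2 + (2 * real k + 1 - x\<^sup>2) * (hermite_fun k x)\<^sup>2" for x
  have w: "(w has_real_derivative (- 2 * x * (hermite_fun k x)\<^sup>2)) (at x)" for x
    unfolding w_def[abs_def]
    by (rule derivative_eq_intros hermite_fun_deriv hermite_deriv_deriv refl)+ (simp add: power2_eq_square algebra_simps)
  have "w a \<le> w 0"
  proof (cases "a \<ge> 0")
    case True
    then show ?thesis
    proof (rule DERIV_nonpos_imp_nonincreasing)
      fix x assume x: "0 \<le> x" "x \<le> a"
      then show "\<exists>y. (w has_real_derivative y) (at x) \<and> y \<le> 0"
        by (intro exI[of _ "- 2 * x * (hermite_fun k x)\<^sup>2"] conjI w) simp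
    qed
  next
    case False
    then have "a \<le> 0" by simp
    then show ?thesis
    proof (rule DERIV_nonneg_imp_nondecreasing)
      fix x assume x: "a \<le> x" "x \<le> 0"
      then show "\<exists>y. (w has_real_derivative y) (at x) \<and> y \<ge> 0"
        by (intro exI[of _ "- 2 * x * (hermite_fun k x)\<^sup>2"] conjI w) (simp add: mult_nonpos_nonneg)
    qed
  qed
  then show ?thesis by (simp add: w_def)
qed

text \<open>At 0 the three-term recurrence links indices two apart, and the ratio of the squares is
  m / (m + 1). For m = 0 the truncated index m - 1 is multiplied by 0.\<close>

lemma hermite_fun_at_0: "(hermite_fun k 0)\<^sup>2 \<le> 1"
proof (induction k rule: less_induct)
  case (less k)
  show ?case
  proof (cases k)
    case 0
    have "1 \<le> sqrt pi" using pi_ge_two by simp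
    then have "1 / sqrt pi \<le> 1" by simp
    then show ?thesis using 0 hermite_const_0 by (simp add: hermite_fun_eq power_mult_distrib)
  next
    case (Suc m)
    have "sqrt (2 * real m + 2) * hermite_fun (Suc m) 0 = - sqrt (2 * real m) * hermite_fun (m - 1) 0"
      using x_hermite_fun[of 0 m] by simp
    then have "(sqrt (2 * real m + 2) * hermite_fun (Suc m) 0)\<^sup>2 = (sqrt (2 * real m) * hermite_fun (m - 1) 0)\<^sup>2" by simp
    then have "(2 * real m + 2) * (hermite_fun (Suc m) 0)\<^sup>2 = 2 * real m * (hermite_fun (m - 1) 0)\<^sup>2"
      by (simp add: power_mult_distrib)
    also have "\<dots> \<le> 2 * real m * 1"
      using less.IH[of "m - 1"] Suc by (intro mult_left_mono) auto
    also have "\<dots> \<le> (2 * real m + 2) * 1" by simp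
    finally show ?thesis using Suc by (simp add: mult_le_cancel_left)
  qed
qed

text \<open>Sonin's function at 0 is at most 4 k + 1. As soon as k >= a^2, the factor in front of
  the square at \<open>a\<close> is at least k + 1/2, so the absolute value is at most 2. The
  remaining indices are finite in number and are covered by a sum.\<close>

lemma hermite_fun_bounded: "\<exists>B. \<forall>k. \<bar>hermite_fun k a\<bar> \<le> B"
proof -
  define m where "m = nat \<lceil>a\<^sup>2\<rceil>"
  have "\<bar>hermite_fun k a\<bar> \<le> 2 + (\<Sum>j\<le>m. \<bar>hermite_fun j a\<bar>)" for k
  proof (cases "k \<le> m")
    case True
    then have "\<bar>hermite_fun k a\<bar> \<le> (\<Sum>j\<le>m. \<bar>hermite_fun j a\<bar>)"
      by (intro member_le_sum) auto
    then show ?thesis by simp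
  next
    case False
    then have "a\<^sup>2 \<le> real k" unfolding m_def by linarith
    then have l: "2 * real k + 1 - a\<^sup>2 \<ge> (4 * real k + 2) / 4" by (simp add: field_simps)
    have "hermite_deriv k 0 = sqrt (2 * real k) * hermite_fun (k - 1) 0"
      by (simp add: hermite_deriv_eq)
    then have "(hermite_deriv k 0)\<^sup>2 = 2 * real k * (hermite_fun (k - 1) 0)\<^sup>2"
      by (simp add: power_mult_distrib)
    also have "\<dots> \<le> 2 * real k * 1" by (intro mult_left_mono hermite_fun_at_0) auto
    finally have d: "(hermite_deriv k 0)\<^sup>2 \<le> 2 * real k" by simp
    have "(4 * real k + 2) / 4 * (hermite_fun k a)\<^sup>2 \<le> (2 * real k + 1 - a\<^sup>2) * (hermite_fun k a)\<^sup>2"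
      using l by (intro mult_right_mono) auto
    also have "\<dots> \<le> (hermite_deriv k 0)\<^sup>2 + (2 * real k + 1) * (hermite_fun k 0)\<^sup>2"
      using hermite_fun_Sonin[of k a] by (smt (verit) zero_le_power2)
    also have "\<dots> \<le> 2 * real k + (2 * real k + 1) * 1"
      by (intro add_mono d mult_left_mono hermite_fun_at_0) auto
    also have "\<dots> \<le> (4 * real k + 2) / 4 * 4" by simp
    finally have "(hermite_fun k a)\<^sup>2 \<le> 4" by (subst (asm) mult_le_cancel_left_pos) auto
    then have "\<bar>hermite_fun k a\<bar>\<^sup>2 \<le> 2\<^sup>2" by simp
    then have "\<bar>hermite_fun k a\<bar> \<le> 2" by (rule power2_le_imp_le) simp
    then show ?thesis by (smt (verit) sum_nonneg abs_ge_zero)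
  qed
  then show ?thesis by blast
qed

section \<open>Hermite expansions and the functional calculus of the oscillator\<close>

abbreviation hcoef :: "L2 \<Rightarrow> nat \<Rightarrow> complex" where
  "hcoef \<psi> k \<equiv> cinner_L2 \<psi> (hermite_L2 k)"

definition hseries :: "(nat \<Rightarrow> complex) \<Rightarrow> L2" where
  "hseries c = (\<Sum>k. c k *\<^sub>c hermite_L2 k)"

abbreviation sq_summable :: "(nat \<Rightarrow> complex) \<Rightarrow> bool" where
  "sq_summable c \<equiv> summable (\<lambda>k. (cmod (c k))\<^sup>2)"

lemma hcoef_eq: "hcoef \<psi> k = (\<integral>x. fun_L2 \<psi> x * of_real (hermite_fun k x) \<partial>lborel)"
  unfolding hermite_L2_def by (simp add: cinner_L2_of_right square_integrable_hermite)

lemma hcoef_hermite_sum: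
  assumes "finite A"
  shows "hcoef (\<Sum>k\<in>A. c k *\<^sub>c hermite_L2 k) j = (if j \<in> A then c j else 0)"
proof -
  have "hcoef (\<Sum>k\<in>A. c k *\<^sub>c hermite_L2 k) j = (\<Sum>k\<in>A. if k = j then c k else 0)"
    by (simp add: cinner_sum_left cinner_scaleC_left cinner_hermite of_bool_def if_distrib cong: if_cong)
  then show ?thesis using assms by simp
qed

lemma inner_hermite_sum:
  assumes "finite A"
  shows "inner (\<Sum>k\<in>A. c k *\<^sub>c hermite_L2 k) \<psi> = (\<Sum>k\<in>A. Re (c k * cnj (hcoef \<psi> k)))"
proof -
  have "cinner_L2 (\<Sum>k\<in>A. c k *\<^sub>c hermite_L2 k) \<psi> = (\<Sum>k\<in>A. c k * cnj (hcoef \<psi> k))"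
    by (simp add: cinner_sum_left cinner_scaleC_left cinner_commute[of "hermite_L2 _" \<psi>])
  then show ?thesis by (simp add: inner_L2_def)
qed

lemma norm_hermite_sum:
  assumes "finite A"
  shows "(norm (\<Sum>k\<in>A. c k *\<^sub>c hermite_L2 k))\<^sup>2 = (\<Sum>k\<in>A. (cmod (c k))\<^sup>2)"
proof -
  have "(norm (\<Sum>k\<in>A. c k *\<^sub>c hermite_L2 k))\<^sup>2 = (\<Sum>k\<in>A. Re (c k * cnj (c k)))"
    unfolding power2_norm_eq_inner inner_hermite_sum[OF assms]
    by (intro sum.cong refl) (simp add: hcoef_hermite_sum[OF assms])
  then show ?thesis by (simp add: complex_norm_square[symmetric] flip: of_real_power)
qed

lemma Bessel_finite: "(\<Sum>k<n. (cmod (hcoef \<psi> k))\<^sup>2) \<le> (norm \<psi>)\<^sup>2"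
proof -
  define p where "p = (\<Sum>k<n. hcoef \<psi> k *\<^sub>c hermite_L2 k)"
  have pp: "inner p \<psi> = (\<Sum>k<n. (cmod (hcoef \<psi> k))\<^sup>2)" "inner p p = (\<Sum>k<n. (cmod (hcoef \<psi> k))\<^sup>2)"
    unfolding power2_norm_eq_inner[of p, symmetric]
    by (simp_all add: p_def inner_hermite_sum norm_hermite_sum complex_norm_square[symmetric] flip: of_real_power)
  have "0 \<le> inner (\<psi> - p) (\<psi> - p)" by simp
  also have "\<dots> = inner \<psi> \<psi> - 2 * inner p \<psi> + inner p p"
    by (simp add: inner_diff_left inner_diff_right inner_commute)
  finally show ?thesis by (simp add: pp power2_norm_eq_inner)
qed

lemma Bessel:
  "sq_summable (hcoef \<psi>)" "(\<Sum>k. (cmod (hcoef \<psi> k))\<^sup>2) \<le> (norm \<psi>)\<^sup>2"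
proof -
  show s: "sq_summable (hcoef \<psi>)"
    by (rule summableI_nonneg_bounded[where x = "(norm \<psi>)\<^sup>2"]) (auto simp: Bessel_finite)
  show "(\<Sum>k. (cmod (hcoef \<psi> k))\<^sup>2) \<le> (norm \<psi>)\<^sup>2"
    by (rule suminf_le_const[OF s Bessel_finite])
qed

text \<open>Orthonormality turns blocks of the series into blocks of the series of squares;
  completeness of \<open>L2\<close> does the rest.\<close>

lemma summable_hseries:
  assumes c: "sq_summable c"
  shows "summable (\<lambda>k. c k *\<^sub>c hermite_L2 k)"
  unfolding summable_Cauchy
proof (intro allI impI)
  fix e :: real assume "e > 0"
  then have "e\<^sup>2 > 0" by simp
  then obtain N where N: "\<And>m n. m \<ge> N \<Longrightarrow> norm (\<Sum>k\<in>{m..<n}. (cmod (c k))\<^sup>2) < e\<^sup>2"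
    using c unfolding summable_Cauchy by blast
  have "norm (\<Sum>k\<in>{m..<n}. c k *\<^sub>c hermite_L2 k) < e" if "m \<ge> N" for m n
  proof (rule power2_less_imp_less)
    show "(norm (\<Sum>k\<in>{m..<n}. c k *\<^sub>c hermite_L2 k))\<^sup>2 < e\<^sup>2"
      using N[OF that, of n] by (simp add: norm_hermite_sum)
  qed (use \<open>e > 0\<close> in simp)
  then show "\<exists>N. \<forall>m\<ge>N. \<forall>n. norm (\<Sum>k\<in>{m..<n}. c k *\<^sub>c hermite_L2 k) < e" by blast
qed

lemma hcoef_hseries:
  assumes "sq_summable c"
  shows "hcoef (hseries c) j = c j"
proof -
  have "(\<lambda>n. hcoef (\<Sum>k<n. c k *\<^sub>c hermite_L2 k) j) \<longlonglongrightarrow> hcoef (hseries c) j"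
    unfolding hseries_def
    by (rule bounded_linear.tendsto[OF bounded_linear_cinner_left summable_LIMSEQ[OF summable_hseries[OF assms]]])
  moreover have "(\<lambda>n. hcoef (\<Sum>k<n. c k *\<^sub>c hermite_L2 k) j) \<longlonglongrightarrow> c j"
  proof (rule tendsto_eventually)
    show "\<forall>\<^sub>F n in sequentially. hcoef (\<Sum>k<n. c k *\<^sub>c hermite_L2 k) j = c j"
      using eventually_gt_at_top[of j] by eventually_elim (simp add: hcoef_hermite_sum)
  qed
  ultimately show ?thesis by (rule LIMSEQ_unique)
qed

lemma norm_hseries:
  assumes "sq_summable c"
  shows "(norm (hseries c))\<^sup>2 = (\<Sum>k. (cmod (c k))\<^sup>2)"
proof -
  have "(\<lambda>n. (norm (\<Sum>k<n. c k *\<^sub>c hermite_L2 k))\<^sup>2) \<longlonglongrightarrow> (norm (hseries c))\<^sup>2"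
    unfolding hseries_def by (intro tendsto_intros summable_LIMSEQ summable_hseries assms)
  then have "(\<lambda>n. \<Sum>k<n. (cmod (c k))\<^sup>2) \<longlonglongrightarrow> (norm (hseries c))\<^sup>2" by (simp add: norm_hermite_sum)
  then show ?thesis using summable_LIMSEQ[OF assms] LIMSEQ_unique by blast
qed

text \<open>Bounds on finite partial sums give convergence and the norm bound together; this is how
  all coefficient estimates below reach \<open>L2\<close>.\<close>

lemma norm_hseries_le:
  assumes "\<And>n. (\<Sum>k<n. (cmod (c k))\<^sup>2) \<le> B\<^sup>2" "B \<ge> 0"
  shows "sq_summable c" "norm (hseries c) \<le> B"
proof -
  show s: "sq_summable c"
    by (rule summableI_nonneg_bounded[where x = "B\<^sup>2"]) (auto simp: assms)
  have "(norm (hseries c))\<^sup>2 \<le> B\<^sup>2"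
    unfolding norm_hseries[OF s] by (rule suminf_le_const[OF s assms(1)])
  then show "norm (hseries c) \<le> B" using assms(2) by (rule power2_le_imp_le)
qed

lemma sq_summable_add:
  assumes "sq_summable c" "sq_summable d"
  shows "sq_summable (\<lambda>k. c k + d k)"
proof (rule summable_comparison_test')
  show "summable (\<lambda>k. 2 * (cmod (c k))\<^sup>2 + 2 * (cmod (d k))\<^sup>2)"
    using assms by (intro summable_add summable_mult)
  show "norm ((cmod (c n + d n))\<^sup>2) \<le> 2 * (cmod (c n))\<^sup>2 + 2 * (cmod (d n))\<^sup>2" if "n \<ge> 0" for n
  proof -
    have "(cmod (c n + d n))\<^sup>2 \<le> (cmod (c n) + cmod (d n))\<^sup>2"
      by (intro power_mono norm_triangle_ineq) auto
    also have "\<dots> \<le> 2 * (cmod (c n))\<^sup>2 + 2 * (cmod (d n))\<^sup>2"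
      using sum_squares_bound[of "cmod (c n)" "cmod (d n)"] by (simp add: power2_sum)
    finally show ?thesis by simp
  qed
qed

lemma sq_summable_mult:
  assumes "sq_summable c" "\<And>k. cmod (d k) \<le> K"
  shows "sq_summable (\<lambda>k. d k * c k)"
proof (rule summable_comparison_test')
  show "summable (\<lambda>k. K\<^sup>2 * (cmod (c k))\<^sup>2)" using assms(1) by (rule summable_mult)
  show "norm ((cmod (d n * c n))\<^sup>2) \<le> K\<^sup>2 * (cmod (c n))\<^sup>2" if "n \<ge> 0" for n
    using power_mono[OF assms(2), of n 2] by (simp add: norm_mult power_mult_distrib mult_right_mono)
qed

lemma hseries_add: "sq_summable c \<Longrightarrow> sq_summable d \<Longrightarrow> hseries (\<lambda>k. c k + d k) = hseries c + hseries d"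
  unfolding hseries_def by (simp add: scaleC_add_left suminf_add[symmetric] summable_hseries)

lemma hseries_scaleC:
  assumes "sq_summable c"
  shows "hseries (\<lambda>k. a * c k) = a *\<^sub>c hseries c"
  unfolding hseries_def scaleC_scaleC[symmetric]
  by (rule bounded_linear.suminf[OF bounded_linear_scaleC summable_hseries[OF assms], symmetric])

lemma hseries_diff:
  assumes "sq_summable c" "sq_summable d"
  shows "hseries (\<lambda>k. c k - d k) = hseries c - hseries d"
proof -
  have "sq_summable (\<lambda>k. - 1 * d k)" by (rule sq_summable_mult[OF assms(2), where K = 1]) simp
  then have "hseries (\<lambda>k. c k + - 1 * d k) = hseries c + (- 1) *\<^sub>c hseries d"
    by (subst hseries_add[OF assms(1)]) (simp_all only: hseries_scaleC[OF assms(2)])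
  then show ?thesis by (simp add: minus_L2_def)
qed

text \<open>The range of the orthogonal projection onto the closed span of the Hermite functions.
  Inside it an element is determined by its coefficients, see
  \<open>hermite_span_eqI\<close>.\<close>

definition hermite_span :: "L2 set" where
  "hermite_span = {\<psi>. hseries (hcoef \<psi>) = \<psi>}"

lemma hseries_in_span: "sq_summable c \<Longrightarrow> hseries c \<in> hermite_span"
  unfolding hermite_span_def by (simp add: hcoef_hseries[of c])

lemma hermite_span_eqI:
  assumes "\<psi> \<in> hermite_span" "\<psi>' \<in> hermite_span" "\<And>k. hcoef \<psi> k = hcoef \<psi>' k"
  shows "\<psi> = \<psi>'"
proof -
  have "hcoef \<psi> = hcoef \<psi>'" using assms(3) by (rule ext)
  then show ?thesis using assms(1,2) unfolding hermite_span_def by (metis (mono_tags) mem_Collect_eq)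
qed

lemma hermite_span_add: "\<psi> \<in> hermite_span \<Longrightarrow> \<psi>' \<in> hermite_span \<Longrightarrow> \<psi> + \<psi>' \<in> hermite_span"
  using hseries_in_span[OF sq_summable_add[OF Bessel(1)[of \<psi>] Bessel(1)[of \<psi>']]]
  by (simp add: hseries_add Bessel(1)) (simp add: hermite_span_def)

lemma hermite_span_scaleC: "\<psi> \<in> hermite_span \<Longrightarrow> a *\<^sub>c \<psi> \<in> hermite_span"
  using hseries_in_span[OF sq_summable_mult[OF Bessel(1)[of \<psi>], of "\<lambda>_. a" "cmod a"]]
  by (simp add: hseries_scaleC Bessel(1)) (simp add: hermite_span_def)

lemma hermite_span_diff: "\<psi> \<in> hermite_span \<Longrightarrow> \<psi>' \<in> hermite_span \<Longrightarrow> \<psi> - \<psi>' \<in> hermite_span"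
  unfolding minus_L2_def by (intro hermite_span_add hermite_span_scaleC)

text \<open>Bounded diagonal operators. The group, H^(-1/2) and the projection onto
  \<open>hermite_span\<close> are the instances in use.\<close>

definition multiplier :: "(nat \<Rightarrow> complex) \<Rightarrow> L2 \<Rightarrow> L2" where
  "multiplier d \<psi> = hseries (\<lambda>k. d k * hcoef \<psi> k)"

lemma hcoef_multiplier: 
  assumes "\<And>k. cmod (d k) \<le> K"
  shows "hcoef (multiplier d \<psi>) k = d k * hcoef \<psi> k"
  unfolding multiplier_def by (rule hcoef_hseries[OF sq_summable_mult[OF Bessel(1) assms]])

lemma multiplier_in_span: 
  assumes "\<And>k. cmod (d k) \<le> K"
  shows "multiplier d \<psi> \<in> hermite_span"
  unfolding multiplier_def by (rule hseries_in_span[OF sq_summable_mult[OF Bessel(1) assms]])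

lemma norm_multiplier_le:
  assumes "\<And>k. cmod (d k) \<le> K"
  shows "norm (multiplier d \<psi>) \<le> K * norm \<psi>"
  unfolding multiplier_def
proof (rule norm_hseries_le(2))
  have K: "0 \<le> K" using order_trans[OF norm_ge_zero assms] .
  then show "0 \<le> K * norm \<psi>" by simp
  fix n
  have "(\<Sum>k<n. (cmod (d k * hcoef \<psi> k))\<^sup>2) \<le> (\<Sum>k<n. K\<^sup>2 * (cmod (hcoef \<psi> k))\<^sup>2)"
    unfolding norm_mult power_mult_distrib by (intro sum_mono mult_right_mono power_mono assms) auto
  also have "\<dots> \<le> K\<^sup>2 * (norm \<psi>)\<^sup>2"
    unfolding sum_distrib_left[symmetric] by (intro mult_left_mono Bessel_finite) auto
  finally show "(\<Sum>k<n. (cmod (d k * hcoef \<psi> k))\<^sup>2) \<le> (K * norm \<psi>)\<^sup>2" by (simp add: power_mult_distrib)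
qed

lemma multiplier_bounded_linear:
  assumes d: "\<And>k. cmod (d k) \<le> K"
  shows "bounded_linear (multiplier d)"
proof (rule bounded_linear_intro[where K = K])
  note s = sq_summable_mult[OF Bessel(1) d]
  show "multiplier d (\<psi> + \<psi>') = multiplier d \<psi> + multiplier d \<psi>'" for \<psi> \<psi>'
    unfolding multiplier_def by (simp add: cinner_add_left distrib_left hseries_add s)
  show "multiplier d (r *\<^sub>R \<psi>) = r *\<^sub>R multiplier d \<psi>" for r \<psi>
    unfolding multiplier_def scaleR_L2_eq
    by (simp add: cinner_scaleC_left hseries_scaleC[OF s, symmetric] mult_ac)
  show "norm (multiplier d \<psi>) \<le> norm \<psi> * K" for \<psi>
    using norm_multiplier_le[of d K \<psi>] d by (simp add: mult.commute)
qed

text \<open>Convergence of each single coefficient together with a common bound suffices. For a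
  fixed vector the head of the series converges termwise and its tail is small uniformly; a moving
  vector is then compared with its limit through the common bound.\<close>

lemma multiplier_continuous:
  assumes d: "\<And>t k. cmod (d t k) \<le> K" and lim: "\<And>k. ((\<lambda>t. d t k) \<longlongrightarrow> d0 k) F"
    and d0: "\<And>k. cmod (d0 k) \<le> K"
    and \<psi>: "(\<psi> \<longlongrightarrow> \<psi>0) F"
  shows "((\<lambda>t. multiplier (d t) (\<psi> t)) \<longlongrightarrow> multiplier d0 \<psi>0) F"
proof -
  have K: "0 \<le> K" using order_trans[OF norm_ge_zero d0] .
  have fixed: "((\<lambda>t. multiplier (d t) \<psi>0) \<longlongrightarrow> multiplier d0 \<psi>0) F"
  proof (rule tendstoI)
    fix e :: real assume e: "e > 0"
    define a where "a k = (cmod (hcoef \<psi>0 k))\<^sup>2" for k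
    have a: "summable a" unfolding a_def by (rule Bessel(1))
    \<comment> \<open>The square of 2 K bounds the squared differences of coefficients; the summand
      1 permits division also for K = 0.\<close>
    define K' where "K' = 4 * K\<^sup>2 + 1"
    have K': "K' > 0" by (simp add: K'_def add_nonneg_pos)
    obtain N where N: "norm (suminf (\<lambda>i. a (i + N))) < e\<^sup>2 / (2 * K')"
      using suminf_exist_split[OF _ a, of "e\<^sup>2 / (2 * K')"] e K' by auto
    have "((\<lambda>t. \<Sum>k<N. (cmod (d t k - d0 k))\<^sup>2 * a k) \<longlongrightarrow> (\<Sum>k<N. (cmod (d0 k - d0 k))\<^sup>2 * a k)) F"
      by (intro tendsto_intros lim)
    then have "((\<lambda>t. \<Sum>k<N. (cmod (d t k - d0 k))\<^sup>2 * a k) \<longlongrightarrow> 0) F" by simp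
    then have "\<forall>\<^sub>F t in F. (\<Sum>k<N. (cmod (d t k - d0 k))\<^sup>2 * a k) < e\<^sup>2 / 2"
      by (rule order_tendstoD) (use e in simp)
    then show "\<forall>\<^sub>F t in F. dist (multiplier (d t) \<psi>0) (multiplier d0 \<psi>0) < e"
    proof eventually_elim
      case (elim t)
      have s: "sq_summable (\<lambda>k. d t k * hcoef \<psi>0 k - d0 k * hcoef \<psi>0 k)"
        unfolding left_diff_distrib[symmetric]
        by (rule sq_summable_mult[OF Bessel(1), where K = "2 * K"])
          (rule order_trans[OF norm_triangle_ineq4], use d d0 in \<open>smt (verit)\<close>)
      have "(norm (multiplier (d t) \<psi>0 - multiplier d0 \<psi>0))\<^sup>2 = (\<Sum>k. (cmod (d t k - d0 k))\<^sup>2 * a k)"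
        unfolding multiplier_def
        by (simp add: hseries_diff[symmetric] sq_summable_mult[OF Bessel(1) d] sq_summable_mult[OF Bessel(1) d0] norm_hseries[OF s])
          (simp add: a_def norm_mult power_mult_distrib flip: left_diff_distrib)
      also have "\<dots> = (\<Sum>k. (cmod (d t (k + N) - d0 (k + N)))\<^sup>2 * a (k + N)) + (\<Sum>k<N. (cmod (d t k - d0 k))\<^sup>2 * a k)"
        using s by (intro suminf_split_initial_segment)
          (simp add: a_def norm_mult power_mult_distrib flip: left_diff_distrib)
      also have "(\<Sum>k. (cmod (d t (k + N) - d0 (k + N)))\<^sup>2 * a (k + N)) \<le> (\<Sum>k. K' * a (k + N))"
      proof (rule suminf_le)
        show "(cmod (d t (k + N) - d0 (k + N)))\<^sup>2 * a (k + N) \<le> K' * a (k + N)" for k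
        proof (rule mult_right_mono)
          have "cmod (d t (k + N) - d0 (k + N)) \<le> 2 * K"
            using norm_triangle_ineq4[of "d t (k+N)" "d0 (k+N)"] d[of t "k+N"] d0[of "k+N"] by linarith
          then have "(cmod (d t (k + N) - d0 (k + N)))\<^sup>2 \<le> (2 * K)\<^sup>2" by (intro power_mono) auto
          then show "(cmod (d t (k + N) - d0 (k + N)))\<^sup>2 \<le> K'" by (simp add: K'_def power_mult_distrib)
        qed (simp add: a_def)
        show "summable (\<lambda>k. (cmod (d t (k + N) - d0 (k + N)))\<^sup>2 * a (k + N))"
          using s unfolding a_def left_diff_distrib[symmetric] norm_mult power_mult_distrib
          by (rule summable_ignore_initial_segment)
        show "summable (\<lambda>k. K' * a (k + N))"
          by (intro summable_mult summable_ignore_initial_segment a)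
      qed
      also have "(\<Sum>k. K' * a (k + N)) = K' * suminf (\<lambda>k. a (k + N))"
        by (intro suminf_mult summable_ignore_initial_segment a)
      also have "\<dots> < e\<^sup>2 / 2"
        using order_le_less_trans[OF abs_ge_self N[unfolded real_norm_def]] K' by (simp add: field_simps)
      finally have "(norm (multiplier (d t) \<psi>0 - multiplier d0 \<psi>0))\<^sup>2 < e\<^sup>2" using elim by simp
      then show ?case unfolding dist_norm by (rule power2_less_imp_less) (use e in simp)
    qed
  qed
  have diff: "((\<lambda>t. multiplier (d t) (\<psi> t - \<psi>0)) \<longlongrightarrow> 0) F"
  proof (rule Lim_null_comparison)
    show "\<forall>\<^sub>F t in F. norm (multiplier (d t) (\<psi> t - \<psi>0)) \<le> K * norm (\<psi> t - \<psi>0)"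
      by (intro always_eventually allI norm_multiplier_le d)
    show "((\<lambda>t. K * norm (\<psi> t - \<psi>0)) \<longlongrightarrow> 0) F"
      by (intro tendsto_mult_right_zero tendsto_norm_zero) (use \<psi> in \<open>simp add: LIM_zero\<close>)
  qed
  have "multiplier (d t) (\<psi> t) = multiplier (d t) (\<psi> t - \<psi>0) + multiplier (d t) \<psi>0" for t
    using linear_add[OF bounded_linear.linear[OF multiplier_bounded_linear[of "d t", OF d]], of "\<psi> t - \<psi>0" \<psi>0] by simp
  then show ?thesis using tendsto_add[OF diff fixed] by simp
qed

definition phase :: "real \<Rightarrow> nat \<Rightarrow> complex" where
  "phase t k = exp (- \<i> * of_real ((2 * real k + 1) * t))"

lemma norm_phase [simp]: "cmod (phase t k) = 1"
  by (simp add: phase_def)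

lemma phase_add: "phase (s + t) k = phase s k * phase t k"
  by (simp add: phase_def algebra_simps flip: exp_add)

lemma exp_iH_eq: "exp_iH t = multiplier (phase t)"
  by (simp add: fun_eq_iff exp_iH_def multiplier_def hseries_def phase_def)

lemma hcoef_exp_iH [simp]: "hcoef (exp_iH t \<psi>) k = phase t k * hcoef \<psi> k"
  unfolding exp_iH_eq by (rule hcoef_multiplier[where K = 1]) simp

lemma exp_iH_in_span [simp]: "exp_iH t \<psi> \<in> hermite_span"
  unfolding exp_iH_eq by (rule multiplier_in_span[where K = 1]) simp

lemma norm_exp_iH_le: "norm (exp_iH t \<psi>) \<le> norm \<psi>"
  using norm_multiplier_le[of "phase t" 1 \<psi>] by (simp add: exp_iH_eq)

lemma bounded_linear_exp_iH: "bounded_linear (exp_iH t)"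
  unfolding exp_iH_eq by (rule multiplier_bounded_linear[where K = 1]) simp

lemma exp_iH_tendsto:
  assumes "(t \<longlongrightarrow> t0) F" "(\<psi> \<longlongrightarrow> \<psi>0) F"
  shows "((\<lambda>x. exp_iH (t x) (\<psi> x)) \<longlongrightarrow> exp_iH t0 \<psi>0) F"
  unfolding exp_iH_eq
proof (rule multiplier_continuous[where K = 1])
  show "((\<lambda>x. phase (t x) k) \<longlongrightarrow> phase t0 k) F" for k
    unfolding phase_def by (intro tendsto_intros assms)
qed (use assms in auto)

definition H_half_inv :: "L2 \<Rightarrow> L2" where
  "H_half_inv = multiplier (\<lambda>k. of_real (1 / sqrt (2 * real k + 1)))"

lemma H_half_inv_bound: "cmod (complex_of_real (1 / sqrt (2 * real k + 1))) \<le> 1"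
  by (simp add: norm_divide)

lemma hcoef_H_half_inv [simp]: "hcoef (H_half_inv \<xi>) k = of_real (1 / sqrt (2 * real k + 1)) * hcoef \<xi> k"
  unfolding H_half_inv_def by (rule hcoef_multiplier[OF H_half_inv_bound])

lemma H_half_inv_in_span [simp]: "H_half_inv \<xi> \<in> hermite_span"
  unfolding H_half_inv_def by (rule multiplier_in_span[OF H_half_inv_bound])

lemma bounded_linear_H_half_inv: "bounded_linear H_half_inv"
  unfolding H_half_inv_def by (rule multiplier_bounded_linear[OF H_half_inv_bound])

text \<open>Unbounded, hence not an instance of \<open>multiplier\<close>; the series is meaningful
  under \<open>H1_summable\<close>. On that domain inside \<open>hermite_span\<close> it inverts
  \<open>H_half_inv\<close> and carries the norm of \<open>H1h\<close> to that of
  \<open>L2\<close>.\<close>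

definition H_half :: "L2 \<Rightarrow> L2" where
  "H_half \<psi> = hseries (\<lambda>k. of_real (sqrt (2 * real k + 1)) * hcoef \<psi> k)"

abbreviation H1_summable :: "L2 \<Rightarrow> bool" where
  "H1_summable \<psi> \<equiv> summable (\<lambda>k. (2 * real k + 1) * (cmod (hcoef \<psi> k))\<^sup>2)"

lemma H1_summable_iff: "H1_summable \<psi> \<longleftrightarrow> sq_summable (\<lambda>k. of_real (sqrt (2 * real k + 1)) * hcoef \<psi> k)"
  by (simp add: norm_mult power_mult_distrib)

lemma hcoef_H_half: "H1_summable \<psi> \<Longrightarrow> hcoef (H_half \<psi>) k = of_real (sqrt (2 * real k + 1)) * hcoef \<psi> k"
  unfolding H_half_def H1_summable_iff by (rule hcoef_hseries)

lemma H_half_in_span: "H1_summable \<psi> \<Longrightarrow> H_half \<psi> \<in> hermite_span"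
  unfolding H_half_def H1_summable_iff by (rule hseries_in_span)

lemma norm_H_half: "H1_summable \<psi> \<Longrightarrow> norm (H_half \<psi>) = H1h_norm \<psi>"
proof -
  assume s: "H1_summable \<psi>"
  have "(norm (H_half \<psi>))\<^sup>2 = (\<Sum>k. (2 * real k + 1) * (cmod (hcoef \<psi> k))\<^sup>2)"
    using norm_hseries[of "\<lambda>k. of_real (sqrt (2 * real k + 1)) * hcoef \<psi> k"] s
    unfolding H1_summable_iff H_half_def by (simp add: norm_mult power_mult_distrib)
  then show ?thesis unfolding H1h_norm_def by (metis norm_ge_zero real_sqrt_unique)
qed

lemma H1_summable_H_half_inv: "H1_summable (H_half_inv \<xi>)"
  unfolding H1_summable_iff using Bessel(1)[of \<xi>] 
  by (simp add: norm_mult norm_divide)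

lemma H_half_H_half_inv: "\<xi> \<in> hermite_span \<Longrightarrow> H_half (H_half_inv \<xi>) = \<xi>"
  by (rule hermite_span_eqI)
    (auto simp: H_half_in_span[OF H1_summable_H_half_inv] hcoef_H_half[OF H1_summable_H_half_inv]
      simp flip: of_real_mult)

lemma H_half_inv_H_half: "\<psi> \<in> hermite_span \<Longrightarrow> H1_summable \<psi> \<Longrightarrow> H_half_inv (H_half \<psi>) = \<psi>"
  by (rule hermite_span_eqI) (auto simp: hcoef_H_half simp flip: of_real_mult)

lemma H1_summable_diff:
  assumes "H1_summable \<psi>" "H1_summable \<psi>'" 
  shows "H1_summable (\<psi> - \<psi>')" "H_half (\<psi> - \<psi>') = H_half \<psi> - H_half \<psi>'"
proof -
  have "sq_summable (\<lambda>k. - 1 * (of_real (sqrt (2 * real k + 1)) * hcoef \<psi>' k))"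
    by (rule sq_summable_mult[where K = 1]) (use assms(2)[unfolded H1_summable_iff] in auto)
  from sq_summable_add[OF assms(1)[unfolded H1_summable_iff] this] hseries_diff[OF assms[unfolded H1_summable_iff]]
  show "H1_summable (\<psi> - \<psi>')" "H_half (\<psi> - \<psi>') = H_half \<psi> - H_half \<psi>'"
    unfolding H1_summable_iff H_half_def by (simp_all add: cinner_diff_left right_diff_distrib)
qed

section \<open>The space \<open>H1h\<close>\<close>

lemma square_integrable_locally:
  assumes "square_integrable f"
  shows "set_integrable lborel {p..q} f"
  unfolding set_integrable_def
proof (rule Bochner_Integration.integrable_bound)
  have [measurable]: "f \<in> borel_measurable borel" using square_integrableD(1)[OF assms] by simp
  show "integrable lborel (\<lambda>x. indicator {p..q} x *\<^sub>R (1::real) + (cmod (f x))\<^sup>2)"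
    using square_integrableD(2)[OF assms] set_integrable_const[of p q "1::real"]
    by (intro Bochner_Integration.integrable_add) (simp_all add: set_integrable_def)
  show "AE x in lborel. norm (indicator {p..q} x *\<^sub>R f x) \<le> norm (indicator {p..q} x *\<^sub>R (1::real) + (cmod (f x))\<^sup>2)"
  proof (rule AE_I2)
    fix x
    have "2 * cmod (f x) * 1 \<le> (cmod (f x))\<^sup>2 + 1\<^sup>2" by (rule sum_squares_bound)
    then have "cmod (f x) \<le> 1 + (cmod (f x))\<^sup>2" using norm_ge_zero[of "f x"] by (simp only: power_one)
    then show "norm (indicator {p..q} x *\<^sub>R f x) \<le> norm (indicator {p..q} x *\<^sub>R (1::real) + (cmod (f x))\<^sup>2)"
      by (auto simp: indicator_def)
  qed
  show "(\<lambda>x. indicator {p..q} x *\<^sub>R f x) \<in> borel_measurable lborel" by measurable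
qed

lemma square_integrable_mult_locally:
  assumes "square_integrable f" "continuous_on UNIV g"
  shows "set_integrable lborel {p..q} (\<lambda>x. of_real (g x) * f x)"
proof -
  have [measurable]: "g \<in> borel_measurable borel" by (rule borel_measurable_continuous_onI[OF assms(2)])
  have [measurable]: "f \<in> borel_measurable borel" using square_integrableD(1)[OF assms(1)] by simp
  have "bounded (g ` {p..q})"
    by (intro compact_imp_bounded compact_continuous_image continuous_on_subset[OF assms(2)]) auto
  then obtain K where K: "\<And>x. x \<in> {p..q} \<Longrightarrow> \<bar>g x\<bar> \<le> K"
    unfolding bounded_iff real_norm_def by blast
  show ?thesis
    unfolding set_integrable_def
  proof (rule Bochner_Integration.integrable_bound)
    show "integrable lborel (\<lambda>x. K * norm (indicator {p..q} x *\<^sub>R f x))"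
      using square_integrable_locally[OF assms(1)] unfolding set_integrable_def
      by (intro integrable_mult_right integrable_norm)
    show "AE x in lborel. norm (indicator {p..q} x *\<^sub>R (of_real (g x) * f x)) \<le> norm (K * norm (indicator {p..q} x *\<^sub>R f x))"
      by (intro AE_I2) (auto simp: indicator_def norm_mult abs_mult
            intro!: mult_right_mono order_trans[OF K abs_ge_self])
  qed measurable
qed

lemma integrable_mult_square:
  assumes "square_integrable f" "square_integrable (\<lambda>x. complex_of_real (g x))"
  shows "integrable lborel (\<lambda>x. f x * of_real (g x))"
  using integrable_mult_cnj[OF assms] by simp

text \<open>On the compact support, multiplication by e^(x^2/4) keeps a continuous function
  bounded.\<close>

lemma test_function_gauss_C1:
  assumes "test_function I \<theta>"
  shows "gauss_C1 \<theta> (deriv \<theta>)"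
proof -
  have d: "(\<theta> has_real_derivative deriv \<theta> x) (at x)" "(deriv \<theta> has_real_derivative deriv (deriv \<theta>) x) (at x)" for x
  proof -
    have "(deriv ^^ 0) \<theta> field_differentiable at x" "(deriv ^^ 1) \<theta> field_differentiable at x"
      using assms unfolding test_function_def by blast+
    then show "(\<theta> has_real_derivative deriv \<theta> x) (at x)" "(deriv \<theta> has_real_derivative deriv (deriv \<theta>) x) (at x)"
      by (simp_all add: DERIV_deriv_iff_field_differentiable)
  qed
  have cont: "continuous_on UNIV \<theta>" "continuous_on UNIV (deriv \<theta>)"
    using d by (meson DERIV_isCont continuous_at_imp_continuous_on)+
  define S where "S = closure {x. \<theta> x \<noteq> 0}"
  have S: "compact S" using assms by (simp add: test_function_def S_def)
  have "open (- S)" by (simp add: S_def open_Compl)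
  have z: "\<theta> x = 0" if "x \<notin> S" for x
    using that closure_subset[of "{x. \<theta> x \<noteq> 0}"] unfolding S_def by auto
  have dz: "deriv \<theta> x = 0" if "x \<notin> S" for x
  proof -
    have "(\<theta> has_real_derivative 0) (at x)"
      by (rule has_field_derivative_transform_within_open[of "\<lambda>x. 0" 0 x "- S"])
        (use that z \<open>open (- S)\<close> in auto)
    then show ?thesis by (rule DERIV_imp_deriv)
  qed
  have bd: "\<exists>C. \<forall>x. \<bar>h x\<bar> \<le> C * exp (- (1/4) * x\<^sup>2)" if h: "continuous_on UNIV h" "\<And>x. x \<notin> S \<Longrightarrow> h x = 0" for h :: "real \<Rightarrow> real"
  proof -
    have "bounded ((\<lambda>x. h x * exp (1/4 * x\<^sup>2)) ` S)"
      by (intro compact_imp_bounded compact_continuous_image continuous_intros continuous_on_subset[OF h(1)] S) auto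
    then obtain C where C: "\<And>x. x \<in> S \<Longrightarrow> \<bar>h x * exp (1/4 * x\<^sup>2)\<bar> \<le> C"
      unfolding bounded_iff real_norm_def by blast
    have "\<bar>h x\<bar> \<le> \<bar>C\<bar> * exp (- (1/4) * x\<^sup>2)" for x
    proof (cases "x \<in> S")
      case True
      have "\<bar>h x\<bar> = \<bar>h x * exp (1/4 * x\<^sup>2)\<bar> * exp (- (1/4) * x\<^sup>2)"
        by (simp add: abs_mult mult.assoc flip: exp_add)
      also have "\<dots> \<le> \<bar>C\<bar> * exp (- (1/4) * x\<^sup>2)"
        by (intro mult_right_mono order_trans[OF C[OF True] abs_ge_self]) auto
      finally show ?thesis .
    qed (simp add: h(2))
    then show ?thesis by blast
  qed
  obtain C where C: "\<And>x. \<bar>\<theta> x\<bar> \<le> C * exp (- (1/4) * x\<^sup>2)" using bd[OF cont(1) z] by blast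
  obtain D where D: "\<And>x. \<bar>deriv \<theta> x\<bar> \<le> D * exp (- (1/4) * x\<^sup>2)" using bd[OF cont(2) dz] by blast
  have "\<bar>\<theta> x\<bar> \<le> max C D * exp (- (1/4) * x\<^sup>2)" "\<bar>deriv \<theta> x\<bar> \<le> max C D * exp (- (1/4) * x\<^sup>2)" for x
    by (rule order_trans[OF C], simp add: mult_right_mono, rule order_trans[OF D], simp add: mult_right_mono)
  then show ?thesis using d cont unfolding gauss_C1_def by blast
qed

text \<open>The assumption is what 2 |x| |v| <= x^2 + |v|^2 yields for w = x v - g with square
  integrable \<open>v\<close> and \<open>g\<close>. Integration gives a cubic bound on
  \<open>W\<close>, which fits under the growth allowed in
  \<open>integral_by_parts_gauss\<close>.\<close>

lemma primitive_growth:
  fixes W :: "real \<Rightarrow> complex"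
  assumes W: "primitive W w" and h: "integrable lborel h"
    and le: "\<And>x. cmod (w x) \<le> 1 + x\<^sup>2 + h x" and h0: "\<And>x. h x \<ge> 0"
  shows "\<exists>K. \<forall>x. cmod (W x) \<le> K * exp (x\<^sup>2 / 8)"
proof -
  define H where "H = (\<integral>x. h x \<partial>lborel)"
  have *: "cmod (W q - W p) \<le> 2 * r * (1 + r\<^sup>2) + H" if "p \<le> q" "-r \<le> p" "q \<le> r" "r \<ge> 0" for p q r
  proof -
    have c: "set_integrable lborel {p..q} (\<lambda>x. 1 + r\<^sup>2)" by (rule set_integrable_const)
    have hs: "set_integrable lborel {p..q} h"
      unfolding set_integrable_def by (rule integrable_mult_indicator[OF _ h]) simp
    have "cmod (W q - W p) = cmod (LINT x:{p..q}|lborel. w x)" by (simp add: primitive_diff_eq[OF W that(1)])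
    also have "\<dots> \<le> (LINT x:{p..q}|lborel. cmod (w x))" 
      by (rule set_integral_norm_bound[OF primitive_set_integrable[OF W]])
    also have "\<dots> \<le> (LINT x:{p..q}|lborel. (1 + r\<^sup>2) + h x)"
    proof (rule set_integral_mono)
      show "set_integrable lborel {p..q} (\<lambda>x. cmod (w x))" by (rule set_integrable_norm[OF primitive_set_integrable[OF W]])
      show "set_integrable lborel {p..q} (\<lambda>x. 1 + r\<^sup>2 + h x)" by (rule set_integral_add(1)[OF c hs])
      fix x assume "x \<in> {p..q}"
      then have "\<bar>x\<bar> \<le> \<bar>r\<bar>" using that by auto
      then have "x\<^sup>2 \<le> r\<^sup>2" by (simp add: abs_le_square_iff)
      then show "cmod (w x) \<le> 1 + r\<^sup>2 + h x" using le[of x] by simp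
    qed
    also have "\<dots> = (LINT x:{p..q}|lborel. 1 + r\<^sup>2) + (LINT x:{p..q}|lborel. h x)"
      by (rule set_integral_add(2)[OF c hs])
    also have "\<dots> = (q - p) * (1 + r\<^sup>2) + (LINT x:{p..q}|lborel. h x)"
      using that by (subst set_lebesgue_integral_def) simp
    also have "\<dots> \<le> 2 * r * (1 + r\<^sup>2) + H"
    proof (rule add_mono)
      show "(q - p) * (1 + r\<^sup>2) \<le> 2 * r * (1 + r\<^sup>2)" using that by (intro mult_right_mono) auto
      show "(LINT x:{p..q}|lborel. h x) \<le> H"
        unfolding H_def set_lebesgue_integral_def
        using hs h h0 by (intro integral_mono) (auto simp: set_integrable_def indicator_def)
    qed
    finally show ?thesis .
  qed
  have b: "cmod (W x) \<le> cmod (W 0) + 2 * \<bar>x\<bar> * (1 + x\<^sup>2) + H" for x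
  proof (cases "x \<ge> 0")
    case True
    then show ?thesis using *[of 0 x x] norm_triangle_ineq2[of "W x" "W 0"] by simp
  next
    case False
    then show ?thesis using *[of x 0 "-x"] norm_triangle_ineq2[of "W x" "W 0"] by (simp add: norm_minus_commute)
  qed
  \<comment> \<open>The polynomial 2 x + 2 x^3, whose absolute value is the cubic part of the bound
    \<open>b\<close>.\<close>
  obtain C where C: "\<And>x::real. \<bar>poly [:0, 2, 0, 2:] x\<bar> \<le> C * exp (1/8 * x\<^sup>2)"
    using poly_le_gauss[of "1/8" "[:0, 2, 0, 2:]"] by (simp del: poly_pCons) blast
  have H0: "H \<ge> 0" unfolding H_def by (intro Bochner_Integration.integral_nonneg h0)
  have "cmod (W x) \<le> (cmod (W 0) + C + H) * exp (x\<^sup>2 / 8)" for x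
  proof -
    have "\<bar>poly [:0, 2, 0, 2:] x\<bar> = \<bar>2 * x * (1 + x * x)\<bar>" by (simp add: algebra_simps)
    also have "\<dots> = 2 * \<bar>x\<bar> * (1 + x\<^sup>2)" by (simp add: abs_mult power2_eq_square)
    finally have "2 * \<bar>x\<bar> * (1 + x\<^sup>2) \<le> C * exp (x\<^sup>2 / 8)" using C[of x] by simp
    moreover have "(cmod (W 0) + H) * 1 \<le> (cmod (W 0) + H) * exp (x\<^sup>2 / 8)"
      using H0 by (intro mult_left_mono) auto
    ultimately show ?thesis using b[of x] by (simp add: algebra_simps)
  qed
  then show ?thesis by blast
qed

lemma square_integrable_x_hermite: "square_integrable (\<lambda>x. complex_of_real (x * hermite_fun k x))"
proof -
  have "square_integrable (\<lambda>x. of_real (sqrt (2 * real k + 2) / 2) * complex_of_real (hermite_fun (Suc k) x)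
      + of_real (sqrt (2 * real k) / 2) * complex_of_real (hermite_fun (k - 1) x))"
    by (intro square_integrable_add square_integrable_mult_left square_integrable_hermite)
  moreover have "of_real (sqrt (2 * real k + 2) / 2) * complex_of_real (hermite_fun (Suc k) x)
      + of_real (sqrt (2 * real k) / 2) * complex_of_real (hermite_fun (k - 1) x) = complex_of_real (x * hermite_fun k x)" for x
  proof -
    have "sqrt (2 * real k + 2) / 2 * hermite_fun (Suc k) x + sqrt (2 * real k) / 2 * hermite_fun (k - 1) x = x * hermite_fun k x"
      using x_hermite_fun[of x k] by linarith
    then show ?thesis by (metis of_real_add of_real_mult)
  qed
  ultimately show ?thesis by simp
qed

text \<open>The Hermite functions do not have compact support and cannot be tested directly. The
  weak equation says that the derivative of \<psi> is x \<psi> - g, so \<psi> agrees almost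
  everywhere with an actual primitive, which may be integrated by parts against Gaussian
  decay.\<close>

lemma H1h_imp_H1_summable:
  assumes "\<psi> \<in> H1h"
  shows "H1_summable \<psi>"
proof -
  define v where "v = fun_L2 \<psi>"
  have v: "square_integrable v" by (simp add: v_def)
  obtain G where G: "\<And>\<theta>. test_function UNIV \<theta> \<Longrightarrow>
     (\<integral>x. v x * of_real (deriv \<theta> x + x * \<theta> x) \<partial>lborel) = (\<integral>x. fun_L2 G x * of_real (\<theta> x) \<partial>lborel)"
    using assms by (auto simp: H1h_def v_def)
  define g where "g = fun_L2 G"
  have g: "square_integrable g" by (simp add: g_def)
  define w where "w x = of_real x * v x - g x" for x
  have wl: "set_integrable lborel {p..q} w" for p q
    unfolding w_def by (intro set_integral_diff(1) square_integrable_mult_locally square_integrable_locally v g continuous_intros)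
  obtain W where W: "primitive W w" using primitive_exists wl by blast
  have "\<exists>c. AE x in lborel. x \<in> UNIV \<longrightarrow> v x = W x + c"
  proof (rule weak_derivative_primitive[OF _ _ W])
    show "set_integrable lborel {p..q} v" for p q by (rule square_integrable_locally[OF v])
    fix \<theta> assume \<theta>: "test_function UNIV \<theta>"
    have gc: "gauss_C1 \<theta> (deriv \<theta>)" by (rule test_function_gauss_C1[OF \<theta>])
    have i1: "integrable lborel (\<lambda>x. v x * of_real (deriv \<theta> x))"
      by (rule integrable_mult_square[OF v gauss_C1_square_integrable(2)[OF gc]])
    have i2: "integrable lborel (\<lambda>x. w x * of_real (\<theta> x))"
      using test_function_primitive_zero(2)[OF W \<theta>] by (simp add: set_integrable_def)
    have i3: "integrable lborel (\<lambda>x. g x * of_real (\<theta> x))"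
      by (rule integrable_mult_square[OF g gauss_C1_square_integrable(1)[OF gc]])
    have "v x * of_real (deriv \<theta> x + x * \<theta> x) = v x * of_real (deriv \<theta> x) + w x * of_real (\<theta> x) + g x * of_real (\<theta> x)" for x
      by (simp add: w_def algebra_simps)
    then have "(\<integral>x. v x * of_real (deriv \<theta> x) \<partial>lborel) + (\<integral>x. w x * of_real (\<theta> x) \<partial>lborel) = 0"
      using G[OF \<theta>] i1 i2 i3 by (simp add: g_def[symmetric])
    then show "set_integrable lborel UNIV (\<lambda>x. v x * of_real (deriv \<theta> x)) \<and>
        (LINT x:UNIV|lborel. v x * of_real (deriv \<theta> x)) = - (LINT x:UNIV|lborel. w x * of_real (\<theta> x))"
      using i1 by (simp add: set_integrable_def set_lebesgue_integral_def add_eq_0_iff)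
  qed (auto simp: is_interval_univ)
  then obtain c where c: "AE x in lborel. v x = W x + c" by auto
  have W': "primitive (\<lambda>x. W x + c) w"
    using primitive_add[OF W primitive_const[of c]] by simp
  obtain K where K: "\<And>x. cmod (W x + c) \<le> K * exp (x\<^sup>2 / 8)"
  proof -
    have "\<exists>K. \<forall>x. cmod (W x + c) \<le> K * exp (x\<^sup>2 / 8)"
    proof (rule primitive_growth[OF W', of "\<lambda>x. (cmod (v x))\<^sup>2 + (cmod (g x))\<^sup>2"])
      show "integrable lborel (\<lambda>x. (cmod (v x))\<^sup>2 + (cmod (g x))\<^sup>2)"
        using v g by (auto dest: square_integrableD)
      fix x
      have "2 * \<bar>x\<bar> * cmod (v x) \<le> \<bar>x\<bar>\<^sup>2 + (cmod (v x))\<^sup>2" "2 * 1 * cmod (g x) \<le> 1\<^sup>2 + (cmod (g x))\<^sup>2"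
        by (rule sum_squares_bound)+
      moreover have "cmod (w x) \<le> \<bar>x\<bar> * cmod (v x) + cmod (g x)"
        unfolding w_def using norm_triangle_ineq4[of "of_real x * v x" "g x"] by (simp add: norm_mult)
      moreover have "0 \<le> \<bar>x\<bar> * cmod (v x)" "0 \<le> cmod (g x)" by simp_all
      ultimately show "cmod (w x) \<le> 1 + x\<^sup>2 + ((cmod (v x))\<^sup>2 + (cmod (g x))\<^sup>2)"
        unfolding power_one power2_abs mult_1_right by linarith
    qed auto
    then show ?thesis using that by blast
  qed
  \<comment> \<open>Testing with index k + 1 and lowering it back to \<open>k\<close> expresses the
    weighted coefficients of \<psi> as coefficients of the square integrable \<open>G\<close>;
    Bessel's inequality then concludes.\<close>
  have coef: "of_real (sqrt (2 * real k + 2)) * hcoef \<psi> k = hcoef G (Suc k)" for k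
  proof -
    define m where "m = Suc k"
    have i2: "integrable lborel (\<lambda>x. v x * of_real (x * hermite_fun m x))"
      by (rule integrable_mult_square[OF v square_integrable_x_hermite])
    have i3: "integrable lborel (\<lambda>x. g x * of_real (hermite_fun m x))"
      by (rule integrable_mult_square[OF g square_integrable_hermite])
    have we: "w x * of_real (hermite_fun m x) = v x * of_real (x * hermite_fun m x) - g x * of_real (hermite_fun m x)" for x
      by (simp add: w_def algebra_simps)
    have i: "integrable lborel (\<lambda>x. w x * of_real (hermite_fun m x))" using i2 i3 by (simp add: we)
    have i1: "integrable lborel (\<lambda>x. v x * of_real (hermite_deriv m x))"
      by (rule integrable_mult_square[OF v gauss_C1_square_integrable(2)[OF gauss_C1_hermite]])
    have "(\<integral>x. v x * of_real (hermite_deriv m x) \<partial>lborel) = (\<integral>x. (W x + c) * of_real (hermite_deriv m x) \<partial>lborel)"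
    proof (rule Bochner_Integration.integral_cong_AE)
      show "(\<lambda>x. (W x + c) * of_real (hermite_deriv m x)) \<in> borel_measurable lborel"
        using primitive_measurable[OF W] by measurable
      show "AE x in lborel. v x * of_real (hermite_deriv m x) = (W x + c) * of_real (hermite_deriv m x)"
        using c by eventually_elim simp
    qed (use i1 in auto)
    also have "\<dots> = - (\<integral>x. w x * of_real (hermite_fun m x) \<partial>lborel)"
      by (rule integral_by_parts_gauss(2)[OF W' gauss_C1_hermite K i])
    finally have "(\<integral>x. v x * of_real (hermite_deriv m x) + v x * of_real (x * hermite_fun m x) \<partial>lborel) = (\<integral>x. g x * of_real (hermite_fun m x) \<partial>lborel)"
      using i1 i2 i3 by (simp add: we)
    moreover have "v x * of_real (hermite_deriv m x) + v x * of_real (x * hermite_fun m x)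
        = of_real (sqrt (2 * real k + 2)) * (v x * of_real (hermite_fun k x))" for x
    proof -
      have "hermite_deriv m x + x * hermite_fun m x = sqrt (2 * real k + 2) * hermite_fun k x"
        unfolding hermite_deriv_eq m_def by (simp add: algebra_simps)
      then have "v x * of_real (hermite_deriv m x + x * hermite_fun m x) = v x * of_real (sqrt (2 * real k + 2) * hermite_fun k x)" by simp
      then show ?thesis by (simp add: algebra_simps)
    qed
    ultimately show ?thesis by (simp add: hcoef_eq v_def g_def m_def)
  qed
  show ?thesis
  proof (rule summable_comparison_test')
    show "summable (\<lambda>k. (cmod (hcoef G (Suc k)))\<^sup>2)" 
      using Bessel(1)[of G] summable_Suc_iff[of "\<lambda>k. (cmod (hcoef G k))\<^sup>2"] by blast
    show "norm ((2 * real k + 1) * (cmod (hcoef \<psi> k))\<^sup>2) \<le> (cmod (hcoef G (Suc k)))\<^sup>2" if "k \<ge> 0" for k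
      unfolding coef[symmetric] by (simp add: norm_mult power_mult_distrib mult_right_mono)
  qed
qed

lemma cinner_hseries:
  assumes "sq_summable c"
  shows "(\<lambda>k. c k * cinner_L2 (hermite_L2 k) g) sums cinner_L2 (hseries c) g"
  using bounded_linear.sums[OF bounded_linear_cinner_left summable_sums[OF summable_hseries[OF assms]], of g]
  by (simp add: cinner_scaleC_left hseries_def)

text \<open>The function (-d/dx + x) \<psi> is given by its Hermite series, read off from the
  raising relation; the weak identity is checked on each Hermite function and summed.\<close>

lemma H1_summable_imp_H1h:
  assumes "\<psi> \<in> hermite_span" "H1_summable \<psi>"
  shows "\<psi> \<in> H1h"
proof -
  \<comment> \<open>Raising shifts the coefficients by one index. At k = 0 the truncated index is
    multiplied by sqrt 0, so the shifted series loses nothing there.\<close>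
  define c where "c k = of_real (sqrt (2 * real k)) * hcoef \<psi> (k - 1)" for k
  have c0: "c 0 = 0" by (simp add: c_def)
  have "summable (\<lambda>k. (cmod (c (Suc k)))\<^sup>2)"
  proof (rule summable_comparison_test')
    show "summable (\<lambda>k. 2 * ((2 * real k + 1) * (cmod (hcoef \<psi> k))\<^sup>2))" by (rule summable_mult[OF assms(2)])
    show "norm ((cmod (c (Suc k)))\<^sup>2) \<le> 2 * ((2 * real k + 1) * (cmod (hcoef \<psi> k))\<^sup>2)" if "k \<ge> 0" for k
      by (simp add: c_def norm_mult power_mult_distrib algebra_simps mult_right_mono)
  qed
  then have sc: "sq_summable c" using summable_Suc_iff[of "\<lambda>k. (cmod (c k))\<^sup>2"] by blast
  have "(\<integral>x. fun_L2 \<psi> x * of_real (deriv \<theta> x + x * \<theta> x) \<partial>lborel) = (\<integral>x. fun_L2 (hseries c) x * of_real (\<theta> x) \<partial>lborel)"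
    if \<theta>: "test_function UNIV \<theta>" for \<theta>
  proof -
    have gc: "gauss_C1 \<theta> (deriv \<theta>)" by (rule test_function_gauss_C1[OF \<theta>])
    have s\<theta>: "square_integrable (\<lambda>x. complex_of_real (\<theta> x))" "square_integrable (\<lambda>x. complex_of_real (deriv \<theta> x))"
      by (rule gauss_C1_square_integrable[OF gc])+
    obtain C where C: "\<And>x. \<bar>\<theta> x\<bar> \<le> C * exp (- (1/4) * x\<^sup>2)" using gc by (auto simp: gauss_C1_def)
    obtain B where B: "\<And>x. x \<in> closure {x. \<theta> x \<noteq> 0} \<Longrightarrow> \<bar>x\<bar> \<le> B"
    proof -
      have "bounded (closure {x. \<theta> x \<noteq> 0})"
        using \<theta> by (intro compact_imp_bounded) (simp add: test_function_def)
      then show ?thesis using that by (auto simp: bounded_iff)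
    qed
    have "\<bar>x * \<theta> x\<bar> \<le> \<bar>B\<bar> * \<bar>\<theta> x\<bar>" for x
    proof (cases "\<theta> x = 0")
      case False
      then have "\<bar>x\<bar> \<le> B" using B closure_subset[of "{x. \<theta> x \<noteq> 0}"] by blast
      then show ?thesis by (auto simp: abs_mult intro: mult_right_mono)
    qed simp
    then have xb: "\<bar>x * \<theta> x\<bar> \<le> (\<bar>B\<bar> * C) * exp (- (1/4) * x\<^sup>2)" for x
      using mult_left_mono[OF C[of x] abs_ge_zero[of B]] by (metis (no_types) mult.assoc order_trans)
    have sx: "square_integrable (\<lambda>x. complex_of_real (x * \<theta> x))"
      by (rule square_integrable_gauss_bound[OF _ xb]) (use gauss_C1_measurable[OF gc] in measurable)
    define t1 where "t1 = L2_of (\<lambda>x. complex_of_real (deriv \<theta> x + x * \<theta> x))"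
    define t2 where "t2 = L2_of (\<lambda>x. complex_of_real (\<theta> x))"
    have st1: "square_integrable (\<lambda>x. complex_of_real (deriv \<theta> x + x * \<theta> x))"
      using square_integrable_add[OF s\<theta>(2) sx] by simp
    have e: "cinner_L2 (hermite_L2 k) t1 = of_real (sqrt (2 * real k + 2)) * cinner_L2 (hermite_L2 (Suc k)) t2" for k
    proof -
      have gk: "primitive (\<lambda>x. complex_of_real (hermite_fun k x)) (\<lambda>x. complex_of_real (hermite_deriv k x))"
        by (intro primitive_of_real gauss_C1_primitive gauss_C1_hermite)
      note sd = gauss_C1_square_integrable(2)[OF gauss_C1_hermite[of k]]
      have p: "(\<integral>x. complex_of_real (hermite_fun k x) * of_real (deriv \<theta> x) \<partial>lborel)
         = - (\<integral>x. complex_of_real (hermite_deriv k x) * of_real (\<theta> x) \<partial>lborel)"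
        using test_function_primitive_zero(3)[OF gk \<theta>] by (simp add: set_lebesgue_integral_def)
      have i: "integrable lborel (\<lambda>x. complex_of_real (hermite_fun k x) * of_real (deriv \<theta> x))"
        "integrable lborel (\<lambda>x. complex_of_real (hermite_fun k x) * of_real (x * \<theta> x))"
        "integrable lborel (\<lambda>x. complex_of_real (hermite_deriv k x) * of_real (\<theta> x))"
        by (intro integrable_mult_square square_integrable_hermite s\<theta> sx sd)+
      have "cinner_L2 (hermite_L2 k) t1 = (\<integral>x. complex_of_real (hermite_fun k x) * of_real (deriv \<theta> x) + complex_of_real (hermite_fun k x) * of_real (x * \<theta> x) \<partial>lborel)"
        unfolding hermite_L2_def t1_def by (subst cinner_L2_of[OF square_integrable_hermite st1]) (simp add: distrib_left)
      also have "\<dots> = (\<integral>x. complex_of_real (hermite_fun k x) * of_real (x * \<theta> x) - complex_of_real (hermite_deriv k x) * of_real (\<theta> x) \<partial>lborel)"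
        using i p by simp
      also have "\<dots> = (\<integral>x. of_real (sqrt (2 * real k + 2)) * (complex_of_real (hermite_fun (Suc k) x) * of_real (\<theta> x)) \<partial>lborel)"
      proof (intro Bochner_Integration.integral_cong refl)
        fix x
        have "hermite_fun k x * (x * \<theta> x) - hermite_deriv k x * \<theta> x = sqrt (2 * real k + 2) * (hermite_fun (Suc k) x * \<theta> x)"
          unfolding hermite_deriv_def by (simp add: algebra_simps)
        then show "complex_of_real (hermite_fun k x) * of_real (x * \<theta> x) - complex_of_real (hermite_deriv k x) * of_real (\<theta> x)
            = of_real (sqrt (2 * real k + 2)) * (complex_of_real (hermite_fun (Suc k) x) * of_real (\<theta> x))"
          by (metis of_real_diff of_real_mult)
      qed
      also have "\<dots> = of_real (sqrt (2 * real k + 2)) * cinner_L2 (hermite_L2 (Suc k)) t2"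
        unfolding hermite_L2_def t2_def by (subst cinner_L2_of[OF square_integrable_hermite s\<theta>(1)]) simp
      finally show ?thesis .
    qed
    have "(\<lambda>k. hcoef \<psi> k * cinner_L2 (hermite_L2 k) t1) sums cinner_L2 \<psi> t1"
      using cinner_hseries[OF Bessel(1)[of \<psi>], of t1] assms(1) by (simp add: hermite_span_def)
    moreover have "(\<lambda>k. c (Suc k) * cinner_L2 (hermite_L2 (Suc k)) t2) sums cinner_L2 (hseries c) t2"
      using cinner_hseries[OF sc, of t2] c0 by (subst sums_Suc_iff) simp
    moreover have "c (Suc k) * cinner_L2 (hermite_L2 (Suc k)) t2 = hcoef \<psi> k * cinner_L2 (hermite_L2 k) t1" for k
      by (simp add: e c_def algebra_simps)
    ultimately have "cinner_L2 \<psi> t1 = cinner_L2 (hseries c) t2" using sums_unique2 by fastforce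
    then show ?thesis
      unfolding t1_def t2_def cinner_L2_of_right[OF st1] cinner_L2_of_right[OF s\<theta>(1)] by simp
  qed
  then show ?thesis unfolding H1h_def by blast
qed

section \<open>Piecewise \<open>H\<^sup>1\<close> functions\<close>

lemma open_piece: "open (piece N a j)"
proof -
  have "piece N a j = (if 0 < j then {a j<..} else UNIV) \<inter> (if j < N then {..<a (Suc j)} else UNIV)"
    by (auto simp: piece_def)
  also have "open \<dots>" by (intro open_Int) auto
  finally show ?thesis .
qed

lemma is_interval_piece: "is_interval (piece N a j)"
  unfolding is_interval_1 piece_def by force

lemma piece_sets [measurable]: "piece N a j \<in> sets borel"
  using open_piece by auto

text \<open>On the piece with index \<open>j\<close> exactly the steps at the first \<open>j\<close>
  points are switched on, so the sum of the jumps there telescopes.\<close>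

lemma piece_less_iff:
  assumes "strict_mono_on {1..N} a" "j \<le> N" "x \<in> piece N a j" "i \<in> {1..N}"
  shows "a i < x \<longleftrightarrow> i \<le> j"
proof
  have m: "p \<in> {1..N} \<Longrightarrow> q \<in> {1..N} \<Longrightarrow> p \<le> q \<Longrightarrow> a p \<le> a q" for p q
    using strict_mono_on_leD[OF assms(1)] by blast
  show "a i < x" if "i \<le> j"
    using that assms(2-4) m[of i j] by (auto simp: piece_def)
  show "i \<le> j" if "a i < x"
  proof (rule ccontr)
    assume "\<not> i \<le> j"
    then have "Suc j \<le> i" by simp
    then show False using that assms(2-4) m[of "Suc j" i] by (auto simp: piece_def)
  qed
qed

lemma piece_disjoint:
  assumes "strict_mono_on {1..N} a" "i \<le> N" "j \<le> N" "x \<in> piece N a i" "x \<in> piece N a j"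
  shows "i = j"
proof (rule ccontr)
  assume "i \<noteq> j"
  \<comment> \<open>The point with this index has the piece of smaller index on its left and the
    other piece on its right.\<close>
  then have "Suc (min i j) \<in> {1..N}" "max i j \<ge> Suc (min i j)" using assms by auto
  then show False
    using piece_less_iff[OF assms(1,2,4), of "Suc (min i j)"] piece_less_iff[OF assms(1,3,5), of "Suc (min i j)"] \<open>i \<noteq> j\<close>
    by (auto simp: min_def max_def split: if_splits)
qed

lemma piece_cover:
  assumes "x \<notin> a ` {1..N}"
  obtains j where "j \<le> N" "x \<in> piece N a j"
proof -
  \<comment> \<open>The inserted 0 stands for the unbounded piece to the left of all the
    points.\<close>
  define S where "S = insert 0 {i\<in>{1..N}. a i < x}"
  define j where "j = Max S"
  have S: "finite S" "S \<noteq> {}" by (auto simp: S_def)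
  have jS: "j \<in> S" unfolding j_def using S by (rule Max_in)
  then have "j \<le> N" by (auto simp: S_def)
  have "x \<in> piece N a j"
    unfolding piece_def
  proof (intro CollectI conjI impI)
    assume "0 < j" then show "a j < x" using jS by (auto simp: S_def)
  next
    assume "j < N"
    have "Suc j \<notin> S" using Max_ge[OF S(1), of "Suc j"] by (auto simp: j_def)
    then have "x \<le> a (Suc j)" using \<open>j < N\<close> by (auto simp: S_def)
    moreover have "x \<noteq> a (Suc j)" using assms \<open>j < N\<close> by auto
    ultimately show "x < a (Suc j)" by simp
  qed
  with \<open>j \<le> N\<close> show ?thesis using that by blast
qed

text \<open>The weak derivatives on the pieces are glued to one square integrable \<open>w\<close>
  on the line, with one global primitive \<open>W\<close>. On each piece \<psi> - W is constant, so
  \<psi> is a continuous function plus a step function, and the part of the norm carried by the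
  derivatives controls \<open>w\<close>.\<close>

lemma H1_tilde_representation:
  assumes a: "strict_mono_on {1..N} a" and \<psi>: "\<psi> \<in> H1_tilde N a"
  obtains w W J where "square_integrable w" "primitive W w"
    "AE x in lborel. fun_L2 \<psi> x = W x + (\<Sum>j=1..N. J j * of_bool (a j < x))"
    "(\<integral>x. (cmod (w x))\<^sup>2 \<partial>lborel) \<le> (H1_tilde_norm N a \<psi>)\<^sup>2"
proof -
  \<comment> \<open>The same choice as in \<open>H1_norm_on\<close>, so that the norm there is
    literally the one of this derivative.\<close>
  define g where "g j = (SOME g. has_weak_deriv (piece N a j) \<psi> g)" for j
  have g: "has_weak_deriv (piece N a j) \<psi> (g j)" if "j \<le> N" for j
    using \<psi> that unfolding g_def H1_tilde_def H1_on_def by (auto intro: someI_ex)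
  define w where "w x = (\<Sum>j\<le>N. indicator (piece N a j) x * fun_L2 (g j) x)" for x
  have other: "indicator (piece N a i) x = (0::'b::zero_neq_one)" if "j \<le> N" "x \<in> piece N a j" "i \<in> {..N} - {j}" for i j x
    using piece_disjoint[OF a _ that(1) _ that(2), of i] that(3) by (auto simp: indicator_def)
  have w_piece: "w x = fun_L2 (g j) x" if "j \<le> N" "x \<in> piece N a j" for j x
  proof -
    have "w x = (\<Sum>i\<in>{j}. indicator (piece N a i) x * fun_L2 (g i) x)"
      unfolding w_def using that by (intro sum.mono_neutral_right ballI) (simp_all only: other[OF that], simp_all)
    then show ?thesis using that by simp
  qed
  have [measurable]: "w \<in> borel_measurable borel" unfolding w_def by measurable
  have w2: "(cmod (w x))\<^sup>2 = (\<Sum>j\<le>N. indicator (piece N a j) x * (cmod (fun_L2 (g j) x))\<^sup>2)" for x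
  proof (cases "\<exists>j\<le>N. x \<in> piece N a j")
    case True
    then obtain j where j: "j \<le> N" "x \<in> piece N a j" by blast
    have "(\<Sum>i\<le>N. indicator (piece N a i) x * (cmod (fun_L2 (g i) x))\<^sup>2) = (\<Sum>i\<in>{j}. indicator (piece N a i) x * (cmod (fun_L2 (g i) x))\<^sup>2)"
      using j by (intro sum.mono_neutral_right ballI) (simp_all only: other[OF j], simp_all)
    then show ?thesis using j w_piece[OF j] by simp
  qed (auto simp: w_def indicator_def intro!: sum.neutral)
  have gi: "integrable lborel (\<lambda>x. indicator (piece N a j) x * (cmod (fun_L2 (g j) x))\<^sup>2)" for j
    using integrable_mult_indicator[of "piece N a j" lborel "\<lambda>x. (cmod (fun_L2 (g j) x))\<^sup>2"]
      square_integrableD(2)[of "fun_L2 (g j)"] by simp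
  have sw: "square_integrable w"
    unfolding square_integrable_def w2
    by (intro conjI Bochner_Integration.integrable_sum gi) simp
  have nw: "(\<integral>x. (cmod (w x))\<^sup>2 \<partial>lborel) \<le> (H1_tilde_norm N a \<psi>)\<^sup>2"
  proof -
    have h1: "(LINT x:piece N a j|lborel. (cmod (fun_L2 (g j) x))\<^sup>2) \<le> (H1_norm_on (piece N a j) \<psi>)\<^sup>2" for j
    proof -
      have nn: "0 \<le> (LINT x:piece N a j|lborel. (cmod (fun_L2 h x))\<^sup>2)" for h
        unfolding set_lebesgue_integral_def by (intro Bochner_Integration.integral_nonneg) auto
      have "(H1_norm_on (piece N a j) \<psi>)\<^sup>2 = (LINT x:piece N a j|lborel. (cmod (fun_L2 \<psi> x))\<^sup>2) + (LINT x:piece N a j|lborel. (cmod (fun_L2 (g j) x))\<^sup>2)"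
        unfolding H1_norm_on_def Let_def g_def[symmetric] using nn by (subst real_sqrt_pow2) auto
      then show ?thesis using nn[of \<psi>] by simp
    qed
    have "(\<integral>x. (cmod (w x))\<^sup>2 \<partial>lborel) = (\<Sum>j\<le>N. (LINT x:piece N a j|lborel. (cmod (fun_L2 (g j) x))\<^sup>2))"
      unfolding w2 set_lebesgue_integral_def by (subst Bochner_Integration.integral_sum[OF gi]) simp
    also have "\<dots> \<le> (\<Sum>j\<le>N. (H1_norm_on (piece N a j) \<psi>)\<^sup>2)" by (intro sum_mono h1)
    also have "\<dots> \<le> (\<Sum>j\<le>N. (H1_norm_on (piece N a j) \<psi>)\<^sup>2) + (\<integral>x. (cmod (of_real (1 + \<bar>x\<bar>) * fun_L2 \<psi> x))\<^sup>2 \<partial>lborel)"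
      by (simp add: Bochner_Integration.integral_nonneg)
    also have "\<dots> = (H1_tilde_norm N a \<psi>)\<^sup>2"
      unfolding H1_tilde_norm_def
      by (subst real_sqrt_pow2) (auto intro!: add_nonneg_nonneg sum_nonneg Bochner_Integration.integral_nonneg)
    finally show ?thesis .
  qed
  obtain W where W: "primitive W w" using primitive_exists square_integrable_locally[OF sw] by blast
  have "\<exists>c. AE x in lborel. x \<in> piece N a j \<longrightarrow> fun_L2 \<psi> x = W x + c" if j: "j \<le> N" for j
  proof (rule weak_derivative_primitive[OF open_piece is_interval_piece W square_integrable_locally])
    fix \<theta> assume \<theta>: "test_function (piece N a j) \<theta>"
    have "integrable lborel (\<lambda>x. fun_L2 \<psi> x * of_real (deriv \<theta> x))"
      by (intro integrable_mult_square gauss_C1_square_integrable(2)[OF test_function_gauss_C1[OF \<theta>]]) simp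
    then have "set_integrable lborel (piece N a j) (\<lambda>x. fun_L2 \<psi> x * of_real (deriv \<theta> x))"
      unfolding set_integrable_def by (rule integrable_mult_indicator[rotated]) simp
    moreover have "(LINT x:piece N a j|lborel. fun_L2 (g j) x * of_real (\<theta> x)) = (LINT x:piece N a j|lborel. w x * of_real (\<theta> x))"
      by (rule set_lebesgue_integral_cong) (use w_piece[OF j] in auto)
    ultimately show "set_integrable lborel (piece N a j) (\<lambda>x. fun_L2 \<psi> x * of_real (deriv \<theta> x)) \<and>
        (LINT x:piece N a j|lborel. fun_L2 \<psi> x * of_real (deriv \<theta> x)) = - (LINT x:piece N a j|lborel. w x * of_real (\<theta> x))"
      using g[OF j] \<theta> by (simp add: has_weak_deriv_def)
  qed simp
  then obtain c where c: "\<And>j. j \<le> N \<Longrightarrow> AE x in lborel. x \<in> piece N a j \<longrightarrow> fun_L2 \<psi> x = W x + c j"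
    by metis
  \<comment> \<open>The constant of the leftmost piece is moved into \<open>W\<close>; the jumps are
    the differences of consecutive constants.\<close>
  define J where "J j = c j - c (j - 1)" for j
  have "AE x in lborel. \<forall>j\<in>{..N}. x \<in> piece N a j \<longrightarrow> fun_L2 \<psi> x = W x + c j"
    using c by (intro AE_finite_allI) auto
  moreover have "AE x in lborel. x \<notin> a ` {1..N}"
    by (rule AE_not_in) (auto intro: finite_imp_null_set_lborel)
  ultimately have rep: "AE x in lborel. fun_L2 \<psi> x = (W x + c 0) + (\<Sum>j=1..N. J j * of_bool (a j < x))"
  proof eventually_elim
    case (elim x)
    obtain j where j: "j \<le> N" "x \<in> piece N a j" using piece_cover[OF elim(2)] .
    have "(\<Sum>i=1..N. J i * of_bool (a i < x)) = (\<Sum>i=1..N. if i \<le> j then J i else 0)"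
      by (intro sum.cong refl) (simp add: piece_less_iff[OF a j])
    also have "\<dots> = (\<Sum>i\<in>{1..j}. J i)"
      using j(1) by (intro sum.mono_neutral_cong_right) auto
    also have "\<dots> = c j - c 0"
      unfolding J_def by (induction j) auto
    finally show ?case using elim(1) j by simp
  qed
  have "primitive (\<lambda>x. W x + c 0) w" using primitive_add[OF W primitive_const[of "c 0"]] by simp
  then show ?thesis using that sw rep nw by blast
qed

lemma gauss_C1_integrable:
  assumes "gauss_C1 \<Theta> \<Theta>'"
  shows "integrable lborel \<Theta>" "integrable lborel \<Theta>'"
proof -
  note m = gauss_C1_measurable[OF assms]
  obtain C where C: "\<And>x. \<bar>\<Theta> x\<bar> \<le> C * exp (- (1/4) * x\<^sup>2)" "\<And>x. \<bar>\<Theta>' x\<bar> \<le> C * exp (- (1/4) * x\<^sup>2)"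
    using assms by (auto simp: gauss_C1_def)
  have i: "integrable lborel (\<lambda>x::real. C * exp (- (1/4) * x\<^sup>2))"
    by (intro integrable_mult_right gauss_integrable) simp
  show "integrable lborel \<Theta>"
    by (rule Bochner_Integration.integrable_bound[OF i]) (use m in simp, rule AE_I2, simp only: real_norm_def order_trans[OF C(1) abs_ge_self])
  show "integrable lborel \<Theta>'"
    by (rule Bochner_Integration.integrable_bound[OF i]) (use m in simp, rule AE_I2, simp only: real_norm_def order_trans[OF C(2) abs_ge_self])
qed

lemma gauss_C1_half_line:
  assumes T: "gauss_C1 \<Theta> \<Theta>'"
  shows "(\<integral>x. of_bool (b < x) * complex_of_real (\<Theta>' x) \<partial>lborel) = - of_real (\<Theta> b)"
proof -
  note p = gauss_C1_primitive[OF T]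
  note i = gauss_C1_integrable(2)[OF T]
  have [measurable]: "\<Theta>' \<in> borel_measurable borel" by (rule gauss_C1_measurable[OF T])
  have "(\<lambda>n. \<integral>x. indicator {b..b + real n} x *\<^sub>R \<Theta>' x \<partial>lborel) \<longlonglongrightarrow> (\<integral>x. of_bool (b < x) * \<Theta>' x \<partial>lborel)"
  proof (rule integral_dominated_convergence[where w = "\<lambda>x. norm (\<Theta>' x)"])
    have "AE x in lborel. x \<noteq> b" by (rule AE_lborel_singleton)
    then show "AE x in lborel. (\<lambda>n. indicator {b..b + real n} x *\<^sub>R \<Theta>' x) \<longlonglongrightarrow> of_bool (b < x) * \<Theta>' x"
    proof eventually_elim
      case (elim x)
      obtain k :: nat where "\<bar>x - b\<bar> < real k" using reals_Archimedean2 by blast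
      then show ?case using elim
        by (intro tendsto_eventually) (auto simp: eventually_sequentially indicator_def intro!: exI[of _ k])
    qed
  qed (use i in \<open>auto simp: indicator_def intro!: AE_I2\<close>)
  moreover have "(\<integral>x. indicator {b..b + real n} x *\<^sub>R \<Theta>' x \<partial>lborel) = \<Theta> (b + real n) - \<Theta> b" for n
    using primitive_diff_eq[OF p, of b "b + real n"] by (simp add: set_lebesgue_integral_def)
  moreover have "(\<lambda>n. \<Theta> (b + real n) - \<Theta> b) \<longlonglongrightarrow> 0 - \<Theta> b"
  proof (intro tendsto_diff tendsto_const)
    obtain C where C: "\<And>x. norm (\<Theta> x) \<le> C * exp (- (1/4) * x\<^sup>2)"
      using T by (auto simp: gauss_C1_def)
    have "filterlim (\<lambda>n. b + real n) at_top sequentially"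
      by (rule filterlim_tendsto_add_at_top[OF tendsto_const filterlim_real_sequentially])
    then show "(\<lambda>n. \<Theta> (b + real n)) \<longlonglongrightarrow> 0"
      by (rule filterlim_compose[OF gauss_tendsto_zero(1)[OF C], rotated]) simp
  qed
  ultimately have "(\<integral>x. of_bool (b < x) * \<Theta>' x \<partial>lborel) = - \<Theta> b" using LIMSEQ_unique by fastforce
  moreover have "(\<integral>x. of_bool (b < x) * complex_of_real (\<Theta>' x) \<partial>lborel) = of_real (\<integral>x. of_bool (b < x) * \<Theta>' x \<partial>lborel)"
    by (subst integral_complex_of_real[symmetric]) (auto intro!: Bochner_Integration.integral_cong)
  ultimately show ?thesis by simp
qed

text \<open>The distributional derivative of \<psi> is \<open>w\<close> plus point masses of size
  \<open>J j\<close> at the points \<open>a j\<close>, tested against the whole class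
  \<open>gauss_C1\<close>.\<close>

definition jump_pairing :: "nat \<Rightarrow> (nat \<Rightarrow> real) \<Rightarrow> L2 \<Rightarrow> (real \<Rightarrow> complex) \<Rightarrow> (nat \<Rightarrow> complex) \<Rightarrow> bool" where
  "jump_pairing N a \<psi> w J \<longleftrightarrow> (\<forall>\<Theta> \<Theta>'. gauss_C1 \<Theta> \<Theta>' \<longrightarrow>
     (\<integral>x. fun_L2 \<psi> x * of_real (\<Theta>' x) \<partial>lborel)
       = - (\<integral>x. w x * of_real (\<Theta> x) \<partial>lborel) - (\<Sum>j=1..N. J j * of_real (\<Theta> (a j))))"

text \<open>The primitive \<open>W\<close> contributes by integration by parts, its growth being
  controlled by \<open>primitive_growth\<close>; each step contributes an integral over a half-line,
  which is minus the value at its left end.\<close>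

lemma jump_pairing_representation:
  assumes w: "square_integrable w" and W: "primitive W w"
    and rep: "AE x in lborel. fun_L2 \<psi> x = W x + (\<Sum>j=1..N. J j * of_bool (a j < x))"
  shows "jump_pairing N a \<psi> w J"
  unfolding jump_pairing_def
proof (intro allI impI)
  fix \<Theta> \<Theta>' assume T: "gauss_C1 \<Theta> \<Theta>'"
  have [measurable]: "\<Theta>' \<in> borel_measurable borel" "W \<in> borel_measurable borel" "fun_L2 \<psi> \<in> borel_measurable borel"
    using gauss_C1_measurable[OF T] primitive_measurable[OF W] by simp_all
  obtain K where K: "\<And>x. cmod (W x) \<le> K * exp (x\<^sup>2 / 8)"
  proof -
    have "\<exists>K. \<forall>x. cmod (W x) \<le> K * exp (x\<^sup>2 / 8)"
    proof (rule primitive_growth[OF W, of "\<lambda>x. (cmod (w x))\<^sup>2"])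
      show "integrable lborel (\<lambda>x. (cmod (w x))\<^sup>2)" using w by (rule square_integrableD)
      fix x
      have "2 * 1 * cmod (w x) \<le> 1\<^sup>2 + (cmod (w x))\<^sup>2" by (rule sum_squares_bound)
      then have "cmod (w x) \<le> 1 + (cmod (w x))\<^sup>2" using norm_ge_zero[of "w x"] unfolding power_one mult_1_right by linarith
      then show "cmod (w x) \<le> 1 + x\<^sup>2 + (cmod (w x))\<^sup>2" using zero_le_power2[of x] by linarith
    qed simp
    then show ?thesis using that by blast
  qed
  have iw: "integrable lborel (\<lambda>x. w x * of_real (\<Theta> x))"
    by (rule integrable_mult_square[OF w gauss_C1_square_integrable(1)[OF T]])
  note ibp = integral_by_parts_gauss[OF W T K iw]
  have ib: "integrable lborel (\<lambda>x. of_bool (a j < x) * complex_of_real (\<Theta>' x))" for j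
  proof (rule Bochner_Integration.integrable_bound[OF gauss_C1_integrable(2)[OF T]])
    show "(\<lambda>x. of_bool (a j < x) * complex_of_real (\<Theta>' x)) \<in> borel_measurable lborel" by measurable
  qed auto
  have "(\<integral>x. fun_L2 \<psi> x * of_real (\<Theta>' x) \<partial>lborel)
      = (\<integral>x. W x * of_real (\<Theta>' x) + (\<Sum>j=1..N. J j * (of_bool (a j < x) * complex_of_real (\<Theta>' x))) \<partial>lborel)"
  proof (rule Bochner_Integration.integral_cong_AE)
    show "AE x in lborel. fun_L2 \<psi> x * of_real (\<Theta>' x) = W x * of_real (\<Theta>' x) + (\<Sum>j=1..N. J j * (of_bool (a j < x) * complex_of_real (\<Theta>' x)))"
      using rep by eventually_elim (simp only: distrib_right sum_distrib_right mult.assoc)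
    show "(\<lambda>x. fun_L2 \<psi> x * of_real (\<Theta>' x)) \<in> borel_measurable lborel" by measurable
    show "(\<lambda>x. W x * of_real (\<Theta>' x) + (\<Sum>j=1..N. J j * (of_bool (a j < x) * complex_of_real (\<Theta>' x)))) \<in> borel_measurable lborel"
      by measurable
  qed
  also have "\<dots> = - (\<integral>x. w x * of_real (\<Theta> x) \<partial>lborel) - (\<Sum>j=1..N. J j * of_real (\<Theta> (a j)))"
    using ibp ib by (simp add: gauss_C1_half_line[OF T] sum_negf)
  finally show "(\<integral>x. fun_L2 \<psi> x * of_real (\<Theta>' x) \<partial>lborel)
       = - (\<integral>x. w x * of_real (\<Theta> x) \<partial>lborel) - (\<Sum>j=1..N. J j * of_real (\<Theta> (a j)))" .
qed

text \<open>A test function of radius 1 / r around \<open>b\<close>. In its centre both factors of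
  the bump equal e^(-1), and the factor e^2 normalizes the value there to 1.\<close>

definition spike :: "real \<Rightarrow> real \<Rightarrow> real \<Rightarrow> real" where
  "spike b r x = exp 2 * bump r (b - 1 / r) (b + 1 / r) x"

lemma bump_fun_gauss_C1:
  assumes "bump_fun f" "\<And>x. x \<notin> {l..r} \<Longrightarrow> f x = 0"
  shows "gauss_C1 f (deriv f)"
proof (rule test_function_gauss_C1[of UNIV])
  show "test_function UNIV f"
    unfolding test_function_def
    using bump_fun_smooth[OF assms(1)] compact_closure_of_support(1)[of l r f] assms(2) by auto
qed

lemma spike_eq_0:
  assumes "r > 0" "1 / r \<le> \<bar>x - b\<bar>"
  shows "spike b r x = 0"
proof -
  have "x \<le> b - 1/r \<or> b + 1/r \<le> x" using assms(2) by linarith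
  then show ?thesis using bump_eq_0[OF assms(1), of x "b - 1/r" "b + 1/r"] by (auto simp: spike_def)
qed

lemma spike_center:
  assumes "r > 0"
  shows "spike b r b = 1"
  using assms by (simp add: spike_def bump_def exp_recip_def algebra_simps flip: exp_add)

lemma gauss_C1_spike:
  assumes "r > 0"
  shows "gauss_C1 (spike b r) (deriv (spike b r))"
proof (rule bump_fun_gauss_C1[where l = "b - 1/r" and r = "b + 1/r"])
  show "bump_fun (spike b r)" unfolding spike_def[abs_def] by (intro bump_fun.intros bump_fun_bump)
  show "spike b r x = 0" if "x \<notin> {b - 1/r..b + 1/r}" for x
    using that by (intro spike_eq_0[OF assms]) auto
qed

lemma spike_bound: "\<bar>spike b r x\<bar> \<le> exp 2"
  using bump_bounds[of r "b - 1/r" "b + 1/r" x] by (simp add: spike_def abs_mult mult_left_le)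

lemma eventually_spike_eq_0:
  assumes "x \<noteq> b"
  shows "\<forall>\<^sub>F n in sequentially. spike b (real (Suc n)) x = 0"
proof -
  have "(\<lambda>n. 1 / real (Suc n)) \<longlonglongrightarrow> 0" by (rule LIMSEQ_Suc[OF lim_1_over_n])
  moreover have "0 < \<bar>x - b\<bar>" using assms by simp
  ultimately have "\<forall>\<^sub>F n in sequentially. 1 / real (Suc n) < \<bar>x - b\<bar>" by (rule order_tendstoD)
  then show ?thesis by eventually_elim (rule spike_eq_0, auto)
qed

text \<open>A jump in terms of \<psi> alone: shrinking spikes isolate the point mass at
  \<open>b\<close>, and the absolutely continuous part disappears in the limit. A decomposition
  picked separately for each time would say nothing about measurability; a limit of continuous
  functionals does.\<close>

definition jump :: "real \<Rightarrow> L2 \<Rightarrow> complex" where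
  "jump b \<psi> = lim (\<lambda>n. - (\<integral>x. fun_L2 \<psi> x * of_real (deriv (spike b (real (Suc n))) x) \<partial>lborel))"

lemma jump_eq:
  assumes a: "strict_mono_on {1..N} a" and w: "square_integrable w"
    and p: "jump_pairing N a \<psi> w J" and j: "j \<in> {1..N}"
  shows "jump (a j) \<psi> = J j"
proof -
  have [measurable]: "w \<in> borel_measurable borel" using w by (simp add: square_integrable_def)
  have inj: "a i \<noteq> a j" if "i \<in> {1..N}" "i \<noteq> j" for i
    using inj_onD[OF strict_mono_on_imp_inj_on[OF a], of i j] that j by blast
  have [measurable]: "spike b (real (Suc n)) \<in> borel_measurable borel" for b n
    by (rule gauss_C1_measurable[OF gauss_C1_spike]) simp
  have "(\<lambda>n. \<integral>x. w x * of_real (spike (a j) (real (Suc n)) x) \<partial>lborel) \<longlonglongrightarrow> (\<integral>x. 0 \<partial>(lborel :: real measure))"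
  \<comment> \<open>All spikes are bounded by e^2 and supported within distance 1 of the centre, and
    away from the centre they are eventually 0.\<close>
  proof (rule integral_dominated_convergence[where w = "\<lambda>x. exp 2 * norm (indicator {a j - 1..a j + 1} x *\<^sub>R w x)"])
    show "integrable lborel (\<lambda>x. exp 2 * norm (indicator {a j - 1..a j + 1} x *\<^sub>R w x))"
      using square_integrable_locally[OF w] unfolding set_integrable_def
      by (intro integrable_mult_right integrable_norm)
    have "AE x in lborel. x \<noteq> a j" by (rule AE_lborel_singleton)
    then show "AE x in lborel. (\<lambda>n. w x * of_real (spike (a j) (real (Suc n)) x)) \<longlonglongrightarrow> 0"
    proof eventually_elim
      case (elim x)
      show ?case
        by (rule tendsto_eventually) (use eventually_spike_eq_0[OF elim] in \<open>eventually_elim, simp\<close>)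
    qed
    show "AE x in lborel. norm (w x * of_real (spike (a j) (real (Suc n)) x)) \<le> exp 2 * norm (indicator {a j - 1..a j + 1} x *\<^sub>R w x)" for n
    proof (rule AE_I2)
      fix x
      show "norm (w x * of_real (spike (a j) (real (Suc n)) x)) \<le> exp 2 * norm (indicator {a j - 1..a j + 1} x *\<^sub>R w x)"
      proof (cases "x \<in> {a j - 1..a j + 1}")
        case True
        then show ?thesis using mult_right_mono[OF spike_bound[of "a j" "real (Suc n)" x] norm_ge_zero[of "w x"]]
          by (simp add: norm_mult mult.commute)
      next
        case False
        have "1 / real (Suc n) \<le> 1" by simp
        also have "1 \<le> \<bar>x - a j\<bar>" using False by auto
        finally have "spike (a j) (real (Suc n)) x = 0" by (intro spike_eq_0) auto
        then show ?thesis by simp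
      qed
    qed
  qed measurable
  then have 1: "(\<lambda>n. \<integral>x. w x * of_real (spike (a j) (real (Suc n)) x) \<partial>lborel) \<longlonglongrightarrow> 0" by simp
  have "(\<lambda>n. \<Sum>i=1..N. J i * of_real (spike (a j) (real (Suc n)) (a i))) \<longlonglongrightarrow> (\<Sum>i=1..N. J i * of_real (if i = j then 1 else 0))"
  proof (intro tendsto_sum tendsto_mult tendsto_const tendsto_of_real)
    fix i assume i: "i \<in> {1..N}"
    show "(\<lambda>n. spike (a j) (real (Suc n)) (a i)) \<longlonglongrightarrow> (if i = j then 1 else 0)"
    proof (cases "i = j")
      case True
      then show ?thesis by (simp add: spike_center del: of_nat_Suc)
    next
      case False
      then show ?thesis using tendsto_eventually[OF eventually_spike_eq_0[OF inj[OF i False]]] by simp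
    qed
  qed
  also have "(\<Sum>i=1..N. J i * of_real (if i = j then 1 else 0)) = J j"
    using j by (simp add: if_distrib cong: if_cong)
  finally have "(\<lambda>n. (\<integral>x. w x * of_real (spike (a j) (real (Suc n)) x) \<partial>lborel) + (\<Sum>i=1..N. J i * of_real (spike (a j) (real (Suc n)) (a i)))) \<longlonglongrightarrow> 0 + J j"
    by (intro tendsto_add 1)
  moreover have "- (\<integral>x. fun_L2 \<psi> x * of_real (deriv (spike (a j) (real (Suc n))) x) \<partial>lborel) = (\<integral>x. w x * of_real (spike (a j) (real (Suc n)) x) \<partial>lborel) + (\<Sum>i=1..N. J i * of_real (spike (a j) (real (Suc n)) (a i)))" for n
  proof -
    have "gauss_C1 (spike (a j) (real (Suc n))) (deriv (spike (a j) (real (Suc n))))"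
      by (rule gauss_C1_spike) simp
    then have "(\<integral>x. fun_L2 \<psi> x * of_real (deriv (spike (a j) (real (Suc n))) x) \<partial>lborel)
      = - (\<integral>x. w x * of_real (spike (a j) (real (Suc n)) x) \<partial>lborel) - (\<Sum>i=1..N. J i * of_real (spike (a j) (real (Suc n)) (a i)))"
      using p unfolding jump_pairing_def by blast
    then show ?thesis by (simp only: minus_diff_eq minus_minus) simp
  qed
  ultimately show ?thesis unfolding jump_def by (simp add: limI)
qed

lemma jump_measurable:
  assumes "f \<in> borel_measurable M"
  shows "(\<lambda>s. jump b (f s)) \<in> borel_measurable M"
  unfolding jump_def
proof (rule borel_measurable_lim_metric)
  fix n
  have s: "square_integrable (\<lambda>x. complex_of_real (deriv (spike b (real (Suc n))) x))"
    by (rule gauss_C1_square_integrable(2)[OF gauss_C1_spike]) simp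
  have "(\<lambda>s. - cinner_L2 (f s) (L2_of (\<lambda>x. complex_of_real (deriv (spike b (real (Suc n))) x)))) \<in> borel_measurable M"
    using borel_measurable_continuous_on[OF linear_continuous_on[OF bounded_linear_cinner_left] assms] by measurable
  then show "(\<lambda>s. - (\<integral>x. fun_L2 (f s) x * of_real (deriv (spike b (real (Suc n))) x) \<partial>lborel)) \<in> borel_measurable M"
    by (simp only: cinner_L2_of_right[OF s])  simp
qed

lemma integral_mult_le_norm:
  assumes f: "square_integrable f" and g: "square_integrable (\<lambda>x. complex_of_real (g x))"
  shows "cmod (\<integral>x. f x * of_real (g x) \<partial>lborel) \<le> norm (L2_of f) * norm (L2_of (\<lambda>x. complex_of_real (g x)))"
  using norm_cinner_le[of "L2_of f" "L2_of (\<lambda>x. complex_of_real (g x))"]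
  unfolding cinner_L2_of[OF f g] by simp

text \<open>One fixed spike at each point, narrow enough to vanish at all the others, already
  expresses the jump by two pairings; Cauchy-Schwarz bounds both. The constant depends only on the
  points.\<close>

lemma jump_bound:
  assumes a: "strict_mono_on {1..N} a"
  obtains C where "C \<ge> 0"
    "\<And>\<psi> w J j. square_integrable w \<Longrightarrow> jump_pairing N a \<psi> w J \<Longrightarrow> j \<in> {1..N} \<Longrightarrow>
       cmod (J j) \<le> C * (norm \<psi> + norm (L2_of w))"
proof -
  have "\<exists>n. \<forall>i\<in>{1..N} - {j}. spike (a j) (real (Suc n)) (a i) = 0" if j: "j \<in> {1..N}" for j
  proof -
    have "\<forall>\<^sub>F n in sequentially. \<forall>i\<in>{1..N} - {j}. spike (a j) (real (Suc n)) (a i) = 0"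
    proof (intro eventually_ball_finite ballI eventually_spike_eq_0)
      show "a i \<noteq> a j" if "i \<in> {1..N} - {j}" for i
        using inj_onD[OF strict_mono_on_imp_inj_on[OF a], of i j] that j by blast
    qed auto
    then show ?thesis by (rule eventually_happens'[OF sequentially_bot])
  qed
  then obtain n where n: "\<And>i j. j \<in> {1..N} \<Longrightarrow> i \<in> {1..N} - {j} \<Longrightarrow> spike (a j) (real (Suc (n j))) (a i) = 0"
    by metis
  define T where "T j = spike (a j) (real (Suc (n j)))" for j
  have gT: "gauss_C1 (T j) (deriv (T j))" for j unfolding T_def by (rule gauss_C1_spike) simp
  define P where "P j = norm (L2_of (\<lambda>x. complex_of_real (deriv (T j) x)))" for j
  define Q where "Q j = norm (L2_of (\<lambda>x. complex_of_real (T j x)))" for j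
  define C where "C = (\<Sum>j=1..N. P j + Q j)"
  have PQ: "P j \<ge> 0" "Q j \<ge> 0" for j by (auto simp: P_def Q_def)
  show ?thesis
  proof (rule that[of C])
    show "C \<ge> 0" unfolding C_def by (intro sum_nonneg add_nonneg_nonneg PQ)
    fix \<psi> w J j assume w: "square_integrable w" and p: "jump_pairing N a \<psi> w J" and j: "j \<in> {1..N}"
    have "(\<Sum>i=1..N. J i * of_real (T j (a i))) = (\<Sum>i\<in>{j}. J i * of_real (T j (a i)))"
      by (rule sum.mono_neutral_right) (use j n[OF j] in \<open>auto simp: T_def simp del: of_nat_Suc\<close>)
    also have "\<dots> = J j" by (simp add: T_def spike_center del: of_nat_Suc)
    finally have "(\<integral>x. fun_L2 \<psi> x * of_real (deriv (T j) x) \<partial>lborel) = - (\<integral>x. w x * of_real (T j x) \<partial>lborel) - J j"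
      using p gT[of j] unfolding jump_pairing_def by metis
    then have "J j = - (\<integral>x. fun_L2 \<psi> x * of_real (deriv (T j) x) \<partial>lborel) - (\<integral>x. w x * of_real (T j x) \<partial>lborel)"
      by simp
    then have "cmod (J j) \<le> cmod (\<integral>x. fun_L2 \<psi> x * of_real (deriv (T j) x) \<partial>lborel) + cmod (\<integral>x. w x * of_real (T j x) \<partial>lborel)"
      by (metis norm_minus_cancel norm_triangle_ineq4)
    also have "\<dots> \<le> norm \<psi> * P j + norm (L2_of w) * Q j"
      using integral_mult_le_norm[OF square_integrable_fun_L2 gauss_C1_square_integrable(2)[OF gT], of \<psi> j]
        integral_mult_le_norm[OF w gauss_C1_square_integrable(1)[OF gT], of j]
      unfolding P_def Q_def by simp
    also have "\<dots> \<le> norm \<psi> * C + norm (L2_of w) * C"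
    proof -
      have "P j + Q j \<le> C" unfolding C_def using j PQ by (intro member_le_sum) (auto intro: add_nonneg_nonneg)
      then show ?thesis using PQ[of j] by (intro add_mono mult_left_mono) auto
    qed
    finally show "cmod (J j) \<le> C * (norm \<psi> + norm (L2_of w))" by (simp add: algebra_simps)
  qed
qed

lemma H1_tilde_norm_bounds:
  assumes x: "square_integrable (\<lambda>x. of_real x * fun_L2 \<psi> x)"
  shows "(norm \<psi>)\<^sup>2 \<le> (H1_tilde_norm N a \<psi>)\<^sup>2"
    "(\<integral>x. (cmod (of_real x * fun_L2 \<psi> x))\<^sup>2 \<partial>lborel) \<le> (H1_tilde_norm N a \<psi>)\<^sup>2"
proof -
  have i: "integrable lborel (\<lambda>x. (cmod (of_real (1 + \<bar>x\<bar>) * fun_L2 \<psi> x))\<^sup>2)"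
  proof (rule Bochner_Integration.integrable_bound)
    show "integrable lborel (\<lambda>x. 2 * (cmod (fun_L2 \<psi> x))\<^sup>2 + 2 * (cmod (of_real x * fun_L2 \<psi> x))\<^sup>2)"
      using square_integrableD(2)[OF x] square_integrableD(2)[of "fun_L2 \<psi>"] by simp
    have "(cmod (of_real (1 + \<bar>x\<bar>) * fun_L2 \<psi> x))\<^sup>2 \<le> 2 * (cmod (fun_L2 \<psi> x))\<^sup>2 + 2 * (cmod (of_real x * fun_L2 \<psi> x))\<^sup>2" for x
    proof -
      define c where "c = cmod (fun_L2 \<psi> x)"
      have "cmod (of_real (1 + \<bar>x\<bar>) * fun_L2 \<psi> x) = c + \<bar>x\<bar> * c"
        unfolding norm_mult norm_of_real c_def by (simp add: distrib_right)
      moreover have "cmod (of_real x * fun_L2 \<psi> x) = \<bar>x\<bar> * c" by (simp add: norm_mult c_def)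
      moreover have "2 * c * (\<bar>x\<bar> * c) \<le> c\<^sup>2 + (\<bar>x\<bar> * c)\<^sup>2" by (rule sum_squares_bound)
      ultimately show ?thesis by (simp add: power2_sum c_def)
    qed
    then show "AE x in lborel. norm ((cmod (of_real (1 + \<bar>x\<bar>) * fun_L2 \<psi> x))\<^sup>2) \<le> norm (2 * (cmod (fun_L2 \<psi> x))\<^sup>2 + 2 * (cmod (of_real x * fun_L2 \<psi> x))\<^sup>2)"
      by (intro AE_I2) simp
  qed measurable
  have "(H1_tilde_norm N a \<psi>)\<^sup>2 = (\<Sum>j\<le>N. (H1_norm_on (piece N a j) \<psi>)\<^sup>2) + (\<integral>x. (cmod (of_real (1 + \<bar>x\<bar>) * fun_L2 \<psi> x))\<^sup>2 \<partial>lborel)"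
    unfolding H1_tilde_norm_def
    by (subst real_sqrt_pow2) (auto intro!: add_nonneg_nonneg sum_nonneg Bochner_Integration.integral_nonneg)
  then have n: "(\<integral>x. (cmod (of_real (1 + \<bar>x\<bar>) * fun_L2 \<psi> x))\<^sup>2 \<partial>lborel) \<le> (H1_tilde_norm N a \<psi>)\<^sup>2"
    by (simp add: sum_nonneg)
  have m: "cmod (fun_L2 \<psi> x) \<le> cmod (of_real (1 + \<bar>x\<bar>) * fun_L2 \<psi> x)" "cmod (of_real x * fun_L2 \<psi> x) \<le> cmod (of_real (1 + \<bar>x\<bar>) * fun_L2 \<psi> x)" for x
    unfolding norm_mult norm_of_real by (auto simp: mult_le_cancel_right1 intro: mult_right_mono)
  have "(norm \<psi>)\<^sup>2 \<le> (\<integral>x. (cmod (of_real (1 + \<bar>x\<bar>) * fun_L2 \<psi> x))\<^sup>2 \<partial>lborel)"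
    unfolding power2_norm_L2 by (intro integral_mono i square_integrableD(2) power_mono m) auto
  with n show "(norm \<psi>)\<^sup>2 \<le> (H1_tilde_norm N a \<psi>)\<^sup>2" by linarith
  have "(\<integral>x. (cmod (of_real x * fun_L2 \<psi> x))\<^sup>2 \<partial>lborel) \<le> (\<integral>x. (cmod (of_real (1 + \<bar>x\<bar>) * fun_L2 \<psi> x))\<^sup>2 \<partial>lborel)"
    by (intro integral_mono i square_integrableD(2) x power_mono m) auto
  with n show "(\<integral>x. (cmod (of_real x * fun_L2 \<psi> x))\<^sup>2 \<partial>lborel) \<le> (H1_tilde_norm N a \<psi>)\<^sup>2" by linarith
qed

lemma H1_tilde_norm_nonneg: "H1_tilde_norm N a \<psi> \<ge> 0"
  unfolding H1_tilde_norm_def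
  by (intro real_sqrt_ge_zero add_nonneg_nonneg sum_nonneg Bochner_Integration.integral_nonneg) auto

section \<open>Square summable part and jump part of the Hermite coefficients\<close>

text \<open>The pairing with \<open>\<phi>\<^bsub>k+1\<^esub>\<close> gains the factor \<open>sqrt (2 k + 2)\<close> up to a square summable sequence and finitely
  many multiples of the bounded sequences \<open>\<phi>\<^bsub>k\<^esub>(a\<^sub>j)\<close>.\<close>

lemma hcoef_Suc_jump:
  assumes p: "jump_pairing N a \<psi> w J" and w: "square_integrable w"
    and x: "square_integrable (\<lambda>x. of_real x * fun_L2 \<psi> x)"
  shows "of_real (sqrt (2 * real k + 2)) * hcoef \<psi> (Suc k)
    = hcoef (L2_of (\<lambda>x. w x + of_real x * fun_L2 \<psi> x)) k + (\<Sum>j=1..N. J j * of_real (hermite_fun k (a j)))"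
proof -
  define v where "v = fun_L2 \<psi>"
  have v: "square_integrable v" by (simp add: v_def)
  have xv: "square_integrable (\<lambda>x. of_real x * v x)" using x by (simp add: v_def)
  have i: "integrable lborel (\<lambda>x. (of_real x * v x) * of_real (hermite_fun k x))"
    "integrable lborel (\<lambda>x. w x * of_real (hermite_fun k x))"
    "integrable lborel (\<lambda>x. v x * of_real (hermite_deriv k x))"
    by (intro integrable_mult_square xv w v square_integrable_hermite gauss_C1_square_integrable(2)[OF gauss_C1_hermite])+
  have e: "of_real (sqrt (2 * real k + 2)) * (v x * of_real (hermite_fun (Suc k) x))
    = (of_real x * v x) * of_real (hermite_fun k x) - v x * of_real (hermite_deriv k x)" for x
    unfolding hermite_deriv_def by (simp add: algebra_simps)
  have "of_real (sqrt (2 * real k + 2)) * hcoef \<psi> (Suc k)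
    = (\<integral>x. of_real (sqrt (2 * real k + 2)) * (v x * of_real (hermite_fun (Suc k) x)) \<partial>lborel)"
    by (simp add: hcoef_eq v_def)
  also have "\<dots> = (\<integral>x. (of_real x * v x) * of_real (hermite_fun k x) \<partial>lborel) - (\<integral>x. v x * of_real (hermite_deriv k x) \<partial>lborel)"
    unfolding e using i by simp
  also have "(\<integral>x. v x * of_real (hermite_deriv k x) \<partial>lborel) = - (\<integral>x. w x * of_real (hermite_fun k x) \<partial>lborel) - (\<Sum>j=1..N. J j * of_real (hermite_fun k (a j)))"
    using p gauss_C1_hermite[of k] unfolding jump_pairing_def v_def by blast
  also have "(\<integral>x. (of_real x * v x) * of_real (hermite_fun k x) \<partial>lborel) - (- (\<integral>x. w x * of_real (hermite_fun k x) \<partial>lborel) - (\<Sum>j=1..N. J j * of_real (hermite_fun k (a j))))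
    = (\<integral>x. (w x + of_real x * v x) * of_real (hermite_fun k x) \<partial>lborel) + (\<Sum>j=1..N. J j * of_real (hermite_fun k (a j)))"
    using i by (simp add: distrib_right)
  also have "(\<integral>x. (w x + of_real x * v x) * of_real (hermite_fun k x) \<partial>lborel) = hcoef (L2_of (\<lambda>x. w x + of_real x * v x)) k"
    unfolding hermite_L2_def by (subst cinner_L2_of[OF square_integrable_add[OF w xv] square_integrable_hermite]) simp
  finally show ?thesis by (simp add: v_def)
qed

text \<open>Abstract shape of the coefficients: after the gain of sqrt (2 k + 2) they are square
  summable up to combinations of the sequences \<open>b j\<close>, and one number \<open>G\<close>
  bounds everything. Index 0 is listed separately because raising reaches only indices
  \<open>Suc k\<close>. Bounds on finite sums are all that is used later.\<close>

definition jump_decomp :: "nat \<Rightarrow> (nat \<Rightarrow> nat \<Rightarrow> real) \<Rightarrow> (nat \<Rightarrow> complex) \<Rightarrow> (nat \<Rightarrow> complex) \<Rightarrow> real \<Rightarrow> bool" where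
  "jump_decomp N b v h G \<longleftrightarrow>
     (\<forall>n. (\<Sum>k<n. (cmod (of_real (sqrt (2 * real k + 2)) * v (Suc k) - (\<Sum>j=1..N. h j * of_real (b j k))))\<^sup>2) \<le> G) \<and>
     (\<forall>j\<in>{1..N}. (cmod (h j))\<^sup>2 \<le> G) \<and> (cmod (v 0))\<^sup>2 \<le> G"

lemma jump_decomp_mono: "jump_decomp N b v h G \<Longrightarrow> G \<le> G' \<Longrightarrow> jump_decomp N b v h G'"
  unfolding jump_decomp_def by (meson order_trans)

lemma H1_tilde_jump_decomp:
  assumes a: "strict_mono_on {1..N} a"
  obtains C where "C \<ge> 0" "\<And>\<psi>. \<psi> \<in> H1_tilde N a \<Longrightarrow>
     jump_decomp N (\<lambda>j k. hermite_fun k (a j)) (hcoef \<psi>) (\<lambda>j. jump (a j) \<psi>) (C * (H1_tilde_norm N a \<psi>)\<^sup>2)"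
proof -
  obtain C where C: "C \<ge> 0"
    "\<And>\<psi> w J j. square_integrable w \<Longrightarrow> jump_pairing N a \<psi> w J \<Longrightarrow> j \<in> {1..N} \<Longrightarrow>
       cmod (J j) \<le> C * (norm \<psi> + norm (L2_of w))"
    using jump_bound[OF a] by blast
  \<comment> \<open>The 5 covers the factor 4 from the square of n + n and the factor 1 for the
    coefficient of index 0; the square of 2 C comes from the jumps.\<close>
  have "jump_decomp N (\<lambda>j k. hermite_fun k (a j)) (hcoef \<psi>) (\<lambda>j. jump (a j) \<psi>) ((5 + (2 * C)\<^sup>2) * (H1_tilde_norm N a \<psi>)\<^sup>2)"
    if \<psi>: "\<psi> \<in> H1_tilde N a" for \<psi>
  proof -
    define n where "n = H1_tilde_norm N a \<psi>"
    have n0: "n \<ge> 0" by (simp add: n_def H1_tilde_norm_nonneg)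
    obtain w W J where w: "square_integrable w" and W: "primitive W w"
      and rep: "AE x in lborel. fun_L2 \<psi> x = W x + (\<Sum>j=1..N. J j * of_bool (a j < x))"
      and wn: "(\<integral>x. (cmod (w x))\<^sup>2 \<partial>lborel) \<le> n\<^sup>2"
      using H1_tilde_representation[OF a \<psi>] unfolding n_def by blast
    have p: "jump_pairing N a \<psi> w J" by (rule jump_pairing_representation[OF w W rep])
    have x: "square_integrable (\<lambda>x. of_real x * fun_L2 \<psi> x)" using \<psi> by (simp add: H1_tilde_def)
    have nw: "norm (L2_of w) \<le> n" and n\<psi>: "norm \<psi> \<le> n" and nx: "norm (L2_of (\<lambda>x. of_real x * fun_L2 \<psi> x)) \<le> n"
      using wn H1_tilde_norm_bounds[OF x, of N a] n0
      by (auto intro!: power2_le_imp_le[of _ n] simp: norm_L2_of_power2[OF w] norm_L2_of_power2[OF x] n_def[symmetric])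
    show ?thesis
      unfolding jump_decomp_def n_def[symmetric]
    proof (intro conjI allI ballI)
      fix m
      have "(\<Sum>k<m. (cmod (of_real (sqrt (2 * real k + 2)) * hcoef \<psi> (Suc k) - (\<Sum>j=1..N. jump (a j) \<psi> * of_real (hermite_fun k (a j)))))\<^sup>2)
        = (\<Sum>k<m. (cmod (hcoef (L2_of (\<lambda>x. w x + of_real x * fun_L2 \<psi> x)) k))\<^sup>2)"
        by (simp add: hcoef_Suc_jump[OF p w x] jump_eq[OF a w p])
      also have "\<dots> \<le> (norm (L2_of (\<lambda>x. w x + of_real x * fun_L2 \<psi> x)))\<^sup>2" by (rule Bessel_finite)
      also have "\<dots> \<le> (n + n)\<^sup>2"
        unfolding L2_of_add[OF w x] by (intro power_mono order_trans[OF norm_triangle_ineq] add_mono nw nx) auto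
      also have "\<dots> \<le> (5 + (2 * C)\<^sup>2) * n\<^sup>2"
      proof -
        have "(n + n)\<^sup>2 = 4 * n\<^sup>2" by (simp add: power2_eq_square)
        also have "\<dots> \<le> (5 + (2 * C)\<^sup>2) * n\<^sup>2" by (intro mult_right_mono) (auto intro: add_increasing2)
        finally show ?thesis .
      qed
      finally show "(\<Sum>k<m. (cmod (of_real (sqrt (2 * real k + 2)) * hcoef \<psi> (Suc k) - (\<Sum>j=1..N. jump (a j) \<psi> * of_real (hermite_fun k (a j)))))\<^sup>2)
         \<le> (5 + (2 * C)\<^sup>2) * n\<^sup>2" .
    next
      fix j assume j: "j \<in> {1..N}"
      have "cmod (J j) \<le> C * (norm \<psi> + norm (L2_of w))" by (rule C(2)[OF w p j])
      also have "\<dots> \<le> C * (n + n)" by (intro mult_left_mono add_mono nw n\<psi> C(1))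
      finally have "(cmod (J j))\<^sup>2 \<le> (2 * C * n)\<^sup>2" by (intro power_mono) auto
      also have "\<dots> = (2 * C)\<^sup>2 * n\<^sup>2" by (simp add: power_mult_distrib)
      also have "\<dots> \<le> (5 + (2 * C)\<^sup>2) * n\<^sup>2" by (intro mult_right_mono) auto
      finally show "(cmod (jump (a j) \<psi>))\<^sup>2 \<le> (5 + (2 * C)\<^sup>2) * n\<^sup>2" by (simp add: jump_eq[OF a w p j])
    next
      have "(cmod (hcoef \<psi> 0))\<^sup>2 \<le> (norm \<psi>)\<^sup>2" using Bessel_finite[of \<psi> 1] by simp
      also have "\<dots> \<le> n\<^sup>2" by (intro power_mono n\<psi>) auto
      also have "\<dots> \<le> (5 + (2 * C)\<^sup>2) * n\<^sup>2"
        using mult_right_mono[of 1 "5 + (2 * C)\<^sup>2" "n\<^sup>2"] by simp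
      finally show "(cmod (hcoef \<psi> 0))\<^sup>2 \<le> (5 + (2 * C)\<^sup>2) * n\<^sup>2" .
    qed
  qed
  then show ?thesis by (intro that[of "5 + (2 * C)\<^sup>2"]) auto
qed

section \<open>Multiplication by a piecewise \<open>H\<^sup>1\<close> function\<close>

text \<open>Cauchy-Schwarz against the indicator of an interval of length at most 1.\<close>

lemma primitive_L2_increment:
  assumes W: "primitive W w" and w: "square_integrable w" and xy: "x \<le> y" "y \<le> x + 1"
  shows "cmod (W y - W x) \<le> norm (L2_of w)"
proof -
  have s: "square_integrable (\<lambda>z. complex_of_real (indicator {x..y} z))"
  proof -
    have "(\<lambda>z. complex_of_real (indicator {x..y} z)) = (\<lambda>z. 1 * indicator {x..y} z)"
      by (auto simp: indicator_def)
    then show ?thesis using square_integrable_indicator[of "{x..y}" 1] xy(1) by simp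
  qed
  have "(norm (L2_of (\<lambda>z. complex_of_real (indicator {x..y} z))))\<^sup>2 = (\<integral>z. indicator {x..y} z \<partial>lborel)"
  proof -
    have "(cmod (complex_of_real (indicator {x..y} z)))\<^sup>2 = indicator {x..y} z" for z
      by (simp add: indicator_def)
    then show ?thesis unfolding norm_L2_of_power2[OF s] by simp
  qed
  also have "\<dots> \<le> 1\<^sup>2" using xy by simp
  finally have n: "norm (L2_of (\<lambda>z. complex_of_real (indicator {x..y} z))) \<le> 1"
    by (rule power2_le_imp_le) simp
  have "W y - W x = (\<integral>z. w z * of_real (indicator {x..y} z) \<partial>lborel)"
    using primitive_diff_eq[OF W xy(1)] 
    by (simp add: set_lebesgue_integral_def scaleR_conv_of_real mult.commute)
  then have "cmod (W y - W x) \<le> norm (L2_of w) * norm (L2_of (\<lambda>z. complex_of_real (indicator {x..y} z)))"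
    using integral_mult_le_norm[OF w s] by simp
  also have "\<dots> \<le> norm (L2_of w)" using n by (intro mult_left_le) auto
  finally show ?thesis .
qed

text \<open>One-dimensional Sobolev embedding in the presence of jumps: from \<open>x\<close> to any
  point of [x, x + 1] the function changes by at most the norm of \<open>w\<close> plus the total
  jump, and averaging over that unit interval replaces the value there by the L2 norm.\<close>

lemma step_sup_bound:
  fixes J :: "nat \<Rightarrow> complex"
  assumes W: "primitive W w" and w: "square_integrable w"
    and m: "m = (\<lambda>x. W x + (\<Sum>j=1..N. J j * of_bool (a j < x)))" and sm: "square_integrable m"
  shows "(cmod (m x))\<^sup>2 \<le> 2 * (\<integral>x. (cmod (m x))\<^sup>2 \<partial>lborel) + 2 * (norm (L2_of w) + (\<Sum>j=1..N. cmod (J j)))\<^sup>2"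
proof -
  define K where "K = norm (L2_of w) + (\<Sum>j=1..N. cmod (J j))"
  have le: "cmod (m x) \<le> cmod (m y) + K" if "y \<in> {x..x+1}" for y
  proof -
    define Z where "Z = (\<Sum>j=1..N. J j * (of_bool (a j < y) - of_bool (a j < x)))"
    have "m x = m y - ((W y - W x) + Z)"
      unfolding m Z_def right_diff_distrib sum_subtractf by (simp only: algebra_simps)
    then have "cmod (m x) \<le> cmod (m y) + cmod ((W y - W x) + Z)"
      using norm_triangle_ineq4[of "m y" "(W y - W x) + Z"] by (simp only:)
    then have "cmod (m x) \<le> cmod (m y) + (cmod (W y - W x) + cmod Z)"
      using norm_triangle_ineq[of "W y - W x" Z] by linarith
    moreover have "cmod Z \<le> (\<Sum>j=1..N. cmod (J j))"
      unfolding Z_def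
    proof (rule sum_norm_le)
      show "cmod (J j * (of_bool (a j < y) - of_bool (a j < x))) \<le> cmod (J j)" for j
        by (auto simp: of_bool_def norm_mult)
    qed
    ultimately show ?thesis
      using primitive_L2_increment[OF W w, of x y] that by (simp add: K_def)
  qed
  have le2: "(cmod (m x))\<^sup>2 \<le> 2 * (cmod (m y))\<^sup>2 + 2 * K\<^sup>2" if "y \<in> {x..x+1}" for y
  proof -
    have "(cmod (m x))\<^sup>2 \<le> (cmod (m y) + K)\<^sup>2" by (rule power_mono[OF le[OF that]]) simp
    also have "\<dots> \<le> 2 * (cmod (m y))\<^sup>2 + 2 * K\<^sup>2"
      using sum_squares_bound[of "cmod (m y)" K] by (simp add: power2_sum)
    finally show ?thesis .
  qed
  have i: "integrable lborel (\<lambda>y. (cmod (m y))\<^sup>2)" by (rule square_integrableD(2)[OF sm])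
  have s: "set_integrable lborel {x..x+1} (\<lambda>y. (cmod (m y))\<^sup>2)"
    unfolding set_integrable_def by (rule integrable_mult_indicator[OF _ i]) simp
  have s2: "set_integrable lborel {x..x+1} (\<lambda>y. 2 * (cmod (m y))\<^sup>2)" by (rule set_integrable_mult_right) (rule s)
  have "(cmod (m x))\<^sup>2 = (LINT y:{x..x+1}|lborel. (cmod (m x))\<^sup>2)"
    by (simp add: set_lebesgue_integral_def)
  also have "\<dots> \<le> (LINT y:{x..x+1}|lborel. 2 * (cmod (m y))\<^sup>2 + 2 * K\<^sup>2)"
    by (rule set_integral_mono[OF set_integrable_const set_integral_add(1)[OF s2 set_integrable_const] le2])
  also have "\<dots> = 2 * (LINT y:{x..x+1}|lborel. (cmod (m y))\<^sup>2) + 2 * K\<^sup>2"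
    by (subst set_integral_add(2)[OF s2 set_integrable_const]) (simp add: set_lebesgue_integral_def)
  also have "(LINT y:{x..x+1}|lborel. (cmod (m y))\<^sup>2) \<le> (\<integral>x. (cmod (m x))\<^sup>2 \<partial>lborel)"
    unfolding set_lebesgue_integral_def using s i
    by (intro integral_mono) (auto simp: set_integrable_def indicator_def)
  finally show ?thesis by (simp add: K_def)
qed

section \<open>Finite Hermite sums and their energy\<close>

lemma L2_of_hermite_sum:
  fixes n :: nat
  shows
  "square_integrable (\<lambda>x. \<Sum>m<n. c m * of_real (hermite_fun (\<iota> m) x))"
  "L2_of (\<lambda>x. \<Sum>m<n. c m * of_real (hermite_fun (\<iota> m) x)) = (\<Sum>m<n. c m *\<^sub>c hermite_L2 (\<iota> m))"
proof (induction n)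
  case 0
  show "square_integrable (\<lambda>x. \<Sum>m<0. c m * of_real (hermite_fun (\<iota> m) x))" 
    "L2_of (\<lambda>x. \<Sum>m<0. c m * of_real (hermite_fun (\<iota> m) x)) = (\<Sum>m<0. c m *\<^sub>c hermite_L2 (\<iota> m))"
    by (simp_all add: square_integrable_zero L2_of_def zero_L2.abs_eq)
next
  case (Suc n)
  have s: "square_integrable (\<lambda>x. c n * complex_of_real (hermite_fun (\<iota> n) x))"
    by (intro square_integrable_mult_left square_integrable_hermite)
  show "square_integrable (\<lambda>x. \<Sum>m<Suc n. c m * of_real (hermite_fun (\<iota> m) x))"
    using square_integrable_add[OF Suc(1) s] by simp
  show "L2_of (\<lambda>x. \<Sum>m<Suc n. c m * of_real (hermite_fun (\<iota> m) x)) = (\<Sum>m<Suc n. c m *\<^sub>c hermite_L2 (\<iota> m))"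
    using L2_of_add[OF Suc(1) s] Suc(2) by (simp add: L2_of_scaleC square_integrable_hermite hermite_L2_def)
qed

lemma norm_hermite_sum_Suc:
  "(norm (\<Sum>m<n. c m *\<^sub>c hermite_L2 (Suc m)))\<^sup>2 = (\<Sum>m<n. (cmod (c m))\<^sup>2)"
proof -
  have "(\<Sum>m<n. c m *\<^sub>c hermite_L2 (Suc m)) = (\<Sum>m\<in>Suc ` {..<n}. c (m - 1) *\<^sub>c hermite_L2 m)"
    by (subst sum.reindex) auto
  also have "(norm \<dots>)\<^sup>2 = (\<Sum>m\<in>Suc ` {..<n}. (cmod (c (m - 1)))\<^sup>2)"
    by (rule norm_hermite_sum) simp
  also have "\<dots> = (\<Sum>m<n. (cmod (c m))\<^sup>2)" by (subst sum.reindex) auto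
  finally show ?thesis .
qed

lemma norm_hermite_sum_pred:
  assumes "c 0 = 0"
  shows "(norm (\<Sum>m<n. c m *\<^sub>c hermite_L2 (m - 1)))\<^sup>2 = (\<Sum>m<n. (cmod (c m))\<^sup>2)"
proof (cases n)
  case (Suc n')
  show ?thesis unfolding Suc sum.lessThan_Suc_shift by (simp add: assms norm_hermite_sum)
qed simp

context
  fixes c :: "nat \<Rightarrow> complex" and n :: nat
begin

definition hsum :: "real \<Rightarrow> complex" where
  "hsum x = (\<Sum>m<n. c m * of_real (hermite_fun m x))"

text \<open>The image of \<open>hsum\<close> under d/dx + x, by the lowering relation.\<close>

definition hsum_lower :: "real \<Rightarrow> complex" where
  "hsum_lower x = (\<Sum>m<n. (c m * of_real (sqrt (2 * real m))) * of_real (hermite_fun (m - 1) x))"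

text \<open>The squared norm of the finite sum in \<open>H1h\<close>.\<close>

definition hsum_energy :: real where
  "hsum_energy = (\<Sum>m<n. (2 * real m + 1) * (cmod (c m))\<^sup>2)"

lemma hsum_energy_nonneg: "hsum_energy \<ge> 0"
  unfolding hsum_energy_def by (intro sum_nonneg) auto

lemma square_integrable_hsum: "square_integrable hsum" "square_integrable hsum_lower"
  unfolding hsum_def[abs_def] hsum_lower_def[abs_def]
  using L2_of_hermite_sum(1)[of c "\<lambda>m. m" n] 
    L2_of_hermite_sum(1)[of "\<lambda>m. c m * of_real (sqrt (2 * real m))" "\<lambda>m. m - 1" n] by simp_all

lemma L2_of_hsum: "L2_of hsum = (\<Sum>m<n. c m *\<^sub>c hermite_L2 m)"
  unfolding hsum_def[abs_def] using L2_of_hermite_sum(2)[of c "\<lambda>m. m" n] by simp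

lemma norm_hsum_le: "(norm (L2_of hsum))\<^sup>2 \<le> hsum_energy"
  unfolding L2_of_hsum norm_hermite_sum[OF finite_lessThan] hsum_energy_def
  by (intro sum_mono) (simp add: mult_le_cancel_right1 distrib_right)

lemma norm_hsum_lower_le: "(norm (L2_of hsum_lower))\<^sup>2 \<le> hsum_energy"
proof -
  have "L2_of hsum_lower = (\<Sum>m<n. (c m * of_real (sqrt (2 * real m))) *\<^sub>c hermite_L2 (m - 1))"
    unfolding hsum_lower_def[abs_def] by (rule L2_of_hermite_sum(2))
  then have "(norm (L2_of hsum_lower))\<^sup>2 = (\<Sum>m<n. (cmod (c m * of_real (sqrt (2 * real m))))\<^sup>2)"
    using norm_hermite_sum_pred[of "\<lambda>m. c m * of_real (sqrt (2 * real m))" n] by simp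
  also have "\<dots> \<le> hsum_energy"
    unfolding hsum_energy_def by (intro sum_mono) (simp add: norm_mult power_mult_distrib algebra_simps)
  finally show ?thesis .
qed

text \<open>The derivative is half the difference of the lowered and the raised sum, whose squared
  norms add up to twice the energy; so it is bounded in \<open>L2\<close> by the energy, and
  \<open>step_sup_bound\<close> applies with no jumps. The 4 is 2 for the function plus 2 for its
  derivative.\<close>

lemma hsum_sup: "(cmod (hsum x))\<^sup>2 \<le> 4 * hsum_energy"
proof -
  define d where "d x = (\<Sum>m<n. c m * of_real (hermite_deriv m x))" for x
  define u where "u x = (\<Sum>m<n. (c m * of_real (sqrt (2 * real m + 2))) * of_real (hermite_fun (Suc m) x))" for x
  have su: "square_integrable u" and Lu: "L2_of u = (\<Sum>m<n. (c m * of_real (sqrt (2 * real m + 2))) *\<^sub>c hermite_L2 (Suc m))"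
    unfolding u_def[abs_def] by (rule L2_of_hermite_sum)+
  have nu: "(norm (L2_of u))\<^sup>2 = (\<Sum>m<n. (2 * real m + 2) * (cmod (c m))\<^sup>2)"
    unfolding Lu norm_hermite_sum_Suc by (intro sum.cong refl) (simp add: norm_mult power_mult_distrib)
  have nl: "(norm (L2_of hsum_lower))\<^sup>2 = (\<Sum>m<n. 2 * real m * (cmod (c m))\<^sup>2)"
  proof -
    have "L2_of hsum_lower = (\<Sum>m<n. (c m * of_real (sqrt (2 * real m))) *\<^sub>c hermite_L2 (m - 1))"
      unfolding hsum_lower_def[abs_def] by (rule L2_of_hermite_sum(2))
    then show ?thesis
      using norm_hermite_sum_pred[of "\<lambda>m. c m * of_real (sqrt (2 * real m))" n]
      by (simp add: norm_mult power_mult_distrib mult.commute)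
  qed
  \<comment> \<open>Averages the lowering and the raising form of the derivative, with
    \<open>y\<close> standing for the product of \<open>x\<close> and the Hermite function.\<close>
  have average: "r = p - y \<Longrightarrow> r = y - q \<Longrightarrow> r = (1/2) * (p - q)" for p q r y :: real by simp
  have de: "d x = (1/2) * (hsum_lower x - u x)" for x
  proof -
    have dm: "of_real (hermite_deriv m x) = (1/2) * (complex_of_real (sqrt (2 * real m)) * of_real (hermite_fun (m - 1) x)
        - of_real (sqrt (2 * real m + 2)) * of_real (hermite_fun (Suc m) x))" for m
    proof -
      have "hermite_deriv m x = (1/2) * (sqrt (2 * real m) * hermite_fun (m - 1) x - sqrt (2 * real m + 2) * hermite_fun (Suc m) x)"
        by (rule average[OF hermite_deriv_eq hermite_deriv_def])
      then show ?thesis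
        by (simp only: of_real_mult of_real_diff of_real_divide of_real_1 of_real_numeral)
    qed
    show ?thesis
      unfolding d_def dm hsum_lower_def u_def sum_subtractf[symmetric] sum_distrib_left
      by (intro sum.cong refl) (simp add: algebra_simps)
  qed
  have sd: "square_integrable d"
    unfolding de[abs_def] by (intro square_integrable_mult_left square_integrable_diff square_integrable_hsum su)
  have "L2_of d = (1/2) *\<^sub>c (L2_of hsum_lower - L2_of u)"
    unfolding de[abs_def] L2_of_scaleC[OF square_integrable_diff[OF square_integrable_hsum(2) su]]
      L2_of_diff[OF square_integrable_hsum(2) su] ..
  then have "norm (L2_of d) \<le> (1/2) * (norm (L2_of hsum_lower) + norm (L2_of u))"
    using norm_triangle_ineq4[of "L2_of hsum_lower" "L2_of u"] by (simp add: norm_scaleC)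
  then have "(norm (L2_of d))\<^sup>2 \<le> ((1/2) * (norm (L2_of hsum_lower) + norm (L2_of u)))\<^sup>2"
    by (intro power_mono) auto
  also have "\<dots> \<le> (1/2) * ((norm (L2_of hsum_lower))\<^sup>2 + (norm (L2_of u))\<^sup>2)"
    using sum_squares_bound[of "norm (L2_of hsum_lower)" "norm (L2_of u)"]
    by (simp add: power_mult_distrib power2_sum power_divide)
  also have "\<dots> = hsum_energy"
    unfolding nu nl hsum_energy_def sum.distrib[symmetric] sum_distrib_left
    by (intro sum.cong refl) (simp add: algebra_simps)
  finally have nd: "(norm (L2_of d))\<^sup>2 \<le> hsum_energy" .
  have prim: "primitive hsum d"
    unfolding hsum_def[abs_def] d_def[abs_def]
  proof (induction n)
    case 0
    show ?case using primitive_const[of 0] by simp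
  next
    case (Suc n)
    have "primitive (\<lambda>x. c n * complex_of_real (hermite_fun n x)) (\<lambda>x. c n * complex_of_real (hermite_deriv n x))"
      by (rule primitive_bounded_linear[OF bounded_linear_mult_right primitive_of_real[OF gauss_C1_primitive[OF gauss_C1_hermite]]])
    from primitive_add[OF Suc this] show ?case by simp
  qed
  have "(cmod (hsum x))\<^sup>2 \<le> 2 * (\<integral>x. (cmod (hsum x))\<^sup>2 \<partial>lborel) + 2 * (norm (L2_of d) + (\<Sum>j=1..(0::nat). cmod (0::complex)))\<^sup>2"
    by (rule step_sup_bound[OF prim sd, where m = hsum and N = 0 and J = "\<lambda>_. 0"]) (simp_all add: square_integrable_hsum)
  also have "\<dots> = 2 * (norm (L2_of hsum))\<^sup>2 + 2 * (norm (L2_of d))\<^sup>2"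
    by (simp add: norm_L2_of_power2 square_integrable_hsum)
  also have "\<dots> \<le> 4 * hsum_energy" using nd norm_hsum_le by linarith
  finally show ?thesis .
qed

end

lemma square_integrable_mult_bounded:
  assumes "AE x in lborel. cmod (f x) \<le> B" "f \<in> borel_measurable borel" "square_integrable g"
  shows "square_integrable (\<lambda>x. f x * g x)"
    "(\<integral>x. (cmod (f x * g x))\<^sup>2 \<partial>lborel) \<le> B\<^sup>2 * (\<integral>x. (cmod (g x))\<^sup>2 \<partial>lborel)"
proof -
  have [measurable]: "f \<in> borel_measurable borel" "g \<in> borel_measurable borel"
    using assms by (simp_all add: square_integrable_def)
  have le: "AE x in lborel. (cmod (f x * g x))\<^sup>2 \<le> B\<^sup>2 * (cmod (g x))\<^sup>2"
    using assms(1)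
  proof eventually_elim
    case (elim x)
    then show ?case
      using power_mono[OF elim, of 2] by (simp add: norm_mult power_mult_distrib mult_right_mono)
  qed
  have i: "integrable lborel (\<lambda>x. B\<^sup>2 * (cmod (g x))\<^sup>2)"
    using assms(3) by (intro integrable_mult_right square_integrableD)
  have i2: "integrable lborel (\<lambda>x. (cmod (f x * g x))\<^sup>2)"
    by (rule Bochner_Integration.integrable_bound[OF i]) (use le in auto)
  then show "square_integrable (\<lambda>x. f x * g x)" by (simp add: square_integrable_def)
  have "(\<integral>x. (cmod (f x * g x))\<^sup>2 \<partial>lborel) \<le> (\<integral>x. B\<^sup>2 * (cmod (g x))\<^sup>2 \<partial>lborel)"
    by (rule integral_mono_AE[OF i2 i le])
  then show "(\<integral>x. (cmod (f x * g x))\<^sup>2 \<partial>lborel) \<le> B\<^sup>2 * (\<integral>x. (cmod (g x))\<^sup>2 \<partial>lborel)" by simp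
qed

text \<open>The decomposition into primitive and steps meets \<open>step_sup_bound\<close>.
  Boundedness guarantees that \<open>mult_L2\<close> with this factor is the true product and not
  the default 0 of \<open>L2_of\<close>.\<close>

lemma H1_tilde_bounded:
  assumes a: "strict_mono_on {1..N} a" and \<mu>: "\<mu> \<in> H1_tilde N a"
  shows "\<exists>B\<ge>0. AE x in lborel. cmod (fun_L2 \<mu> x) \<le> B"
proof -
  obtain w W J where w: "square_integrable w" and W: "primitive W w"
    and rep: "AE x in lborel. fun_L2 \<mu> x = W x + (\<Sum>j=1..N. J j * of_bool (a j < x))"
    using H1_tilde_representation[OF a \<mu>] by blast
  define m where "m = (\<lambda>x. W x + (\<Sum>j=1..N. J j * of_bool (a j < x)))"
  have [measurable]: "W \<in> borel_measurable borel" by (rule primitive_measurable[OF W])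
  have mm: "m \<in> borel_measurable borel" unfolding m_def by measurable
  have rep': "AE x in lborel. fun_L2 \<mu> x = m x" using rep by (simp only: m_def)
  have "integrable lborel (\<lambda>x. (cmod (m x))\<^sup>2) \<longleftrightarrow> integrable lborel (\<lambda>x. (cmod (fun_L2 \<mu> x))\<^sup>2)"
    by (rule integrable_cong_AE) (use mm rep' in \<open>auto elim: eventually_mono\<close>)
  then have sm: "square_integrable m"
    using mm square_integrableD(2)[OF square_integrable_fun_L2[of \<mu>]] by (simp add: square_integrable_def)
  define K where "K = 2 * (\<integral>x. (cmod (m x))\<^sup>2 \<partial>lborel) + 2 * (norm (L2_of w) + (\<Sum>j=1..N. cmod (J j)))\<^sup>2"
  have "(cmod (m x))\<^sup>2 \<le> K" for x
    unfolding K_def by (rule step_sup_bound[OF W w m_def sm])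
  then have "cmod (m x) \<le> sqrt K" for x by (rule real_le_rsqrt)
  moreover have "K \<ge> 0" unfolding K_def by (intro add_nonneg_nonneg mult_nonneg_nonneg Bochner_Integration.integral_nonneg) auto
  ultimately show ?thesis using rep' by (intro exI[of _ "sqrt K"]) (auto elim: eventually_mono)
qed

lemma mult_L2_bounded:
  assumes B: "AE x in lborel. cmod (fun_L2 \<mu> x) \<le> B" "B \<ge> 0"
  shows "fun_L2 (mult_L2 \<mu> \<psi>) = fun_L2 (L2_of (\<lambda>x. fun_L2 \<mu> x * fun_L2 \<psi> x))"
    "AE x in lborel. fun_L2 (mult_L2 \<mu> \<psi>) x = fun_L2 \<mu> x * fun_L2 \<psi> x"
    "norm (mult_L2 \<mu> \<psi>) \<le> B * norm \<psi>"
    "bounded_linear (mult_L2 \<mu>)"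
proof -
  note s = square_integrable_mult_bounded[OF B(1) fun_L2_borel square_integrable_fun_L2]
  show "fun_L2 (mult_L2 \<mu> \<psi>) = fun_L2 (L2_of (\<lambda>x. fun_L2 \<mu> x * fun_L2 \<psi> x))" by (simp add: mult_L2_def)
  show "AE x in lborel. fun_L2 (mult_L2 \<mu> \<psi>) x = fun_L2 \<mu> x * fun_L2 \<psi> x"
    unfolding mult_L2_def by (rule fun_L2_L2_of[OF s(1)])
  have n: "norm (mult_L2 \<mu> \<psi>) \<le> B * norm \<psi>" for \<psi>
  proof (rule power2_le_imp_le)
    have "(norm (mult_L2 \<mu> \<psi>))\<^sup>2 = (\<integral>x. (cmod (fun_L2 \<mu> x * fun_L2 \<psi> x))\<^sup>2 \<partial>lborel)"
      unfolding mult_L2_def by (rule norm_L2_of_power2[OF s(1)])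
    also have "\<dots> \<le> B\<^sup>2 * (\<integral>x. (cmod (fun_L2 \<psi> x))\<^sup>2 \<partial>lborel)" by (rule s(2))
    finally show "(norm (mult_L2 \<mu> \<psi>))\<^sup>2 \<le> (B * norm \<psi>)\<^sup>2"
      by (simp only: power_mult_distrib power2_norm_L2)
  qed (use B in simp)
  then show "norm (mult_L2 \<mu> \<psi>) \<le> B * norm \<psi>" .
  show "bounded_linear (mult_L2 \<mu>)"
  proof (rule bounded_linear_intro[where K = B])
    show "mult_L2 \<mu> (\<psi> + \<psi>') = mult_L2 \<mu> \<psi> + mult_L2 \<mu> \<psi>'" for \<psi> \<psi>'
    proof -
      have "mult_L2 \<mu> (\<psi> + \<psi>') = L2_of (\<lambda>x. fun_L2 \<mu> x * fun_L2 \<psi> x + fun_L2 \<mu> x * fun_L2 \<psi>' x)"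
        unfolding mult_L2_def
        by (subst L2_of_eq_iff[OF s(1) square_integrable_add[OF s(1) s(1)]])
          (use fun_L2_add[of \<psi> \<psi>'] in \<open>eventually_elim, simp add: distrib_left\<close>)
      then show ?thesis by (simp add: mult_L2_def L2_of_add s(1))
    qed
    show "mult_L2 \<mu> (r *\<^sub>R \<psi>) = r *\<^sub>R mult_L2 \<mu> \<psi>" for r \<psi>
    proof -
      have "mult_L2 \<mu> (r *\<^sub>R \<psi>) = L2_of (\<lambda>x. of_real r * (fun_L2 \<mu> x * fun_L2 \<psi> x))"
        unfolding mult_L2_def scaleR_L2_eq
        by (subst L2_of_eq_iff[OF s(1) square_integrable_mult_left[OF s(1)]])
          (use fun_L2_scaleC[of "of_real r" \<psi>] in \<open>eventually_elim, simp\<close>)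
      then show ?thesis by (simp add: mult_L2_def L2_of_scaleR s(1))
    qed
  qed (use n in \<open>simp add: mult.commute\<close>)
qed

text \<open>Product rule for \<mu> times a Hermite sum: the derivative of \<mu> is tested with
  products of two Hermite functions. The regular part \<open>h\<close> is w \<psi> + \<mu> (\<psi>'
  + x \<psi>), and the jumps of the product are those of \<mu> times the values of the sum.\<close>

lemma jump_pairing_hermite_product:
  fixes c :: "nat \<Rightarrow> complex" and n k :: nat
  assumes p: "jump_pairing N a \<mu> w J" and w: "square_integrable w"
    and B: "AE x in lborel. cmod (fun_L2 \<mu> x) \<le> B" "B \<ge> 0"
  defines "h \<equiv> \<lambda>x. w x * hsum c n x + fun_L2 \<mu> x * hsum_lower c n x"
  shows "square_integrable h"
    "(norm (L2_of h))\<^sup>2 \<le> (8 * (norm (L2_of w))\<^sup>2 + 2 * B\<^sup>2) * hsum_energy c n"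
    "of_real (sqrt (2 * real k + 2)) * hcoef (mult_L2 \<mu> (\<Sum>m<n. c m *\<^sub>c hermite_L2 m)) (Suc k)
      = hcoef (L2_of h) k + (\<Sum>j=1..N. (J j * hsum c n (a j)) * of_real (hermite_fun k (a j)))"
proof -
  define v where "v = fun_L2 \<mu>"
  define E where "E = hsum_energy c n"
  have E: "E \<ge> 0" by (simp add: E_def hsum_energy_nonneg)
  have sh: "square_integrable (hsum c n)" "square_integrable (hsum_lower c n)" by (rule square_integrable_hsum)+
  have hm: "hsum c n \<in> borel_measurable borel" using sh(1) by (simp add: square_integrable_def)
  have "cmod (hsum c n x) \<le> sqrt (4 * E)" for x
    using hsum_sup unfolding E_def by (rule real_le_rsqrt)
  \<comment> \<open>In the first product the Hermite sum is the bounded factor, in the second one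
    \<mu> is.\<close>
  then have b1: "AE x in lborel. cmod (hsum c n x) \<le> sqrt (4 * E)" by simp
  note s1 = square_integrable_mult_bounded[OF b1 hm w, unfolded mult.commute[of "hsum c n _"]]
  note s2 = square_integrable_mult_bounded[OF B(1) fun_L2_borel sh(2)]
  show h: "square_integrable h" unfolding h_def by (rule square_integrable_add[OF s1(1) s2(1)])
  have "norm (L2_of h) \<le> norm (L2_of (\<lambda>x. w x * hsum c n x)) + norm (L2_of (\<lambda>x. fun_L2 \<mu> x * hsum_lower c n x))"
    unfolding h_def L2_of_add[OF s1(1) s2(1)] by (rule norm_triangle_ineq)
  then have "(norm (L2_of h))\<^sup>2 \<le> (norm (L2_of (\<lambda>x. w x * hsum c n x)) + norm (L2_of (\<lambda>x. fun_L2 \<mu> x * hsum_lower c n x)))\<^sup>2"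
    by (intro power_mono) auto
  also have "\<dots> \<le> 2 * (norm (L2_of (\<lambda>x. w x * hsum c n x)))\<^sup>2 + 2 * (norm (L2_of (\<lambda>x. fun_L2 \<mu> x * hsum_lower c n x)))\<^sup>2"
    using sum_squares_bound[of "norm (L2_of (\<lambda>x. w x * hsum c n x))" "norm (L2_of (\<lambda>x. fun_L2 \<mu> x * hsum_lower c n x))"]
    by (simp add: power2_sum)
  also have "\<dots> \<le> 2 * (4 * E * (norm (L2_of w))\<^sup>2) + 2 * (B\<^sup>2 * E)"
  proof (intro add_mono mult_left_mono)
    show "(norm (L2_of (\<lambda>x. w x * hsum c n x)))\<^sup>2 \<le> 4 * E * (norm (L2_of w))\<^sup>2"
      unfolding norm_L2_of_power2[OF s1(1)] norm_L2_of_power2[OF w] using s1(2) E by simp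
    have "(norm (L2_of (\<lambda>x. fun_L2 \<mu> x * hsum_lower c n x)))\<^sup>2 \<le> B\<^sup>2 * (norm (L2_of (hsum_lower c n)))\<^sup>2"
      unfolding norm_L2_of_power2[OF s2(1)] norm_L2_of_power2[OF sh(2)] by (rule s2(2))
    also have "\<dots> \<le> B\<^sup>2 * E" unfolding E_def by (intro mult_left_mono norm_hsum_lower_le) simp
    finally show "(norm (L2_of (\<lambda>x. fun_L2 \<mu> x * hsum_lower c n x)))\<^sup>2 \<le> B\<^sup>2 * E" .
  qed auto
  finally show "(norm (L2_of h))\<^sup>2 \<le> (8 * (norm (L2_of w))\<^sup>2 + 2 * B\<^sup>2) * hsum_energy c n"
    by (simp add: E_def algebra_simps)
  define s where "s = complex_of_real (sqrt (2 * real k + 2))"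
  have gc: "gauss_C1 (\<lambda>x. hermite_fun m x * hermite_fun k x)
      (\<lambda>x. hermite_deriv m x * hermite_fun k x + hermite_fun m x * hermite_deriv k x)" for m k
    by (rule gauss_C1_mult[OF gauss_C1_hermite gauss_C1_hermite])
  have iv: "integrable lborel (\<lambda>x. v x * of_real (hermite_fun m x * hermite_fun k x))" for m k
    unfolding v_def by (rule integrable_mult_square[OF square_integrable_fun_L2 gauss_C1_square_integrable(1)[OF gc]])
  have iw: "integrable lborel (\<lambda>x. w x * of_real (hermite_fun m x * hermite_fun k x))" for m k
    by (rule integrable_mult_square[OF w gauss_C1_square_integrable(1)[OF gc]])
  have base: "s * (\<integral>x. v x * of_real (hermite_fun m x * hermite_fun (Suc k) x) \<partial>lborel)
    = of_real (sqrt (2 * real m)) * (\<integral>x. v x * of_real (hermite_fun (m - 1) x * hermite_fun k x) \<partial>lborel)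
      + (\<integral>x. w x * of_real (hermite_fun m x * hermite_fun k x) \<partial>lborel)
      + (\<Sum>j=1..N. J j * of_real (hermite_fun m (a j) * hermite_fun k (a j)))" for m
  proof -
    \<comment> \<open>Lowering \<open>m\<close> while raising \<open>k\<close> cancels the terms
      with \<open>x\<close>. The raised term is the sought pairing at index
      \<open>Suc k\<close>.\<close>
    have q: "hermite_deriv m x * hermite_fun k x + hermite_fun m x * hermite_deriv k x
      = sqrt (2 * real m) * (hermite_fun (m - 1) x * hermite_fun k x) - sqrt (2 * real k + 2) * (hermite_fun m x * hermite_fun (Suc k) x)" for x
      unfolding hermite_deriv_eq[of m] hermite_deriv_def[of k] by (simp add: algebra_simps)
    have e: "v x * of_real (hermite_deriv m x * hermite_fun k x + hermite_fun m x * hermite_deriv k x)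
      = of_real (sqrt (2 * real m)) * (v x * of_real (hermite_fun (m - 1) x * hermite_fun k x))
        - s * (v x * of_real (hermite_fun m x * hermite_fun (Suc k) x))" for x
      unfolding q by (simp add: s_def algebra_simps)
    have "(\<integral>x. v x * of_real (hermite_deriv m x * hermite_fun k x + hermite_fun m x * hermite_deriv k x) \<partial>lborel)
      = - (\<integral>x. w x * of_real (hermite_fun m x * hermite_fun k x) \<partial>lborel) - (\<Sum>j=1..N. J j * of_real (hermite_fun m (a j) * hermite_fun k (a j)))"
      using p gc[of m k] unfolding jump_pairing_def v_def by blast
    moreover have "(\<integral>x. v x * of_real (hermite_deriv m x * hermite_fun k x + hermite_fun m x * hermite_deriv k x) \<partial>lborel)
      = of_real (sqrt (2 * real m)) * (\<integral>x. v x * of_real (hermite_fun (m - 1) x * hermite_fun k x) \<partial>lborel)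
        - s * (\<integral>x. v x * of_real (hermite_fun m x * hermite_fun (Suc k) x) \<partial>lborel)"
      unfolding e using iv by (simp del: of_real_mult)
    moreover have "p = - q - r \<Longrightarrow> p = y - z \<Longrightarrow> z = y + q + r" for p q r y z :: complex by algebra
    ultimately show ?thesis by blast
  qed
  have prod: "hcoef (mult_L2 \<mu> (\<Sum>m<n. c m *\<^sub>c hermite_L2 m)) i = (\<Sum>m<n. c m * (\<integral>x. v x * of_real (hermite_fun m x * hermite_fun i x) \<partial>lborel))" for i
  proof -
    have "hcoef (mult_L2 \<mu> (\<Sum>m<n. c m *\<^sub>c hermite_L2 m)) i = (\<integral>x. (\<Sum>m<n. c m * (v x * of_real (hermite_fun m x * hermite_fun i x))) \<partial>lborel)"
      unfolding hcoef_eq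
    proof (rule Bochner_Integration.integral_cong_AE)
      have "AE x in lborel. fun_L2 (\<Sum>m<n. c m *\<^sub>c hermite_L2 m) x = hsum c n x"
        using fun_L2_L2_of[OF sh(1)] by (simp add: L2_of_hsum)
      with mult_L2_bounded(2)[OF B, of "\<Sum>m<n. c m *\<^sub>c hermite_L2 m"]
      show "AE x in lborel. fun_L2 (mult_L2 \<mu> (\<Sum>m<n. c m *\<^sub>c hermite_L2 m)) x * of_real (hermite_fun i x) = (\<Sum>m<n. c m * (v x * of_real (hermite_fun m x * hermite_fun i x)))"
        by eventually_elim (simp add: hsum_def v_def sum_distrib_left sum_distrib_right mult_ac)
      show "(\<lambda>x. \<Sum>m<n. c m * (v x * of_real (hermite_fun m x * hermite_fun i x))) \<in> borel_measurable lborel"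
        unfolding v_def by measurable
    qed measurable
    then show ?thesis using iv by (simp del: of_real_mult)
  qed
  have "hcoef (L2_of h) k = (\<integral>x. h x * of_real (hermite_fun k x) \<partial>lborel)"
    unfolding hermite_L2_def by (subst cinner_L2_of[OF h square_integrable_hermite]) simp
  also have "\<dots> = (\<integral>x. (\<Sum>m<n. c m * (w x * of_real (hermite_fun m x * hermite_fun k x)) + 
      c m * of_real (sqrt (2 * real m)) * (v x * of_real (hermite_fun (m - 1) x * hermite_fun k x))) \<partial>lborel)"
    by (intro Bochner_Integration.integral_cong refl)
      (simp only: h_def hsum_def hsum_lower_def v_def sum_distrib_left sum_distrib_right distrib_right sum.distrib,
        simp add: mult_ac)
  also have "\<dots> = (\<Sum>m<n. c m * (\<integral>x. w x * of_real (hermite_fun m x * hermite_fun k x) \<partial>lborel) + 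
      c m * of_real (sqrt (2 * real m)) * (\<integral>x. v x * of_real (hermite_fun (m - 1) x * hermite_fun k x) \<partial>lborel))"
    using iv iw by (simp del: of_real_mult)
  finally have hk: "hcoef (L2_of h) k = \<dots>" .
  have jj: "(\<Sum>j=1..N. (J j * hsum c n (a j)) * of_real (hermite_fun k (a j))) = (\<Sum>m<n. c m * (\<Sum>j=1..N. J j * of_real (hermite_fun m (a j) * hermite_fun k (a j))))"
    unfolding hsum_def sum_distrib_left sum_distrib_right by (subst sum.swap) (simp add: mult_ac)
  show "of_real (sqrt (2 * real k + 2)) * hcoef (mult_L2 \<mu> (\<Sum>m<n. c m *\<^sub>c hermite_L2 m)) (Suc k)
      = hcoef (L2_of h) k + (\<Sum>j=1..N. (J j * hsum c n (a j)) * of_real (hermite_fun k (a j)))"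
    unfolding prod hk jj s_def[symmetric] sum_distrib_left sum.distrib[symmetric]
  proof (intro sum.cong refl)
    fix m
    show "s * (c m * (\<integral>x. v x * of_real (hermite_fun m x * hermite_fun (Suc k) x) \<partial>lborel))
      = c m * (\<integral>x. w x * of_real (hermite_fun m x * hermite_fun k x) \<partial>lborel) 
        + c m * of_real (sqrt (2 * real m)) * (\<integral>x. v x * of_real (hermite_fun (m - 1) x * hermite_fun k x) \<partial>lborel)
        + (\<Sum>j=1..N. c m * (J j * of_real (hermite_fun m (a j) * hermite_fun k (a j))))"
      unfolding sum_distrib_left[symmetric] using arg_cong[OF base[of m], of "\<lambda>z. c m * z"]
      by (simp add: algebra_simps del: of_real_mult)
  qed
qed

text \<open>Neither the constant nor the jumps depend on \<open>c\<close> or \<open>n\<close>, which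
  is what a passage to infinite Hermite series requires.\<close>

lemma mult_L2_jump_decomp:
  assumes a: "strict_mono_on {1..N} a" and \<mu>: "\<mu> \<in> H1_tilde N a"
  obtains C J where "C \<ge> 0" "\<And>c n.
     jump_decomp N (\<lambda>j k. hermite_fun k (a j)) (hcoef (mult_L2 \<mu> (\<Sum>m<n. c m *\<^sub>c hermite_L2 m)))
       (\<lambda>j. J j * hsum c n (a j)) (C * hsum_energy c n)"
proof -
  obtain w W J where w: "square_integrable w" and W: "primitive W w"
    and rep: "AE x in lborel. fun_L2 \<mu> x = W x + (\<Sum>j=1..N. J j * of_bool (a j < x))"
    using H1_tilde_representation[OF a \<mu>] by blast
  have p: "jump_pairing N a \<mu> w J" by (rule jump_pairing_representation[OF w W rep])
  obtain B where B: "AE x in lborel. cmod (fun_L2 \<mu> x) \<le> B" "B \<ge> 0" using H1_tilde_bounded[OF a \<mu>] by blast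
  define S where "S = (\<Sum>j=1..N. (cmod (J j))\<^sup>2)"
  have S: "(cmod (J j))\<^sup>2 \<le> S" if "j \<in> {1..N}" for j
    unfolding S_def using that by (intro member_le_sum) auto
  have S0: "S \<ge> 0" unfolding S_def by (intro sum_nonneg) auto
  define C where "C = 8 * (norm (L2_of w))\<^sup>2 + 2 * B\<^sup>2 + 4 * S"
  have "jump_decomp N (\<lambda>j k. hermite_fun k (a j)) (hcoef (mult_L2 \<mu> (\<Sum>m<n. c m *\<^sub>c hermite_L2 m)))
       (\<lambda>j. J j * hsum c n (a j)) (C * hsum_energy c n)" for c n
  proof -
    define h where "h x = w x * hsum c n x + fun_L2 \<mu> x * hsum_lower c n x" for x
    note P = jump_pairing_hermite_product[OF p w B, where c = c and n = n, folded h_def[abs_def]]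
    define E where "E = hsum_energy c n"
    have E: "E \<ge> 0" by (simp add: E_def hsum_energy_nonneg)
    have CE: "(8 * (norm (L2_of w))\<^sup>2 + 2 * B\<^sup>2) * E \<le> C * E" "4 * S * E \<le> C * E" "B\<^sup>2 * E \<le> C * E"
      using E S0 by (auto simp: C_def intro!: mult_right_mono)
    show ?thesis
      unfolding jump_decomp_def E_def[symmetric]
    proof (intro conjI allI ballI)
      fix m
      have "(\<Sum>k<m. (cmod (of_real (sqrt (2 * real k + 2)) * hcoef (mult_L2 \<mu> (\<Sum>m<n. c m *\<^sub>c hermite_L2 m)) (Suc k) - (\<Sum>j=1..N. J j * hsum c n (a j) * of_real (hermite_fun k (a j)))))\<^sup>2)
        = (\<Sum>k<m. (cmod (hcoef (L2_of h) k))\<^sup>2)"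
        unfolding P(3) by simp
      also have "\<dots> \<le> (norm (L2_of h))\<^sup>2" by (rule Bessel_finite)
      also have "\<dots> \<le> C * E" using P(2) CE(1) unfolding E_def by linarith
      finally show "(\<Sum>k<m. (cmod (of_real (sqrt (2 * real k + 2)) * hcoef (mult_L2 \<mu> (\<Sum>m<n. c m *\<^sub>c hermite_L2 m)) (Suc k) - (\<Sum>j=1..N. J j * hsum c n (a j) * of_real (hermite_fun k (a j)))))\<^sup>2) \<le> C * E" .
    next
      fix j assume j: "j \<in> {1..N}"
      have "(cmod (J j * hsum c n (a j)))\<^sup>2 \<le> S * (4 * E)"
        unfolding norm_mult power_mult_distrib E_def using S[OF j] S0 hsum_sup by (intro mult_mono) auto
      then show "(cmod (J j * hsum c n (a j)))\<^sup>2 \<le> C * E" using CE(2) by simp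
    next
      have "(cmod (hcoef (mult_L2 \<mu> (\<Sum>m<n. c m *\<^sub>c hermite_L2 m)) 0))\<^sup>2 \<le> (norm (mult_L2 \<mu> (\<Sum>m<n. c m *\<^sub>c hermite_L2 m)))\<^sup>2"
        using Bessel_finite[of _ 1] by simp
      also have "\<dots> \<le> (B * norm (\<Sum>m<n. c m *\<^sub>c hermite_L2 m))\<^sup>2"
        by (intro power_mono mult_L2_bounded(3)[OF B]) simp
      also have "\<dots> \<le> B\<^sup>2 * E"
        unfolding power_mult_distrib E_def L2_of_hsum[symmetric] by (intro mult_left_mono norm_hsum_le) simp
      also have "\<dots> \<le> C * E" by (rule CE)
      finally show "(cmod (hcoef (mult_L2 \<mu> (\<Sum>m<n. c m *\<^sub>c hermite_L2 m)) 0))\<^sup>2 \<le> C * E" .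
    qed
  qed
  moreover have "C \<ge> 0" using S0 by (simp add: C_def)
  ultimately show ?thesis using that by blast
qed

section \<open>Smoothing by the Duhamel integral\<close>

text \<open>The frequencies differ by the even number 2 (k - l), so \<pi> is a common period of the
  products; any number of periods may be used to cover the time interval.\<close>

lemma phase_orthogonal:
  "(LINT s:{0..real n * pi}|lborel. phase (- s) k * cnj (phase (- s) l)) = (if k = l then of_real (real n * pi) else 0)"
proof (cases "k = l")
  case True
  have "phase (- s) k * cnj (phase (- s) k) = 1" for s
    by (simp add: complex_norm_square[symmetric])
  then show ?thesis using True by (simp add: set_lebesgue_integral_def scaleR_conv_of_real)
next
  case False
  define d where "d = 2 * (real k - real l)"
  have d: "d \<noteq> 0" using False by (simp add: d_def)
  have e: "phase (- s) k * cnj (phase (- s) l) = exp (\<i> * of_real (d * s))" for s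
    by (simp add: phase_def exp_cnj d_def algebra_simps flip: exp_add)
  have p: "primitive (\<lambda>s. exp (\<i> * of_real (d * s)) / (\<i> * of_real d)) (\<lambda>s. exp (\<i> * of_real (d * s)))"
  proof (rule primitive_FTC)
    fix s
    have "((\<lambda>z. exp (\<i> * (of_real d * z)) / (\<i> * of_real d)) has_field_derivative exp (\<i> * (of_real d * of_real s))) (at (of_real s))"
      using d by (auto intro!: derivative_eq_intros simp: mult_ac)
    then have "((\<lambda>s. exp (\<i> * (of_real d * of_real s)) / (\<i> * of_real d)) has_vector_derivative exp (\<i> * (of_real d * of_real s))) (at s)"
      by (rule has_vector_derivative_real_field)
    then show "((\<lambda>s. exp (\<i> * of_real (d * s)) / (\<i> * of_real d)) has_vector_derivative exp (\<i> * of_real (d * s))) (at s)"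
      by simp
  qed (intro continuous_intros)
  have "exp (\<i> * of_real (d * (real n * pi))) = 1"
    unfolding exp_eq_1
    by (auto simp: d_def intro!: exI[of _ "(int k - int l) * int n"])
  then show ?thesis
    unfolding e using primitive_diff_eq[OF p, of 0 "real n * pi"] False by simp
qed

lemma phase_continuous: "continuous_on A (\<lambda>s. phase (- s) k)"
  unfolding phase_def by (intro continuous_intros)

text \<open>The integrand is nonnegative, so \<open>S\<close> may be enlarged to full periods, where
  orthogonality evaluates the integral exactly.\<close>

lemma trig_sum_bound:
  assumes A: "finite A" and S: "S \<in> sets lebesgue" "S \<subseteq> {0..real n * pi}"
  shows "(\<integral>s. (cmod (\<Sum>k\<in>A. c k * phase (- s) k))\<^sup>2 \<partial>lebesgue_on S) \<le> real n * pi * (\<Sum>k\<in>A. (cmod (c k))\<^sup>2)"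
    "integrable (lebesgue_on S) (\<lambda>s. (cmod (\<Sum>k\<in>A. c k * phase (- s) k))\<^sup>2)"
proof -
  define q where "q s = (\<Sum>k\<in>A. c k * phase (- s) k)" for s
  define I where "I = {0..real n * pi}"
  have cq: "continuous_on B q" for B unfolding q_def by (intro continuous_intros phase_continuous)
  have si: "set_integrable lborel I (\<lambda>s. (cmod (q s))\<^sup>2)"
    unfolding I_def by (intro borel_integrable_atLeastAtMost' continuous_intros cq)
  have "complex_of_real (LINT s:I|lborel. (cmod (q s))\<^sup>2) = (LINT s:I|lborel. complex_of_real ((cmod (q s))\<^sup>2))"
    by (rule set_integral_complex_of_real[symmetric])
  also have "\<dots> = (LINT s:I|lborel. (\<Sum>k\<in>A. \<Sum>l\<in>A. c k * cnj (c l) * (phase (- s) k * cnj (phase (- s) l))))"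
  proof (rule arg_cong[where f = "set_lebesgue_integral lborel I"], rule ext)
    fix s
    have "complex_of_real ((cmod (q s))\<^sup>2) = q s * cnj (q s)" by (simp add: complex_norm_square[symmetric])
    also have "\<dots> = (\<Sum>k\<in>A. \<Sum>l\<in>A. c k * cnj (c l) * (phase (- s) k * cnj (phase (- s) l)))"
      unfolding q_def cnj_sum sum_product by (intro sum.cong refl) simp
    finally show "complex_of_real ((cmod (q s))\<^sup>2) = (\<Sum>k\<in>A. \<Sum>l\<in>A. c k * cnj (c l) * (phase (- s) k * cnj (phase (- s) l)))" .
  qed
  also have "\<dots> = (\<Sum>k\<in>A. \<Sum>l\<in>A. c k * cnj (c l) * (LINT s:I|lborel. phase (- s) k * cnj (phase (- s) l)))"
  proof -
    have i: "set_integrable lborel I (\<lambda>s. c k * cnj (c l) * (phase (- s) k * cnj (phase (- s) l)))" for k l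
      unfolding I_def by (intro borel_integrable_atLeastAtMost' continuous_intros phase_continuous)
    have i2: "set_integrable lborel I (\<lambda>s. \<Sum>l\<in>A. c k * cnj (c l) * (phase (- s) k * cnj (phase (- s) l)))" for k
      unfolding I_def by (intro borel_integrable_atLeastAtMost' continuous_intros phase_continuous)
    have ss: "(LINT s:I|lborel. (\<Sum>k\<in>A. f k s)) = (\<Sum>k\<in>A. LINT s:I|lborel. f k s)"
      if "\<And>k. set_integrable lborel I (f k)" for f :: "nat \<Rightarrow> real \<Rightarrow> complex"
      using that unfolding set_lebesgue_integral_def set_integrable_def scaleR_sum_right
      by (intro Bochner_Integration.integral_sum)
    show ?thesis
      by (simp only: ss[OF i2] ss[OF i] set_integral_mult_right)
  qed
  also have "\<dots> = (\<Sum>k\<in>A. c k * cnj (c k) * of_real (real n * pi))"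
    using A by (intro sum.cong refl) (simp add: I_def phase_orthogonal if_distrib cong: if_cong)
  also have "\<dots> = complex_of_real (real n * pi * (\<Sum>k\<in>A. (cmod (c k))\<^sup>2))"
    by (simp add: complex_norm_square[symmetric] sum_distrib_left mult.commute)
  finally have I: "(LINT s:I|lborel. (cmod (q s))\<^sup>2) = real n * pi * (\<Sum>k\<in>A. (cmod (c k))\<^sup>2)"
    by (simp only: of_real_eq_iff)
  have m: "(\<lambda>s. (cmod (q s))\<^sup>2) \<in> borel_measurable borel"
    by (intro borel_measurable_continuous_onI continuous_intros cq)
  have iI: "integrable lebesgue (\<lambda>s. indicator I s *\<^sub>R (cmod (q s))\<^sup>2)"
    using si unfolding set_integrable_def I_def by (subst integrable_completion) (use m in auto)
  have iS: "integrable lebesgue (\<lambda>s. indicator S s *\<^sub>R (cmod (q s))\<^sup>2)"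
  proof (rule Bochner_Integration.integrable_bound[OF iI])
    show "(\<lambda>s. indicator S s *\<^sub>R (cmod (q s))\<^sup>2) \<in> borel_measurable lebesgue"
      using m by (intro borel_measurable_scaleR borel_measurable_indicator S(1) measurable_completion) simp
    show "AE s in lebesgue. norm (indicator S s *\<^sub>R (cmod (q s))\<^sup>2) \<le> norm (indicator I s *\<^sub>R (cmod (q s))\<^sup>2)"
      using S(2) by (intro AE_I2) (auto simp: indicator_def I_def)
  qed
  then show "integrable (lebesgue_on S) (\<lambda>s. (cmod (\<Sum>k\<in>A. c k * phase (- s) k))\<^sup>2)"
    using S(1) by (simp add: integrable_restrict_space q_def)
  have "(\<integral>s. (cmod (q s))\<^sup>2 \<partial>lebesgue_on S) = (\<integral>s. indicator S s *\<^sub>R (cmod (q s))\<^sup>2 \<partial>lebesgue)"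
    using S(1) by (intro integral_restrict_space) simp
  also have "\<dots> \<le> (\<integral>s. indicator I s *\<^sub>R (cmod (q s))\<^sup>2 \<partial>lebesgue)"
    using S(2) by (intro integral_mono iS iI) (auto simp: indicator_def I_def)
  also have "\<dots> = (LINT s:I|lborel. (cmod (q s))\<^sup>2)"
    unfolding set_lebesgue_integral_def I_def by (subst integral_completion) (use m in auto)
  finally show "(\<integral>s. (cmod (\<Sum>k\<in>A. c k * phase (- s) k))\<^sup>2 \<partial>lebesgue_on S) \<le> real n * pi * (\<Sum>k\<in>A. (cmod (c k))\<^sup>2)"
    unfolding I unfolding q_def .
qed

lemma finite_measure_integrable_square:
  fixes f :: "_ \<Rightarrow> complex"
  assumes "finite_measure M" "f \<in> borel_measurable M" "integrable M (\<lambda>s. (cmod (f s))\<^sup>2)"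
  shows "integrable M f"
proof -
  interpret finite_measure M by fact
  show ?thesis
  proof (rule Bochner_Integration.integrable_bound)
    show "integrable M (\<lambda>s. 1 + (cmod (f s))\<^sup>2)" using assms by simp
    show "AE s in M. norm (f s) \<le> norm (1 + (cmod (f s))\<^sup>2)"
    proof (rule AE_I2)
      fix s
      have "2 * cmod (f s) * 1 \<le> (cmod (f s))\<^sup>2 + 1\<^sup>2" by (rule sum_squares_bound)
      then have "norm (f s) \<le> 1 + (cmod (f s))\<^sup>2"
        using norm_ge_zero[of "f s"] unfolding power_one mult_1_right by linarith
      then show "norm (f s) \<le> norm (1 + (cmod (f s))\<^sup>2)" by simp
    qed
  qed (use assms in simp)
qed

lemma finite_measure_lebesgue_on_bounded:
  assumes "S \<in> sets lebesgue" "S \<subseteq> {p..q::real}"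
  shows "finite_measure (lebesgue_on S)"
  using bounded_set_imp_lmeasurable[OF bounded_subset[OF bounded_closed_interval assms(2)] assms(1)]
  by (rule finite_measure_lebesgue_on)

lemma phase_measurable [measurable]: "(\<lambda>s. phase (- s) k) \<in> borel_measurable (lebesgue_on S)"
proof -
  have "(\<lambda>s. phase (- s) k) \<in> borel_measurable borel"
    by (rule borel_measurable_continuous_onI[OF phase_continuous])
  then have "(\<lambda>s. phase (- s) k) \<in> borel_measurable lebesgue" by (intro measurable_completion) simp
  then show ?thesis by (rule measurable_restrict_space1)
qed

text \<open>Bessel's inequality for the functions \<open>e\<^bsup>i(2k+1)s\<^esup>\<close>, by duality from the bound for trigonometric sums.\<close>

lemma time_Bessel:
  assumes A: "finite A" and S: "S \<in> sets lebesgue" "S \<subseteq> {0..real n * pi}" and n: "n > 0"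
    and h: "h \<in> borel_measurable (lebesgue_on S)" "integrable (lebesgue_on S) (\<lambda>s. (cmod (h s))\<^sup>2)"
  shows "(\<Sum>k\<in>A. (cmod (\<integral>s. phase (- s) k * h s \<partial>lebesgue_on S))\<^sup>2) \<le> real n * pi * (\<integral>s. (cmod (h s))\<^sup>2 \<partial>lebesgue_on S)"
proof -
  define I where "I k = (\<integral>s. phase (- s) k * h s \<partial>lebesgue_on S)" for k
  \<comment> \<open>With the conjugate coefficients as weights, the integral of \<open>q\<close>
    times \<open>h\<close> is the very sum of squares \<open>Z\<close> to be bounded.\<close>
  define q where "q s = (\<Sum>k\<in>A. cnj (I k) * phase (- s) k)" for s
  define Z where "Z = (\<Sum>k\<in>A. (cmod (I k))\<^sup>2)"
  define L where "L = real n * pi"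
  have L: "L > 0" using n by (simp add: L_def)
  have fin: "finite_measure (lebesgue_on S)" by (rule finite_measure_lebesgue_on_bounded[OF S])
  have hi: "integrable (lebesgue_on S) h" by (rule finite_measure_integrable_square[OF fin h])
  have pi: "integrable (lebesgue_on S) (\<lambda>s. phase (- s) k * h s)" for k
    by (rule Bochner_Integration.integrable_bound[OF hi]) (use h(1) in \<open>auto simp: norm_mult\<close>)
  note qb = trig_sum_bound[OF A S, of "\<lambda>k. cnj (I k)", folded q_def L_def]
  have "complex_of_real Z = (\<Sum>k\<in>A. cnj (I k) * I k)"
    by (simp only: Z_def of_real_sum complex_norm_square mult.commute)
  also have "\<dots> = (\<integral>s. (\<Sum>k\<in>A. cnj (I k) * (phase (- s) k * h s)) \<partial>lebesgue_on S)"
    using pi by (simp add: I_def)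
  also have "\<dots> = (\<integral>s. q s * h s \<partial>lebesgue_on S)"
    by (simp add: q_def sum_distrib_right mult.assoc)
  finally have Z: "complex_of_real Z = (\<integral>s. q s * h s \<partial>lebesgue_on S)" .
  have Z0: "Z \<ge> 0" unfolding Z_def by (intro sum_nonneg) auto
  have i2: "integrable (lebesgue_on S) (\<lambda>s. (1/2) * ((cmod (q s))\<^sup>2 / L + L * (cmod (h s))\<^sup>2))"
    using qb(2) h(2) by simp
  \<comment> \<open>The inequality is balanced with \<open>L\<close> because the squared norm of
    \<open>q\<close> is at most L Z: its share becomes Z / 2 and is absorbed on the left.\<close>
  have pw: "cmod (q s * h s) \<le> (1/2) * ((cmod (q s))\<^sup>2 / L + L * (cmod (h s))\<^sup>2)" for s
  proof -
    have "0 \<le> (cmod (q s) - L * cmod (h s))\<^sup>2 / L" using L by simp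
    also have "\<dots> = (cmod (q s))\<^sup>2 / L + L * (cmod (h s))\<^sup>2 - 2 * (cmod (q s) * cmod (h s))"
      using L by (simp add: field_simps power2_eq_square)
    finally show ?thesis by (simp add: norm_mult)
  qed
  have "Z = cmod (complex_of_real Z)" using Z0 by simp
  also have "\<dots> \<le> (\<integral>s. cmod (q s * h s) \<partial>lebesgue_on S)" unfolding Z by (rule integral_norm_bound)
  also have "\<dots> \<le> (\<integral>s. (1/2) * ((cmod (q s))\<^sup>2 / L + L * (cmod (h s))\<^sup>2) \<partial>lebesgue_on S)"
  proof (rule integral_mono[OF _ i2 pw])
    have "q \<in> borel_measurable (lebesgue_on S)" unfolding q_def by measurable
    then have "(\<lambda>s. q s * h s) \<in> borel_measurable (lebesgue_on S)" using h(1) by measurable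
    then have "integrable (lebesgue_on S) (\<lambda>s. q s * h s)"
      by (rule Bochner_Integration.integrable_bound[OF i2]) (rule AE_I2, rule order_trans[OF pw], simp only: real_norm_def abs_ge_self)
    then show "integrable (lebesgue_on S) (\<lambda>s. cmod (q s * h s))" by (rule integrable_norm)
  qed
  also have "\<dots> = (1/2) * ((\<integral>s. (cmod (q s))\<^sup>2 \<partial>lebesgue_on S) / L + L * (\<integral>s. (cmod (h s))\<^sup>2 \<partial>lebesgue_on S))"
    using qb(2) h(2) by simp
  also have "\<dots> \<le> (1/2) * (Z + L * (\<integral>s. (cmod (h s))\<^sup>2 \<partial>lebesgue_on S))"
    using qb(1) L by (simp add: Z_def pos_divide_le_eq mult.commute)
  finally have "Z \<le> L * (\<integral>s. (cmod (h s))\<^sup>2 \<partial>lebesgue_on S)" by simp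
  then show ?thesis by (simp add: Z_def I_def L_def)
qed

lemma norm_add_sum_square_le:
  fixes x :: complex and y :: "nat \<Rightarrow> complex"
  shows "(cmod (x + (\<Sum>j=1..N. y j)))\<^sup>2 \<le> 2 * (cmod x)\<^sup>2 + 2 * real N * (\<Sum>j=1..N. (cmod (y j))\<^sup>2)"
proof -
  have "(cmod (x + (\<Sum>j=1..N. y j)))\<^sup>2 \<le> (cmod x + (\<Sum>j=1..N. cmod (y j)))\<^sup>2"
    by (intro power_mono order_trans[OF norm_triangle_ineq] add_mono norm_sum) auto
  also have "\<dots> \<le> 2 * (cmod x)\<^sup>2 + 2 * (\<Sum>j=1..N. cmod (y j))\<^sup>2"
    using sum_squares_bound[of "cmod x" "\<Sum>j=1..N. cmod (y j)"] by (simp add: power2_sum)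
  also have "(\<Sum>j=1..N. cmod (y j))\<^sup>2 \<le> (\<Sum>j=1..N. (cmod (y j))\<^sup>2) * card {1..N}"
    by (rule sum_squared_le_sum_of_squares)
  finally show ?thesis by (simp add: mult_ac)
qed

text \<open>The bounded sequences \<open>b j\<close> are not square summable; time integration against the orthogonal
  family \<open>e\<^bsup>i(2k+1)s\<^esup>\<close> restores summability.\<close>

lemma Duhamel_bound:
  assumes S: "S \<in> sets lebesgue" "S \<subseteq> {0..real n * pi}" and n: "n > 0"
    and b: "\<And>j k. j \<in> {1..N} \<Longrightarrow> \<bar>b j k\<bar> \<le> B"
    and v: "\<And>k. (\<lambda>s. v s k) \<in> borel_measurable (lebesgue_on S)"
    and h: "\<And>j. (\<lambda>s. h s j) \<in> borel_measurable (lebesgue_on S)"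
    and G: "integrable (lebesgue_on S) G"
    and dec: "AE s in lebesgue_on S. jump_decomp N b (v s) (h s) (G s)"
  shows "(\<Sum>k<K. (2 * real k + 1) * (cmod (\<integral>s. phase (- s) k * v s k \<partial>lebesgue_on S))\<^sup>2)
      \<le> (real n * pi * (5 + 4 * (real N)\<^sup>2 * B\<^sup>2)) * (\<integral>s. G s \<partial>lebesgue_on S)"
proof -
  define M where "M = lebesgue_on S"
  define L where "L = real n * pi"
  define IG where "IG = (\<integral>s. G s \<partial>M)"
  have L: "L > 0" using n by (simp add: L_def)
  have fin: "finite_measure M" unfolding M_def by (rule finite_measure_lebesgue_on_bounded[OF S])
  note mm [measurable] = v[folded M_def] h[folded M_def]
  have phm [measurable]: "(\<lambda>s. phase (- s) k) \<in> borel_measurable M" for k unfolding M_def by (rule phase_measurable)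
  \<comment> \<open>The square summable remainder after the jump terms are removed.\<close>
  define g where "g s k = of_real (sqrt (2 * real k + 2)) * v s (Suc k) - (\<Sum>j=1..N. h s j * of_real (b j k))" for s k
  have gm [measurable]: "(\<lambda>s. g s k) \<in> borel_measurable M" for k unfolding g_def by measurable
  have Gi: "integrable M G" using G unfolding M_def .
  have decM: "AE s in M. jump_decomp N b (v s) (h s) (G s)" using dec unfolding M_def .
  have sqi: "integrable M (\<lambda>s. (cmod (f s))\<^sup>2)" "(\<integral>s. (cmod (f s))\<^sup>2 \<partial>M) \<le> IG"
    if [measurable]: "f \<in> borel_measurable M" and le: "AE s in M. (cmod (f s))\<^sup>2 \<le> G s" for f :: "real \<Rightarrow> complex"
  proof -
    show i: "integrable M (\<lambda>s. (cmod (f s))\<^sup>2)"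
      by (rule Bochner_Integration.integrable_bound[OF Gi]) (use le in \<open>auto elim!: eventually_mono intro: order_trans[OF _ abs_ge_self]\<close>)
    show "(\<integral>s. (cmod (f s))\<^sup>2 \<partial>M) \<le> IG" unfolding IG_def by (rule integral_mono_AE[OF i Gi le])
  qed
  have v0: "AE s in M. (cmod (v s 0))\<^sup>2 \<le> G s" using decM by eventually_elim (simp add: jump_decomp_def)
  have hj: "AE s in M. (cmod (h s j))\<^sup>2 \<le> G s" if "j \<in> {1..N}" for j
    using decM by eventually_elim (use that in \<open>simp add: jump_decomp_def\<close>)
  have gsum: "AE s in M. (\<Sum>k<m. (cmod (g s k))\<^sup>2) \<le> G s" for m
    using decM by eventually_elim (simp add: jump_decomp_def g_def)
  have gk: "AE s in M. (cmod (g s k))\<^sup>2 \<le> G s" for k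
    using gsum[of "Suc k"]
  proof eventually_elim
    case (elim s)
    have "(cmod (g s k))\<^sup>2 \<le> (\<Sum>i<Suc k. (cmod (g s i))\<^sup>2)" by (rule member_le_sum) auto
    with elim show ?case by linarith
  qed
  have Bess: "(\<Sum>k\<in>A. (cmod (\<integral>s. phase (- s) k * f s \<partial>M))\<^sup>2) \<le> L * (\<integral>s. (cmod (f s))\<^sup>2 \<partial>M)"
    if "finite A" "f \<in> borel_measurable M" "integrable M (\<lambda>s. (cmod (f s))\<^sup>2)" for A f
    using time_Bessel[OF that(1) S n, of f] that(2,3) unfolding M_def L_def by simp
  define J where "J k = (\<integral>s. phase (- s) k * v s k \<partial>M)" for k
  have J0: "(cmod (J 0))\<^sup>2 \<le> L * IG"
  proof -
    have "(cmod (J 0))\<^sup>2 \<le> L * (\<integral>s. (cmod (v s 0))\<^sup>2 \<partial>M)"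
      using Bess[of "{0}" "\<lambda>s. v s 0"] sqi(1)[OF _ v0] by (simp add: J_def)
    also have "\<dots> \<le> L * IG" using L sqi(2)[OF _ v0] by (intro mult_left_mono) auto
    finally show ?thesis .
  qed
  have int: "integrable M (\<lambda>s. phase (- s) k * f s)" if [measurable]: "f \<in> borel_measurable M" and le: "AE s in M. (cmod (f s))\<^sup>2 \<le> G s" for f k
    by (rule Bochner_Integration.integrable_bound[OF finite_measure_integrable_square[OF fin that(1) sqi(1)[OF that]]])
      (auto simp: norm_mult)
  define P where "P k = (\<integral>s. phase (- s) (Suc k) * g s k \<partial>M)" for k
  define Q where "Q j k = (\<integral>s. phase (- s) (Suc k) * h s j \<partial>M)" for j k
  have JS: "of_real (sqrt (2 * real k + 2)) * J (Suc k) = P k + (\<Sum>j=1..N. of_real (b j k) * Q j k)" for k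
  proof -
    have "of_real (sqrt (2 * real k + 2)) * J (Suc k) = (\<integral>s. of_real (sqrt (2 * real k + 2)) * (phase (- s) (Suc k) * v s (Suc k)) \<partial>M)"
      unfolding J_def by simp
    also have "\<dots> = (\<integral>s. phase (- s) (Suc k) * g s k + (\<Sum>j=1..N. of_real (b j k) * (phase (- s) (Suc k) * h s j)) \<partial>M)"
      by (intro Bochner_Integration.integral_cong refl) (simp add: g_def algebra_simps sum_distrib_left)
    also have "\<dots> = P k + (\<Sum>j=1..N. of_real (b j k) * Q j k)"
    proof -
      have i1: "integrable M (\<lambda>s. phase (- s) (Suc k) * g s k)" by (rule int[OF gm gk])
      have i2: "integrable M (\<lambda>s. of_real (b j k) * (phase (- s) (Suc k) * h s j))" if "j \<in> {1..N}" for j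
        by (intro integrable_mult_right int[OF mm(2) hj[OF that]])
      have i3: "integrable M (\<lambda>s. \<Sum>j=1..N. of_real (b j k) * (phase (- s) (Suc k) * h s j))"
        by (rule Bochner_Integration.integrable_sum[OF i2])
      have "(\<integral>s. (\<Sum>j=1..N. of_real (b j k) * (phase (- s) (Suc k) * h s j)) \<partial>M)
          = (\<Sum>j=1..N. (\<integral>s. of_real (b j k) * (phase (- s) (Suc k) * h s j) \<partial>M))"
        by (rule Bochner_Integration.integral_sum[OF i2])
      also have "\<dots> = (\<Sum>j=1..N. of_real (b j k) * Q j k)" by (simp add: Q_def)
      finally show ?thesis
        unfolding Bochner_Integration.integral_add[OF i1 i3] P_def by (simp only:)
    qed
    finally show ?thesis .
  qed
  \<comment> \<open>The weight 2 k + 3 is at most twice 2 k + 2. The other factor 2 separates the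
    remainder from the jumps, and N comes from Cauchy-Schwarz over the jumps.\<close>
  have JSle: "(2 * real (Suc k) + 1) * (cmod (J (Suc k)))\<^sup>2 \<le> 4 * (cmod (P k))\<^sup>2 + 4 * real N * B\<^sup>2 * (\<Sum>j=1..N. (cmod (Q j k))\<^sup>2)" for k
  proof -
    have "(2 * real (Suc k) + 1) * (cmod (J (Suc k)))\<^sup>2 \<le> 2 * (2 * real k + 2) * (cmod (J (Suc k)))\<^sup>2"
      by (intro mult_right_mono) auto
    also have "\<dots> = 2 * (cmod (of_real (sqrt (2 * real k + 2)) * J (Suc k)))\<^sup>2"
      by (simp add: norm_mult power_mult_distrib)
    also have "\<dots> \<le> 2 * (2 * (cmod (P k))\<^sup>2 + 2 * real N * (\<Sum>j=1..N. (cmod (of_real (b j k) * Q j k))\<^sup>2))"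
      unfolding JS by (intro mult_left_mono norm_add_sum_square_le) simp
    also have "\<dots> \<le> 2 * (2 * (cmod (P k))\<^sup>2 + 2 * real N * (\<Sum>j=1..N. B\<^sup>2 * (cmod (Q j k))\<^sup>2))"
    proof (intro mult_left_mono add_left_mono sum_mono)
      fix j assume j: "j \<in> {1..N}"
      show "(cmod (of_real (b j k) * Q j k))\<^sup>2 \<le> B\<^sup>2 * (cmod (Q j k))\<^sup>2"
        using power_mono[OF b[OF j, of k] abs_ge_zero, of 2]
        by (simp add: norm_mult power_mult_distrib mult_right_mono)
    qed auto
    finally show ?thesis by (simp add: sum_distrib_left[symmetric] algebra_simps)
  qed
  \<comment> \<open>The remainder changes with \<open>k\<close>, so the time estimate is used for
    one frequency at a time; summability in \<open>k\<close> comes from the remainder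
    itself.\<close>
  have Psum: "(\<Sum>k<m. (cmod (P k))\<^sup>2) \<le> L * IG" for m
  proof -
    have "(\<Sum>k<m. (cmod (P k))\<^sup>2) \<le> (\<Sum>k<m. L * (\<integral>s. (cmod (g s k))\<^sup>2 \<partial>M))"
    proof (rule sum_mono)
      fix k
      show "(cmod (P k))\<^sup>2 \<le> L * (\<integral>s. (cmod (g s k))\<^sup>2 \<partial>M)"
        using Bess[of "{Suc k}" "\<lambda>s. g s k"] sqi(1)[OF _ gk] by (simp add: P_def)
    qed
    also have "\<dots> = L * (\<integral>s. (\<Sum>k<m. (cmod (g s k))\<^sup>2) \<partial>M)"
      using sqi(1)[OF gm gk] by (simp add: sum_distrib_left)
    also have "\<dots> \<le> L * IG"
      unfolding IG_def using sqi(1)[OF gm gk] L by (intro mult_left_mono integral_mono_AE Gi gsum) auto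
    finally show ?thesis .
  qed
  \<comment> \<open>Here the function of time is the same for all \<open>k\<close>, and Bessel's
    inequality over all frequencies together supplies the summability in \<open>k\<close>.\<close>
  have Qsum: "(\<Sum>k<m. (cmod (Q j k))\<^sup>2) \<le> L * IG" if j: "j \<in> {1..N}" for j m
  proof -
    have "(\<Sum>k<m. (cmod (Q j k))\<^sup>2) = (\<Sum>k\<in>Suc ` {..<m}. (cmod (\<integral>s. phase (- s) k * h s j \<partial>M))\<^sup>2)"
      by (subst sum.reindex) (auto simp: Q_def)
    also have "\<dots> \<le> L * (\<integral>s. (cmod (h s j))\<^sup>2 \<partial>M)"
      using Bess[of "Suc ` {..<m}" "\<lambda>s. h s j"] sqi(1)[OF _ hj[OF j]] by simp
    also have "\<dots> \<le> L * IG" using L sqi(2)[OF _ hj[OF j]] by (intro mult_left_mono) auto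
    finally show ?thesis .
  qed
  have LG: "L * IG \<ge> 0" using order_trans[OF zero_le_power2 J0] .
  have "(\<Sum>k<K. (2 * real k + 1) * (cmod (J k))\<^sup>2) \<le> (\<Sum>k<Suc K. (2 * real k + 1) * (cmod (J k))\<^sup>2)"
    by (intro sum_mono2) auto
  also have "\<dots> = (cmod (J 0))\<^sup>2 + (\<Sum>k<K. (2 * real (Suc k) + 1) * (cmod (J (Suc k)))\<^sup>2)"
    unfolding sum.lessThan_Suc_shift by simp
  also have "\<dots> \<le> L * IG + (\<Sum>k<K. 4 * (cmod (P k))\<^sup>2 + 4 * real N * B\<^sup>2 * (\<Sum>j=1..N. (cmod (Q j k))\<^sup>2))"
    by (intro add_mono J0 sum_mono JSle)
  also have "\<dots> = L * IG + 4 * (\<Sum>k<K. (cmod (P k))\<^sup>2) + 4 * real N * B\<^sup>2 * (\<Sum>j=1..N. \<Sum>k<K. (cmod (Q j k))\<^sup>2)"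
    unfolding sum.distrib sum_distrib_left[symmetric] by (subst sum.swap) simp
  also have "\<dots> \<le> L * IG + 4 * (L * IG) + 4 * real N * B\<^sup>2 * (\<Sum>j=1..N. L * IG)"
    by (intro add_mono mult_left_mono Psum sum_mono Qsum order_refl) auto
  \<comment> \<open>The 5 is 1 for index 0 plus 4 for the remainder. One factor N comes from
    Cauchy-Schwarz, the other from summing the N jumps.\<close>
  also have "\<dots> = (L * (5 + 4 * (real N)\<^sup>2 * B\<^sup>2)) * IG"
    by (simp add: algebra_simps power2_eq_square)
  finally show ?thesis by (simp add: J_def M_def L_def IG_def)
qed

section \<open>Volterra equations\<close>

lemma set_integrable_mult_continuous:
  fixes r g :: "real \<Rightarrow> real"
  assumes r: "set_integrable lborel {p..q} r" and g: "continuous_on {p..q} g"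
  shows "set_integrable lborel {p..q} (\<lambda>x. r x * g x)"
proof -
  have "bounded (g ` {p..q})" by (intro compact_imp_bounded compact_continuous_image g) auto
  then obtain K where K: "\<And>x. x \<in> {p..q} \<Longrightarrow> \<bar>g x\<bar> \<le> K" unfolding bounded_iff real_norm_def by blast
  have m1: "(\<lambda>x. indicator {p..q} x *\<^sub>R r x) \<in> borel_measurable lborel"
    using r unfolding set_integrable_def by (rule borel_measurable_integrable)
  have m2: "(\<lambda>x. indicator {p..q} x *\<^sub>R g x) \<in> borel_measurable lborel"
    using borel_integrable_atLeastAtMost'[OF g] unfolding set_integrable_def by (rule borel_measurable_integrable)
  show ?thesis
    unfolding set_integrable_def
  proof (rule Bochner_Integration.integrable_bound)
    show "integrable lborel (\<lambda>x. K * norm (indicator {p..q} x *\<^sub>R r x))"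
      using r unfolding set_integrable_def by (intro integrable_mult_right integrable_norm)
    have "(\<lambda>x. (indicator {p..q} x *\<^sub>R r x) * (indicator {p..q} x *\<^sub>R g x)) \<in> borel_measurable lborel"
      using m1 m2 by (rule borel_measurable_times)
    moreover have "(indicator {p..q} x *\<^sub>R r x) * (indicator {p..q} x *\<^sub>R g x) = indicator {p..q} x *\<^sub>R (r x * g x)" for x
      by (auto simp: indicator_def)
    ultimately show "(\<lambda>x. indicator {p..q} x *\<^sub>R (r x * g x)) \<in> borel_measurable lborel" by (simp only:)
    show "AE x in lborel. norm (indicator {p..q} x *\<^sub>R (r x * g x)) \<le> norm (K * norm (indicator {p..q} x *\<^sub>R r x))"
      by (intro AE_I2) (auto simp: indicator_def abs_mult mult.commute[of "\<bar>r _\<bar>"] intro!: mult_right_mono order_trans[OF K abs_ge_self])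
  qed
qed

text \<open>A power of \<open>1 + \<integral> r\<close> serves as weight: its density is a large multiple of \<open>r\<close> times the weight itself.\<close>

lemma Volterra_weight:
  fixes r :: "real \<Rightarrow> real"
  assumes r: "\<And>p q. set_integrable lborel {p..q} r" and r0: "\<And>x. r x \<ge> 0" and T: "T > 0" and K: "K \<ge> 0"
  obtains \<omega> M where "continuous_on {0..T} \<omega>" "\<And>t. t \<in> {0..T} \<Longrightarrow> 1 \<le> \<omega> t \<and> \<omega> t \<le> M"
    "\<And>t. t \<in> {0..T} \<Longrightarrow> K * (LINT s:{0..t}|lborel. r s * \<omega> s) \<le> \<omega> t / 4"
proof -
  obtain V where V: "primitive V r" "V 0 = 1" using primitive_exists[OF r, of 0 1] by blast
  have mono: "V p \<le> V q" if "p \<le> q" for p q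
  proof -
    have "0 \<le> (LINT x:{p..q}|lborel. r x)"
      unfolding set_lebesgue_integral_def by (intro Bochner_Integration.integral_nonneg) (simp add: r0)
    then show ?thesis using primitive_diff_eq[OF V(1) that] by simp
  qed
  have V1: "1 \<le> V t" if "t \<ge> 0" for t using mono[OF that] V(2) by simp
  have VT: "0 < V T" using V1[of T] T by simp
  have P: "primitive (\<lambda>x. V x ^ Suc n) (\<lambda>x. real (Suc n) * (r x * V x ^ n))" for n
  proof (induction n)
    case 0 then show ?case using V(1) by simp
  next
    case (Suc n)
    have "primitive (\<lambda>x. V x ^ Suc n * V x) (\<lambda>x. (real (Suc n) * (r x * V x ^ n)) * V x + V x ^ Suc n * r x)"
      by (rule primitive_mult[OF Suc V(1)])
    moreover have "(real (Suc n) * (r x * V x ^ n)) * V x + V x ^ Suc n * r x = real (Suc (Suc n)) * (r x * V x ^ Suc n)" for x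
      by (simp add: algebra_simps)
    ultimately show ?case by (simp only: power_Suc2[of _ "Suc n"])
  qed
  \<comment> \<open>Integrating \<open>r\<close> against the n-th power of \<open>V\<close> gains 1
    / (n + 1) and loses a factor at most \<open>V T\<close>; this \<open>n\<close> makes the product
    with \<open>K\<close> at most 1/4.\<close>
  obtain n :: nat where n: "4 * K * V T < real n" using reals_Archimedean2 by blast
  define \<omega> where "\<omega> t = V t ^ n" for t
  have cV: "continuous_on UNIV V" by (rule primitive_continuous[OF V(1)])
  show ?thesis
  proof (rule that[of \<omega> "V T ^ n"])
    show "continuous_on {0..T} \<omega>" unfolding \<omega>_def
      by (intro continuous_intros continuous_on_subset[OF cV]) auto
    show "1 \<le> \<omega> t \<and> \<omega> t \<le> V T ^ n" if "t \<in> {0..T}" for t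
      using that V1[of t] mono[of t T] by (auto simp: \<omega>_def one_le_power intro!: power_mono)
    show "K * (LINT s:{0..t}|lborel. r s * \<omega> s) \<le> \<omega> t / 4" if t: "t \<in> {0..T}" for t
    proof -
      have "real (Suc n) * (LINT s:{0..t}|lborel. r s * \<omega> s) = (LINT s:{0..t}|lborel. real (Suc n) * (r s * V s ^ n))"
        by (simp add: \<omega>_def)
      also have "\<dots> = V t ^ Suc n - V 0 ^ Suc n"
        using t by (intro primitive_diff_eq[OF P, symmetric]) simp
      also have "\<dots> \<le> V t * \<omega> t" using V(2) by (simp add: \<omega>_def)
      also have "\<dots> \<le> V T * \<omega> t" using t mono[of t T] V1[of t] by (intro mult_right_mono) (auto simp: \<omega>_def)
      finally have "(LINT s:{0..t}|lborel. r s * \<omega> s) \<le> V T * \<omega> t / real (Suc n)" by (simp add: field_simps)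
      then have "K * (LINT s:{0..t}|lborel. r s * \<omega> s) \<le> K * (V T * \<omega> t / real (Suc n))" using K by (rule mult_left_mono)
      also have "\<dots> = (4 * K * V T / real (Suc n)) * \<omega> t / 4" by (simp add: field_simps)
      also have "\<dots> \<le> 1 * \<omega> t / 4"
        using n t V1[of t] by (intro divide_right_mono mult_right_mono) (auto simp: \<omega>_def field_simps)
      finally show ?thesis by simp
    qed
  qed
qed

text \<open>The quotient of \<delta> and \<omega> is evaluated at its maximum, where the integral
  term recovers at most a quarter of the maximum. The remaining three quarters are bounded by
  \<open>P\<close>, and the loss from 4/3 to 2 is harmless.\<close>

lemma Gronwall_weight:
  fixes r \<omega> \<delta> :: "real \<Rightarrow> real"
  assumes r: "\<And>p q. set_integrable lborel {p..q} r" and r0: "\<And>x. r x \<ge> 0" and T: "T > 0" and K: "K \<ge> 0"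
    and \<omega>: "continuous_on {0..T} \<omega>" "\<And>t. t \<in> {0..T} \<Longrightarrow> 1 \<le> \<omega> t \<and> \<omega> t \<le> M"
      "\<And>t. t \<in> {0..T} \<Longrightarrow> K * (LINT s:{0..t}|lborel. r s * \<omega> s) \<le> \<omega> t / 4"
    and \<delta>: "continuous_on {0..T} \<delta>" "\<And>t. t \<in> {0..T} \<Longrightarrow> \<delta> t \<ge> 0" and P: "P \<ge> 0"
    and le: "\<And>t. t \<in> {0..T} \<Longrightarrow> \<delta> t \<le> P + K * (LINT s:{0..t}|lborel. r s * \<delta> s)"
    and t: "t \<in> {0..T}"
  shows "\<delta> t \<le> 2 * P * M"
proof -
  have \<omega>pos: "\<omega> s > 0" if "s \<in> {0..T}" for s using \<omega>(2)[OF that] by linarith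
  have "continuous_on {0..T} (\<lambda>s. \<delta> s / \<omega> s)"
    using \<omega>pos by (intro continuous_intros \<delta> \<omega>) force
  then obtain z where z: "z \<in> {0..T}" "\<And>s. s \<in> {0..T} \<Longrightarrow> \<delta> s / \<omega> s \<le> \<delta> z / \<omega> z"
    using continuous_attains_sup[of "{0..T}" "\<lambda>s. \<delta> s / \<omega> s"] T by auto
  define m where "m = \<delta> z / \<omega> z"
  have m0: "m \<ge> 0" unfolding m_def using \<delta>(2)[OF z(1)] \<omega>pos[OF z(1)] by simp
  have dm: "\<delta> s \<le> m * \<omega> s" if "s \<in> {0..T}" for s
    using z(2)[OF that] \<omega>pos[OF that] by (simp add: m_def pos_divide_le_eq)
  have sub: "{0..z} \<subseteq> {0..T}" using z(1) by auto
  have i1: "set_integrable lborel {0..z} (\<lambda>s. r s * \<delta> s)"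
    by (rule set_integrable_mult_continuous[OF r continuous_on_subset[OF \<delta>(1) sub]])
  have i2: "set_integrable lborel {0..z} (\<lambda>s. r s * \<omega> s)"
    by (rule set_integrable_mult_continuous[OF r continuous_on_subset[OF \<omega>(1) sub]])
  have "(LINT s:{0..z}|lborel. r s * \<delta> s) \<le> (LINT s:{0..z}|lborel. m * (r s * \<omega> s))"
  proof (rule set_integral_mono[OF i1])
    show "set_integrable lborel {0..z} (\<lambda>s. m * (r s * \<omega> s))" by (rule set_integrable_mult_right) (rule i2)
    show "r s * \<delta> s \<le> m * (r s * \<omega> s)" if "s \<in> {0..z}" for s
      using mult_left_mono[OF dm r0[of s], of s] sub that by (auto simp: mult_ac)
  qed
  also have "\<dots> = m * (LINT s:{0..z}|lborel. r s * \<omega> s)" by simp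
  finally have "K * (LINT s:{0..z}|lborel. r s * \<delta> s) \<le> K * (m * (LINT s:{0..z}|lborel. r s * \<omega> s))"
    using K by (rule mult_left_mono)
  also have "\<dots> = m * (K * (LINT s:{0..z}|lborel. r s * \<omega> s))" by simp
  also have "\<dots> \<le> m * (\<omega> z / 4)" by (intro mult_left_mono \<omega>(3) z m0)
  finally have "\<delta> z \<le> P + m * \<omega> z / 4" using le[OF z(1)] by simp
  moreover have "\<delta> z = m * \<omega> z" using \<omega>pos[OF z(1)] by (simp add: m_def)
  ultimately have 1: "3 * (m * \<omega> z) \<le> 4 * P" by simp
  have "m \<le> m * \<omega> z" using \<omega>(2)[OF z(1)] m0 by (simp add: mult_le_cancel_left1)
  then have "m \<le> 2 * P" using 1 P by linarith
  then have "m * \<omega> t \<le> (2 * P) * M" using \<omega>(2)[OF t] P m0 by (intro mult_mono) auto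
  then show ?thesis using dm[OF t] by simp
qed

text \<open>Picard iteration on the whole interval: in the weighted norm each step divides squared
  distances by 4, so the iterates converge uniformly at rate 1/2.\<close>

lemma Volterra_fixed_point:
  fixes L :: "(real \<Rightarrow> 'a::banach) \<Rightarrow> real \<Rightarrow> 'a"
  assumes r: "\<And>p q. set_integrable lborel {p..q} r" and r0: "\<And>x. r x \<ge> 0" and T: "T > 0" and K: "K \<ge> 0"
    and cont: "\<And>\<xi>. continuous_on {0..T} \<xi> \<Longrightarrow> continuous_on {0..T} (L \<xi>)"
    and lip: "\<And>\<xi> \<xi>' t. continuous_on {0..T} \<xi> \<Longrightarrow> continuous_on {0..T} \<xi>' \<Longrightarrow> t \<in> {0..T} \<Longrightarrow>
       (norm (L \<xi> t - L \<xi>' t))\<^sup>2 \<le> K * (LINT s:{0..t}|lborel. r s * (norm (\<xi> s - \<xi>' s))\<^sup>2)"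
  shows "\<exists>\<xi>. continuous_on {0..T} \<xi> \<and> (\<forall>t\<in>{0..T}. \<xi> t = L \<xi> t)"
proof -
  obtain \<omega> M where \<omega>: "continuous_on {0..T} \<omega>" "\<And>t. t \<in> {0..T} \<Longrightarrow> 1 \<le> \<omega> t \<and> \<omega> t \<le> M"
    "\<And>t. t \<in> {0..T} \<Longrightarrow> K * (LINT s:{0..t}|lborel. r s * \<omega> s) \<le> \<omega> t / 4"
    using Volterra_weight[OF r r0 T K] by blast
  define X where "X n = (L ^^ n) (\<lambda>_. 0)" for n
  have X: "X 0 = (\<lambda>_. 0)" "X (Suc n) = L (X n)" for n by (simp_all add: X_def)
  have cX: "continuous_on {0..T} (X n)" for n
    by (induction n) (auto simp: X intro: cont)
  have "bounded (X 1 ` {0..T})" by (intro compact_imp_bounded compact_continuous_image cX) auto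
  then obtain D where D: "\<And>t. t \<in> {0..T} \<Longrightarrow> norm (X 1 t) \<le> D" unfolding bounded_iff by blast
  have D0: "D \<ge> 0" using order_trans[OF norm_ge_zero D[of 0]] T by simp
  have step: "(norm (X (Suc n) t - X n t))\<^sup>2 \<le> D\<^sup>2 * (1/4)^n * \<omega> t" if "t \<in> {0..T}" for n t
    using that
  proof (induction n arbitrary: t)
    case 0
    have "(norm (X 1 t))\<^sup>2 \<le> D\<^sup>2" by (intro power_mono D 0) simp
    also have "\<dots> \<le> D\<^sup>2 * \<omega> t" using \<omega>(2)[OF 0] by (simp add: mult_le_cancel_left1)
    finally show ?case by (simp add: X(1))
  next
    case (Suc n)
    have sub: "{0..t} \<subseteq> {0..T}" using Suc(2) by auto
    have i1: "set_integrable lborel {0..t} (\<lambda>s. r s * (norm (X (Suc n) s - X n s))\<^sup>2)"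
      by (intro set_integrable_mult_continuous[OF r] continuous_intros continuous_on_subset[OF cX sub])
    have i2: "set_integrable lborel {0..t} (\<lambda>s. r s * \<omega> s)"
      by (rule set_integrable_mult_continuous[OF r continuous_on_subset[OF \<omega>(1) sub]])
    have "(norm (X (Suc (Suc n)) t - X (Suc n) t))\<^sup>2 \<le> K * (LINT s:{0..t}|lborel. r s * (norm (X (Suc n) s - X n s))\<^sup>2)"
      unfolding X(2)[of "Suc n"] X(2)[of n] using lip[OF cX[of "Suc n"] cX[of n] Suc(2)] by (simp only: X(2))
    also have "\<dots> \<le> K * (LINT s:{0..t}|lborel. (D\<^sup>2 * (1/4)^n) * (r s * \<omega> s))"
    proof (intro mult_left_mono K set_integral_mono[OF i1])
      show "set_integrable lborel {0..t} (\<lambda>s. (D\<^sup>2 * (1/4)^n) * (r s * \<omega> s))"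
        by (rule set_integrable_mult_right) (rule i2)
      show "r s * (norm (X (Suc n) s - X n s))\<^sup>2 \<le> (D\<^sup>2 * (1/4)^n) * (r s * \<omega> s)" if "s \<in> {0..t}" for s
        using mult_left_mono[OF Suc.IH r0[of s], of s] sub that by (auto simp: mult_ac)
    qed
    also have "\<dots> = (D\<^sup>2 * (1/4)^n) * (K * (LINT s:{0..t}|lborel. r s * \<omega> s))" by simp
    also have "\<dots> \<le> (D\<^sup>2 * (1/4)^n) * (\<omega> t / 4)" by (intro mult_left_mono \<omega>(3) Suc(2)) simp
    finally show ?case by simp
  qed
  have step': "norm (X (Suc n) t - X n t) \<le> (D * sqrt M) * (1/2)^n" if t: "t \<in> {0..T}" for n t
  proof (rule power2_le_imp_le)
    have M: "1 \<le> M" using \<omega>(2)[OF t] by linarith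
    have q: "((1/2::real)^n)\<^sup>2 = (1/4)^n" by (simp add: power2_eq_square flip: power_mult_distrib)
    have "(norm (X (Suc n) t - X n t))\<^sup>2 \<le> D\<^sup>2 * (1/4)^n * M"
      by (rule order_trans[OF step[OF t]]) (use \<omega>(2)[OF t] in \<open>intro mult_left_mono, auto\<close>)
    also have "\<dots> = ((D * sqrt M) * (1/2)^n)\<^sup>2" using M by (simp add: power_mult_distrib q)
    finally show "(norm (X (Suc n) t - X n t))\<^sup>2 \<le> ((D * sqrt M) * (1/2)^n)\<^sup>2" .
    show "0 \<le> (D * sqrt M) * (1/2)^n" using D0 M by simp
  qed
  define \<xi> where "\<xi> t = (\<Sum>i. X (Suc i) t - X i t)" for t
  have "uniform_limit {0..T} (\<lambda>n t. \<Sum>i<n. X (Suc i) t - X i t) \<xi> sequentially"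
    unfolding \<xi>_def by (rule Weierstrass_m_test[where M = "\<lambda>n. (D * sqrt M) * (1/2)^n"])
      (auto intro: step' summable_mult summable_geometric)
  moreover have "(\<Sum>i<n. X (Suc i) t - X i t) = X n t" for n t
    using sum_lessThan_telescope[of "\<lambda>i. X i t" n] by (simp add: X(1))
  ultimately have ul: "uniform_limit {0..T} X \<xi> sequentially" by simp
  have c\<xi>: "continuous_on {0..T} \<xi>"
    by (rule uniform_limit_theorem[OF _ ul]) (auto simp: cX)
  have "\<xi> t = L \<xi> t" if t: "t \<in> {0..T}" for t
  proof -
    have sub: "{0..t} \<subseteq> {0..T}" using t by auto
    have "(\<lambda>n. X (Suc n) t) \<longlonglongrightarrow> L \<xi> t"
    proof (rule tendstoI)
      fix e :: real assume e: "e > 0"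
      define R where "R = (LINT s:{0..t}|lborel. r s)"
      have R: "R \<ge> 0" unfolding R_def set_lebesgue_integral_def by (intro Bochner_Integration.integral_nonneg) (simp add: r0)
      \<comment> \<open>Uniform closeness \<open>d\<close> of the arguments becomes closeness
        \<open>e\<close> of the images, as d^2 (K R + 1) = e^2; the summand 1 keeps the root
        positive.\<close>
      define d where "d = e / sqrt (K * R + 1)"
      have KR: "K * R + 1 > 0" using K R by (simp add: add_nonneg_pos)
      have d: "d > 0" using e KR by (simp add: d_def)
      have "\<forall>\<^sub>F n in sequentially. \<forall>s\<in>{0..T}. dist (X n s) (\<xi> s) < d" using ul d by (rule uniform_limitD)
      then show "\<forall>\<^sub>F n in sequentially. dist (X (Suc n) t) (L \<xi> t) < e"
      proof eventually_elim
        case (elim n)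
        have i1: "set_integrable lborel {0..t} (\<lambda>s. r s * (norm (X n s - \<xi> s))\<^sup>2)"
          by (intro set_integrable_mult_continuous[OF r] continuous_intros continuous_on_subset[OF cX sub] continuous_on_subset[OF c\<xi> sub])
        have "(norm (X (Suc n) t - L \<xi> t))\<^sup>2 \<le> K * (LINT s:{0..t}|lborel. r s * (norm (X n s - \<xi> s))\<^sup>2)"
          unfolding X(2) by (rule lip[OF cX c\<xi> t])
        also have "\<dots> \<le> K * (LINT s:{0..t}|lborel. d\<^sup>2 * r s)"
        proof (intro mult_left_mono K set_integral_mono[OF i1])
          show "set_integrable lborel {0..t} (\<lambda>s. d\<^sup>2 * r s)" by (rule set_integrable_mult_right) (rule r)
          show "r s * (norm (X n s - \<xi> s))\<^sup>2 \<le> d\<^sup>2 * r s" if "s \<in> {0..t}" for s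
          proof -
            have "norm (X n s - \<xi> s) \<le> d" using elim sub that by (force simp: dist_norm)
            then have "(norm (X n s - \<xi> s))\<^sup>2 \<le> d\<^sup>2" by (intro power_mono) auto
            then have "(norm (X n s - \<xi> s))\<^sup>2 * r s \<le> d\<^sup>2 * r s" using r0[of s] by (rule mult_right_mono)
            then show ?thesis by (simp only: mult.commute)
          qed
        qed
        also have "\<dots> = d\<^sup>2 * (K * R)" by (simp add: R_def)
        also have "\<dots> < d\<^sup>2 * (K * R + 1)" using d by simp
        also have "\<dots> = e\<^sup>2" using KR by (simp add: d_def power_divide)
        finally show "dist (X (Suc n) t) (L \<xi> t) < e"
          unfolding dist_norm by (rule power2_less_imp_less) (use e in simp)
      qed
    qed
    moreover have "(\<lambda>n. X (Suc n) t) \<longlonglongrightarrow> \<xi> t"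
      using tendsto_uniform_limitI[OF ul t] by (rule LIMSEQ_Suc)
    ultimately show ?thesis using LIMSEQ_unique by blast
  qed
  with c\<xi> show ?thesis by blast
qed

section \<open>The Duhamel term as a continuous function of time\<close>

text \<open>A consequence of completeness of Lebesgue measure: the preimages differ by null sets,
  and those are measurable.\<close>

lemma lebesgue_measurable_AE:
  assumes f: "f \<in> borel_measurable (lebesgue :: 'a::euclidean_space measure)" and eq: "AE x in lebesgue. f x = g x"
  shows "g \<in> borel_measurable lebesgue"
proof (rule measurableI)
  fix A :: "'b set" assume A: "A \<in> sets borel"
  have s1: "f -` A \<inter> space lebesgue \<in> sets lebesgue" by (rule measurable_sets[OF f A])
  have s2: "AE x in lebesgue. x \<in> f -` A \<inter> space lebesgue \<longleftrightarrow> x \<in> g -` A \<inter> space lebesgue"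
    using eq by eventually_elim auto
  show "g -` A \<inter> space lebesgue \<in> sets lebesgue"
    by (rule completion.in_sets_AE[OF s2 s1]) simp
qed simp

lemma AE_lebesgue_neq: "AE x in lebesgue. x \<noteq> (c::real)"
  by (rule AE_completion) (rule AE_lborel_singleton)

text \<open>The data are given on the open interval, while the integrals of
  \<open>mild_solution\<close> run over closed ones. This lemma and the next two bridge the gap,
  which consists of two points.\<close>

lemma closed_interval_measurable:
  fixes f :: "real \<Rightarrow> 'b::{second_countable_topology, real_normed_vector}"
  assumes "f \<in> borel_measurable (lebesgue_on {0<..<T})"
  shows "f \<in> borel_measurable (lebesgue_on {0..T})"
proof -
  have "(\<lambda>x. indicator {0<..<T} x *\<^sub>R f x) \<in> borel_measurable lebesgue"
    using assms by (subst (asm) borel_measurable_restrict_space_iff) auto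
  moreover have "AE x in lebesgue. indicator {0<..<T} x *\<^sub>R f x = indicator {0..T} x *\<^sub>R f x"
    using AE_lebesgue_neq[of 0] AE_lebesgue_neq[of T] by eventually_elim (auto simp: indicator_def)
  ultimately have "(\<lambda>x. indicator {0..T} x *\<^sub>R f x) \<in> borel_measurable lebesgue"
    by (rule lebesgue_measurable_AE)
  then show ?thesis by (subst borel_measurable_restrict_space_iff) auto
qed

lemma closed_interval_AE:
  assumes "AE x in lebesgue_on {0<..<T::real}. P x"
  shows "AE x in lebesgue_on {0..T}. P x"
proof -
  have "AE x in lebesgue. x \<in> {0<..<T} \<longrightarrow> P x" using assms by (simp add: AE_restrict_space_iff)
  with AE_lebesgue_neq[of 0] AE_lebesgue_neq[of T] have "AE x in lebesgue. x \<in> {0..T} \<longrightarrow> P x"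
    by eventually_elim auto
  then show ?thesis by (simp add: AE_restrict_space_iff)
qed

lemma closed_interval_integral:
  fixes f :: "real \<Rightarrow> 'b::{second_countable_topology, banach}"
  assumes "integrable (lebesgue_on {0<..<T}) f"
  shows "integrable (lebesgue_on {0..T}) f" "integral\<^sup>L (lebesgue_on {0..T}) f = integral\<^sup>L (lebesgue_on {0<..<T}) f"
proof -
  have i: "integrable lebesgue (\<lambda>x. indicator {0<..<T} x *\<^sub>R f x)"
    using assms by (simp add: integrable_restrict_space)
  have eq: "AE x in lebesgue. indicator {0<..<T} x *\<^sub>R f x = indicator {0..T} x *\<^sub>R f x"
    using AE_lebesgue_neq[of 0] AE_lebesgue_neq[of T] by eventually_elim (auto simp: indicator_def)
  have m: "(\<lambda>x. indicator {0..T} x *\<^sub>R f x) \<in> borel_measurable lebesgue"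
    by (rule lebesgue_measurable_AE[OF borel_measurable_integrable[OF i] eq])
  show "integrable (lebesgue_on {0..T}) f"
    using integrable_cong_AE_imp[OF i m eq] by (simp add: integrable_restrict_space)
  show "integral\<^sup>L (lebesgue_on {0..T}) f = integral\<^sup>L (lebesgue_on {0<..<T}) f"
    using integral_cong_AE[OF borel_measurable_integrable[OF i] m eq] by (simp add: integral_restrict_space)
qed

lemma lebesgue_on_integrable_subset:
  fixes f :: "real \<Rightarrow> 'b::{second_countable_topology, banach}"
  assumes "integrable (lebesgue_on A) f" "A \<in> sets lebesgue" "S \<in> sets lebesgue" "S \<subseteq> A"
  shows "integrable (lebesgue_on S) f"
proof -
  have "integrable lebesgue (\<lambda>x. indicator A x *\<^sub>R f x)" using assms by (simp add: integrable_restrict_space)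
  then have "integrable lebesgue (\<lambda>x. indicator S x *\<^sub>R indicator A x *\<^sub>R f x)"
    by (rule integrable_mult_indicator[OF assms(3)])
  moreover have "indicator S x *\<^sub>R indicator A x *\<^sub>R f x = indicator S x *\<^sub>R f x" for x
    using assms(4) by (auto simp: indicator_def)
  ultimately have "integrable lebesgue (\<lambda>x. indicator S x *\<^sub>R f x)" by (simp only:)
  then show ?thesis using assms(3) by (simp add: integrable_restrict_space)
qed

lemma lebesgue_on_measurable_subset:
  assumes "f \<in> borel_measurable (lebesgue_on A)" "S \<subseteq> A"
  shows "f \<in> borel_measurable (lebesgue_on S)"
  using measurable_restrict_mono[OF assms] .

lemma lebesgue_on_AE_subset:
  assumes "AE x in lebesgue_on A. P x" "A \<in> sets lebesgue" "S \<in> sets lebesgue" "S \<subseteq> A"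
  shows "AE x in lebesgue_on S. P x"
proof -
  have "AE x in lebesgue. x \<in> A \<longrightarrow> P x" using assms by (simp add: AE_restrict_space_iff)
  then have "AE x in lebesgue. x \<in> S \<longrightarrow> P x" by eventually_elim (use assms(4) in auto)
  then show ?thesis using assms by (simp add: AE_restrict_space_iff)
qed

lemma continuous_on_interval_measurable:
  fixes f :: "real \<Rightarrow> 'b::{second_countable_topology, real_normed_vector}"
  assumes "continuous_on {p..q} f"
  shows "f \<in> borel_measurable (lebesgue_on {p..q})"
proof -
  have "(\<lambda>x. indicator {p..q} x *\<^sub>R f x) \<in> borel_measurable borel"
    by (rule borel_measurable_continuous_on_indicator[OF _ assms]) simp
  then have "(\<lambda>x. indicator {p..q} x *\<^sub>R f x) \<in> borel_measurable lebesgue"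
    by (intro measurable_completion) simp
  then show ?thesis by (subst borel_measurable_restrict_space_iff) auto
qed

text \<open>The gain of H^(1/2) under integration in time, in the form proved by
  \<open>Duhamel_bound\<close>. Asking for it on every measurable \<open>S\<close> makes it apply to
  [0,t] for the size of the Duhamel term and to (p,q] for its increments.\<close>

definition smoothing :: "real \<Rightarrow> (real \<Rightarrow> L2) \<Rightarrow> (real \<Rightarrow> real) \<Rightarrow> bool" where
  "smoothing T v G \<longleftrightarrow> integrable (lebesgue_on {0..T}) v \<and> integrable (lebesgue_on {0..T}) G \<and>
     (\<forall>S\<in>sets lebesgue. S \<subseteq> {0..T} \<longrightarrow> (\<forall>K.
        (\<Sum>k<K. (2 * real k + 1) * (cmod (\<integral>s. phase (- s) k * hcoef (v s) k \<partial>lebesgue_on S))\<^sup>2)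
          \<le> (\<integral>s. G s \<partial>lebesgue_on S)))"

lemma integrable_phase_hcoef:
  assumes "integrable (lebesgue_on S) v"
  shows "integrable (lebesgue_on S) (\<lambda>s. phase (- s) k * hcoef (v s) k)"
proof -
  have i: "integrable (lebesgue_on S) (\<lambda>s. hcoef (v s) k)"
    by (rule integrable_bounded_linear[OF bounded_linear_cinner_left assms])
  show ?thesis
    by (rule Bochner_Integration.integrable_bound[OF i])
      (use borel_measurable_integrable[OF i] in \<open>auto simp: norm_mult\<close>)
qed

lemma smoothing_integrable_phase:
  assumes "smoothing T v G" "S \<in> sets lebesgue" "S \<subseteq> {0..T}"
  shows "integrable (lebesgue_on S) (\<lambda>s. phase (- s) k * hcoef (v s) k)"
proof (rule integrable_phase_hcoef)
  have "integrable (lebesgue_on {0..T}) v" using assms(1) by (simp add: smoothing_def)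
  then show "integrable (lebesgue_on S) v" by (rule lebesgue_on_integrable_subset) (use assms in auto)
qed

lemma smoothing_add:
  assumes v: "smoothing T v G" and w: "smoothing T w H"
  shows "smoothing T (\<lambda>s. v s + w s) (\<lambda>s. 2 * G s + 2 * H s)"
  unfolding smoothing_def
proof (intro conjI ballI impI allI)
  show "integrable (lebesgue_on {0..T}) (\<lambda>s. v s + w s)" "integrable (lebesgue_on {0..T}) (\<lambda>s. 2 * G s + 2 * H s)"
    using v w by (auto simp: smoothing_def)
  fix S :: "real set" and K assume S: "S \<in> sets lebesgue" "S \<subseteq> {0..T}"
  define I where "I k = (\<integral>s. phase (- s) k * hcoef (v s) k \<partial>lebesgue_on S)" for k
  define J where "J k = (\<integral>s. phase (- s) k * hcoef (w s) k \<partial>lebesgue_on S)" for k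
  have e: "(\<integral>s. phase (- s) k * hcoef (v s + w s) k \<partial>lebesgue_on S) = I k + J k" for k
    unfolding I_def J_def cinner_add_left distrib_left
    by (rule Bochner_Integration.integral_add[OF smoothing_integrable_phase[OF v S] smoothing_integrable_phase[OF w S]])
  have sq: "(cmod (x + y))\<^sup>2 \<le> 2 * (cmod x)\<^sup>2 + 2 * (cmod y)\<^sup>2" for x y
  proof -
    have "(cmod (x + y))\<^sup>2 \<le> (cmod x + cmod y)\<^sup>2" by (intro power_mono norm_triangle_ineq) auto
    also have "\<dots> \<le> 2 * (cmod x)\<^sup>2 + 2 * (cmod y)\<^sup>2"
      using sum_squares_bound[of "cmod x" "cmod y"] by (simp add: power2_sum)
    finally show ?thesis .
  qed
  have iG: "integrable (lebesgue_on S) G" "integrable (lebesgue_on S) H"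
  proof -
    have "integrable (lebesgue_on {0..T}) G" "integrable (lebesgue_on {0..T}) H"
      using v w by (auto simp: smoothing_def)
    then show "integrable (lebesgue_on S) G" "integrable (lebesgue_on S) H"
      using lebesgue_on_integrable_subset[OF _ _ S] by simp_all
  qed
  have "(\<Sum>k<K. (2 * real k + 1) * (cmod (I k + J k))\<^sup>2) \<le> (\<Sum>k<K. (2 * real k + 1) * (2 * (cmod (I k))\<^sup>2 + 2 * (cmod (J k))\<^sup>2))"
    by (intro sum_mono mult_left_mono sq) auto
  also have "\<dots> = 2 * (\<Sum>k<K. (2 * real k + 1) * (cmod (I k))\<^sup>2) + 2 * (\<Sum>k<K. (2 * real k + 1) * (cmod (J k))\<^sup>2)"
    unfolding sum_distrib_left sum.distrib[symmetric] by (intro sum.cong refl) (simp add: algebra_simps)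
  also have "\<dots> \<le> 2 * (\<integral>s. G s \<partial>lebesgue_on S) + 2 * (\<integral>s. H s \<partial>lebesgue_on S)"
    unfolding I_def J_def using v w S by (intro add_mono mult_left_mono) (auto simp: smoothing_def)
  also have "\<dots> = (\<integral>s. 2 * G s + 2 * H s \<partial>lebesgue_on S)" using iG by simp
  finally show "(\<Sum>k<K. (2 * real k + 1) * (cmod (\<integral>s. phase (- s) k * hcoef (v s + w s) k \<partial>lebesgue_on S))\<^sup>2)
     \<le> (\<integral>s. 2 * G s + 2 * H s \<partial>lebesgue_on S)"
    unfolding e .
qed

text \<open>The coefficients of H^(1/2) applied to the integral of e^(iHs) v(s) over [0,t]. The
  outer factor e^(-iHt) is split off and restored later, so that an increment in \<open>t\<close> is
  again an integral over an interval.\<close>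

definition duhamel_coef :: "(real \<Rightarrow> L2) \<Rightarrow> real \<Rightarrow> nat \<Rightarrow> complex" where
  "duhamel_coef v t k = of_real (sqrt (2 * real k + 1)) * (\<integral>s. phase (- s) k * hcoef (v s) k \<partial>lebesgue_on {0..t})"

definition duhamel :: "(real \<Rightarrow> L2) \<Rightarrow> real \<Rightarrow> L2" where
  "duhamel v t = hseries (duhamel_coef v t)"

lemma duhamel_coef_sum:
  "(\<Sum>k<K. (cmod (of_real (sqrt (2 * real k + 1)) * z k))\<^sup>2) = (\<Sum>k<K. (2 * real k + 1) * (cmod (z k))\<^sup>2)"
  by (intro sum.cong refl) (simp add: norm_mult power_mult_distrib)

lemma duhamel_bound:
  assumes v: "smoothing T v G" and t: "t \<in> {0..T}"
  shows "sq_summable (duhamel_coef v t)" "(norm (duhamel v t))\<^sup>2 \<le> (\<integral>s. G s \<partial>lebesgue_on {0..t})"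
proof -
  have le: "(\<Sum>k<K. (cmod (duhamel_coef v t k))\<^sup>2) \<le> (\<integral>s. G s \<partial>lebesgue_on {0..t})" for K
    unfolding duhamel_coef_def duhamel_coef_sum using v t by (auto simp: smoothing_def)
  have G0: "0 \<le> (\<integral>s. G s \<partial>lebesgue_on {0..t})" using le[of 0] by simp
  have le': "(\<Sum>k<K. (cmod (duhamel_coef v t k))\<^sup>2) \<le> (sqrt (\<integral>s. G s \<partial>lebesgue_on {0..t}))\<^sup>2" for K
    using le[of K] G0 by simp
  show "sq_summable (duhamel_coef v t)" by (rule norm_hseries_le(1)[OF le' real_sqrt_ge_zero[OF G0]])
  have "norm (duhamel v t) \<le> sqrt (\<integral>s. G s \<partial>lebesgue_on {0..t})"
    unfolding duhamel_def by (rule norm_hseries_le(2)[OF le' real_sqrt_ge_zero[OF G0]])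
  then have "(norm (duhamel v t))\<^sup>2 \<le> (sqrt (\<integral>s. G s \<partial>lebesgue_on {0..t}))\<^sup>2" by (intro power_mono) auto
  then show "(norm (duhamel v t))\<^sup>2 \<le> (\<integral>s. G s \<partial>lebesgue_on {0..t})" using G0 by simp
qed

lemma lebesgue_on_integral_split:
  fixes f :: "real \<Rightarrow> 'b::{second_countable_topology, banach}"
  assumes f: "integrable (lebesgue_on {0..T}) f" and t: "0 \<le> p" "p \<le> q" "q \<le> T"
  shows "integral\<^sup>L (lebesgue_on {0..q}) f - integral\<^sup>L (lebesgue_on {0..p}) f = integral\<^sup>L (lebesgue_on {p<..q}) f"
proof -
  have i: "integrable lebesgue (\<lambda>x. indicator S x *\<^sub>R f x)" if "S \<in> sets lebesgue" "S \<subseteq> {0..T}" for S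
    using lebesgue_on_integrable_subset[OF f _ that] that by (simp add: integrable_restrict_space)
  have "indicator {0..q} x *\<^sub>R f x - indicator {0..p} x *\<^sub>R f x = indicator {p<..q} x *\<^sub>R f x" for x
    using t by (auto simp: indicator_def)
  then show ?thesis
    using Bochner_Integration.integral_diff[OF i[of "{0..q}"] i[of "{0..p}"]] t
    by (simp add: integral_restrict_space)
qed

lemma duhamel_increment:
  assumes v: "smoothing T v G" and t: "0 \<le> p" "p \<le> q" "q \<le> T"
  shows "(norm (duhamel v q - duhamel v p))\<^sup>2 \<le> (\<integral>s. G s \<partial>lebesgue_on {p<..q})"
proof -
  have sub: "{p<..q} \<subseteq> {0..T}" using t by auto
  have d: "duhamel_coef v q k - duhamel_coef v p k = of_real (sqrt (2 * real k + 1)) * (\<integral>s. phase (- s) k * hcoef (v s) k \<partial>lebesgue_on {p<..q})" for k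
    unfolding duhamel_coef_def right_diff_distrib[symmetric]
    by (subst lebesgue_on_integral_split[OF smoothing_integrable_phase[OF v] t]) auto
  have le: "(\<Sum>k<K. (cmod (duhamel_coef v q k - duhamel_coef v p k))\<^sup>2) \<le> (\<integral>s. G s \<partial>lebesgue_on {p<..q})" for K
    unfolding d duhamel_coef_sum using v sub by (auto simp: smoothing_def)
  have G0: "0 \<le> (\<integral>s. G s \<partial>lebesgue_on {p<..q})" using le[of 0] by simp
  have le': "(\<Sum>k<K. (cmod (duhamel_coef v q k - duhamel_coef v p k))\<^sup>2) \<le> (sqrt (\<integral>s. G s \<partial>lebesgue_on {p<..q}))\<^sup>2" for K
    using le[of K] G0 by simp
  have "duhamel v q - duhamel v p = hseries (\<lambda>k. duhamel_coef v q k - duhamel_coef v p k)"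
    unfolding duhamel_def using t by (intro hseries_diff[symmetric] duhamel_bound(1)[OF v]) auto
  then have "norm (duhamel v q - duhamel v p) \<le> sqrt (\<integral>s. G s \<partial>lebesgue_on {p<..q})"
    using norm_hseries_le(2)[OF le' real_sqrt_ge_zero[OF G0]] by simp
  then have "(norm (duhamel v q - duhamel v p))\<^sup>2 \<le> (sqrt (\<integral>s. G s \<partial>lebesgue_on {p<..q}))\<^sup>2" by (intro power_mono) auto
  then show ?thesis using G0 by simp
qed

text \<open>The squared increment is dominated by the increment of the indefinite integral of
  \<open>G\<close>, which is continuous.\<close>

lemma duhamel_continuous:
  assumes v: "smoothing T v G"
  shows "continuous_on {0..T} (duhamel v)"
proof -
  have G: "integrable (lebesgue_on {0..T}) G" using v by (simp add: smoothing_def)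
  define \<Gamma> where "\<Gamma> t = integral\<^sup>L (lebesgue_on {0..t}) G" for t
  have "continuous_on {0..T} (\<lambda>t. integral {0..t} G)"
    by (rule indefinite_integral_continuous_1[OF integrable_on_lebesgue_on[OF G]]) simp
  moreover have "integral {0..t} G = \<Gamma> t" if "t \<in> {0..T}" for t
    unfolding \<Gamma>_def using that lebesgue_on_integrable_subset[OF G, of "{0..t}"]
    by (intro lebesgue_integral_eq_integral[symmetric]) auto
  ultimately have c: "continuous_on {0..T} \<Gamma>" by (rule continuous_on_eq)
  have inc: "(norm (duhamel v s - duhamel v t))\<^sup>2 \<le> \<bar>\<Gamma> s - \<Gamma> t\<bar>" if "s \<in> {0..T}" "t \<in> {0..T}" for s t
  proof (cases "s \<le> t")
    case True
    then show ?thesis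
      using duhamel_increment[OF v, of s t] lebesgue_on_integral_split[OF G, of s t] that
      by (simp add: \<Gamma>_def norm_minus_commute)
  next
    case False
    then show ?thesis
      using duhamel_increment[OF v, of t s] lebesgue_on_integral_split[OF G, of t s] that
      by (simp add: \<Gamma>_def)
  qed
  show ?thesis
    unfolding continuous_on_def
  proof
    fix t assume t: "t \<in> {0..T}"
    have "(\<Gamma> \<longlongrightarrow> \<Gamma> t) (at t within {0..T})" using c t by (simp add: continuous_on_def)
    then have "((\<lambda>s. sqrt \<bar>\<Gamma> s - \<Gamma> t\<bar>) \<longlongrightarrow> sqrt \<bar>\<Gamma> t - \<Gamma> t\<bar>) (at t within {0..T})" by (intro tendsto_intros)
    then have z: "((\<lambda>s. sqrt \<bar>\<Gamma> s - \<Gamma> t\<bar>) \<longlongrightarrow> 0) (at t within {0..T})" by simp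
    have "((\<lambda>s. duhamel v s - duhamel v t) \<longlongrightarrow> 0) (at t within {0..T})"
    proof (rule Lim_null_comparison[OF _ z])
      show "\<forall>\<^sub>F s in at t within {0..T}. norm (duhamel v s - duhamel v t) \<le> sqrt \<bar>\<Gamma> s - \<Gamma> t\<bar>"
        unfolding eventually_at_filter using inc[OF _ t] by (auto intro!: always_eventually real_le_rsqrt)
    qed
    then show "(duhamel v \<longlongrightarrow> duhamel v t) (at t within {0..T})" by (simp add: LIM_zero_iff)
  qed
qed

lemma duhamel_diff:
  assumes v: "smoothing T v G" and w: "smoothing T w H" and t: "t \<in> {0..T}"
  shows "duhamel v t - duhamel w t = duhamel (\<lambda>s. v s - w s) t"
proof -
  have "duhamel_coef v t k - duhamel_coef w t k = duhamel_coef (\<lambda>s. v s - w s) t k" for k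
    unfolding duhamel_coef_def right_diff_distrib[symmetric] cinner_diff_left
    by (subst Bochner_Integration.integral_diff[OF smoothing_integrable_phase[OF v] smoothing_integrable_phase[OF w], symmetric])
      (use t in \<open>auto simp: right_diff_distrib\<close>)
  then have "(\<lambda>k. duhamel_coef v t k - duhamel_coef w t k) = duhamel_coef (\<lambda>s. v s - w s) t" by (rule ext)
  then show ?thesis
    unfolding duhamel_def hseries_diff[OF duhamel_bound(1)[OF v t] duhamel_bound(1)[OF w t], symmetric] by (simp only:)
qed

lemma exp_iH_measurable:
  assumes "v \<in> borel_measurable M" "f \<in> borel_measurable M"
  shows "(\<lambda>s. exp_iH (f s) (v s)) \<in> borel_measurable M"
proof (rule borel_measurable_continuous_Pair[OF assms(2,1)])
  show "continuous_on UNIV (\<lambda>x. exp_iH (fst x) (snd x))"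
    unfolding continuous_on_def by (intro ballI exp_iH_tendsto tendsto_intros)
qed

lemma duhamel_integrable:
  assumes v: "integrable (lebesgue_on {0..T}) v" and t: "t \<in> {0..T}"
  shows "integrable (lebesgue_on {0..t}) (\<lambda>s. exp_iH (t - s) (v s))"
proof -
  have i: "integrable (lebesgue_on {0..t}) v"
    using t by (intro lebesgue_on_integrable_subset[OF v]) auto
  show ?thesis
  proof (rule Bochner_Integration.integrable_bound[OF i])
    show "(\<lambda>s. exp_iH (t - s) (v s)) \<in> borel_measurable (lebesgue_on {0..t})"
      by (intro exp_iH_measurable borel_measurable_integrable[OF i] continuous_on_interval_measurable continuous_intros)
  qed (simp add: norm_exp_iH_le)
qed

lemma duhamel_integral_coef:
  assumes "has_bochner_integral (lebesgue_on {0..t}) (\<lambda>s. exp_iH (t - s) (v s)) J"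
  shows "J \<in> hermite_span" "hcoef J k = phase t k * (\<integral>s. phase (- s) k * hcoef (v s) k \<partial>lebesgue_on {0..t})"
proof -
  have "has_bochner_integral (lebesgue_on {0..t}) (\<lambda>s. hcoef (exp_iH (t - s) (v s)) k) (hcoef J k)"
    by (rule has_bochner_integral_bounded_linear[OF bounded_linear_cinner_left assms])
  then have "hcoef J k = (\<integral>s. hcoef (exp_iH (t - s) (v s)) k \<partial>lebesgue_on {0..t})"
    by (rule has_bochner_integral_integral_eq[symmetric])
  also have "\<dots> = (\<integral>s. phase t k * (phase (- s) k * hcoef (v s) k) \<partial>lebesgue_on {0..t})"
    using phase_add[of t "- s" k for s] by (simp add: mult.assoc)
  finally show "hcoef J k = phase t k * (\<integral>s. phase (- s) k * hcoef (v s) k \<partial>lebesgue_on {0..t})" by simp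
  \<comment> \<open>The projection onto \<open>hermite_span\<close>. It is bounded and fixes the
    integrand, hence it fixes the integral.\<close>
  define P where "P = multiplier (\<lambda>_. 1)"
  have P: "P \<psi> = hseries (hcoef \<psi>)" for \<psi> by (simp add: P_def multiplier_def)
  have "bounded_linear P" unfolding P_def by (rule multiplier_bounded_linear[where K = 1]) simp
  from has_bochner_integral_bounded_linear[OF this assms]
  have "has_bochner_integral (lebesgue_on {0..t}) (\<lambda>s. P (exp_iH (t - s) (v s))) (P J)" .
  moreover have "P (exp_iH (t - s) (v s)) = exp_iH (t - s) (v s)" for s
    using exp_iH_in_span[of "t - s" "v s"] unfolding P hermite_span_def by simp
  ultimately have "P J = J" using assms has_bochner_integral_eq by fastforce
  then show "J \<in> hermite_span" by (simp add: P hermite_span_def)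
qed

lemma square_integrable_cong:
  assumes "square_integrable f" "g \<in> borel_measurable borel" "AE x in lborel. f x = g x"
  shows "square_integrable g"
  unfolding square_integrable_def
proof
  show "integrable lborel (\<lambda>x. (cmod (g x))\<^sup>2)"
    by (rule integrable_cong_AE_imp[OF square_integrableD(2)[OF assms(1)]])
      (use assms(2,3) in \<open>auto elim: eventually_mono\<close>)
qed (use assms in simp)

lemma square_integrable_x_diff:
  assumes "square_integrable (\<lambda>x. of_real x * fun_L2 \<phi> x)" "square_integrable (\<lambda>x. of_real x * fun_L2 \<psi> x)"
  shows "square_integrable (\<lambda>x. of_real x * fun_L2 (\<phi> - \<psi>) x)"
proof (rule square_integrable_cong[OF square_integrable_diff[OF assms]])
  show "AE x in lborel. of_real x * fun_L2 \<phi> x - of_real x * fun_L2 \<psi> x = of_real x * fun_L2 (\<phi> - \<psi>) x"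
    using fun_L2_diff[of \<phi> \<psi>] by eventually_elim (simp add: right_diff_distrib)
qed measurable

lemma norm_le_H1_tilde_norm:
  assumes "square_integrable (\<lambda>x. of_real x * fun_L2 \<psi> x)"
  shows "norm \<psi> \<le> H1_tilde_norm N a \<psi>"
  using H1_tilde_norm_bounds(1)[OF assms] H1_tilde_norm_nonneg by (rule power2_le_imp_le)

text \<open>Strong measurability is given for the norm of \<open>H1_tilde\<close>, which dominates
  that of \<open>L2\<close>: the simple functions also converge in \<open>L2\<close> almost
  everywhere, and their limit is measurable.\<close>

lemma L2_time_measurable:
  assumes "f \<in> L2_time T (H1_tilde N a) (H1_tilde_norm N a)"
  shows "f \<in> borel_measurable (lebesgue_on {0..T})"
proof -
  define M where "M = lebesgue_on {0<..<T}"
  have X: "AE t in M. f t \<in> H1_tilde N a"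
    using assms unfolding L2_time_def M_def by blast
  obtain s where s: "\<And>n. simple_function M (s n)" "\<And>n. s n ` {0<..<T} \<subseteq> H1_tilde N a"
    "AE t in M. (\<lambda>n. H1_tilde_norm N a (f t - s n t)) \<longlonglongrightarrow> 0"
    using assms unfolding L2_time_def strongly_measurable_time_def M_def by blast
  define g where "g t = lim (\<lambda>n. s n t)" for t
  have g: "g \<in> borel_measurable M"
    unfolding g_def by (rule borel_measurable_lim_metric) (rule borel_measurable_simple_function[OF s(1)])
  have "AE t in M. t \<in> space M" by (rule AE_space)
  with X s(3) have "AE t in M. g t = f t"
  proof eventually_elim
    case (elim t)
    have st: "s n t \<in> H1_tilde N a" for n using s(2)[of n] elim(3) by (auto simp: M_def)
    \<comment> \<open>The comparison of norms needs square integrability of \<open>x\<close> times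
      the difference, which both terms provide as members of \<open>H1_tilde\<close>.\<close>
    have le: "norm (s n t - f t) \<le> H1_tilde_norm N a (f t - s n t)" for n
      unfolding norm_minus_commute[of "s n t"]
      by (intro norm_le_H1_tilde_norm square_integrable_x_diff) (use elim(1) st in \<open>auto simp: H1_tilde_def\<close>)
    have "(\<lambda>n. s n t - f t) \<longlonglongrightarrow> 0"
      by (rule Lim_null_comparison[OF always_eventually[OF allI[OF le]] elim(2)])
    then have "(\<lambda>n. s n t) \<longlonglongrightarrow> f t" by (simp add: LIM_zero_iff)
    then show ?case unfolding g_def by (rule limI)
  qed
  then have ae: "AE t in lebesgue. indicator {0<..<T} t *\<^sub>R g t = indicator {0<..<T} t *\<^sub>R f t"
    unfolding M_def by (simp add: AE_restrict_space_iff indicator_def) (auto elim: eventually_mono)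
  have gm: "(\<lambda>t. indicator {0<..<T} t *\<^sub>R g t) \<in> borel_measurable lebesgue"
    using g unfolding M_def by (subst (asm) borel_measurable_restrict_space_iff) auto
  have "(\<lambda>t. indicator {0<..<T} t *\<^sub>R f t) \<in> borel_measurable lebesgue"
    by (rule lebesgue_measurable_AE[OF gm ae])
  then have "f \<in> borel_measurable (lebesgue_on {0<..<T})"
    by (subst borel_measurable_restrict_space_iff) auto
  then show ?thesis by (rule closed_interval_measurable)
qed

section \<open>Smoothing for the source and for the control term\<close>

lemma hcoef_measurable:
  assumes "f \<in> borel_measurable M"
  shows "(\<lambda>s. hcoef (f s) k) \<in> borel_measurable M"
  by (rule borel_measurable_continuous_on[OF linear_continuous_on[OF bounded_linear_cinner_left] assms])

lemma hermite_points_bounded: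
  obtains B where "\<And>j k. j \<in> {1..N::nat} \<Longrightarrow> \<bar>hermite_fun k (a j)\<bar> \<le> B"
proof -
  have "\<forall>j. \<exists>b. \<forall>k. \<bar>hermite_fun k (a j)\<bar> \<le> b" using hermite_fun_bounded by blast
  from choice[OF this] obtain b where b: "\<And>j k. \<bar>hermite_fun k (a j)\<bar> \<le> b j" by blast
  have b0: "b j \<ge> 0" for j using order_trans[OF abs_ge_zero b] .
  have "\<bar>hermite_fun k (a j)\<bar> \<le> (\<Sum>j=1..N. b j)" if "j \<in> {1..N}" for j k
    by (rule order_trans[OF b member_le_sum[OF that]]) (auto simp: b0)
  then show ?thesis using that by blast
qed

lemma interval_in_periods:
  obtains n :: nat where "n > 0" "{0..T} \<subseteq> {0..real n * pi}"
proof -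
  obtain n :: nat where n: "T / pi < real n" using reals_Archimedean2 by blast
  then have "T < real n * pi" by (simp add: pos_divide_less_eq)
  moreover have "real (Suc n) * pi = pi + real n * pi" by (simp add: algebra_simps)
  ultimately have "T \<le> real (Suc n) * pi" using pi_gt_zero by linarith
  then show ?thesis using that[of "Suc n"] by auto
qed

text \<open>For almost every time the decomposition of \<open>H1_tilde_jump_decomp\<close> feeds
  \<open>Duhamel_bound\<close>; \<open>jump_measurable\<close> supplies the measurability in time.
  The constant is independent of \<open>f\<close>.\<close>

lemma L2_time_smoothing:
  assumes a: "strict_mono_on {1..N} a"
  obtains C where "C \<ge> 0" "\<And>f. f \<in> L2_time T (H1_tilde N a) (H1_tilde_norm N a) \<Longrightarrow>
     smoothing T f (\<lambda>s. C * (H1_tilde_norm N a (f s))\<^sup>2)"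
proof -
  obtain n :: nat where n: "n > 0" "{0..T} \<subseteq> {0..real n * pi}" by (rule interval_in_periods)
  obtain B where B: "\<And>j k. j \<in> {1..N} \<Longrightarrow> \<bar>hermite_fun k (a j)\<bar> \<le> B" using hermite_points_bounded by blast
  obtain C0 where C0: "C0 \<ge> 0" "\<And>\<psi>. \<psi> \<in> H1_tilde N a \<Longrightarrow>
     jump_decomp N (\<lambda>j k. hermite_fun k (a j)) (hcoef \<psi>) (\<lambda>j. jump (a j) \<psi>) (C0 * (H1_tilde_norm N a \<psi>)\<^sup>2)"
    using H1_tilde_jump_decomp[OF a] by blast
  define c where "c = real n * pi * (5 + 4 * (real N)\<^sup>2 * B\<^sup>2)"
  have c: "c \<ge> 0" unfolding c_def by (intro mult_nonneg_nonneg add_nonneg_nonneg) auto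
  have "smoothing T f (\<lambda>s. (c * C0) * (H1_tilde_norm N a (f s))\<^sup>2)"
    if f: "f \<in> L2_time T (H1_tilde N a) (H1_tilde_norm N a)" for f
    unfolding smoothing_def
  proof (intro conjI ballI impI allI)
    have fm: "f \<in> borel_measurable (lebesgue_on {0..T})" by (rule L2_time_measurable[OF f])
    have fX: "AE s in lebesgue_on {0..T}. f s \<in> H1_tilde N a"
      using f unfolding L2_time_def by (intro closed_interval_AE) blast
    have ni: "integrable (lebesgue_on {0..T}) (\<lambda>s. (H1_tilde_norm N a (f s))\<^sup>2)"
      using f unfolding L2_time_def by (intro closed_interval_integral(1)) blast
    then show "integrable (lebesgue_on {0..T}) (\<lambda>s. (c * C0) * (H1_tilde_norm N a (f s))\<^sup>2)" by simp
    have fin: "finite_measure (lebesgue_on {0..T})" by (rule finite_measure_lebesgue_on_bounded) auto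
    show "integrable (lebesgue_on {0..T}) f"
    proof (rule Bochner_Integration.integrable_bound[OF _ fm])
      show "integrable (lebesgue_on {0..T}) (\<lambda>s. 1 + (H1_tilde_norm N a (f s))\<^sup>2)"
        using ni finite_measure.integrable_const[OF fin, of "1::real"] by (intro Bochner_Integration.integrable_add)
      show "AE s in lebesgue_on {0..T}. norm (f s) \<le> norm (1 + (H1_tilde_norm N a (f s))\<^sup>2)"
        using fX
      proof eventually_elim
        case (elim s)
        define z where "z = H1_tilde_norm N a (f s)"
        have "2 * z * 1 \<le> z\<^sup>2 + 1\<^sup>2" by (rule sum_squares_bound)
        moreover have "norm (f s) \<le> z" unfolding z_def using elim by (intro norm_le_H1_tilde_norm) (simp add: H1_tilde_def)
        moreover have "z \<ge> 0" by (simp add: z_def H1_tilde_norm_nonneg)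
        ultimately have "norm (f s) \<le> 1 + z\<^sup>2" unfolding power_one mult_1_right by linarith
        then show ?case by (simp add: z_def)
      qed
    qed
    fix S :: "real set" and K assume S: "S \<in> sets lebesgue" "S \<subseteq> {0..T}"
    have "(\<Sum>k<K. (2 * real k + 1) * (cmod (\<integral>s. phase (- s) k * hcoef (f s) k \<partial>lebesgue_on S))\<^sup>2)
      \<le> (real n * pi * (5 + 4 * (real N)\<^sup>2 * B\<^sup>2)) * (\<integral>s. C0 * (H1_tilde_norm N a (f s))\<^sup>2 \<partial>lebesgue_on S)"
    proof (rule Duhamel_bound[OF S(1) subset_trans[OF S(2) n(2)] n(1) B])
      have fmS: "f \<in> borel_measurable (lebesgue_on S)" by (rule lebesgue_on_measurable_subset[OF fm S(2)])
      show "(\<lambda>s. hcoef (f s) k) \<in> borel_measurable (lebesgue_on S)" for k by (rule hcoef_measurable[OF fmS])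
      show "(\<lambda>s. jump (a j) (f s)) \<in> borel_measurable (lebesgue_on S)" for j by (rule jump_measurable[OF fmS])
      show "integrable (lebesgue_on S) (\<lambda>s. C0 * (H1_tilde_norm N a (f s))\<^sup>2)"
        using lebesgue_on_integrable_subset[OF ni _ S] by simp
      show "AE s in lebesgue_on S. jump_decomp N (\<lambda>j k. hermite_fun k (a j)) (hcoef (f s)) (\<lambda>j. jump (a j) (f s)) (C0 * (H1_tilde_norm N a (f s))\<^sup>2)"
        using lebesgue_on_AE_subset[OF fX _ S] by (auto elim!: eventually_mono intro: C0(2))
    qed
    then show "(\<Sum>k<K. (2 * real k + 1) * (cmod (\<integral>s. phase (- s) k * hcoef (f s) k \<partial>lebesgue_on S))\<^sup>2)
      \<le> (\<integral>s. (c * C0) * (H1_tilde_norm N a (f s))\<^sup>2 \<partial>lebesgue_on S)"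
      unfolding c_def[symmetric] by (simp add: mult.assoc)
  qed
  then show ?thesis using that[of "c * C0"] c C0(1) by simp
qed

lemma jump_decomp_scale:
  assumes "jump_decomp N b v h G"
  shows "jump_decomp N b (\<lambda>k. of_real r * v k) (\<lambda>j. of_real r * h j) (r\<^sup>2 * G)"
proof -
  have e: "of_real (sqrt (2 * real k + 2)) * (of_real r * v (Suc k)) - (\<Sum>j=1..N. of_real r * h j * of_real (b j k))
    = of_real r * (of_real (sqrt (2 * real k + 2)) * v (Suc k) - (\<Sum>j=1..N. h j * of_real (b j k)))" for k
    by (simp add: right_diff_distrib sum_distrib_left mult_ac)
  show ?thesis
    using assms unfolding jump_decomp_def e
    by (auto simp: norm_mult power_mult_distrib sum_distrib_left[symmetric] intro!: mult_left_mono)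
qed

lemma bounded_linear_scaleC_left: "bounded_linear (\<lambda>z. z *\<^sub>c f)"
  by (rule bounded_linear_intro[where K = "norm f"])
    (auto simp: scaleC_add_left norm_scaleC scaleR_L2_eq scaleC_scaleC scaleR_conv_of_real)

text \<open>The jump decomposition of the product is available for finite Hermite sums, so H^(-1/2)
  \<xi> is truncated. The resulting bound is uniform in the length of the truncation and involves
  finitely many coefficients, so it survives the limit.\<close>

lemma mult_smoothing:
  fixes u :: "real \<Rightarrow> real"
  assumes a: "strict_mono_on {1..N} a" and \<mu>: "\<mu> \<in> H1_tilde N a"
    and um: "u \<in> borel_measurable (lebesgue_on {0..T})" and u2: "integrable (lebesgue_on {0..T}) (\<lambda>s. (u s)\<^sup>2)"
  obtains C where "C \<ge> 0" "\<And>\<xi>. continuous_on {0..T} \<xi> \<Longrightarrow>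
     smoothing T (\<lambda>s. u s *\<^sub>R mult_L2 \<mu> (H_half_inv (\<xi> s))) (\<lambda>s. C * ((u s)\<^sup>2 * (norm (\<xi> s))\<^sup>2))"
proof -
  obtain n0 :: nat where n0: "n0 > 0" "{0..T} \<subseteq> {0..real n0 * pi}" by (rule interval_in_periods)
  obtain B where B: "\<And>j k. j \<in> {1..N} \<Longrightarrow> \<bar>hermite_fun k (a j)\<bar> \<le> B" using hermite_points_bounded by blast
  obtain C0 J where C0: "C0 \<ge> 0" "\<And>c n. jump_decomp N (\<lambda>j k. hermite_fun k (a j)) (hcoef (mult_L2 \<mu> (\<Sum>m<n. c m *\<^sub>c hermite_L2 m)))
       (\<lambda>j. J j * hsum c n (a j)) (C0 * hsum_energy c n)"
    using mult_L2_jump_decomp[OF a \<mu>] by blast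
  obtain D where D: "AE x in lborel. cmod (fun_L2 \<mu> x) \<le> D" "D \<ge> 0" using H1_tilde_bounded[OF a \<mu>] by blast
  note bl = mult_L2_bounded(4)[OF D]
  define c where "c = real n0 * pi * (5 + 4 * (real N)\<^sup>2 * B\<^sup>2)"
  have c: "c \<ge> 0" unfolding c_def by (intro mult_nonneg_nonneg add_nonneg_nonneg) auto
  have fin: "finite_measure (lebesgue_on {0..T})" by (rule finite_measure_lebesgue_on_bounded) auto
  have u1: "integrable (lebesgue_on {0..T}) u"
  proof (rule Bochner_Integration.integrable_bound[OF _ um])
    show "integrable (lebesgue_on {0..T}) (\<lambda>s. 1 + (u s)\<^sup>2)"
      using u2 finite_measure.integrable_const[OF fin, of "1::real"] by (intro Bochner_Integration.integrable_add)
    show "AE s in lebesgue_on {0..T}. norm (u s) \<le> norm (1 + (u s)\<^sup>2)"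
    proof (rule AE_I2)
      fix s
      have "2 * \<bar>u s\<bar> * 1 \<le> \<bar>u s\<bar>\<^sup>2 + 1\<^sup>2" by (rule sum_squares_bound)
      then have "\<bar>u s\<bar> \<le> 1 + (u s)\<^sup>2" using abs_ge_zero[of "u s"] unfolding power_one mult_1_right power2_abs by linarith
      then show "norm (u s) \<le> norm (1 + (u s)\<^sup>2)" by simp
    qed
  qed
  have "smoothing T (\<lambda>s. u s *\<^sub>R mult_L2 \<mu> (H_half_inv (\<xi> s))) (\<lambda>s. (c * C0) * ((u s)\<^sup>2 * (norm (\<xi> s))\<^sup>2))"
    if \<xi>: "continuous_on {0..T} \<xi>" for \<xi>
  proof -
    have "bounded (\<xi> ` {0..T})" by (intro compact_imp_bounded compact_continuous_image \<xi>) auto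
    then obtain X where X: "\<And>s. s \<in> {0..T} \<Longrightarrow> norm (\<xi> s) \<le> X" unfolding bounded_iff by blast
    define w where "w s = u s *\<^sub>R mult_L2 \<mu> (H_half_inv (\<xi> s))" for s
    define q where "q s m = hcoef (H_half_inv (\<xi> s)) m" for s m
    define p where "p n s = (\<Sum>m<n. q s m *\<^sub>c hermite_L2 m)" for n s
    define wn where "wn n s = u s *\<^sub>R mult_L2 \<mu> (p n s)" for n s
    have cH: "continuous_on {0..T} (\<lambda>s. H_half_inv (\<xi> s))"
      by (rule continuous_on_compose2[OF linear_continuous_on[OF bounded_linear_H_half_inv] \<xi>]) auto
    have cq: "continuous_on {0..T} (\<lambda>s. q s m)" for m
      unfolding q_def by (rule continuous_on_compose2[OF linear_continuous_on[OF bounded_linear_cinner_left] cH]) auto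
    have cp: "continuous_on {0..T} (p n)" for n
      unfolding p_def
      by (intro continuous_on_sum continuous_on_compose2[OF linear_continuous_on[OF bounded_linear_scaleC_left] cq]) auto
    have wm: "(\<lambda>s. u s *\<^sub>R mult_L2 \<mu> (g s)) \<in> borel_measurable (lebesgue_on {0..T})" if "continuous_on {0..T} g" for g
    proof -
      have "continuous_on {0..T} (\<lambda>s. mult_L2 \<mu> (g s))"
        by (rule continuous_on_compose2[OF linear_continuous_on[OF bl] that]) auto
      from continuous_on_interval_measurable[OF this] show ?thesis by (intro borel_measurable_scaleR um)
    qed
    have nH: "norm (H_half_inv x) \<le> norm x" for x
      using norm_multiplier_le[OF H_half_inv_bound, where \<psi> = x] by (simp add: H_half_inv_def)
    have np: "norm (p n s) \<le> norm (\<xi> s)" for n s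
    proof -
      have "(norm (p n s))\<^sup>2 = (\<Sum>m<n. (cmod (q s m))\<^sup>2)" unfolding p_def by (rule norm_hermite_sum) simp
      also have "\<dots> \<le> (norm (H_half_inv (\<xi> s)))\<^sup>2" unfolding q_def by (rule Bessel_finite)
      finally have "norm (p n s) \<le> norm (H_half_inv (\<xi> s))" by (rule power2_le_imp_le) simp
      then show ?thesis using nH[of "\<xi> s"] by linarith
    qed
    have nw: "norm (u s *\<^sub>R mult_L2 \<mu> g) \<le> D * X * \<bar>u s\<bar>" if "s \<in> {0..T}" "norm g \<le> norm (\<xi> s)" for s g
    proof -
      have "norm (mult_L2 \<mu> g) \<le> D * norm g" by (rule mult_L2_bounded(3)[OF D])
      also have "\<dots> \<le> D * X" using that X[OF that(1)] D(2) by (intro mult_left_mono) auto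
      finally have "\<bar>u s\<bar> * norm (mult_L2 \<mu> g) \<le> \<bar>u s\<bar> * (D * X)" by (rule mult_left_mono) simp
      then show ?thesis by (simp add: mult.commute)
    qed
    have iw: "integrable (lebesgue_on {0..T}) (\<lambda>s. u s *\<^sub>R mult_L2 \<mu> (g s))"
      if g: "continuous_on {0..T} g" "\<And>s. norm (g s) \<le> norm (\<xi> s)" for g
    proof (rule Bochner_Integration.integrable_bound[OF _ wm[OF g(1)]])
      show "integrable (lebesgue_on {0..T}) (\<lambda>s. D * X * \<bar>u s\<bar>)" using u1 by (intro integrable_mult_right integrable_abs)
      have "AE s in lebesgue_on {0..T}. s \<in> space (lebesgue_on {0..T})" by (rule AE_space)
      then show "AE s in lebesgue_on {0..T}. norm (u s *\<^sub>R mult_L2 \<mu> (g s)) \<le> norm (D * X * \<bar>u s\<bar>)"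
      proof eventually_elim
        case (elim s)
        then have "s \<in> {0..T}" by simp
        from nw[OF this g(2)] show ?case by (simp only: real_norm_def order_trans[OF _ abs_ge_self])
      qed
    qed
    have iG: "integrable (lebesgue_on {0..T}) (\<lambda>s. (u s)\<^sup>2 * (norm (\<xi> s))\<^sup>2)"
    proof (rule Bochner_Integration.integrable_bound)
      show "integrable (lebesgue_on {0..T}) (\<lambda>s. X\<^sup>2 * (u s)\<^sup>2)" using u2 by simp
      show "(\<lambda>s. (u s)\<^sup>2 * (norm (\<xi> s))\<^sup>2) \<in> borel_measurable (lebesgue_on {0..T})"
        using um continuous_on_interval_measurable[OF \<xi>] by measurable
      have "AE s in lebesgue_on {0..T}. s \<in> space (lebesgue_on {0..T})" by (rule AE_space)
      then show "AE s in lebesgue_on {0..T}. norm ((u s)\<^sup>2 * (norm (\<xi> s))\<^sup>2) \<le> norm (X\<^sup>2 * (u s)\<^sup>2)"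
      proof eventually_elim
        case (elim s)
        then have "(norm (\<xi> s))\<^sup>2 \<le> X\<^sup>2" by (intro power_mono X) auto
        then show ?case by (simp add: mult.commute[of "(u s)\<^sup>2"] mult_right_mono)
      qed
    qed
    show ?thesis
      unfolding smoothing_def
    proof (intro conjI ballI impI allI)
      show "integrable (lebesgue_on {0..T}) (\<lambda>s. u s *\<^sub>R mult_L2 \<mu> (H_half_inv (\<xi> s)))" by (rule iw[OF cH nH])
      show "integrable (lebesgue_on {0..T}) (\<lambda>s. (c * C0) * ((u s)\<^sup>2 * (norm (\<xi> s))\<^sup>2))" using iG by simp
      fix S :: "real set" and K assume S: "S \<in> sets lebesgue" "S \<subseteq> {0..T}"
      \<comment> \<open>The weights 2 m + 1 of the energy cancel those of H^(-1/2), which leaves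
        Bessel's inequality for \<xi>.\<close>
      have energy: "hsum_energy (q s) n \<le> (norm (\<xi> s))\<^sup>2" for s n
      proof -
        have "hsum_energy (q s) n = (\<Sum>m<n. (cmod (hcoef (\<xi> s) m))\<^sup>2)"
          unfolding hsum_energy_def q_def by (intro sum.cong refl) (simp add: norm_mult norm_divide power_mult_distrib power_divide)
        then show ?thesis using Bessel_finite[of "\<xi> s" n] by simp
      qed
      have trunc: "(\<Sum>k<K. (2 * real k + 1) * (cmod (\<integral>s. phase (- s) k * hcoef (wn n s) k \<partial>lebesgue_on S))\<^sup>2)
        \<le> c * (\<integral>s. C0 * ((u s)\<^sup>2 * (norm (\<xi> s))\<^sup>2) \<partial>lebesgue_on S)" for n
        unfolding c_def
      proof (rule Duhamel_bound[OF S(1) subset_trans[OF S(2) n0(2)] n0(1) B])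
        show "(\<lambda>s. hcoef (wn n s) k) \<in> borel_measurable (lebesgue_on S)" for k
          unfolding wn_def by (intro hcoef_measurable lebesgue_on_measurable_subset[OF wm[OF cp] S(2)])
        show "(\<lambda>s. of_real (u s) * (J j * hsum (q s) n (a j))) \<in> borel_measurable (lebesgue_on S)" for j
        proof (rule lebesgue_on_measurable_subset[OF _ S(2)])
          have "continuous_on {0..T} (\<lambda>s. J j * hsum (q s) n (a j))"
            unfolding hsum_def by (intro continuous_intros cq)
          from continuous_on_interval_measurable[OF this]
          show "(\<lambda>s. of_real (u s) * (J j * hsum (q s) n (a j))) \<in> borel_measurable (lebesgue_on {0..T})"
            by (rule borel_measurable_times[OF measurable_compose[OF um borel_measurable_of_real]])
        qed
        show "integrable (lebesgue_on S) (\<lambda>s. C0 * ((u s)\<^sup>2 * (norm (\<xi> s))\<^sup>2))"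
          using lebesgue_on_integrable_subset[OF iG _ S] by simp
        show "AE s in lebesgue_on S. jump_decomp N (\<lambda>j k. hermite_fun k (a j)) (hcoef (wn n s))
            (\<lambda>j. of_real (u s) * (J j * hsum (q s) n (a j))) (C0 * ((u s)\<^sup>2 * (norm (\<xi> s))\<^sup>2))"
        proof (rule AE_I2)
          fix s
          have "hcoef (wn n s) = (\<lambda>k. of_real (u s) * hcoef (mult_L2 \<mu> (\<Sum>m<n. q s m *\<^sub>c hermite_L2 m)) k)"
            by (rule ext) (simp add: wn_def p_def cinner_scaleR_left scaleR_conv_of_real)
          then have "jump_decomp N (\<lambda>j k. hermite_fun k (a j)) (hcoef (wn n s)) (\<lambda>j. of_real (u s) * (J j * hsum (q s) n (a j)))
              ((u s)\<^sup>2 * (C0 * hsum_energy (q s) n))"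
            using jump_decomp_scale[OF C0(2)[where c = "q s" and n = n], where r = "u s"] by simp
          then show "jump_decomp N (\<lambda>j k. hermite_fun k (a j)) (hcoef (wn n s)) (\<lambda>j. of_real (u s) * (J j * hsum (q s) n (a j)))
              (C0 * ((u s)\<^sup>2 * (norm (\<xi> s))\<^sup>2))"
          proof (rule jump_decomp_mono)
            have "(u s)\<^sup>2 * (C0 * hsum_energy (q s) n) \<le> (u s)\<^sup>2 * (C0 * (norm (\<xi> s))\<^sup>2)"
              by (intro mult_left_mono energy C0(1)) simp
            then show "(u s)\<^sup>2 * (C0 * hsum_energy (q s) n) \<le> C0 * ((u s)\<^sup>2 * (norm (\<xi> s))\<^sup>2)" by (simp add: mult_ac)
          qed
        qed
      qed
      \<comment> \<open>Dominated convergence in time: \<xi> is bounded on [0,T] and \<mu> is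
        essentially bounded, so a multiple of |u| is an integrable majorant for all
        \<open>n\<close>.\<close>
      have lim: "(\<lambda>n. \<integral>s. phase (- s) k * hcoef (wn n s) k \<partial>lebesgue_on S) \<longlonglongrightarrow> (\<integral>s. phase (- s) k * hcoef (w s) k \<partial>lebesgue_on S)" for k
      proof (rule integral_dominated_convergence[where w = "\<lambda>s. (D * X * \<bar>u s\<bar>) * norm (hermite_L2 k)"])
        show "integrable (lebesgue_on S) (\<lambda>s. (D * X * \<bar>u s\<bar>) * norm (hermite_L2 k))"
          using lebesgue_on_integrable_subset[OF integrable_abs[OF u1] _ S] by simp
        have ws: "integrable (lebesgue_on S) w" unfolding w_def
          by (rule lebesgue_on_integrable_subset[OF iw[OF cH nH] _ S]) simp
        have wns: "integrable (lebesgue_on S) (wn n)" for n unfolding wn_def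
          by (rule lebesgue_on_integrable_subset[OF iw[OF cp np] _ S]) simp
        show "(\<lambda>s. phase (- s) k * hcoef (w s) k) \<in> borel_measurable (lebesgue_on S)"
          "(\<lambda>s. phase (- s) k * hcoef (wn n s) k) \<in> borel_measurable (lebesgue_on S)" for n
          by (rule borel_measurable_integrable[OF integrable_phase_hcoef[OF ws]],
            rule borel_measurable_integrable[OF integrable_phase_hcoef[OF wns]])
        show "AE s in lebesgue_on S. (\<lambda>n. phase (- s) k * hcoef (wn n s) k) \<longlonglongrightarrow> phase (- s) k * hcoef (w s) k"
        proof (rule AE_I2)
          fix s
          have "(\<lambda>n. p n s) \<longlonglongrightarrow> hseries (q s)"
            unfolding p_def hseries_def q_def by (rule summable_LIMSEQ[OF summable_hseries[OF Bessel(1)]])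
          also have "hseries (q s) = H_half_inv (\<xi> s)"
            using H_half_inv_in_span[of "\<xi> s"] unfolding q_def hermite_span_def by simp
          finally have "(\<lambda>n. wn n s) \<longlonglongrightarrow> w s"
            unfolding wn_def w_def by (intro tendsto_intros bounded_linear.tendsto[OF bl])
          then show "(\<lambda>n. phase (- s) k * hcoef (wn n s) k) \<longlonglongrightarrow> phase (- s) k * hcoef (w s) k"
            by (intro tendsto_intros bounded_linear.tendsto[OF bounded_linear_cinner_left])
        qed
        have "AE s in lebesgue_on S. s \<in> space (lebesgue_on S)" by (rule AE_space)
        then show "AE s in lebesgue_on S. norm (phase (- s) k * hcoef (wn n s) k) \<le> (D * X * \<bar>u s\<bar>) * norm (hermite_L2 k)" for n
        proof eventually_elim
          case (elim s)
          then have "s \<in> {0..T}" using S(2) by auto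
          from nw[OF this np] have "norm (wn n s) \<le> D * X * \<bar>u s\<bar>" by (simp add: wn_def)
          then have "norm (wn n s) * norm (hermite_L2 k) \<le> (D * X * \<bar>u s\<bar>) * norm (hermite_L2 k)" by (intro mult_right_mono) auto
          with norm_cinner_le[of "wn n s" "hermite_L2 k"] show ?case by (simp add: norm_mult)
        qed
      qed
      have "(\<lambda>n. \<Sum>k<K. (2 * real k + 1) * (cmod (\<integral>s. phase (- s) k * hcoef (wn n s) k \<partial>lebesgue_on S))\<^sup>2)
        \<longlonglongrightarrow> (\<Sum>k<K. (2 * real k + 1) * (cmod (\<integral>s. phase (- s) k * hcoef (w s) k \<partial>lebesgue_on S))\<^sup>2)"
        by (intro tendsto_intros lim)
      then have "(\<Sum>k<K. (2 * real k + 1) * (cmod (\<integral>s. phase (- s) k * hcoef (w s) k \<partial>lebesgue_on S))\<^sup>2)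
        \<le> c * (\<integral>s. C0 * ((u s)\<^sup>2 * (norm (\<xi> s))\<^sup>2) \<partial>lebesgue_on S)"
        by (rule LIMSEQ_le_const2) (use trunc in blast)
      then show "(\<Sum>k<K. (2 * real k + 1) * (cmod (\<integral>s. phase (- s) k * hcoef (u s *\<^sub>R mult_L2 \<mu> (H_half_inv (\<xi> s))) k \<partial>lebesgue_on S))\<^sup>2)
        \<le> (\<integral>s. (c * C0) * ((u s)\<^sup>2 * (norm (\<xi> s))\<^sup>2) \<partial>lebesgue_on S)"
        by (simp add: w_def mult.assoc)
    qed
  qed
  then show ?thesis using that[of "c * C0"] c C0(1) by simp
qed

text \<open>The square of \<open>u\<close> is only Lebesgue measurable and known on [0,T]; the
  Volterra lemmas work with a Borel density on the line. The lemma passes to a Borel version of the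
  extension by zero.\<close>

lemma control_density:
  fixes u :: "real \<Rightarrow> real"
  assumes u2: "integrable (lebesgue_on {0..T}) (\<lambda>s. (u s)\<^sup>2)"
  obtains r where "\<And>p q. set_integrable lborel {p..q} r" "\<And>x. r x \<ge> 0"
    "\<And>g t. continuous_on {0..T} g \<Longrightarrow> t \<in> {0..T} \<Longrightarrow>
       (\<integral>s. (u s)\<^sup>2 * g s \<partial>lebesgue_on {0..t}) = (LINT s:{0..t}|lborel. r s * g s)"
proof -
  define U where "U s = indicator {0..T} s *\<^sub>R (u s)\<^sup>2" for s
  have U: "integrable lebesgue U" using u2 unfolding U_def by (simp add: integrable_restrict_space)
  obtain h where h: "h \<in> borel_measurable lborel" "AE x in lborel. U x = h x"
    using completion_ex_borel_measurable_real[OF borel_measurable_integrable[OF U]] by blast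
  \<comment> \<open>The Borel version agrees with a nonnegative function only almost everywhere; the
    absolute value makes it nonnegative at every point.\<close>
  define r where "r x = \<bar>h x\<bar>" for x
  have [measurable]: "r \<in> borel_measurable borel" using h(1) unfolding r_def by simp
  have U0: "U x \<ge> 0" for x by (simp add: U_def)
  have Ur: "AE x in lebesgue. U x = r x"
    using AE_completion[OF h(2)] by eventually_elim (use U0 in \<open>simp add: r_def\<close>, metis U0 abs_of_nonneg)
  have rm: "r \<in> borel_measurable lebesgue" by (intro measurable_completion) simp
  have "integrable lebesgue r" by (rule integrable_cong_AE_imp[OF U rm Ur])
  then have ri: "integrable lborel r" by (subst (asm) integrable_completion) auto
  have r: "set_integrable lborel {p..q} r" for p q
    unfolding set_integrable_def by (rule integrable_mult_indicator[OF _ ri]) simp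
  show ?thesis
  proof (rule that[of r])
    show "set_integrable lborel {p..q} r" for p q by (rule r)
    show "r x \<ge> 0" for x by (simp add: r_def)
    fix g :: "real \<Rightarrow> real" and t assume g: "continuous_on {0..T} g" and t: "t \<in> {0..T}"
    have gt: "continuous_on {0..t} g" by (rule continuous_on_subset[OF g]) (use t in auto)
    have m: "(\<lambda>s. indicator {0..t} s *\<^sub>R (r s * g s)) \<in> borel_measurable borel"
      using borel_measurable_integrable[OF set_integrable_mult_continuous[OF r gt, unfolded set_integrable_def]] by simp
    have ml: "(\<lambda>s. indicator {0..t} s *\<^sub>R (r s * g s)) \<in> borel_measurable lebesgue"
      by (intro measurable_completion) (use m in simp)
    have ae: "AE s in lebesgue. indicator {0..t} s *\<^sub>R (r s * g s) = indicator {0..t} s *\<^sub>R ((u s)\<^sup>2 * g s)"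
      using Ur by eventually_elim (use t in \<open>auto simp: U_def indicator_def\<close>)
    have "(\<integral>s. (u s)\<^sup>2 * g s \<partial>lebesgue_on {0..t}) = (\<integral>s. indicator {0..t} s *\<^sub>R ((u s)\<^sup>2 * g s) \<partial>lebesgue)"
      by (intro integral_restrict_space) simp
    also have "\<dots> = (\<integral>s. indicator {0..t} s *\<^sub>R (r s * g s) \<partial>lebesgue)"
      by (rule integral_cong_AE[OF lebesgue_measurable_AE[OF ml ae] ml]) (use ae in \<open>auto elim: eventually_mono\<close>)
    also have "\<dots> = (LINT s:{0..t}|lborel. r s * g s)"
      unfolding set_lebesgue_integral_def by (rule integral_completion) (use m in simp)
    finally show "(\<integral>s. (u s)\<^sup>2 * g s \<partial>lebesgue_on {0..t}) = (LINT s:{0..t}|lborel. r s * g s)" .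
  qed
qed

section \<open>Mild solutions\<close>

text \<open>The equation for \<open>H\<^sup>1\<^sup>/\<^sup>2 \<psi>\<close> is the one for \<open>\<psi>\<close> with the smoothed Duhamel term.\<close>

lemma mild_half_power:
  assumes v: "smoothing T v G" and t: "t \<in> {0..T}" and \<psi>0: "H1_summable \<psi>0"
    and J: "has_bochner_integral (lebesgue_on {0..t}) (\<lambda>s. exp_iH (t - s) (v s)) J"
    and X: "X = exp_iH t \<psi>0 - \<i> *\<^sub>c J"
  shows "X \<in> hermite_span" "H1_summable X" "H_half X = exp_iH t (H_half \<psi>0 - \<i> *\<^sub>c duhamel v t)"
proof -
  note J' = duhamel_integral_coef[OF J]
  define Y where "Y = exp_iH t (H_half \<psi>0 - \<i> *\<^sub>c duhamel v t)"
  show "X \<in> hermite_span" unfolding X by (intro hermite_span_diff exp_iH_in_span hermite_span_scaleC J'(1))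
  have d: "hcoef (duhamel v t) k = duhamel_coef v t k" for k
    unfolding duhamel_def by (rule hcoef_hseries[OF duhamel_bound(1)[OF v t]])
  \<comment> \<open>\<open>Y\<close> is a genuine element of \<open>L2\<close>, so Bessel's
    inequality for it yields the summability of \<open>X\<close>, and equality of the series follows
    on \<open>hermite_span\<close>.\<close>
  have e: "of_real (sqrt (2 * real k + 1)) * hcoef X k = hcoef Y k" for k
    unfolding X Y_def hcoef_exp_iH cinner_diff_left cinner_scaleC_left J'(2) d hcoef_H_half[OF \<psi>0] duhamel_coef_def
    by (simp add: algebra_simps)
  show "H1_summable X" unfolding H1_summable_iff e by (rule Bessel(1))
  have "Y \<in> hermite_span" unfolding Y_def by (rule exp_iH_in_span)
  then show "H_half X = exp_iH t (H_half \<psi>0 - \<i> *\<^sub>c duhamel v t)"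
    unfolding H_half_def e Y_def hermite_span_def by simp
qed

lemma mild_map_continuous:
  assumes "smoothing T v G"
  shows "continuous_on {0..T} (\<lambda>t. exp_iH t (h - \<i> *\<^sub>c duhamel v t))"
  unfolding continuous_on_def
proof
  fix t assume t: "t \<in> {0..T}"
  have d: "(duhamel v \<longlongrightarrow> duhamel v t) (at t within {0..T})"
    using duhamel_continuous[OF assms] t by (simp add: continuous_on_def)
  show "((\<lambda>t. exp_iH t (h - \<i> *\<^sub>c duhamel v t)) \<longlongrightarrow> exp_iH t (h - \<i> *\<^sub>c duhamel v t)) (at t within {0..T})"
    by (rule exp_iH_tendsto[OF tendsto_ident_at
          tendsto_diff[OF tendsto_const bounded_linear.tendsto[OF bounded_linear_scaleC d]]])
qed

lemma norm_mild_map_diff: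
  "norm (exp_iH t (h - \<i> *\<^sub>c x) - exp_iH t (h - \<i> *\<^sub>c y)) \<le> norm (x - y)"
proof -
  interpret E: bounded_linear "exp_iH t" by (rule bounded_linear_exp_iH)
  interpret C: bounded_linear "\<lambda>x. \<i> *\<^sub>c x" by (rule bounded_linear_scaleC)
  have "exp_iH t (h - \<i> *\<^sub>c x) - exp_iH t (h - \<i> *\<^sub>c y) = exp_iH t (\<i> *\<^sub>c (y - x))"
    by (simp add: E.diff C.diff)
  then show ?thesis using norm_exp_iH_le[of t "\<i> *\<^sub>c (y - x)"] by (simp add: norm_scaleC norm_minus_commute)
qed

lemma H1h_norm_diff:
  assumes "H1_summable \<psi>" "H1_summable \<psi>'"
  shows "H1h_norm (\<psi> - \<psi>') = norm (H_half \<psi> - H_half \<psi>')"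
  unfolding norm_H_half[OF H1_summable_diff(1)[OF assms], symmetric] H1_summable_diff(2)[OF assms] by (rule refl)

lemma continuous_at_iff_norm:
  fixes g :: "'a::topological_space \<Rightarrow> 'b::real_normed_vector"
  assumes "\<And>s. s \<in> S \<Longrightarrow> n s = norm (g s - l)"
  shows "(n \<longlongrightarrow> 0) (at t within S) \<longleftrightarrow> (g \<longlongrightarrow> l) (at t within S)"
proof -
  have "(n \<longlongrightarrow> 0) (at t within S) \<longleftrightarrow> ((\<lambda>s. norm (g s - l)) \<longlongrightarrow> 0) (at t within S)"
    by (rule tendsto_cong) (simp add: eventually_at_filter assms)
  also have "\<dots> \<longleftrightarrow> (g \<longlongrightarrow> l) (at t within S)"
    by (simp add: tendsto_norm_zero_iff LIM_zero_iff)
  finally show ?thesis .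
qed

text \<open>Differences have the same size in the norm of \<open>H1h\<close> as in \<open>L2\<close>
  after applying \<open>H_half\<close>. With \<open>C_time_H_half_inv\<close> this exchanges
  solutions \<psi> and continuous curves \<xi> in \<open>L2\<close>.\<close>

lemma C_time_H_half:
  assumes "\<psi> \<in> C_time T H1h H1h_norm"
  shows "continuous_on {0..T} (\<lambda>t. H_half (\<psi> t))"
  unfolding continuous_on_def
proof
  fix t assume t: "t \<in> {0..T}"
  have s: "H1_summable (\<psi> s)" if "s \<in> {0..T}" for s
    using assms that by (intro H1h_imp_H1_summable) (auto simp: C_time_def)
  have "((\<lambda>s. H1h_norm (\<psi> s - \<psi> t)) \<longlongrightarrow> 0) (at t within {0..T})"
    using assms t by (auto simp: C_time_def)
  then show "((\<lambda>t. H_half (\<psi> t)) \<longlongrightarrow> H_half (\<psi> t)) (at t within {0..T})"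
    by (subst (asm) continuous_at_iff_norm[OF H1h_norm_diff[OF s s[OF t]]])
qed

lemma H1h_norm_H_half_inv: "\<xi> \<in> hermite_span \<Longrightarrow> H1h_norm (H_half_inv \<xi>) = norm \<xi>"
  using norm_H_half[OF H1_summable_H_half_inv, of \<xi>] H_half_H_half_inv[of \<xi>] by simp

lemma C_time_H_half_inv:
  assumes c: "continuous_on {0..T} \<xi>" and s: "\<And>t. t \<in> {0..T} \<Longrightarrow> \<xi> t \<in> hermite_span"
  shows "(\<lambda>t. H_half_inv (\<xi> t)) \<in> C_time T H1h H1h_norm"
  unfolding C_time_def
proof (intro CollectI ballI conjI)
  fix t assume t: "t \<in> {0..T}"
  show "H_half_inv (\<xi> t) \<in> H1h" by (rule H1_summable_imp_H1h[OF H_half_inv_in_span H1_summable_H_half_inv])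
  have "H1h_norm (H_half_inv (\<xi> x) - H_half_inv (\<xi> t)) = norm (\<xi> x - \<xi> t)" if "x \<in> {0..T}" for x
    unfolding H1h_norm_diff[OF H1_summable_H_half_inv H1_summable_H_half_inv] H_half_H_half_inv[OF s[OF that]]
      H_half_H_half_inv[OF s[OF t]] by (rule refl)
  from continuous_at_iff_norm[where g = \<xi> and S = "{0..T}", OF this]
  show "((\<lambda>s. H1h_norm (H_half_inv (\<xi> s) - H_half_inv (\<xi> t))) \<longlongrightarrow> 0) (at t within {0..T})"
    using c t by (simp add: continuous_on_def)
qed

lemma lebesgue_on_integral_mono:
  fixes g :: "real \<Rightarrow> real"
  assumes g: "integrable (lebesgue_on {0..T}) g" "\<And>s. g s \<ge> 0" and t: "t \<in> {0..T}"
  shows "(\<integral>s. g s \<partial>lebesgue_on {0..t}) \<le> (\<integral>s. g s \<partial>lebesgue_on {0..T})"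
proof -
  have "0 \<le> (\<integral>s. g s \<partial>lebesgue_on {t<..T})" by (rule Bochner_Integration.integral_nonneg) (rule g(2))
  with lebesgue_on_integral_split[OF g(1), of t T] t show ?thesis by auto
qed

theorem proposition5p2:
  fixes N :: nat and a :: "nat \<Rightarrow> real" and T :: real and \<mu> :: L2 and u :: "real \<Rightarrow> real"
  assumes "N \<ge> 1"
    and "strict_mono_on {1..N} a"
    and "T > 0"
    and "\<mu> \<in> H1_tilde N a"
    and "u \<in> L2_time_real T"
  shows "\<exists>C>0. \<forall>\<psi>0\<in>H1h. \<forall>f\<in>L2_time T (H1_tilde N a) (H1_tilde_norm N a).
           \<exists>\<psi>\<in>C_time T H1h H1h_norm.
             mild_solution T \<mu> u f \<psi>0 \<psi> \<and>
             (\<forall>\<psi>'\<in>C_time T H1h H1h_norm.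
                mild_solution T \<mu> u f \<psi>0 \<psi>' \<longrightarrow> (\<forall>t\<in>{0..T}. \<psi>' t = \<psi> t)) \<and>
             C_time_norm T H1h_norm \<psi>
               \<le> C * (H1h_norm \<psi>0 + L2_time_norm T (H1_tilde_norm N a) f)"
proof -
  note a = assms(2) and T = assms(3) and \<mu> = assms(4)
  let ?n = "H1_tilde_norm N a"
  have um: "u \<in> borel_measurable (lebesgue_on {0..T})"
    using assms(5) by (intro closed_interval_measurable) (simp add: L2_time_real_def)
  have u2: "integrable (lebesgue_on {0..T}) (\<lambda>s. (u s)\<^sup>2)"
    using assms(5) by (intro closed_interval_integral(1)) (simp add: L2_time_real_def)
  \<comment> \<open>The control term as a function of the new unknown \<xi>, which stands for
    H^(1/2) \<psi>.\<close>
  define w where "w \<xi> s = u s *\<^sub>R mult_L2 \<mu> (H_half_inv (\<xi> s))" for \<xi> s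
  obtain Cm where Cm: "Cm \<ge> 0" "\<And>\<xi>. continuous_on {0..T} \<xi> \<Longrightarrow>
     smoothing T (w \<xi>) (\<lambda>s. Cm * ((u s)\<^sup>2 * (norm (\<xi> s))\<^sup>2))"
    using mult_smoothing[OF a \<mu> um u2] unfolding w_def by blast
  obtain Cf where Cf: "Cf \<ge> 0" "\<And>f. f \<in> L2_time T (H1_tilde N a) ?n \<Longrightarrow> smoothing T f (\<lambda>s. Cf * (?n (f s))\<^sup>2)"
    using L2_time_smoothing[OF a] by blast
  obtain r where r: "\<And>p q. set_integrable lborel {p..q} r" "\<And>x. r x \<ge> 0"
    "\<And>g t. continuous_on {0..T} g \<Longrightarrow> t \<in> {0..T} \<Longrightarrow>
       (\<integral>s. (u s)\<^sup>2 * g s \<partial>lebesgue_on {0..t}) = (LINT s:{0..t}|lborel. r s * g s)"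
    using control_density[OF u2] by blast
  \<comment> \<open>The factor 2 prepares the a priori estimate, where the square of a sum is split;
    one weight then serves both for this estimate and for uniqueness.\<close>
  have K: "2 * Cm \<ge> 0" using Cm(1) by simp
  obtain \<omega> M where \<omega>: "continuous_on {0..T} \<omega>" "\<And>t. t \<in> {0..T} \<Longrightarrow> 1 \<le> \<omega> t \<and> \<omega> t \<le> M"
    "\<And>t. t \<in> {0..T} \<Longrightarrow> (2 * Cm) * (LINT s:{0..t}|lborel. r s * \<omega> s) \<le> \<omega> t / 4"
    using Volterra_weight[OF r(1,2) T K] by blast
  have Gronwall: "\<delta> t \<le> 2 * P * M"
    if "continuous_on {0..T} \<delta>" "\<And>t. t \<in> {0..T} \<Longrightarrow> \<delta> t \<ge> 0" "P \<ge> 0"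
      "\<And>t. t \<in> {0..T} \<Longrightarrow> \<delta> t \<le> P + (2 * Cm) * (LINT s:{0..t}|lborel. r s * \<delta> s)" "t \<in> {0..T}" for \<delta> P t
    by (rule Gronwall_weight[OF r(1,2) T K \<omega>(1)]) (fact \<omega>(2,3) that)+
  have M: "M \<ge> 1" using \<omega>(2)[of 0] T by auto
  obtain D where D: "AE x in lborel. cmod (fun_L2 \<mu> x) \<le> D" "D \<ge> 0" using H1_tilde_bounded[OF a \<mu>] by blast
  interpret m: bounded_linear "mult_L2 \<mu>" by (rule mult_L2_bounded(4)[OF D])
  interpret Hi: bounded_linear H_half_inv by (rule bounded_linear_H_half_inv)
  have w_diff: "w \<xi> s - w \<xi>' s = w (\<lambda>s. \<xi> s - \<xi>' s) s" for \<xi> \<xi>' s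
    by (simp add: w_def m.diff Hi.diff scaleR_diff_right)
  have w_bound: "(norm (duhamel (w \<xi>) t))\<^sup>2 \<le> Cm * (LINT s:{0..t}|lborel. r s * (norm (\<xi> s))\<^sup>2)"
    if "continuous_on {0..T} \<xi>" "t \<in> {0..T}" for \<xi> t
  proof -
    have "(norm (duhamel (w \<xi>) t))\<^sup>2 \<le> (\<integral>s. Cm * ((u s)\<^sup>2 * (norm (\<xi> s))\<^sup>2) \<partial>lebesgue_on {0..t})"
      by (rule duhamel_bound(2)[OF Cm(2)[OF that(1)] that(2)])
    also have "\<dots> = Cm * (\<integral>s. (u s)\<^sup>2 * (norm (\<xi> s))\<^sup>2 \<partial>lebesgue_on {0..t})" by simp
    also have "(\<integral>s. (u s)\<^sup>2 * (norm (\<xi> s))\<^sup>2 \<partial>lebesgue_on {0..t}) = (LINT s:{0..t}|lborel. r s * (norm (\<xi> s))\<^sup>2)"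
      by (intro r(3) that continuous_intros)
    finally show ?thesis .
  qed
  \<comment> \<open>Gronwall with P = 2 B^2 gives at most 4 B^2 M for the squared norm, whence 2
    sqrt M; the last factor compares \<open>B\<close> with the sum of the two norms of the data. All
    ingredients are fixed before \<psi>0 and \<open>f\<close> are chosen.\<close>
  define C where "C = 2 * sqrt M * (1 + sqrt Cf)"
  have C: "C > 0" unfolding C_def using M Cf(1) by (intro mult_pos_pos add_pos_nonneg) auto
  show ?thesis
  proof (intro exI[of _ C] conjI ballI C)
    fix \<psi>0 f assume \<psi>0: "\<psi>0 \<in> H1h" and f: "f \<in> L2_time T (H1_tilde N a) ?n"
    define nf where "nf = L2_time_norm T ?n f"
    define h where "h = H_half \<psi>0"
    have \<psi>0s: "H1_summable \<psi>0" by (rule H1h_imp_H1_summable[OF \<psi>0])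
    have nh: "norm h = H1h_norm \<psi>0" unfolding h_def by (rule norm_H_half[OF \<psi>0s])
    note fS = Cf(2)[OF f]
    define \<Lambda> where "\<Lambda> \<xi> t = exp_iH t (h - \<i> *\<^sub>c duhamel (\<lambda>s. w \<xi> s + f s) t)" for \<xi> t
    note S = smoothing_add[OF Cm(2) fS]
    have cont: "continuous_on {0..T} (\<Lambda> \<xi>)" if "continuous_on {0..T} \<xi>" for \<xi>
      unfolding \<Lambda>_def by (rule mild_map_continuous[OF S[OF that]])
    have lip: "(norm (\<Lambda> \<xi> t - \<Lambda> \<xi>' t))\<^sup>2 \<le> Cm * (LINT s:{0..t}|lborel. r s * (norm (\<xi> s - \<xi>' s))\<^sup>2)"
      if "continuous_on {0..T} \<xi>" "continuous_on {0..T} \<xi>'" "t \<in> {0..T}" for \<xi> \<xi>' t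
    proof -
      have e: "(\<lambda>s. (w \<xi> s + f s) - (w \<xi>' s + f s)) = w (\<lambda>s. \<xi> s - \<xi>' s)"
        by (rule ext) (simp add: w_diff)
      have "norm (\<Lambda> \<xi> t - \<Lambda> \<xi>' t) \<le> norm (duhamel (\<lambda>s. w \<xi> s + f s) t - duhamel (\<lambda>s. w \<xi>' s + f s) t)"
        unfolding \<Lambda>_def by (rule norm_mild_map_diff)
      also have "\<dots> = norm (duhamel (w (\<lambda>s. \<xi> s - \<xi>' s)) t)"
        unfolding duhamel_diff[OF S[OF that(1)] S[OF that(2)] that(3)] e by (rule refl)
      finally have "(norm (\<Lambda> \<xi> t - \<Lambda> \<xi>' t))\<^sup>2 \<le> (norm (duhamel (w (\<lambda>s. \<xi> s - \<xi>' s)) t))\<^sup>2"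
        by (intro power_mono) auto
      also have "\<dots> \<le> Cm * (LINT s:{0..t}|lborel. r s * (norm (\<xi> s - \<xi>' s))\<^sup>2)"
        by (intro w_bound that continuous_intros)
      finally show ?thesis .
    qed
    obtain \<xi> where \<xi>: "continuous_on {0..T} \<xi>" "\<And>t. t \<in> {0..T} \<Longrightarrow> \<xi> t = \<Lambda> \<xi> t"
      using Volterra_fixed_point[OF r(1,2) T Cm(1) cont lip] by blast
    have span: "\<xi> t \<in> hermite_span" if "t \<in> {0..T}" for t
      unfolding \<xi>(2)[OF that] \<Lambda>_def by (rule exp_iH_in_span)
    define \<psi> where "\<psi> t = H_half_inv (\<xi> t)" for t
    have w_\<psi>: "u s *\<^sub>R mult_L2 \<mu> (\<psi> s) + f s = w \<xi> s + f s" for s by (simp add: w_def \<psi>_def)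
    have \<psi>C: "\<psi> \<in> C_time T H1h H1h_norm" unfolding \<psi>_def by (rule C_time_H_half_inv[OF \<xi>(1) span])
    have mild: "mild_solution T \<mu> u f \<psi>0 \<psi>"
      unfolding mild_solution_def w_\<psi>
    proof
      fix t assume t: "t \<in> {0..T}"
      define J where "J = (\<integral>s. exp_iH (t - s) (w \<xi> s + f s) \<partial>lebesgue_on {0..t})"
      have "integrable (lebesgue_on {0..T}) (\<lambda>s. w \<xi> s + f s)" using S[OF \<xi>(1)] by (simp add: smoothing_def)
      then have J: "has_bochner_integral (lebesgue_on {0..t}) (\<lambda>s. exp_iH (t - s) (w \<xi> s + f s)) J"
        unfolding J_def by (intro has_bochner_integral_integrable duhamel_integrable[OF _ t])
      note X = mild_half_power[OF S[OF \<xi>(1)] t \<psi>0s J refl]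
      have "H_half (exp_iH t \<psi>0 - \<i> *\<^sub>c J) = \<xi> t"
        using X(3) \<xi>(2)[OF t] by (simp add: \<Lambda>_def h_def)
      then have "\<psi> t = exp_iH t \<psi>0 - \<i> *\<^sub>c J" using H_half_inv_H_half[OF X(1,2)] by (simp add: \<psi>_def)
      with J show "\<exists>J. has_bochner_integral (lebesgue_on {0..t}) (\<lambda>s. exp_iH (t - s) (w \<xi> s + f s)) J \<and>
          \<psi> t = exp_iH t \<psi>0 - \<i> *\<^sub>c J" by blast
    qed
    have unique: "\<psi>' t = \<psi> t" if \<psi>': "\<psi>' \<in> C_time T H1h H1h_norm" and mild': "mild_solution T \<mu> u f \<psi>0 \<psi>'"
      and t: "t \<in> {0..T}" for \<psi>' t
    proof -
      define \<xi>' where "\<xi>' s = H_half (\<psi>' s)" for s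
      have c': "continuous_on {0..T} \<xi>'" unfolding \<xi>'_def by (rule C_time_H_half[OF \<psi>'])
      have \<psi>'s: "H1_summable (\<psi>' s)" if "s \<in> {0..T}" for s
        using \<psi>' that by (intro H1h_imp_H1_summable) (auto simp: C_time_def)
      \<comment> \<open>Membership in \<open>H1h\<close> yields the summability; that \<psi>' is
        recovered from its coefficients is read off from the mild equation.\<close>
      have \<psi>'span: "\<psi>' s \<in> hermite_span" if s: "s \<in> {0..T}" for s
      proof -
        obtain J where J: "has_bochner_integral (lebesgue_on {0..s}) (\<lambda>x. exp_iH (s - x) (u x *\<^sub>R mult_L2 \<mu> (\<psi>' x) + f x)) J"
          "\<psi>' s = exp_iH s \<psi>0 - \<i> *\<^sub>c J"
          using mild' s unfolding mild_solution_def by blast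
        show ?thesis unfolding J(2)
          by (intro hermite_span_diff exp_iH_in_span hermite_span_scaleC duhamel_integral_coef(1)[OF J(1)])
      qed
      have inv: "H_half_inv (\<xi>' s) = \<psi>' s" if "s \<in> {0..T}" for s
        unfolding \<xi>'_def by (rule H_half_inv_H_half[OF \<psi>'span[OF that] \<psi>'s[OF that]])
      have fix': "\<xi>' s = \<Lambda> \<xi>' s" if s: "s \<in> {0..T}" for s
      proof -
        obtain J where J: "has_bochner_integral (lebesgue_on {0..s}) (\<lambda>x. exp_iH (s - x) (u x *\<^sub>R mult_L2 \<mu> (\<psi>' x) + f x)) J"
          "\<psi>' s = exp_iH s \<psi>0 - \<i> *\<^sub>c J"
          using mild' s unfolding mild_solution_def by blast
        have "has_bochner_integral (lebesgue_on {0..s}) (\<lambda>x. exp_iH (s - x) (w \<xi>' x + f x)) J"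
        proof (rule has_bochner_integral_cong[THEN iffD1, OF refl _ refl J(1)])
          fix x assume "x \<in> space (lebesgue_on {0..s})"
          then have "x \<in> {0..T}" using s by auto
          then show "exp_iH (s - x) (u x *\<^sub>R mult_L2 \<mu> (\<psi>' x) + f x) = exp_iH (s - x) (w \<xi>' x + f x)"
            by (simp add: w_def inv)
        qed
        from mild_half_power(3)[OF S[OF c'] s \<psi>0s this J(2)]
        show ?thesis by (simp add: \<xi>'_def \<Lambda>_def h_def)
      qed
      \<comment> \<open>The integral term dominates a square and is therefore nonnegative, so
        doubling its constant is allowed; with P = 0 Gronwall gives equality of the two
        curves.\<close>
      have le: "(norm (\<xi> s - \<xi>' s))\<^sup>2 \<le> 0 + (2 * Cm) * (LINT x:{0..s}|lborel. r x * (norm (\<xi> x - \<xi>' x))\<^sup>2)"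
        if s: "s \<in> {0..T}" for s
      proof -
        have l: "(norm (\<xi> s - \<xi>' s))\<^sup>2 \<le> Cm * (LINT x:{0..s}|lborel. r x * (norm (\<xi> x - \<xi>' x))\<^sup>2)"
          using lip[OF \<xi>(1) c' s] unfolding \<xi>(2)[OF s, symmetric] fix'[OF s, symmetric] .
        moreover have "0 \<le> (norm (\<xi> s - \<xi>' s))\<^sup>2" by simp
        ultimately show ?thesis by linarith
      qed
      have "(norm (\<xi> t - \<xi>' t))\<^sup>2 \<le> 2 * 0 * M"
      proof (rule Gronwall[where \<delta> = "\<lambda>s. (norm (\<xi> s - \<xi>' s))\<^sup>2" and t = t])
        show "continuous_on {0..T} (\<lambda>s. (norm (\<xi> s - \<xi>' s))\<^sup>2)" by (intro continuous_intros \<xi>(1) c')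
      qed (use le t in auto)
      then have "\<xi> t = \<xi>' t" by simp
      then show ?thesis using inv[OF t] by (simp add: \<psi>_def)
    qed
    define B where "B = H1h_norm \<psi>0 + sqrt Cf * nf"
    have ni: "integrable (lebesgue_on {0<..<T}) (\<lambda>s. (?n (f s))\<^sup>2)" using f by (simp add: L2_time_def)
    have nf0: "nf \<ge> 0" unfolding nf_def L2_time_norm_def by (intro real_sqrt_ge_zero Bochner_Integration.integral_nonneg) simp
    have nf2: "nf\<^sup>2 = (\<integral>s. (?n (f s))\<^sup>2 \<partial>lebesgue_on {0..T})"
      unfolding nf_def L2_time_norm_def closed_interval_integral(2)[OF ni]
      by (intro real_sqrt_pow2 Bochner_Integration.integral_nonneg) simp
    have n0: "H1h_norm \<psi>0 \<ge> 0" unfolding nh[symmetric] by simp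
    have B0: "B \<ge> 0" unfolding B_def using n0 nf0 Cf(1) by simp
    \<comment> \<open>At the zero curve the control term vanishes, and what remains is the
      contribution of \<psi>0 and \<open>f\<close>.\<close>
    have \<Lambda>0: "norm (\<Lambda> (\<lambda>_. 0) t) \<le> B" if t: "t \<in> {0..T}" for t
    proof -
      have "(norm (duhamel f t))\<^sup>2 \<le> (\<integral>s. Cf * (?n (f s))\<^sup>2 \<partial>lebesgue_on {0..t})" by (rule duhamel_bound(2)[OF fS t])
      also have "\<dots> \<le> (\<integral>s. Cf * (?n (f s))\<^sup>2 \<partial>lebesgue_on {0..T})"
        using closed_interval_integral(1)[OF ni] Cf(1) t by (intro lebesgue_on_integral_mono) auto
      also have "\<dots> = (sqrt Cf * nf)\<^sup>2" using Cf(1) by (simp add: nf2 power_mult_distrib)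
      finally have "norm (duhamel f t) \<le> sqrt Cf * nf" by (rule power2_le_imp_le) (use nf0 Cf(1) in simp)
      moreover have "(\<lambda>s. w (\<lambda>_. 0) s + f s) = f" by (rule ext) (simp add: w_def m.zero Hi.zero)
      moreover have "norm (h - \<i> *\<^sub>c duhamel f t) \<le> norm h + norm (\<i> *\<^sub>c duhamel f t)" by (rule norm_triangle_ineq4)
      ultimately have "norm (h - \<i> *\<^sub>c duhamel (\<lambda>s. w (\<lambda>_. 0) s + f s) t) \<le> B"
        by (simp add: norm_scaleC nh B_def)
      then show ?thesis unfolding \<Lambda>_def by (rule order_trans[OF norm_exp_iH_le])
    qed
    \<comment> \<open>The fixed point is compared with the image of the zero curve; the Lipschitz
      estimate between the two is the integral term.\<close>
    have le: "(norm (\<xi> t))\<^sup>2 \<le> 2 * B\<^sup>2 + (2 * Cm) * (LINT s:{0..t}|lborel. r s * (norm (\<xi> s))\<^sup>2)" if t: "t \<in> {0..T}" for t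
    proof -
      define x where "x = norm (\<Lambda> (\<lambda>_. 0) t)"
      define y where "y = norm (\<Lambda> \<xi> t - \<Lambda> (\<lambda>_. 0) t)"
      have "norm (\<xi> t) \<le> x + y" unfolding \<xi>(2)[OF t] x_def y_def by (rule norm_triangle_sub)
      then have "(norm (\<xi> t))\<^sup>2 \<le> (x + y)\<^sup>2" by (intro power_mono) auto
      also have "\<dots> \<le> 2 * x\<^sup>2 + 2 * y\<^sup>2" using sum_squares_bound[of x y] by (simp add: power2_sum)
      finally have "(norm (\<xi> t))\<^sup>2 \<le> 2 * x\<^sup>2 + 2 * y\<^sup>2" .
      moreover have "x\<^sup>2 \<le> B\<^sup>2" unfolding x_def by (intro power_mono \<Lambda>0 t) auto
      moreover have "y\<^sup>2 \<le> Cm * (LINT s:{0..t}|lborel. r s * (norm (\<xi> s))\<^sup>2)"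
        using lip[OF \<xi>(1) continuous_on_const t, of 0] by (simp add: y_def)
      ultimately show ?thesis by linarith
    qed
    have bound: "H1h_norm (\<psi> t) \<le> C * (H1h_norm \<psi>0 + nf)" if t: "t \<in> {0..T}" for t
    proof -
      have "(norm (\<xi> t))\<^sup>2 \<le> 2 * (2 * B\<^sup>2) * M"
      proof (rule Gronwall[where \<delta> = "\<lambda>s. (norm (\<xi> s))\<^sup>2" and t = t])
        show "continuous_on {0..T} (\<lambda>s. (norm (\<xi> s))\<^sup>2)" by (intro continuous_intros \<xi>(1))
      qed (use le t in auto)
      also have "\<dots> = (2 * sqrt M * B)\<^sup>2" using M by (simp add: power_mult_distrib)
      finally have "norm (\<xi> t) \<le> 2 * sqrt M * B" by (rule power2_le_imp_le) (use B0 M in simp)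
      also have "\<dots> \<le> 2 * sqrt M * ((1 + sqrt Cf) * (H1h_norm \<psi>0 + nf))"
      proof (rule mult_left_mono)
        have "0 \<le> sqrt Cf * H1h_norm \<psi>0" using n0 Cf(1) by simp
        then show "B \<le> (1 + sqrt Cf) * (H1h_norm \<psi>0 + nf)" unfolding B_def using nf0 by (simp add: algebra_simps)
      qed (use M in simp)
      finally show ?thesis unfolding \<psi>_def H1h_norm_H_half_inv[OF span[OF t]] C_def by (simp add: mult.assoc)
    qed
    have "C_time_norm T H1h_norm \<psi> \<le> C * (H1h_norm \<psi>0 + nf)"
      unfolding C_time_norm_def by (rule cSUP_least) (use T bound in auto)
    then show "\<exists>\<psi>\<in>C_time T H1h H1h_norm. mild_solution T \<mu> u f \<psi>0 \<psi> \<and>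
        (\<forall>\<psi>'\<in>C_time T H1h H1h_norm. mild_solution T \<mu> u f \<psi>0 \<psi>' \<longrightarrow> (\<forall>t\<in>{0..T}. \<psi>' t = \<psi> t)) \<and>
        C_time_norm T H1h_norm \<psi> \<le> C * (H1h_norm \<psi>0 + L2_time_norm T ?n f)"
      using \<psi>C mild unique unfolding nf_def by blast
  qed
qed

end
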